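(* Let $E$ be a vector bundle over the manifold $M$ and let $L$ be a closed conic subset of $T^*M\backslash 0$. Then $\mathcal{D}'_L(M;E)=\bigcap_{r\in\mathbb{R}}\mathcal{D}'^r_L(M;E)$ and $$\mathcal{D}'_L(M;E)=\lim_{\substack{\longleftarrow\\ r\rightarrow \infty}}\mathcal{D}'^r_L(M;E)\quad \text{topologically},$$ where the linking mappings in the projective limit are the canonical inclusions $\mathcal{D}'^{r_2}_L(M;E)\subseteq\mathcal{D}'^{r_1}_L(M;E)$, $r_2\geq r_1$.
   Context: Conventions. $M$ is a smooth second countable $m$-dimensional manifold; vector bundles are smooth, complex, of finite rank; $E$ has rank $k$. $\mathcal{F}g(\xi)=\int e^{-ix\xi}g(x)dx$, $\langle\xi\rangle=(1+|\xi|^2)^{1/2}$. $T^*M\backslash0$ is the cotangent bundle without its zero section; $L\subseteq T^*M\backslash0$ is conic if $(p,\xi)\in L$, $t>0$ imply $(p,t\xi)\in L$. $\mathcal{D}(O)$ is the space of smooth compactly supported functions on $O$. Distributional sections. $DM$ is the complex $1$-density bundle, $E^{\vee}:=L(E,DM)$, and $\mathcal{D}'(M;E)$ is the strong dual of $\Gamma_c(E^{\vee})$ (smooth compactly supported sections with the usual $(LF)$-topology). For a chart $(O,x)$ and a local trivialisation $\Phi_x:\pi_E^{-1}(O)\rightarrow O\times\mathbb{C}^k$ with fibre isomorphisms $\Phi_{x,p}$, let $\lambda^x$ be the density on $O$ with $\lambda^x(\partial/\partial x^1,\ldots,\partial/\partial x^m)=1$ and $\sigma^j$ the section of $E^{\vee}$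 over $O$ with $\sigma^j_p(e)=(\Phi_{x,p}e)^j\lambda^x_p$. For $u\in\mathcal{D}'(M;E)$ define $u^j_{\Phi_x}\in\mathcal{D}'(x(O))$ by $\langle u^j_{\Phi_x},\phi\rangle:=\langle u,(\phi\circ x)\sigma^j\rangle$. Wave front sets. For $U\subseteq\mathbb{R}^m$ open, $v\in\mathcal{D}'(U)$, $r\in\mathbb{R}$: $(y,\eta)\in U\times(\mathbb{R}^m\backslash\{0\})$ does not belong to $WF^r(v)$ (resp. to $WF(v)$) iff there are an open cone $V\ni\eta$ and $\varphi\in\mathcal{D}(U)$ with $\varphi(y)\neq0$ such that $\int_V|\mathcal{F}(\varphi v)|^2\langle\xi\rangle^{2r}d\xi<\infty$ (resp. $\sup_{\xi\in V}\langle\xi\rangle^{\nu}|\mathcal{F}(\varphi v)(\xi)|<\infty$ for all $\nu>0$). For $u\in\mathcal{D}'(M;E)$, $(p,\xi_jdx^j|_p)\in WF^r(u)$ iff $(x(p),(\xi_1,\ldots,\xi_m))\in\bigcup_jWF^r(u^j_{\Phi_x})$, and likewise for $WF(u)$ (independent of the choices). Spaces. Call $(O,x,\Phi_x,\varphi,V)$ admissible if $(O,x)$ is a chart over which $E$ trivialises via $\Phi_x$, $\varphi\in\mathcal{D}(O)$ and $V\subseteq\mathbb{R}^m$ is a closed cone with $\{(p,\xi_jdx^j|_p)\,|\,p\in\operatorname{supp}\varphi,\ (\xi_1,\ldots,\xi_m)\in V\}\cap L=\emptyset$. $\mathcal{D}'^r_L(M;E):=\{u\in\mathcal{D}'(M;E)\,|\,WF^r(u)\subseteq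 L\}$ carries the locally convex topology given by all continuous seminorms on $\mathcal{D}'(M;E)$ together with all $\mathfrak{p}^{\Phi_x}_{r;\varphi,V}(u):=\max_{j}\big(\int_V|\mathcal{F}((\varphi\circ x^{-1})u^j_{\Phi_x})(\xi)|^2\langle\xi\rangle^{2r}d\xi\big)^{1/2}$ for admissible data. $\mathcal{D}'_L(M;E):=\{u\in\mathcal{D}'(M;E)\,|\,WF(u)\subseteq L\}$ carries the locally convex topology given by all continuous seminorms on $\mathcal{D}'(M;E)$ together with all $\mathfrak{q}^{\Phi_x}_{\nu;\varphi,V}(u):=\max_{j}\sup_{\xi\in V}\langle\xi\rangle^{\nu}|\mathcal{F}((\varphi\circ x^{-1})u^j_{\Phi_x})(\xi)|$ for $\nu>0$ and admissible data (with $V\ne\emptyset$). *)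

theory Defs
  imports "HOL-Analysis.Analysis" "HOL-Library.Function_Algebras"
begin

section \<open>Complex vector spaces of functions\<close>

text \<open>All spaces below are complex subspaces of iterated function types with values in the complex
  numbers; addition on these types is pointwise (from \<open>Function_Algebras\<close>), and so is scaling.\<close>

class complex_vect = ab_group_add +
  fixes scaleC :: "complex \<Rightarrow> 'a \<Rightarrow> 'a" (infixr \<open>*\<^sub>C\<close> 75)
  assumes scaleC_add_right: "a *\<^sub>C (x + y) = a *\<^sub>C x + a *\<^sub>C y"
    and scaleC_add_left: "(a + b) *\<^sub>C x = a *\<^sub>C x + b *\<^sub>C x"
    and scaleC_scaleC: "a *\<^sub>C b *\<^sub>C x = (a * b) *\<^sub>C x"
    and scaleC_one: "1 *\<^sub>C x = x"

instantiation complex :: complex_vect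
begin

definition scaleC_complex :: "complex \<Rightarrow> complex \<Rightarrow> complex" where
  "scaleC_complex c z = c * z"

instance
  by standard (simp_all add: scaleC_complex_def algebra_simps)

end

instantiation "fun" :: (type, complex_vect) complex_vect
begin

definition scaleC_fun :: "complex \<Rightarrow> ('a \<Rightarrow> 'b) \<Rightarrow> 'a \<Rightarrow> 'b" where
  "scaleC_fun c f = (\<lambda>x. c *\<^sub>C f x)"

instance
  by standard
    (simp_all add: scaleC_fun_def fun_eq_iff scaleC_add_right scaleC_add_left scaleC_scaleC scaleC_one)

end

definition linear_on :: "'v::complex_vect set \<Rightarrow> ('v \<Rightarrow> 'w::complex_vect) \<Rightarrow> bool" where
  "linear_on S f \<longleftrightarrow> (\<forall>x\<in>S. \<forall>y\<in>S. f (x + y) = f x + f y) \<and> (\<forall>c. \<forall>x\<in>S. f (c *\<^sub>C x) = c *\<^sub>C f x)"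

definition seminorm_on :: "'v::complex_vect set \<Rightarrow> ('v \<Rightarrow> real) \<Rightarrow> bool" where
  "seminorm_on S p \<longleftrightarrow> (\<forall>x\<in>S. \<forall>y\<in>S. p (x + y) \<le> p x + p y)
     \<and> (\<forall>c. \<forall>x\<in>S. p (c *\<^sub>C x) = cmod c * p x)"

text \<open>The locally convex topology on the subspace \<open>S\<close> given by a family \<open>P\<close> of seminorms on \<open>S\<close>.\<close>

definition seminorm_topology :: "'v::complex_vect set \<Rightarrow> ('v \<Rightarrow> real) set \<Rightarrow> 'v topology" where
  "seminorm_topology S P =
     topology_generated_by (insert S {{y \<in> S. p (y - x) < e} | p x e. p \<in> P \<and> x \<in> S \<and> 0 < e})"

definition continuous_seminorms :: "'v::complex_vect topology \<Rightarrow> ('v \<Rightarrow> real) set" where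
  "continuous_seminorms X = {p. seminorm_on (topspace X) p \<and> continuous_map X euclideanreal p}"

definition bounded_subset :: "'v::complex_vect topology \<Rightarrow> 'v set \<Rightarrow> bool" where
  "bounded_subset X B \<longleftrightarrow> B \<subseteq> topspace X \<and>
     (\<forall>U. openin X U \<and> 0 \<in> U \<longrightarrow> (\<exists>r. \<forall>c. r \<le> cmod c \<longrightarrow> B \<subseteq> (*\<^sub>C) c ` U))"

text \<open>Elements of the dual are extended by \<open>0\<close> outside the space, so that they are determined by
  their values on it and form a subspace of the function type.\<close>

definition continuous_dual :: "'v::complex_vect topology \<Rightarrow> ('v \<Rightarrow> complex) set" where
  "continuous_dual X = {u. linear_on (topspace X) u \<and> continuous_map X euclidean u
     \<and> (\<forall>x. x \<notin> topspace X \<longrightarrow> u x = 0)}"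

definition strong_dual :: "'v::complex_vect topology \<Rightarrow> ('v \<Rightarrow> complex) topology" where
  "strong_dual X = seminorm_topology (continuous_dual X)
     {\<lambda>u. (SUP x\<in>B. cmod (u x)) | B. bounded_subset X B \<and> B \<noteq> {}}"

text \<open>\<open>f i j\<close>, for \<open>i \<le> j\<close>, is the linking map from \<open>X j\<close> to \<open>X i\<close>.\<close>

definition projective_limit ::
    "('i::order \<Rightarrow> 'v topology) \<Rightarrow> ('i \<Rightarrow> 'i \<Rightarrow> 'v \<Rightarrow> 'v) \<Rightarrow> ('i \<Rightarrow> 'v) topology" where
  "projective_limit X f =
     subtopology (product_topology X UNIV) {t. \<forall>i j. i \<le> j \<longrightarrow> f i j (t j) = t i}"


section \<open>Smooth functions on open subsets of Euclidean space\<close>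

definition partial_deriv ::
    "'m::finite \<Rightarrow> (real^'m \<Rightarrow> 'b::real_normed_vector) \<Rightarrow> real^'m \<Rightarrow> 'b" where
  "partial_deriv i f = (\<lambda>y. frechet_derivative f (at y) (axis i 1))"

text \<open>A multi-index is given as a list of directions.\<close>

definition partial_derivs ::
    "'m::finite list \<Rightarrow> (real^'m \<Rightarrow> 'b::real_normed_vector) \<Rightarrow> real^'m \<Rightarrow> 'b" where
  "partial_derivs is f = foldr partial_deriv is f"

text \<open>To be used for open \<open>U\<close> only; the values of \<open>f\<close> outside \<open>U\<close> are then irrelevant. Differentiability
  of all iterated partial derivatives includes their continuity.\<close>

definition smooth_on :: "(real^'m::finite) set \<Rightarrow> (real^'m \<Rightarrow> 'b::real_normed_vector) \<Rightarrow> bool" where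
  "smooth_on U f \<longleftrightarrow> (\<forall>is. \<forall>y\<in>U. partial_derivs is f differentiable (at y))"

definition test_functions :: "(real^'m::finite) set \<Rightarrow> (real^'m \<Rightarrow> complex) set" where
  "test_functions U = {\<phi>. smooth_on UNIV \<phi> \<and> compact (closure {y. \<phi> y \<noteq> 0})
     \<and> closure {y. \<phi> y \<noteq> 0} \<subseteq> U}"


section \<open>Smooth manifolds\<close>

text \<open>The underlying space of the manifold is a Hausdorff second countable type \<open>'a\<close>. A chart
  \<open>(O, x)\<close> is a domain together with a coordinate map, whose values outside \<open>O\<close> do not matter. The
  smooth structure is a maximal atlas, so that its elements are all charts of the manifold.\<close>

type_synonym ('a, 'm) chart = "'a set \<times> ('a \<Rightarrow> real^'m)"

definition chart_inv :: "('a, 'm::finite) chart \<Rightarrow> real^'m \<Rightarrow> 'a" where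
  "chart_inv c = inv_into (fst c) (snd c)"

definition chart_image :: "('a, 'm::finite) chart \<Rightarrow> (real^'m) set" where
  "chart_image c = snd c ` fst c"

definition is_chart :: "('a::topological_space, 'm::finite) chart \<Rightarrow> bool" where
  "is_chart c \<longleftrightarrow> open (fst c) \<and> open (chart_image c)
     \<and> homeomorphism (fst c) (chart_image c) (snd c) (chart_inv c)"

definition compatible_charts :: "('a, 'm::finite) chart \<Rightarrow> ('a, 'm) chart \<Rightarrow> bool" where
  "compatible_charts c d \<longleftrightarrow>
     smooth_on (snd c ` (fst c \<inter> fst d)) (snd d \<circ> chart_inv c)
     \<and> smooth_on (snd d ` (fst c \<inter> fst d)) (snd c \<circ> chart_inv d)"

definition smooth_manifold ::
    "('a::{t2_space, second_countable_topology}, 'm::finite) chart set \<Rightarrow> bool" where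
  "smooth_manifold A \<longleftrightarrow>
     (\<forall>c\<in>A. is_chart c)
     \<and> (\<Union>c\<in>A. fst c) = UNIV
     \<and> (\<forall>c\<in>A. \<forall>d\<in>A. compatible_charts c d)
     \<and> (\<forall>c. is_chart c \<and> (\<forall>d\<in>A. compatible_charts c d) \<longrightarrow> c \<in> A)"

text \<open>Smooth complex valued functions with compact support contained in the open set \<open>W\<close>.\<close>

definition manifold_test_functions ::
    "('a::topological_space, 'm::finite) chart set \<Rightarrow> 'a set \<Rightarrow> ('a \<Rightarrow> complex) set" where
  "manifold_test_functions A W = {\<phi>. (\<forall>c\<in>A. smooth_on (chart_image c) (\<phi> \<circ> chart_inv c))
     \<and> compact (closure {p. \<phi> p \<noteq> 0}) \<and> closure {p. \<phi> p \<noteq> 0} \<subseteq> W}"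

text \<open>A tangent vector at \<open>p\<close> is the family of its components with respect to all charts around \<open>p\<close>
  (and \<open>0\<close> at the other indices).\<close>

type_synonym ('a, 'm) tangent = "('a, 'm) chart \<Rightarrow> real^'m"

definition tangent_space :: "('a, 'm::finite) chart set \<Rightarrow> 'a \<Rightarrow> ('a, 'm) tangent set" where
  "tangent_space A p = {X.
     (\<forall>c. \<not> (c \<in> A \<and> p \<in> fst c) \<longrightarrow> X c = 0)
     \<and> (\<forall>c\<in>A. \<forall>d\<in>A. p \<in> fst c \<and> p \<in> fst d \<longrightarrow>
          X d = frechet_derivative (snd d \<circ> chart_inv c) (at (snd c p)) (X c))}"

text \<open>The coordinate vector field \<open>\<partial>/\<partial>x\<^sup>i\<close> of the chart \<open>c\<close> at a point \<open>p\<close> of its domain.\<close>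

definition coord_vector ::
    "('a, 'm::finite) chart set \<Rightarrow> ('a, 'm) chart \<Rightarrow> 'a \<Rightarrow> 'm \<Rightarrow> ('a, 'm) tangent" where
  "coord_vector A c p i = (\<lambda>d. if d \<in> A \<and> p \<in> fst d
     then frechet_derivative (snd d \<circ> chart_inv c) (at (snd c p)) (axis i 1) else 0)"


section \<open>The cotangent bundle\<close>

type_synonym ('a, 'm) covector = "('a, 'm) tangent \<Rightarrow> real"

definition cotangent_space :: "('a, 'm::finite) chart set \<Rightarrow> 'a \<Rightarrow> ('a, 'm) covector set" where
  "cotangent_space A p = {\<omega>.
     (\<forall>X. X \<notin> tangent_space A p \<longrightarrow> \<omega> X = 0)
     \<and> (\<forall>X\<in>tangent_space A p. \<forall>Y\<in>tangent_space A p. \<omega> (\<lambda>c. X c + Y c) = \<omega> X + \<omega> Y)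
     \<and> (\<forall>a. \<forall>X\<in>tangent_space A p. \<omega> (\<lambda>c. a *\<^sub>R X c) = a * \<omega> X)}"

definition cotangent_bundle :: "('a, 'm::finite) chart set \<Rightarrow> ('a \<times> ('a, 'm) covector) set" where
  "cotangent_bundle A = {(p, \<omega>). \<omega> \<in> cotangent_space A p}"

definition cotangent_bundle_nonzero ::
    "('a, 'm::finite) chart set \<Rightarrow> ('a \<times> ('a, 'm) covector) set" where
  "cotangent_bundle_nonzero A = {(p, \<omega>). \<omega> \<in> cotangent_space A p \<and> \<omega> \<noteq> (\<lambda>X. 0)}"

text \<open>The covector \<open>\<Sum>\<^sub>j \<xi>\<^sub>j dx\<^sup>j\<close> at a point \<open>p\<close> of the domain of the chart \<open>c\<close>.\<close>

definition coord_covector ::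
    "('a, 'm::finite) chart set \<Rightarrow> ('a, 'm) chart \<Rightarrow> 'a \<Rightarrow> real^'m \<Rightarrow> ('a, 'm) covector" where
  "coord_covector A c p \<xi> = (\<lambda>X. if X \<in> tangent_space A p then (\<Sum>j\<in>UNIV. \<xi> $ j * X c $ j) else 0)"

definition cotangent_topology ::
    "('a, 'm::finite) chart set \<Rightarrow> ('a \<times> ('a, 'm) covector) topology" where
  "cotangent_topology A = topology (\<lambda>W. W \<subseteq> cotangent_bundle A \<and> (\<forall>c\<in>A.
     open {(y, \<xi>). y \<in> chart_image c \<and> (chart_inv c y, coord_covector A c (chart_inv c y) \<xi>) \<in> W}))"

lemma istopology_cotangent:
  "istopology (\<lambda>W. W \<subseteq> cotangent_bundle A \<and> (\<forall>c\<in>A.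
     open {(y, \<xi>). y \<in> chart_image c \<and> (chart_inv c y, coord_covector A c (chart_inv c y) \<xi>) \<in> W}))"
  (is "istopology (\<lambda>W. _ \<and> (\<forall>c\<in>A. open (?P c W)))")
proof -
  have i: "?P c (S \<inter> T) = ?P c S \<inter> ?P c T" for c S T by auto
  have u: "?P c (\<Union>K) = (\<Union>S\<in>K. ?P c S)" for c K by auto
  show ?thesis
    unfolding istopology_def i u by (auto intro!: open_Int open_UN)
qed

definition conic :: "('a \<times> ('a, 'm::finite) covector) set \<Rightarrow> bool" where
  "conic L \<longleftrightarrow> (\<forall>p \<omega> t. (p, \<omega>) \<in> L \<and> 0 < t \<longrightarrow> (p, \<lambda>X. t * \<omega> X) \<in> L)"

definition closed_conic ::
    "('a, 'm::finite) chart set \<Rightarrow> ('a \<times> ('a, 'm) covector) set \<Rightarrow> bool" where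
  "closed_conic A L \<longleftrightarrow>
     closedin (subtopology (cotangent_topology A) (cotangent_bundle_nonzero A)) L \<and> conic L"


section \<open>Densities\<close>

type_synonym ('a, 'm) density = "('m \<Rightarrow> ('a, 'm) tangent) \<Rightarrow> complex"

text \<open>The fibre of \<open>DM\<close> at \<open>p\<close>: functions of \<open>m\<close>-tuples of tangent vectors at \<open>p\<close> which scale by
  \<open>\<bar>det T\<bar>\<close> under the action of a matrix \<open>T\<close>.\<close>

definition density_space :: "('a, 'm::finite) chart set \<Rightarrow> 'a \<Rightarrow> ('a, 'm) density set" where
  "density_space A p = {\<mu>.
     (\<forall>X. \<not> range X \<subseteq> tangent_space A p \<longrightarrow> \<mu> X = 0)
     \<and> (\<forall>X. \<forall>T :: real^'m^'m. range X \<subseteq> tangent_space A p \<longrightarrow>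
          \<mu> (\<lambda>i c. \<Sum>j\<in>UNIV. T $ i $ j *\<^sub>R X j c) = of_real \<bar>det T\<bar> * \<mu> X)}"

text \<open>The density \<open>\<lambda>\<^sup>x\<close> at \<open>p\<close>, given by the determinant of the components with respect to the chart.
  It is the density with value \<open>1\<close> on the coordinate vectors, see \<open>coord_density_unique\<close> below.\<close>

definition coord_density ::
    "('a, 'm::finite) chart set \<Rightarrow> ('a, 'm) chart \<Rightarrow> 'a \<Rightarrow> ('a, 'm) density" where
  "coord_density A c p = (\<lambda>X. if range X \<subseteq> tangent_space A p
     then of_real \<bar>det (\<chi> i. X i c)\<bar> else 0)"

context
  fixes A :: "('a::{t2_space, second_countable_topology}, 'm::finite) chart set" and p :: 'a
  assumes M: "smooth_manifold A"
begin

lemma transition_differentiable: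
  assumes "c \<in> A" "d \<in> A" "p \<in> fst c" "p \<in> fst d"
  shows "(snd d \<circ> chart_inv c) differentiable (at (snd c p))"
proof -
  have "smooth_on (snd c ` (fst c \<inter> fst d)) (snd d \<circ> chart_inv c)"
    using M assms unfolding smooth_manifold_def compatible_charts_def by blast
  then have "partial_derivs [] (snd d \<circ> chart_inv c) differentiable (at (snd c p))"
    using assms unfolding smooth_on_def by blast
  then show ?thesis by (simp add: partial_derivs_def)
qed

lemma chart_inv_chart:
  assumes "c \<in> A" "q \<in> fst c"
  shows "chart_inv c (snd c q) = q"
  using M assms unfolding smooth_manifold_def is_chart_def homeomorphism_def by blast

lemma open_chart_image:
  assumes "c \<in> A" "open W"
  shows "open (snd c ` (fst c \<inter> W))"
proof -
  have h: "homeomorphism (fst c) (chart_image c) (snd c) (chart_inv c)" and o: "open (chart_image c)"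
    using M assms unfolding smooth_manifold_def is_chart_def by blast+
  have "openin (top_of_set (chart_image c)) (snd c ` (fst c \<inter> W))"
    using homeomorphism_imp_open_map[OF h] assms by (simp add: openin_open_Int)
  then show ?thesis using o openin_open_trans by blast
qed

lemma transition_chain:
  assumes "c \<in> A" "d \<in> A" "e \<in> A" "p \<in> fst c" "p \<in> fst d" "p \<in> fst e"
  shows "frechet_derivative (snd e \<circ> chart_inv c) (at (snd c p)) w =
    frechet_derivative (snd e \<circ> chart_inv d) (at (snd d p))
      (frechet_derivative (snd d \<circ> chart_inv c) (at (snd c p)) w)"
proof -
  let ?cd = "snd d \<circ> chart_inv c" and ?de = "snd e \<circ> chart_inv d" and ?ce = "snd e \<circ> chart_inv c"
  let ?W = "snd c ` (fst c \<inter> fst d)"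
  have "open (fst d)"
    using M assms unfolding smooth_manifold_def is_chart_def by blast
  then have oW: "open ?W" using open_chart_image assms by blast
  have y: "?cd (snd c p) = snd d p" using assms by (simp add: chart_inv_chart)
  have 1: "(?cd has_derivative frechet_derivative ?cd (at (snd c p))) (at (snd c p))"
    using transition_differentiable[of c d] assms frechet_derivative_works by blast
  have 2: "(?de has_derivative frechet_derivative ?de (at (snd d p))) (at (?cd (snd c p)))"
    unfolding y using transition_differentiable[of d e] assms frechet_derivative_works by blast
  have 3: "((?de \<circ> ?cd) has_derivative
      (frechet_derivative ?de (at (snd d p)) \<circ> frechet_derivative ?cd (at (snd c p)))) (at (snd c p))"
    by (rule diff_chain_at[OF 1 2])
  have "(?ce has_derivative
      (frechet_derivative ?de (at (snd d p)) \<circ> frechet_derivative ?cd (at (snd c p)))) (at (snd c p))"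
    by (rule has_derivative_transform_within_open[OF 3 oW])
      (use assms in \<open>auto simp: chart_inv_chart\<close>)
  from fun_cong[OF frechet_derivative_at[OF this], of w] show ?thesis by simp
qed

lemma transition_self:
  assumes "c \<in> A" "p \<in> fst c"
  shows "frechet_derivative (snd c \<circ> chart_inv c) (at (snd c p)) w = w"
proof -
  have o: "open (snd c ` (fst c \<inter> UNIV))" using open_chart_image assms by blast
  have "((snd c \<circ> chart_inv c) has_derivative (\<lambda>w. w)) (at (snd c p))"
    by (rule has_derivative_transform_within_open[OF has_derivative_ident o])
      (use assms in \<open>auto simp: chart_inv_chart\<close>)
  from fun_cong[OF frechet_derivative_at[OF this], of w] show ?thesis by simp
qed

lemma coord_vector_tangent:
  assumes "c \<in> A" "p \<in> fst c"
  shows "coord_vector A c p i \<in> tangent_space A p"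
  unfolding tangent_space_def
proof (intro CollectI conjI allI impI ballI)
  fix d assume "\<not> (d \<in> A \<and> p \<in> fst d)"
  then show "coord_vector A c p i d = 0" by (simp only: coord_vector_def if_False)
next
  fix d e assume "d \<in> A" "e \<in> A" "p \<in> fst d \<and> p \<in> fst e"
  then show "coord_vector A c p i e =
      frechet_derivative (snd e \<circ> chart_inv d) (at (snd d p)) (coord_vector A c p i d)"
    using transition_chain[of c d e] assms by (simp add: coord_vector_def)
qed

lemma tangent_expansion:
  assumes "c \<in> A" "p \<in> fst c" "X \<in> tangent_space A p"
  shows "X = (\<lambda>d. \<Sum>j\<in>UNIV. X c $ j *\<^sub>R coord_vector A c p j d)"
proof
  fix d
  show "X d = (\<Sum>j\<in>UNIV. X c $ j *\<^sub>R coord_vector A c p j d)"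
  proof (cases "d \<in> A \<and> p \<in> fst d")
    case True
    let ?D = "frechet_derivative (snd d \<circ> chart_inv c) (at (snd c p))"
    have l: "linear ?D"
      by (rule linear_frechet_derivative[OF transition_differentiable]) (use True assms in auto)
    have "X d = ?D (X c)" using assms True unfolding tangent_space_def by blast
    also have "\<dots> = ?D (\<Sum>j\<in>UNIV. X c $ j *\<^sub>R axis j 1)"
      by (simp add: basis_expansion flip: scalar_mult_eq_scaleR)
    also have "\<dots> = (\<Sum>j\<in>UNIV. X c $ j *\<^sub>R ?D (axis j 1))"
      by (simp add: linear_sum[OF l] linear_cmul[OF l])
    finally show ?thesis using True by (simp add: coord_vector_def)
  next
    case False
    then have "X d = 0" using assms unfolding tangent_space_def by blast
    moreover have "coord_vector A c p j d = 0" for j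
      using False by (simp only: coord_vector_def if_False)
    ultimately show ?thesis by simp
  qed
qed

lemma tangent_combination:
  assumes "range X \<subseteq> tangent_space A p"
  shows "(\<lambda>c. \<Sum>j\<in>(UNIV :: 'm set). t j *\<^sub>R X j c) \<in> tangent_space A p"
  unfolding tangent_space_def
proof (intro CollectI conjI allI impI ballI)
  fix c assume "\<not> (c \<in> A \<and> p \<in> fst c)"
  then have "X j c = 0" for j using assms unfolding tangent_space_def by blast
  then show "(\<Sum>j\<in>UNIV. t j *\<^sub>R X j c) = 0" by simp
next
  fix c d assume a: "c \<in> A" "d \<in> A" "p \<in> fst c \<and> p \<in> fst d"
  let ?D = "frechet_derivative (snd d \<circ> chart_inv c) (at (snd c p))"
  have l: "linear ?D"
    by (rule linear_frechet_derivative[OF transition_differentiable]) (use a in auto)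
  have "X j d = ?D (X j c)" for j using assms a unfolding tangent_space_def by blast
  then show "(\<Sum>j\<in>UNIV. t j *\<^sub>R X j d) = ?D (\<Sum>j\<in>UNIV. t j *\<^sub>R X j c)"
    by (simp add: linear_sum[OF l] linear_cmul[OF l])
qed

lemma coord_density_unique:
  assumes "c \<in> A" "p \<in> fst c"
  shows "\<mu> \<in> density_space A p \<and> \<mu> (coord_vector A c p) = 1 \<longleftrightarrow> \<mu> = coord_density A c p"
proof -
  let ?M = "\<lambda>X :: 'm \<Rightarrow> ('a, 'm) tangent. (\<chi> i. X i c) :: real^'m^'m"
  have r: "range (coord_vector A c p) \<subseteq> tangent_space A p"
    using coord_vector_tangent assms by blast
  have "coord_vector A c p i c = axis i 1" for i
    using assms by (simp add: coord_vector_def transition_self)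
  then have "?M (coord_vector A c p) = mat 1"
    by (simp add: mat_def axis_def vec_eq_iff)
  then have one: "coord_density A c p (coord_vector A c p) = 1"
    using r by (simp add: coord_density_def)
  have "coord_density A c p \<in> density_space A p"
    unfolding density_space_def
  proof (intro CollectI conjI allI impI)
    fix X :: "'m \<Rightarrow> ('a, 'm) tangent" assume "\<not> range X \<subseteq> tangent_space A p"
    then show "coord_density A c p X = 0" by (simp add: coord_density_def)
  next
    fix X :: "'m \<Rightarrow> ('a, 'm) tangent" and T :: "real^'m^'m" assume X: "range X \<subseteq> tangent_space A p"
    let ?Y = "\<lambda>i c. \<Sum>j\<in>UNIV. T $ i $ j *\<^sub>R X j c"
    have Y: "range ?Y \<subseteq> tangent_space A p" using tangent_combination X by blast
    have "?M ?Y = T ** ?M X" by (simp add: vec_eq_iff matrix_matrix_mult_def)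
    then have "det (?M ?Y) = det T * det (?M X)" by (simp add: det_mul)
    then show "coord_density A c p ?Y = of_real \<bar>det T\<bar> * coord_density A c p X"
      using X Y by (simp add: coord_density_def abs_mult)
  qed
  moreover have "\<mu> X = coord_density A c p X"
    if "\<mu> \<in> density_space A p" "\<mu> (coord_vector A c p) = 1" for X
  proof (cases "range X \<subseteq> tangent_space A p")
    case True
    have "X i = (\<lambda>d. \<Sum>j\<in>UNIV. ?M X $ i $ j *\<^sub>R coord_vector A c p j d)" for i
      using tangent_expansion[OF assms, of "X i"] True by (simp add: image_subset_iff)
    then have "X = (\<lambda>i d. \<Sum>j\<in>UNIV. ?M X $ i $ j *\<^sub>R coord_vector A c p j d)"
      by (rule ext)
    moreover have "\<mu> (\<lambda>i d. \<Sum>j\<in>UNIV. ?M X $ i $ j *\<^sub>R coord_vector A c p j d) =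
        of_real \<bar>det (?M X)\<bar> * \<mu> (coord_vector A c p)"
      using that(1) r unfolding density_space_def by blast
    ultimately show ?thesis using True that(2) by (simp add: coord_density_def)
  next
    case False
    then show ?thesis using that(1) by (simp add: coord_density_def density_space_def)
  qed
  ultimately show ?thesis using one by blast
qed

end


section \<open>Vector bundles\<close>

text \<open>A complex vector bundle with total space \<open>'e\<close> and rank \<open>CARD('k)\<close>, given by its projection,
  the vector space operations of its fibres and its local trivialisations. A local trivialisation
  \<open>(O, \<Phi>)\<close> stands for the map sending \<open>e\<close> over \<open>O\<close> to \<open>(proj E e, \<Phi> e)\<close>. As for charts, the family of
  smooth local trivialisations is assumed to be maximal.\<close>

record ('a, 'e, 'k) cvbundle =
  proj :: "'e \<Rightarrow> 'a"
  fadd :: "'e \<Rightarrow> 'e \<Rightarrow> 'e"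
  fscale :: "complex \<Rightarrow> 'e \<Rightarrow> 'e"
  trivs :: "('a set \<times> ('e \<Rightarrow> complex^'k)) set"

definition fibre :: "('a, 'e, 'k::finite) cvbundle \<Rightarrow> 'a \<Rightarrow> 'e set" where
  "fibre E p = {e. proj E e = p}"

text \<open>The fibre isomorphisms transport the vector space axioms from \<open>complex^'k\<close> to the fibres.\<close>

definition is_triv ::
    "('a::topological_space, 'e, 'k::finite) cvbundle \<Rightarrow> 'a set \<times> ('e \<Rightarrow> complex^'k) \<Rightarrow> bool" where
  "is_triv E \<tau> \<longleftrightarrow> open (fst \<tau>) \<and> (\<forall>p\<in>fst \<tau>.
     bij_betw (snd \<tau>) (fibre E p) UNIV
     \<and> (\<forall>e\<in>fibre E p. \<forall>f\<in>fibre E p. snd \<tau> (fadd E e f) = snd \<tau> e + snd \<tau> f)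
     \<and> (\<forall>a. \<forall>e\<in>fibre E p. snd \<tau> (fscale E a e) = a *s snd \<tau> e))"

text \<open>The local frame of a trivialisation \<open>\<Phi>\<close> (second component only) at \<open>p\<close>.\<close>

definition frame :: "('a, 'e, 'k::finite) cvbundle \<Rightarrow> ('e \<Rightarrow> complex^'k) \<Rightarrow> 'a \<Rightarrow> 'k \<Rightarrow> 'e" where
  "frame E \<Phi> p j = inv_into (fibre E p) \<Phi> (axis j 1)"

text \<open>Smoothness of the entries of the transition matrices from \<open>\<sigma>\<close> to \<open>\<tau>\<close>, in all charts.\<close>

definition smooth_transition :: "('a, 'm::finite) chart set \<Rightarrow> ('a, 'e, 'k::finite) cvbundle
    \<Rightarrow> 'a set \<times> ('e \<Rightarrow> complex^'k) \<Rightarrow> 'a set \<times> ('e \<Rightarrow> complex^'k) \<Rightarrow> bool" where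
  "smooth_transition A E \<sigma> \<tau> \<longleftrightarrow> (\<forall>c\<in>A. \<forall>i j.
     smooth_on (snd c ` (fst c \<inter> fst \<sigma> \<inter> fst \<tau>))
       (\<lambda>y. snd \<tau> (frame E (snd \<sigma>) (chart_inv c y) j) $ i))"

definition vector_bundle ::
    "('a::topological_space, 'm::finite) chart set \<Rightarrow> ('a, 'e, 'k::finite) cvbundle \<Rightarrow> bool" where
  "vector_bundle A E \<longleftrightarrow>
     (\<forall>p. \<forall>e\<in>fibre E p. \<forall>f\<in>fibre E p. fadd E e f \<in> fibre E p)
     \<and> (\<forall>p. \<forall>a. \<forall>e\<in>fibre E p. fscale E a e \<in> fibre E p)
     \<and> (\<forall>\<tau>\<in>trivs E. is_triv E \<tau>)
     \<and> (\<Union>\<tau>\<in>trivs E. fst \<tau>) = UNIV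
     \<and> (\<forall>\<sigma>\<in>trivs E. \<forall>\<tau>\<in>trivs E. smooth_transition A E \<sigma> \<tau>)
     \<and> (\<forall>\<tau>. is_triv E \<tau>
          \<and> (\<forall>\<sigma>\<in>trivs E. smooth_transition A E \<sigma> \<tau> \<and> smooth_transition A E \<tau> \<sigma>) \<longrightarrow> \<tau> \<in> trivs E)"

text \<open>A chart of the manifold together with a trivialisation of \<open>E\<close> over its domain.\<close>

definition triv_chart :: "('a, 'm::finite) chart set \<Rightarrow> ('a, 'e, 'k::finite) cvbundle
    \<Rightarrow> ('a, 'm) chart \<Rightarrow> ('e \<Rightarrow> complex^'k) \<Rightarrow> bool" where
  "triv_chart A E c \<Phi> \<longleftrightarrow> c \<in> A \<and> (fst c, \<Phi>) \<in> trivs E"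


section \<open>Distributional sections\<close>

type_synonym ('a, 'm, 'e) dual_section = "'a \<Rightarrow> 'e \<Rightarrow> ('a, 'm) density"
type_synonym ('a, 'm, 'e) distribution = "('a, 'm, 'e) dual_section \<Rightarrow> complex"

text \<open>The fibre \<open>L(E\<^sub>p, D\<^sub>pM)\<close> of \<open>E\<^sup>\<or>\<close> at \<open>p\<close>.\<close>

definition dual_fibre :: "('a, 'm::finite) chart set \<Rightarrow> ('a, 'e, 'k::finite) cvbundle \<Rightarrow> 'a
    \<Rightarrow> ('e \<Rightarrow> ('a, 'm) density) set" where
  "dual_fibre A E p = {f.
     (\<forall>e. e \<notin> fibre E p \<longrightarrow> f e = 0)
     \<and> (\<forall>e\<in>fibre E p. f e \<in> density_space A p)
     \<and> (\<forall>e\<in>fibre E p. \<forall>e'\<in>fibre E p. f (fadd E e e') = f e + f e')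
     \<and> (\<forall>a. \<forall>e\<in>fibre E p. f (fscale E a e) = a *\<^sub>C f e)}"

text \<open>The \<open>j\<close>-th component, in the coordinates of \<open>c\<close>, of a section of \<open>E\<^sup>\<or>\<close> with respect to the
  local frame \<open>\<sigma>\<^sup>j\<close> defined below.\<close>

definition section_comp :: "('a, 'm::finite) chart set \<Rightarrow> ('a, 'e, 'k::finite) cvbundle
    \<Rightarrow> ('a, 'm) chart \<Rightarrow> ('e \<Rightarrow> complex^'k) \<Rightarrow> 'k \<Rightarrow> ('a, 'm, 'e) dual_section \<Rightarrow> real^'m \<Rightarrow> complex"
  where
  "section_comp A E c \<Phi> j s = (\<lambda>y. let p = chart_inv c y in
     s p (frame E \<Phi> p j) (coord_vector A c p))"

definition section_support :: "('a::topological_space, 'm::finite, 'e) dual_section \<Rightarrow> 'a set" where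
  "section_support s = closure {p. s p \<noteq> 0}"

definition compact_sections :: "('a::topological_space, 'm::finite) chart set
    \<Rightarrow> ('a, 'e, 'k::finite) cvbundle \<Rightarrow> ('a, 'm, 'e) dual_section set" where
  "compact_sections A E = {s. (\<forall>p. s p \<in> dual_fibre A E p)
     \<and> (\<forall>c \<Phi> j. triv_chart A E c \<Phi> \<longrightarrow> smooth_on (chart_image c) (section_comp A E c \<Phi> j s))
     \<and> compact (section_support s)}"

text \<open>The Frechet space of sections supported in the compact set \<open>K\<close>, with the topology of uniform
  convergence of all derivatives on compact sets, in all coordinates.\<close>

definition frechet_topology :: "('a::topological_space, 'm::finite) chart set
    \<Rightarrow> ('a, 'e, 'k::finite) cvbundle \<Rightarrow> 'a set \<Rightarrow> ('a, 'm, 'e) dual_section topology" where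
  "frechet_topology A E K =
     seminorm_topology {s \<in> compact_sections A E. section_support s \<subseteq> K}
       {\<lambda>s. (SUP y\<in>snd c ` C. cmod (partial_derivs is (section_comp A E c \<Phi> j s) y)) | c \<Phi> j is C.
          triv_chart A E c \<Phi> \<and> compact C \<and> C \<noteq> {} \<and> C \<subseteq> fst c}"

text \<open>The (LF) topology: the finest locally convex topology for which the inclusions of the Frechet
  spaces above are continuous.\<close>

definition LF_topology :: "('a::topological_space, 'm::finite) chart set
    \<Rightarrow> ('a, 'e, 'k::finite) cvbundle \<Rightarrow> ('a, 'm, 'e) dual_section topology" where
  "LF_topology A E = seminorm_topology (compact_sections A E)
     {p. seminorm_on (compact_sections A E) p
        \<and> (\<forall>K. compact K \<longrightarrow> continuous_map (frechet_topology A E K) euclideanreal p)}"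

definition distributions :: "('a::topological_space, 'm::finite) chart set
    \<Rightarrow> ('a, 'e, 'k::finite) cvbundle \<Rightarrow> ('a, 'm, 'e) distribution set" where
  "distributions A E = continuous_dual (LF_topology A E)"

definition distribution_topology :: "('a::topological_space, 'm::finite) chart set
    \<Rightarrow> ('a, 'e, 'k::finite) cvbundle \<Rightarrow> ('a, 'm, 'e) distribution topology" where
  "distribution_topology A E = strong_dual (LF_topology A E)"

text \<open>The section \<open>\<sigma>\<^sup>j\<close> of \<open>E\<^sup>\<or>\<close> over the domain of \<open>c\<close>, extended by \<open>0\<close>.\<close>

definition dual_frame :: "('a, 'm::finite) chart set \<Rightarrow> ('a, 'e, 'k::finite) cvbundle
    \<Rightarrow> ('a, 'm) chart \<Rightarrow> ('e \<Rightarrow> complex^'k) \<Rightarrow> 'k \<Rightarrow> ('a, 'm, 'e) dual_section" where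
  "dual_frame A E c \<Phi> j = (\<lambda>p e. if p \<in> fst c \<and> e \<in> fibre E p
     then (\<Phi> e $ j) *\<^sub>C coord_density A c p else 0)"

text \<open>The local representative \<open>u\<^sup>j\<close>, a distribution on the image of the chart.\<close>

definition local_rep :: "('a, 'm::finite) chart set \<Rightarrow> ('a, 'e, 'k::finite) cvbundle
    \<Rightarrow> ('a, 'm) chart \<Rightarrow> ('e \<Rightarrow> complex^'k) \<Rightarrow> 'k \<Rightarrow> ('a, 'm, 'e) distribution
    \<Rightarrow> (real^'m \<Rightarrow> complex) \<Rightarrow> complex" where
  "local_rep A E c \<Phi> j u = (\<lambda>\<phi>. u (\<lambda>p. \<phi> (snd c p) *\<^sub>C dual_frame A E c \<Phi> j p))"


section \<open>Wave front sets\<close>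

definition bracket :: "real^'m::finite \<Rightarrow> real" where
  "bracket \<xi> = (1 + (norm \<xi>)\<^sup>2) powr (1 / 2)"

text \<open>The Fourier transform of the compactly supported distribution \<open>\<phi>v\<close>, that is, its value on
  \<open>y \<mapsto> e\<^sup>-\<^sup>i\<^sup>y\<^sup>\<xi>\<close>.\<close>

definition fourier_cutoff ::
    "(real^'m::finite \<Rightarrow> complex) \<Rightarrow> ((real^'m \<Rightarrow> complex) \<Rightarrow> complex) \<Rightarrow> real^'m \<Rightarrow> complex" where
  "fourier_cutoff \<phi> v \<xi> = v (\<lambda>y. \<phi> y * exp (- \<i> * of_real (y \<bullet> \<xi>)))"

definition is_cone :: "(real^'m::finite) set \<Rightarrow> bool" where
  "is_cone V \<longleftrightarrow> (\<forall>\<xi>\<in>V. \<forall>t>0. t *\<^sub>R \<xi> \<in> V)"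

definition WF_sobolev_local :: "(real^'m::finite) set \<Rightarrow> real
    \<Rightarrow> ((real^'m \<Rightarrow> complex) \<Rightarrow> complex) \<Rightarrow> ((real^'m) \<times> (real^'m)) set" where
  "WF_sobolev_local U r v = {(y, \<eta>). y \<in> U \<and> \<eta> \<noteq> 0 \<and>
     \<not> (\<exists>V \<phi>. open V \<and> is_cone V \<and> \<eta> \<in> V \<and> \<phi> \<in> test_functions U \<and> \<phi> y \<noteq> 0
          \<and> set_integrable lborel V (\<lambda>\<xi>. (cmod (fourier_cutoff \<phi> v \<xi>))\<^sup>2 * bracket \<xi> powr (2 * r)))}"

definition WF_local :: "(real^'m::finite) set
    \<Rightarrow> ((real^'m \<Rightarrow> complex) \<Rightarrow> complex) \<Rightarrow> ((real^'m) \<times> (real^'m)) set" where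
  "WF_local U v = {(y, \<eta>). y \<in> U \<and> \<eta> \<noteq> 0 \<and>
     \<not> (\<exists>V \<phi>. open V \<and> is_cone V \<and> \<eta> \<in> V \<and> \<phi> \<in> test_functions U \<and> \<phi> y \<noteq> 0
          \<and> (\<forall>\<nu>>0. bdd_above ((\<lambda>\<xi>. bracket \<xi> powr \<nu> * cmod (fourier_cutoff \<phi> v \<xi>)) ` V)))}"

text \<open>Wave front sets do not depend on the chart and trivialisation used around a given point, and
  so are defined by some choice of these.\<close>

definition WF_sobolev :: "('a, 'm::finite) chart set \<Rightarrow> ('a, 'e, 'k::finite) cvbundle \<Rightarrow> real
    \<Rightarrow> ('a, 'm, 'e) distribution \<Rightarrow> ('a \<times> ('a, 'm) covector) set" where
  "WF_sobolev A E r u = {(p, coord_covector A c p \<xi>) | p c \<Phi> \<xi>. triv_chart A E c \<Phi> \<and> p \<in> fst c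
     \<and> (snd c p, \<xi>) \<in> (\<Union>j. WF_sobolev_local (chart_image c) r (local_rep A E c \<Phi> j u))}"

definition WF :: "('a, 'm::finite) chart set \<Rightarrow> ('a, 'e, 'k::finite) cvbundle
    \<Rightarrow> ('a, 'm, 'e) distribution \<Rightarrow> ('a \<times> ('a, 'm) covector) set" where
  "WF A E u = {(p, coord_covector A c p \<xi>) | p c \<Phi> \<xi>. triv_chart A E c \<Phi> \<and> p \<in> fst c
     \<and> (snd c p, \<xi>) \<in> (\<Union>j. WF_local (chart_image c) (local_rep A E c \<Phi> j u))}"


section \<open>The spaces of distributions with prescribed wave front set\<close>

definition admissible :: "('a::topological_space, 'm::finite) chart set
    \<Rightarrow> ('a, 'e, 'k::finite) cvbundle \<Rightarrow> ('a \<times> ('a, 'm) covector) set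
    \<Rightarrow> ('a, 'm) chart \<Rightarrow> ('e \<Rightarrow> complex^'k) \<Rightarrow> ('a \<Rightarrow> complex) \<Rightarrow> (real^'m) set \<Rightarrow> bool" where
  "admissible A E L c \<Phi> \<phi> V \<longleftrightarrow> triv_chart A E c \<Phi> \<and> \<phi> \<in> manifold_test_functions A (fst c)
     \<and> closed V \<and> is_cone V
     \<and> {(p, coord_covector A c p \<xi>) | p \<xi>. p \<in> closure {p. \<phi> p \<noteq> 0} \<and> \<xi> \<in> V} \<inter> L = {}"

text \<open>The function \<open>\<phi> \<circ> x\<^sup>-\<^sup>1\<close>, extended by \<open>0\<close> outside the image of the chart.\<close>

definition push_forward ::
    "('a, 'm::finite) chart \<Rightarrow> ('a \<Rightarrow> complex) \<Rightarrow> real^'m \<Rightarrow> complex" where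
  "push_forward c \<phi> = (\<lambda>y. if y \<in> chart_image c then \<phi> (chart_inv c y) else 0)"

definition sobolev_seminorm :: "('a, 'm::finite) chart set \<Rightarrow> ('a, 'e, 'k::finite) cvbundle \<Rightarrow> real
    \<Rightarrow> ('a, 'm) chart \<Rightarrow> ('e \<Rightarrow> complex^'k) \<Rightarrow> ('a \<Rightarrow> complex) \<Rightarrow> (real^'m) set
    \<Rightarrow> ('a, 'm, 'e) distribution \<Rightarrow> real" where
  "sobolev_seminorm A E r c \<Phi> \<phi> V u = Max (range (\<lambda>j. sqrt (LINT \<xi>:V|lborel.
     (cmod (fourier_cutoff (push_forward c \<phi>) (local_rep A E c \<Phi> j u) \<xi>))\<^sup>2 * bracket \<xi> powr (2 * r))))"

definition decay_seminorm :: "('a, 'm::finite) chart set \<Rightarrow> ('a, 'e, 'k::finite) cvbundle \<Rightarrow> real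
    \<Rightarrow> ('a, 'm) chart \<Rightarrow> ('e \<Rightarrow> complex^'k) \<Rightarrow> ('a \<Rightarrow> complex) \<Rightarrow> (real^'m) set
    \<Rightarrow> ('a, 'm, 'e) distribution \<Rightarrow> real" where
  "decay_seminorm A E \<nu> c \<Phi> \<phi> V u = Max (range (\<lambda>j. SUP \<xi>\<in>V.
     bracket \<xi> powr \<nu> * cmod (fourier_cutoff (push_forward c \<phi>) (local_rep A E c \<Phi> j u) \<xi>)))"

definition sobolev_WF_space :: "('a::topological_space, 'm::finite) chart set
    \<Rightarrow> ('a, 'e, 'k::finite) cvbundle \<Rightarrow> ('a \<times> ('a, 'm) covector) set \<Rightarrow> real
    \<Rightarrow> ('a, 'm, 'e) distribution set" where
  "sobolev_WF_space A E L r = {u \<in> distributions A E. WF_sobolev A E r u \<subseteq> L}"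

definition sobolev_WF_topology :: "('a::topological_space, 'm::finite) chart set
    \<Rightarrow> ('a, 'e, 'k::finite) cvbundle \<Rightarrow> ('a \<times> ('a, 'm) covector) set \<Rightarrow> real
    \<Rightarrow> ('a, 'm, 'e) distribution topology" where
  "sobolev_WF_topology A E L r = seminorm_topology (sobolev_WF_space A E L r)
     (continuous_seminorms (distribution_topology A E)
      \<union> {sobolev_seminorm A E r c \<Phi> \<phi> V | c \<Phi> \<phi> V. admissible A E L c \<Phi> \<phi> V})"

definition WF_space :: "('a::topological_space, 'm::finite) chart set
    \<Rightarrow> ('a, 'e, 'k::finite) cvbundle \<Rightarrow> ('a \<times> ('a, 'm) covector) set
    \<Rightarrow> ('a, 'm, 'e) distribution set" where
  "WF_space A E L = {u \<in> distributions A E. WF A E u \<subseteq> L}"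

definition WF_topology :: "('a::topological_space, 'm::finite) chart set
    \<Rightarrow> ('a, 'e, 'k::finite) cvbundle \<Rightarrow> ('a \<times> ('a, 'm) covector) set
    \<Rightarrow> ('a, 'm, 'e) distribution topology" where
  "WF_topology A E L = seminorm_topology (WF_space A E L)
     (continuous_seminorms (distribution_topology A E)
      \<union> {decay_seminorm A E \<nu> c \<Phi> \<phi> V | \<nu> c \<Phi> \<phi> V. 0 < \<nu> \<and> admissible A E L c \<Phi> \<phi> V \<and> V \<noteq> {}})"

end

theory Submission
  imports Defs
begin

text \<open>That \<open>u\<close> lies in the space of order \<open>r\<close> means that all its Sobolev seminorms over admissible data
  are finite: a regular direction survives multiplication of the cutoff by a test function, at the cost
  of shrinking the cone, and compactness of \<open>supp \<phi> \<times> (V \<inter> S)\<close>, where \<open>S\<close> is the unit sphere, patches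
  finitely many local estimates together. To control the multiplication, the test function is
  approximated by trigonometric polynomials with uniformly rapidly decreasing coefficients, so that it
  acts by sums of translations on the Fourier side.

  Decay of order \<open>r + m\<close> implies square integrability with weight \<open>r\<close>. Conversely, with
  \<open>k(x) = \<integral> exp(-i x\<theta>) d\<theta>\<close> over a small cube, which has no zeros on \<open>supp \<phi>\<close>, and
  \<open>\<phi>' = \<phi> / k\<close>, one has \<open>\<F>(\<phi>u)(\<xi>) = \<integral> \<F>(\<phi>'u)(\<xi> + \<theta>) d\<theta>\<close>. By Cauchy-Schwarz the supremum of
  \<open>\<langle>\<xi>\<rangle>\<^sup>\<nu> |\<F>(\<phi>u)|\<close> over \<open>V\<close> is bounded by the seminorm of order \<open>\<nu>\<close> for \<open>\<phi>'\<close> over a slightly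
  larger cone, plus a seminorm of the strong dual which handles bounded \<open>\<xi>\<close>. Hence both families of
  seminorms define the same space and the same topology.\<close>

section \<open>Smooth functions\<close>

text \<open>The Fourier transform of a cut-off distribution exists only as the value of a functional
  on a plane wave, so products and integrals cannot simply be moved through it. Both transfers
  follow one principle: a finite combination of waves that approximates a smooth factor on the
  support, with all derivatives up to the order of the distribution there, passes through the
  functional by linearity, and the remainder is small by continuity. Multiplication uses
  trigonometric polynomials, averaging uses Riemann sums. As the order varies with the distribution,
  the polynomials must be good to every order while their coefficients obey one bound; a positive
  kernel whose normalised Fourier coefficients are at most 1 provides this. The two comparisons are
  not symmetric: the step from decay to square integrability loses as many orders as the dimension,
  the return loses none. All orders occur in the limit, which absorbs the loss. Integrals and
  suprema here are real numbers even where they ought to be infinite; finiteness on the spaces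
  therefore has to precede the statements about seminorms.\<close>

lemma has_derivative_cong_open:
  assumes "open U" "y \<in> U" "\<And>x. x \<in> U \<Longrightarrow> f x = g x"
  shows "(f has_derivative D) (at y) \<longleftrightarrow> (g has_derivative D) (at y)"
  using has_derivative_transform_within_open[of f D y UNIV U g]
    has_derivative_transform_within_open[of g D y UNIV U f] assms by metis

lemma partial_deriv_cong:
  assumes "open U" "y \<in> U" "\<And>x. x \<in> U \<Longrightarrow> f x = g x"
  shows "partial_deriv i f y = partial_deriv i g y"
  unfolding partial_deriv_def frechet_derivative_def
  using has_derivative_cong_open[OF assms] by simp

lemma differentiable_cong_open:
  assumes "open U" "y \<in> U" "\<And>x. x \<in> U \<Longrightarrow> f x = g x"
  shows "f differentiable (at y) \<longleftrightarrow> g differentiable (at y)"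
  unfolding differentiable_def using has_derivative_cong_open[of U y f g] assms by blast

lemma partial_deriv_eq:
  assumes "(f has_derivative D) (at y)"
  shows "partial_deriv i f y = D (axis i 1)"
  unfolding partial_deriv_def using frechet_derivative_at[OF assms] by simp

lemma partial_derivs_Nil [simp]: "partial_derivs [] f = f"
  by (simp add: partial_derivs_def)

lemma partial_derivs_Cons: "partial_derivs (i # is) f = partial_deriv i (partial_derivs is f)"
  by (simp add: partial_derivs_def)

lemma partial_derivs_append:
  "partial_derivs (is @ js) f = partial_derivs is (partial_derivs js f)"
  by (simp add: partial_derivs_def)

lemma partial_derivs_snoc:
  "partial_derivs (is @ [i]) f = partial_derivs is (partial_deriv i f)"
  by (simp add: partial_derivs_def)

lemma partial_derivs_cong:
  assumes "open U" "\<And>x. x \<in> U \<Longrightarrow> f x = g x" "y \<in> U"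
  shows "partial_derivs is f y = partial_derivs is g y"
  using assms(3)
proof (induction "is" arbitrary: y)
  case (Cons i "is")
  then show ?case unfolding partial_derivs_Cons
    using partial_deriv_cong[OF assms(1)] by blast
qed (use assms in auto)

lemma smooth_on_cong:
  assumes "open U" "\<And>x. x \<in> U \<Longrightarrow> f x = g x"
  shows "smooth_on U f \<longleftrightarrow> smooth_on U g"
proof -
  have "partial_derivs is f differentiable at y \<longleftrightarrow> partial_derivs is g differentiable at y"
    if "y \<in> U" for "is" y
    by (rule differentiable_cong_open[OF assms(1) that partial_derivs_cong[OF assms]])
  then show ?thesis unfolding smooth_on_def by blast
qed

lemma smooth_on_partial_derivs:
  assumes "smooth_on U f"
  shows "smooth_on U (partial_derivs is f)"
  using assms unfolding smooth_on_def by (metis partial_derivs_append)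

lemma smooth_on_partial_deriv:
  assumes "smooth_on U f"
  shows "smooth_on U (partial_deriv i f)"
  using smooth_on_partial_derivs[OF assms, of "[i]"] by (simp add: partial_derivs_Cons)

lemma smooth_on_differentiable:
  assumes "smooth_on U f" "y \<in> U"
  shows "f differentiable (at y)"
  using assms unfolding smooth_on_def by (metis partial_derivs_Nil)

lemma smooth_on_has_derivative:
  assumes "smooth_on U f" "y \<in> U"
  shows "(f has_derivative frechet_derivative f (at y)) (at y)"
  using smooth_on_differentiable[OF assms] frechet_derivative_works by blast

lemma smooth_on_subset: "smooth_on U f \<Longrightarrow> W \<subseteq> U \<Longrightarrow> smooth_on W f"
  unfolding smooth_on_def by blast

lemma smooth_on_local:
  assumes "\<And>y. y \<in> U \<Longrightarrow> \<exists>W. y \<in> W \<and> smooth_on W f"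
  shows "smooth_on U f"
  using assms unfolding smooth_on_def by blast

lemma smooth_on_imp_continuous_on:
  assumes "smooth_on U f" shows "continuous_on U f"
  using smooth_on_differentiable[OF assms]
  by (simp add: continuous_at_imp_continuous_on differentiable_imp_continuous_within)

text \<open>Iterated partial derivatives never leave \<open>Q\<close> up to equality on
  \<open>U\<close>, so differentiability of the members of \<open>Q\<close> covers every order.
  Equality on \<open>U\<close> is enough because \<open>U\<close> is open and a derivative at a
  point sees only a neighbourhood of it.\<close>

lemma smooth_on_coinduct:
  assumes "open U" "f \<in> Q"
    and diff: "\<And>g y. g \<in> Q \<Longrightarrow> y \<in> U \<Longrightarrow> g differentiable (at y)"
    and deriv: "\<And>g i. g \<in> Q \<Longrightarrow> \<exists>h\<in>Q. \<forall>y\<in>U. partial_deriv i g y = h y"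
  shows "smooth_on U f"
proof -
  have *: "\<exists>g\<in>Q. \<forall>y\<in>U. partial_derivs is f y = g y" for "is"
  proof (induction "is")
    case Nil
    then show ?case using assms(2) by auto
  next
    case (Cons i "is")
    then obtain g where g: "g \<in> Q" "\<forall>y\<in>U. partial_derivs is f y = g y" by blast
    obtain h where h: "h \<in> Q" "\<forall>y\<in>U. partial_deriv i g y = h y" using deriv[OF g(1)] by blast
    have "partial_derivs (i # is) f y = h y" if "y \<in> U" for y
      unfolding partial_derivs_Cons
      using partial_deriv_cong[OF assms(1) that, of "partial_derivs is f" g i] g h that by simp
    then show ?case using h by blast
  qed
  show ?thesis
    unfolding smooth_on_def
  proof (intro allI ballI)
    fix "is" y assume y: "y \<in> U"
    obtain g where g: "g \<in> Q" "\<forall>y\<in>U. partial_derivs is f y = g y" using * by blast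
    show "partial_derivs is f differentiable (at y)"
      using differentiable_cong_open[OF assms(1) y, of "partial_derivs is f" g] g diff y by blast
  qed
qed

lemma smooth_on_const: "smooth_on U (\<lambda>_. c)"
proof -
  have "smooth_on UNIV (\<lambda>_::real^'a. c)"
    by (rule smooth_on_coinduct[where Q = "range (\<lambda>c _. c)"])
      (auto simp: partial_deriv_eq[OF has_derivative_const])
  then show ?thesis using smooth_on_subset by blast
qed

lemma smooth_on_bounded_linear:
  assumes "bounded_linear l" "open U" "smooth_on U f"
  shows "smooth_on U (\<lambda>y. l (f y))"
proof (rule smooth_on_coinduct[OF assms(2), where Q = "{\<lambda>y. l (f y) | f. smooth_on U f}"])
  show "(\<lambda>y. l (f y)) \<in> {\<lambda>y. l (f y) | f. smooth_on U f}" using assms by blast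
next
  fix g y assume "g \<in> {\<lambda>y. l (f y) | f. smooth_on U f}" "y \<in> U"
  then obtain f where f: "g = (\<lambda>y. l (f y))" "smooth_on U f" by blast
  show "g differentiable (at y)"
    using bounded_linear.has_derivative[OF assms(1) smooth_on_has_derivative[OF f(2) \<open>y \<in> U\<close>]] f
    by (auto simp: differentiable_def)
next
  fix g i assume "g \<in> {\<lambda>y. l (f y) | f. smooth_on U f}"
  then obtain f where f: "g = (\<lambda>y. l (f y))" "smooth_on U f" by blast
  have "partial_deriv i g y = l (partial_deriv i f y)" if "y \<in> U" for y
    using partial_deriv_eq[OF bounded_linear.has_derivative[OF assms(1) smooth_on_has_derivative[OF f(2) that]]] f
    by (simp add: partial_deriv_def)
  then show "\<exists>h\<in>{\<lambda>y. l (f y) | f. smooth_on U f}. \<forall>y\<in>U. partial_deriv i g y = h y"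
    using smooth_on_partial_deriv[OF f(2)]
    by (intro bexI[of _ "\<lambda>y. l (partial_deriv i f y)"]) auto
qed

lemma partial_deriv_compose:
  fixes f :: "real^'m::finite \<Rightarrow> complex" and T :: "real^'m \<Rightarrow> real^'m"
  assumes "f differentiable (at (T y))" "T differentiable (at y)"
  shows "(\<lambda>y. f (T y)) differentiable (at y)"
    and "partial_deriv i (\<lambda>y. f (T y)) y =
      (\<Sum>j\<in>UNIV. complex_of_real (partial_deriv i T y $ j) * partial_deriv j f (T y))"
proof -
  let ?f = "frechet_derivative f (at (T y))" and ?T = "frechet_derivative T (at y)"
  have f: "(f has_derivative ?f) (at (T y))" and T: "(T has_derivative ?T) (at y)"
    using assms frechet_derivative_works by blast+
  have c: "((\<lambda>y. f (T y)) has_derivative (\<lambda>v. ?f (?T v))) (at y)"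
    using diff_chain_at[OF T f] by (simp add: o_def)
  then show "(\<lambda>y. f (T y)) differentiable (at y)" by (auto simp: differentiable_def)
  have l: "linear ?f" using f has_derivative_linear by blast
  have ex: "?f v = (\<Sum>j\<in>UNIV. complex_of_real (v $ j) * ?f (axis j 1))" for v
  proof -
    have "?f v = ?f (\<Sum>j\<in>UNIV. v $ j *\<^sub>R axis j 1)"
      by (simp add: basis_expansion flip: scalar_mult_eq_scaleR)
    also have "\<dots> = (\<Sum>j\<in>UNIV. complex_of_real (v $ j) * ?f (axis j 1))"
      by (simp only: linear_sum[OF l] linear_cmul[OF l]) (simp add: scaleR_conv_of_real)
    finally show ?thesis .
  qed
  show "partial_deriv i (\<lambda>y. f (T y)) y =
      (\<Sum>j\<in>UNIV. complex_of_real (partial_deriv i T y $ j) * partial_deriv j f (T y))"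
    using trans[OF partial_deriv_eq[OF c, of i] ex[of "?T (axis i 1)"]] by (simp only: partial_deriv_def)
qed

lemma partial_deriv_add:
  assumes "f differentiable (at y)" "g differentiable (at y)"
  shows "partial_deriv i (\<lambda>y. f y + g y) y = partial_deriv i f y + partial_deriv i g y"
proof -
  have "(f has_derivative frechet_derivative f (at y)) (at y)"
    "(g has_derivative frechet_derivative g (at y)) (at y)"
    using assms frechet_derivative_works by blast+
  from partial_deriv_eq[OF has_derivative_add[OF this], of i] show ?thesis
    by (simp add: partial_deriv_def)
qed

lemma partial_deriv_mult:
  fixes f :: "real^'m::finite \<Rightarrow> complex"
  assumes "f differentiable (at y)" "g differentiable (at y)"
  shows "partial_deriv i (\<lambda>y. f y * g y) y = partial_deriv i f y * g y + f y * partial_deriv i g y"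
proof -
  have "(f has_derivative frechet_derivative f (at y)) (at y)"
    "(g has_derivative frechet_derivative g (at y)) (at y)"
    using assms frechet_derivative_works by blast+
  from partial_deriv_eq[OF has_derivative_mult[OF this], of i] show ?thesis
    by (simp add: partial_deriv_def)
qed

lemma partial_deriv_inverse:
  fixes f :: "real^'m::finite \<Rightarrow> complex"
  assumes "f differentiable (at y)" "f y \<noteq> 0"
  shows "partial_deriv i (\<lambda>y. inverse (f y)) y = - 1 * partial_deriv i f y * (inverse (f y) * inverse (f y))"
proof -
  have "(f has_derivative frechet_derivative f (at y)) (at y)"
    using assms frechet_derivative_works by blast
  from partial_deriv_eq[OF Deriv.has_derivative_inverse[OF assms(2) this], of i] show ?thesis
    by (simp add: partial_deriv_def)
qed

section \<open>Algebras of smooth functions\<close>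

inductive_set smooth_algebra ::
    "(real^'m::finite) set \<Rightarrow> (real^'m \<Rightarrow> complex) set \<Rightarrow> (real^'m \<Rightarrow> complex) set"
  for U :: "(real^'m) set" and G :: "(real^'m \<Rightarrow> complex) set" where
  gen: "f \<in> G \<Longrightarrow> f \<in> smooth_algebra U G" |
  base: "smooth_on U f \<Longrightarrow> f \<in> smooth_algebra U G"
| add: "f \<in> smooth_algebra U G \<Longrightarrow> g \<in> smooth_algebra U G \<Longrightarrow> (\<lambda>y. f y + g y) \<in> smooth_algebra U G"
| mult: "f \<in> smooth_algebra U G \<Longrightarrow> g \<in> smooth_algebra U G \<Longrightarrow> (\<lambda>y. f y * g y) \<in> smooth_algebra U G"
| inv: "f \<in> smooth_algebra U G \<Longrightarrow> (\<And>y. y \<in> U \<Longrightarrow> f y \<noteq> 0) \<Longrightarrow> (\<lambda>y. inverse (f y)) \<in> smooth_algebra U G"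
| comp: "smooth_on (U' :: (real^'m) set) f \<Longrightarrow> smooth_on U (T :: real^'m \<Rightarrow> real^'m) \<Longrightarrow> T ` U \<subseteq> U'
    \<Longrightarrow> (\<lambda>y. f (T y)) \<in> smooth_algebra U G"

lemma smooth_algebra_sum:
  assumes "\<And>j. j \<in> J \<Longrightarrow> f j \<in> smooth_algebra U G"
  shows "(\<lambda>y. \<Sum>j\<in>J. f j y) \<in> smooth_algebra U G"
  using assms
proof (induction J rule: infinite_finite_induct)
  case (insert j J)
  then show ?case
    using smooth_algebra.add[of "f j" U G "\<lambda>y. \<Sum>j\<in>J. f j y"] by simp
qed (simp_all add: smooth_algebra.base smooth_on_const)

text \<open>The Leibniz, quotient and chain rules express derivatives by sums, products, inverses
  and compositions together, so these operations are treated simultaneously. The set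
  \<open>G\<close> admits generators whose smoothness is not yet known, provided their derivatives
  lie in the algebra which they generate; this is how the bump functions below obtain all
  derivatives at once.\<close>

lemma smooth_algebra_deriv:
  assumes "open U" "f \<in> smooth_algebra U G"
    and G: "\<And>f. f \<in> G \<Longrightarrow> (\<forall>y\<in>U. f differentiable (at y)) \<and>
      (\<forall>i. \<exists>h\<in>smooth_algebra U G. \<forall>y\<in>U. partial_deriv i f y = h y)"
  shows "(\<forall>y\<in>U. f differentiable (at y)) \<and>
    (\<forall>i. \<exists>h\<in>smooth_algebra U G. \<forall>y\<in>U. partial_deriv i f y = h y)"
  using assms(2)
proof induction
  case (gen f)
  then show ?case by (rule G)
next
  case (base f)
  then show ?case
    using smooth_on_differentiable smooth_on_partial_deriv smooth_algebra.base by blast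
next
  case (add f g)
  show ?case
  proof (intro conjI ballI allI)
    show "(\<lambda>y. f y + g y) differentiable (at y)" if "y \<in> U" for y
      using add that by (auto intro: differentiable_add)
    fix i
    obtain f' g' where *: "f' \<in> smooth_algebra U G" "\<forall>y\<in>U. partial_deriv i f y = f' y"
      "g' \<in> smooth_algebra U G" "\<forall>y\<in>U. partial_deriv i g y = g' y" using add by metis
    then show "\<exists>h\<in>smooth_algebra U G. \<forall>y\<in>U. partial_deriv i (\<lambda>y. f y + g y) y = h y"
      using add by (intro bexI[of _ "\<lambda>y. f' y + g' y"])
        (auto simp: partial_deriv_add intro: smooth_algebra.add)
  qed
next
  case (mult f g)
  show ?case
  proof (intro conjI ballI allI)
    show "(\<lambda>y. f y * g y) differentiable (at y)" if "y \<in> U" for y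
      using mult that by (auto intro: differentiable_mult)
    fix i
    obtain f' g' where *: "f' \<in> smooth_algebra U G" "\<forall>y\<in>U. partial_deriv i f y = f' y"
      "g' \<in> smooth_algebra U G" "\<forall>y\<in>U. partial_deriv i g y = g' y" using mult by metis
    then show "\<exists>h\<in>smooth_algebra U G. \<forall>y\<in>U. partial_deriv i (\<lambda>y. f y * g y) y = h y"
      using mult by (intro bexI[of _ "\<lambda>y. f' y * g y + f y * g' y"])
        (auto simp: partial_deriv_mult intro!: smooth_algebra.add smooth_algebra.mult)
  qed
next
  case (inv f)
  show ?case
  proof (intro conjI ballI allI)
    show "(\<lambda>y. inverse (f y)) differentiable (at y)" if "y \<in> U" for y
      using inv that by (auto intro: differentiable_inverse)
    fix i
    obtain f' where *: "f' \<in> smooth_algebra U G" "\<forall>y\<in>U. partial_deriv i f y = f' y"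
      using inv by metis
    have "(\<lambda>y. - 1 * f' y * (inverse (f y) * inverse (f y))) \<in> smooth_algebra U G"
      by (intro smooth_algebra.mult smooth_algebra.inv inv * smooth_algebra.base[OF smooth_on_const])
    then show "\<exists>h\<in>smooth_algebra U G. \<forall>y\<in>U. partial_deriv i (\<lambda>y. inverse (f y)) y = h y"
      by (rule bexI[rotated]) (use inv * in \<open>simp add: partial_deriv_inverse\<close>)
  qed
next
  case (comp U' f T)
  show ?case
  proof (intro conjI ballI allI)
    have d: "f differentiable (at (T y))" "T differentiable (at y)" if "y \<in> U" for y
      using comp that smooth_on_differentiable by blast+
    show "(\<lambda>y. f (T y)) differentiable (at y)" if "y \<in> U" for y
      using partial_deriv_compose(1)[OF d] that by blast
    fix i
    have "smooth_on U (\<lambda>y. complex_of_real (partial_deriv i T y $ j))" for j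
      using comp assms(1)
      by (intro smooth_on_bounded_linear[where l = "\<lambda>x. complex_of_real (x $ j)"]
          bounded_linear_intros bounded_linear_compose[OF bounded_linear_of_real]
          smooth_on_partial_deriv bounded_linear_vec_nth) auto
    then have "(\<lambda>y. \<Sum>j\<in>UNIV. complex_of_real (partial_deriv i T y $ j) * partial_deriv j f (T y))
        \<in> smooth_algebra U G"
      by (intro smooth_algebra_sum smooth_algebra.mult smooth_algebra.base
          smooth_algebra.comp[OF smooth_on_partial_deriv[OF comp.hyps(1)] comp.hyps(2,3)])
    then show "\<exists>h\<in>smooth_algebra U G. \<forall>y\<in>U. partial_deriv i (\<lambda>y. f (T y)) y = h y"
      by (rule bexI[rotated]) (intro ballI partial_deriv_compose(2) d)
  qed
qed

lemma smooth_algebra_smooth_on: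
  assumes "open U" "f \<in> smooth_algebra U G"
    and G: "\<And>f. f \<in> G \<Longrightarrow> (\<forall>y\<in>U. f differentiable (at y)) \<and>
      (\<forall>i. \<exists>h\<in>smooth_algebra U G. \<forall>y\<in>U. partial_deriv i f y = h y)"
  shows "smooth_on U f"
proof (rule smooth_on_coinduct[OF assms(1,2)])
  show "g differentiable at y" if "g \<in> smooth_algebra U G" "y \<in> U" for g y
    using smooth_algebra_deriv[OF assms(1) that(1) G] that(2) by simp
  show "\<exists>h\<in>smooth_algebra U G. \<forall>y\<in>U. partial_deriv i g y = h y" if "g \<in> smooth_algebra U G" for g i
    using smooth_algebra_deriv[OF assms(1) that G] by simp
qed

lemma smooth_on_add:
  fixes f :: "real^'m::finite \<Rightarrow> complex"
  shows "open U \<Longrightarrow> smooth_on U f \<Longrightarrow> smooth_on U g \<Longrightarrow> smooth_on U (\<lambda>y. f y + g y)"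
  by (rule smooth_algebra_smooth_on[where G = "{}", OF _ smooth_algebra.add[OF smooth_algebra.base smooth_algebra.base]]) simp_all

lemma smooth_on_mult:
  fixes f :: "real^'m::finite \<Rightarrow> complex"
  shows "open U \<Longrightarrow> smooth_on U f \<Longrightarrow> smooth_on U g \<Longrightarrow> smooth_on U (\<lambda>y. f y * g y)"
  by (rule smooth_algebra_smooth_on[where G = "{}", OF _ smooth_algebra.mult[OF smooth_algebra.base smooth_algebra.base]]) simp_all

lemma smooth_on_diff:
  fixes f :: "real^'m::finite \<Rightarrow> complex"
  assumes "open U" "smooth_on U f" "smooth_on U g" shows "smooth_on U (\<lambda>y. f y - g y)"
  using smooth_on_add[OF assms(1,2) smooth_on_mult[OF assms(1) smooth_on_const[of U "-1"] assms(3)]]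
  by simp

lemma smooth_on_divide:
  fixes f :: "real^'m::finite \<Rightarrow> complex"
  assumes "open U" "smooth_on U f" "smooth_on U g" "\<And>y. y \<in> U \<Longrightarrow> g y \<noteq> 0"
  shows "smooth_on U (\<lambda>y. f y / g y)"
  unfolding divide_inverse
  using smooth_algebra_smooth_on[where G = "{}", OF assms(1) smooth_algebra.mult[OF smooth_algebra.base[OF assms(2)]
      smooth_algebra.inv[OF smooth_algebra.base[OF assms(3)]]]] assms(4) by simp

lemma smooth_on_compose:
  fixes f :: "real^'m::finite \<Rightarrow> complex" and T :: "real^'m \<Rightarrow> real^'m"
  shows "open U \<Longrightarrow> smooth_on U' f \<Longrightarrow> smooth_on U T \<Longrightarrow> T ` U \<subseteq> U' \<Longrightarrow> smooth_on U (\<lambda>y. f (T y))"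
  by (rule smooth_algebra_smooth_on[where G = "{}", OF _ smooth_algebra.comp[of U' f U T]]) simp_all

lemma smooth_on_sum:
  fixes f :: "'i \<Rightarrow> real^'m::finite \<Rightarrow> complex"
  shows "open U \<Longrightarrow> (\<And>j. j \<in> J \<Longrightarrow> smooth_on U (f j)) \<Longrightarrow> smooth_on U (\<lambda>y. \<Sum>j\<in>J. f j y)"
  by (rule smooth_algebra_smooth_on[where G = "{}", OF _ smooth_algebra_sum[OF smooth_algebra.base]])
    simp_all

lemma smooth_on_prod:
  fixes f :: "'i \<Rightarrow> real^'m::finite \<Rightarrow> complex"
  assumes "open U" "\<And>j. j \<in> J \<Longrightarrow> smooth_on U (f j)"
  shows "smooth_on U (\<lambda>y. \<Prod>j\<in>J. f j y)"
  using assms(2)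
proof (induction J rule: infinite_finite_induct)
  case (insert j J)
  then show ?case
    using smooth_on_mult[OF assms(1), of "f j" "\<lambda>y. \<Prod>j\<in>J. f j y"] by simp
qed (simp_all add: smooth_on_const)

lemma partial_derivs_add:
  fixes f :: "real^'m::finite \<Rightarrow> complex"
  assumes "open U" "smooth_on U f" "smooth_on U g" "y \<in> U"
  shows "partial_derivs is (\<lambda>y. f y + g y) y = partial_derivs is f y + partial_derivs is g y"
  using assms(4)
proof (induction "is" arbitrary: y)
  case (Cons i "is")
  have "partial_derivs (i # is) (\<lambda>y. f y + g y) y =
      partial_deriv i (\<lambda>y. partial_derivs is f y + partial_derivs is g y) y"
    unfolding partial_derivs_Cons by (rule partial_deriv_cong[OF assms(1)]) (use Cons in auto)
  also have "\<dots> = partial_derivs (i # is) f y + partial_derivs (i # is) g y"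
    unfolding partial_derivs_Cons
    by (intro partial_deriv_add smooth_on_differentiable[of U] smooth_on_partial_derivs assms Cons)
  finally show ?case .
qed simp

lemma partial_derivs_zero [simp]: "partial_derivs is (\<lambda>_. 0) = (\<lambda>_. 0::complex)"
proof (induction "is")
  case (Cons i "is")
  then show ?case
    unfolding partial_derivs_Cons Cons.IH using partial_deriv_eq[OF has_derivative_const] by blast
qed simp

lemma partial_derivs_sum:
  fixes f :: "'i \<Rightarrow> real^'m::finite \<Rightarrow> complex"
  assumes "open U" "\<And>j. j \<in> J \<Longrightarrow> smooth_on U (f j)" "y \<in> U"
  shows "partial_derivs is (\<lambda>y. \<Sum>j\<in>J. f j y) y = (\<Sum>j\<in>J. partial_derivs is (f j) y)"
  using assms(2)
proof (induction J rule: infinite_finite_induct)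
  case (insert j J)
  then show ?case
    using partial_derivs_add[OF assms(1) _ smooth_on_sum[OF assms(1)] assms(3), of "f j" J f]
    by simp
qed simp_all

lemma partial_derivs_cmult:
  fixes f :: "real^'m::finite \<Rightarrow> complex"
  assumes "open U" "smooth_on U f" "y \<in> U"
  shows "partial_derivs is (\<lambda>y. c * f y) y = c * partial_derivs is f y"
  using assms(3)
proof (induction "is" arbitrary: y)
  case (Cons i "is")
  have "partial_derivs (i # is) (\<lambda>y. c * f y) y = partial_deriv i (\<lambda>y. c * partial_derivs is f y) y"
    unfolding partial_derivs_Cons by (rule partial_deriv_cong[OF assms(1)]) (use Cons in auto)
  also have "\<dots> = c * partial_derivs (i # is) f y"
    unfolding partial_derivs_Cons
    using partial_deriv_mult[OF differentiable_const[of c]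
        smooth_on_differentiable[OF smooth_on_partial_derivs[OF assms(2)] Cons.prems], of i "is"]
    by (simp add: partial_deriv_eq[OF has_derivative_const])
  finally show ?case .
qed simp

lemma finite_multi_indices [simp]: "finite {is :: 'm::finite list. length is \<le> n}"
  using finite_lists_length_le[of "UNIV :: 'm set" n] by simp

text \<open>Directions are listed in order, so a mixed derivative occurs once for every ordering of
  its directions. For smooth functions this changes the usual norm of the jet by constant factors
  only.\<close>

definition jet_norm :: "nat \<Rightarrow> (real^'m::finite \<Rightarrow> complex) \<Rightarrow> real^'m \<Rightarrow> real" where
  "jet_norm n f x = (\<Sum>is | length is \<le> n. cmod (partial_derivs is f x))"

lemma jet_norm_partial_deriv: "jet_norm n (partial_deriv i f) x \<le> jet_norm (Suc n) f x"
proof -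
  have "jet_norm n (partial_deriv i f) x =
      (\<Sum>is | length is \<le> n. cmod (partial_derivs (is @ [i]) f x))"
    by (simp add: jet_norm_def partial_derivs_snoc)
  also have "\<dots> = (\<Sum>is\<in>(\<lambda>is. is @ [i]) ` {is. length is \<le> n}. cmod (partial_derivs is f x))"
    by (simp add: sum.reindex inj_on_def)
  also have "\<dots> \<le> jet_norm (Suc n) f x"
    unfolding jet_norm_def by (rule sum_mono2) auto
  finally show ?thesis .
qed

lemma jet_norm_mono: "n \<le> k \<Longrightarrow> jet_norm n f x \<le> jet_norm k f x"
  unfolding jet_norm_def by (rule sum_mono2) auto

text \<open>The innermost derivative turns \<open>a * (\<rho> \<circ> T)\<close> into a sum of
  products of the same shape, with new coefficients \<open>D\<close> and \<open>B j\<close> and with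
  \<open>\<rho>\<close> or one of its partial derivatives in the second factor. Hence the induction
  peels off the last entry of the list, which is applied first, and ranges over all coefficients
  \<open>a\<close>. The constant does not depend on \<open>\<rho>\<close>; later \<open>T\<close> is
  a change of charts.\<close>

lemma partial_derivs_mult_compose_bound:
  fixes a :: "real^'m::finite \<Rightarrow> complex" and T :: "real^'m \<Rightarrow> real^'m"
  assumes U: "open U" "smooth_on U T" "T ` U \<subseteq> U'" and C: "compact C" "C \<subseteq> U"
    and a: "smooth_on U a"
  shows "\<exists>K\<ge>0. \<forall>\<rho>. smooth_on U' \<rho> \<longrightarrow> (\<forall>y\<in>C.
    cmod (partial_derivs is (\<lambda>y. a y * \<rho> (T y)) y) \<le> K * jet_norm (length is) \<rho> (T y))"
  using a
proof (induction "is" arbitrary: a rule: rev_induct)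
  case Nil
  have "bounded (a ` C)"
    by (intro compact_imp_bounded compact_continuous_image C continuous_on_subset[OF _ C(2)]
        smooth_on_imp_continuous_on Nil)
  then obtain K where K: "\<And>y. y \<in> C \<Longrightarrow> cmod (a y) \<le> K" unfolding bounded_iff by auto
  have "cmod (a y) * cmod (\<rho> (T y)) \<le> max K 0 * jet_norm 0 \<rho> (T y)" if "y \<in> C" for y \<rho>
    using K[OF that] by (auto simp: jet_norm_def intro!: mult_right_mono)
  then show ?case by (intro exI[of _ "max K 0"]) (simp add: norm_mult)
next
  case (snoc i "is")
  define D where "D = partial_deriv i a"
  define B where "B j y = a y * complex_of_real (partial_deriv i T y $ j)" for j y
  have D: "smooth_on U D" unfolding D_def by (rule smooth_on_partial_deriv[OF snoc.prems])
  have "smooth_on U (\<lambda>y. complex_of_real (partial_deriv i T y $ j))" for j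
    by (intro smooth_on_bounded_linear[where l = "\<lambda>x. complex_of_real (x $ j)"] U
          bounded_linear_compose[OF bounded_linear_of_real]
          smooth_on_partial_deriv bounded_linear_vec_nth)
  then have B: "smooth_on U (B j)" for j
    unfolding B_def by (intro smooth_on_mult U snoc.prems)
  obtain K0 where K0: "K0 \<ge> 0" "\<And>\<rho> y. smooth_on U' \<rho> \<Longrightarrow> y \<in> C \<Longrightarrow>
    cmod (partial_derivs is (\<lambda>y. D y * \<rho> (T y)) y) \<le> K0 * jet_norm (length is) \<rho> (T y)"
    using snoc.IH[OF D] by blast
  have "\<forall>j. \<exists>K\<ge>0. \<forall>\<rho>. smooth_on U' \<rho> \<longrightarrow> (\<forall>y\<in>C.
    cmod (partial_derivs is (\<lambda>y. B j y * \<rho> (T y)) y) \<le> K * jet_norm (length is) \<rho> (T y))"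
    using snoc.IH[OF B] by blast
  then obtain K where K: "\<And>j. K j \<ge> 0" "\<And>j \<rho> y. smooth_on U' \<rho> \<Longrightarrow> y \<in> C \<Longrightarrow>
    cmod (partial_derivs is (\<lambda>y. B j y * \<rho> (T y)) y) \<le> K j * jet_norm (length is) \<rho> (T y)"
    by metis
  have "cmod (partial_derivs (is @ [i]) (\<lambda>y. a y * \<rho> (T y)) y)
      \<le> (K0 + sum K UNIV) * jet_norm (length (is @ [i])) \<rho> (T y)"
    if \<rho>: "smooth_on U' \<rho>" and y: "y \<in> C" for \<rho> y
  proof -
    have yU: "y \<in> U" using y C by blast
    have eq: "partial_deriv i (\<lambda>y. a y * \<rho> (T y)) z =
        D z * \<rho> (T z) + (\<Sum>j\<in>UNIV. B j z * partial_deriv j \<rho> (T z))" if "z \<in> U" for z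
    proof -
      have "\<rho> differentiable (at (T z))" "T differentiable (at z)" "a differentiable (at z)"
        using \<rho> that U snoc.prems smooth_on_differentiable by blast+
      note d = this
      have "partial_deriv i (\<lambda>y. a y * \<rho> (T y)) z =
          partial_deriv i a z * \<rho> (T z) + a z * partial_deriv i (\<lambda>y. \<rho> (T y)) z"
        by (rule partial_deriv_mult[OF d(3) partial_deriv_compose(1)[OF d(1,2)]])
      also have "partial_deriv i (\<lambda>y. \<rho> (T y)) z =
          (\<Sum>j\<in>UNIV. complex_of_real (partial_deriv i T z $ j) * partial_deriv j \<rho> (T z))"
        by (rule partial_deriv_compose(2)[OF d(1,2)])
      finally show ?thesis by (simp add: D_def B_def sum_distrib_left mult.assoc)
    qed
    have sm: "smooth_on U (\<lambda>y. D y * \<rho> (T y))"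
      "\<And>j. smooth_on U (\<lambda>y. B j y * partial_deriv j \<rho> (T y))"
      by (rule smooth_on_mult[OF U(1) D smooth_on_compose[OF U(1) \<rho> U(2,3)]])
        (rule smooth_on_mult[OF U(1) B
          smooth_on_compose[OF U(1) smooth_on_partial_deriv[OF \<rho>] U(2,3)]])
    have "partial_derivs (is @ [i]) (\<lambda>y. a y * \<rho> (T y)) y =
        partial_derivs is (\<lambda>z. D z * \<rho> (T z) + (\<Sum>j\<in>UNIV. B j z * partial_deriv j \<rho> (T z))) y"
      unfolding partial_derivs_snoc by (rule partial_derivs_cong[OF U(1) eq yU])
    also have "\<dots> = partial_derivs is (\<lambda>z. D z * \<rho> (T z)) y
        + (\<Sum>j\<in>UNIV. partial_derivs is (\<lambda>z. B j z * partial_deriv j \<rho> (T z)) y)"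
      by (simp only: partial_derivs_add[OF U(1) sm(1) smooth_on_sum[OF U(1) sm(2)] yU]
          partial_derivs_sum[OF U(1) sm(2) yU])
    also have "cmod \<dots> \<le> cmod (partial_derivs is (\<lambda>z. D z * \<rho> (T z)) y)
        + (\<Sum>j\<in>UNIV. cmod (partial_derivs is (\<lambda>z. B j z * partial_deriv j \<rho> (T z)) y))"
      by (rule order.trans[OF norm_triangle_ineq add_left_mono[OF norm_sum]])
    also have "\<dots> \<le> K0 * jet_norm (Suc (length is)) \<rho> (T y)
        + (\<Sum>j\<in>UNIV. K j * jet_norm (Suc (length is)) \<rho> (T y))"
    proof (intro add_mono sum_mono)
      show "cmod (partial_derivs is (\<lambda>z. D z * \<rho> (T z)) y) \<le> K0 * jet_norm (Suc (length is)) \<rho> (T y)"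
        using K0(2)[OF \<rho> y] mult_left_mono[OF jet_norm_mono[of "length is" "Suc (length is)" \<rho> "T y"] K0(1)]
        by simp
      show "cmod (partial_derivs is (\<lambda>z. B j z * partial_deriv j \<rho> (T z)) y)
          \<le> K j * jet_norm (Suc (length is)) \<rho> (T y)" for j
        using K(2)[OF smooth_on_partial_deriv[OF \<rho>, of j] y, of j]
          mult_left_mono[OF jet_norm_partial_deriv[of "length is" j \<rho> "T y"] K(1)[of j]]
        by simp
    qed
    finally show ?thesis by (simp only: sum_distrib_right distrib_right length_append_singleton)
  qed
  then show ?case using K0 K by (intro exI[of _ "K0 + sum K UNIV"]) (auto intro!: add_nonneg_nonneg sum_nonneg)
qed

section \<open>Topologies given by seminorms\<close>

lemma scaleC_zero_left [simp]: "0 *\<^sub>C x = (0 :: 'v::complex_vect)"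
  using scaleC_add_left[of 0 0 x] by simp

lemma scaleC_zero_right [simp]: "c *\<^sub>C 0 = (0 :: 'v::complex_vect)"
  using scaleC_add_right[of c 0 "0::'v"] by simp

lemma scaleC_minus_one: "(- 1) *\<^sub>C x = - (x :: 'v::complex_vect)"
  using scaleC_add_left[of 1 "-1" x] by (simp add: scaleC_one add_eq_0_iff)

definition csubspace :: "'v::complex_vect set \<Rightarrow> bool" where
  "csubspace S \<longleftrightarrow> 0 \<in> S \<and> (\<forall>x\<in>S. \<forall>y\<in>S. x + y \<in> S) \<and> (\<forall>c. \<forall>x\<in>S. c *\<^sub>C x \<in> S)"

lemma csubspace_diff: "csubspace S \<Longrightarrow> x \<in> S \<Longrightarrow> y \<in> S \<Longrightarrow> x - y \<in> S"
  unfolding csubspace_def by (metis diff_conv_add_uminus scaleC_minus_one)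

lemma seminorm_on_zero: "csubspace S \<Longrightarrow> seminorm_on S p \<Longrightarrow> p 0 = 0"
  unfolding csubspace_def seminorm_on_def by (metis mult_zero_left norm_zero scaleC_zero_left)

lemma seminorm_on_minus:
  assumes "seminorm_on S p" "x \<in> S" shows "p (- x) = p x"
proof -
  have "p ((- 1) *\<^sub>C x) = cmod (- 1) * p x" using assms unfolding seminorm_on_def by blast
  then show ?thesis by (simp add: scaleC_minus_one)
qed

lemma seminorm_on_nonneg:
  assumes "csubspace S" "seminorm_on S p" "x \<in> S" shows "0 \<le> p x"
proof -
  have "- x \<in> S" using csubspace_diff[OF assms(1), of 0 x] assms unfolding csubspace_def by simp
  then have "p (x + - x) \<le> p x + p (- x)" using assms unfolding seminorm_on_def by blast
  then show ?thesis using seminorm_on_zero[OF assms(1,2)] seminorm_on_minus[OF assms(2,3)] by simp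
qed

lemma seminorm_on_diff_triangle:
  assumes "csubspace S" "seminorm_on S p" "x \<in> S" "y \<in> S" "z \<in> S"
  shows "p (x - z) \<le> p (x - y) + p (y - z)"
proof -
  have "p ((x - y) + (y - z)) \<le> p (x - y) + p (y - z)"
    using assms csubspace_diff unfolding seminorm_on_def by blast
  then show ?thesis by simp
qed

lemma seminorm_on_subset: "seminorm_on S p \<Longrightarrow> S' \<subseteq> S \<Longrightarrow> seminorm_on S' p"
  unfolding seminorm_on_def by blast

lemma topspace_seminorm_topology [simp]: "topspace (seminorm_topology S P) = S"
  unfolding seminorm_topology_def topology_generated_by_topspace by auto

text \<open>Subbasic sets are balls around arbitrary centres, whereas local arguments need balls
  around the given point \<open>x\<close>. The triangle inequality shifts the centre
  \<open>z\<close> to \<open>x\<close> at the cost of subtracting \<open>p (x - z)\<close> from the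
  radius.\<close>

lemma openin_seminorm_topologyD:
  assumes S: "csubspace S" and P: "\<And>p. p \<in> P \<Longrightarrow> seminorm_on S p"
    and U: "openin (seminorm_topology S P) U" and x: "x \<in> U"
  obtains F \<delta> where "finite F" "F \<subseteq> P" "0 < \<delta>"
    "\<And>y. y \<in> S \<Longrightarrow> (\<And>p. p \<in> F \<Longrightarrow> p (y - x) < \<delta>) \<Longrightarrow> y \<in> U"
proof -
  let ?G = "insert S {{y \<in> S. p (y - x) < e} | p x e. p \<in> P \<and> x \<in> S \<and> 0 < e}"
  have "generate_topology_on ?G U"
    using U unfolding seminorm_topology_def openin_topology_generated_by_iff .
  then have "\<forall>x\<in>U. \<exists>F \<delta>. finite F \<and> F \<subseteq> P \<and> 0 < \<delta> \<and>
    (\<forall>y\<in>S. (\<forall>p\<in>F. p (y - x) < \<delta>) \<longrightarrow> y \<in> U)"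
  proof induction
    case Empty
    then show ?case by simp
  next
    case (Int a b)
    show ?case
    proof
      fix x assume "x \<in> a \<inter> b"
      then have x: "x \<in> a" "x \<in> b" by auto
      obtain F \<delta> where 1: "finite F" "F \<subseteq> P" "0 < \<delta>"
        "\<And>y. y \<in> S \<Longrightarrow> \<forall>p\<in>F. p (y - x) < \<delta> \<Longrightarrow> y \<in> a" using bspec[OF Int.IH(1) x(1)] by blast
      obtain F' \<delta>' where 2: "finite F'" "F' \<subseteq> P" "0 < \<delta>'"
        "\<And>y. y \<in> S \<Longrightarrow> \<forall>p\<in>F'. p (y - x) < \<delta>' \<Longrightarrow> y \<in> b" using bspec[OF Int.IH(2) x(2)] by blast
      show "\<exists>F \<delta>. finite F \<and> F \<subseteq> P \<and> 0 < \<delta> \<and>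
          (\<forall>y\<in>S. (\<forall>p\<in>F. p (y - x) < \<delta>) \<longrightarrow> y \<in> a \<inter> b)"
      proof (intro exI conjI ballI impI)
        show "finite (F \<union> F')" "F \<union> F' \<subseteq> P" "0 < min \<delta> \<delta>'" using 1 2 by auto
        fix y assume "y \<in> S" "\<forall>p\<in>F \<union> F'. p (y - x) < min \<delta> \<delta>'"
        then show "y \<in> a \<inter> b" using 1(4)[of y] 2(4)[of y] by simp
      qed
    qed
  next
    case (UN K)
    show ?case
    proof
      fix x assume "x \<in> \<Union>K"
      then obtain k where k: "k \<in> K" "x \<in> k" by blast
      obtain F \<delta> where 1: "finite F" "F \<subseteq> P" "0 < \<delta>"
        "\<And>y. y \<in> S \<Longrightarrow> \<forall>p\<in>F. p (y - x) < \<delta> \<Longrightarrow> y \<in> k" using bspec[OF UN.IH[OF k(1)] k(2)] by blast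
      show "\<exists>F \<delta>. finite F \<and> F \<subseteq> P \<and> 0 < \<delta> \<and> (\<forall>y\<in>S. (\<forall>p\<in>F. p (y - x) < \<delta>) \<longrightarrow> y \<in> \<Union>K)"
        by (intro exI[of _ F] exI[of _ \<delta>] conjI ballI impI 1) (use 1(4) k(1) in auto)
    qed
  next
    case (Basis s)
    show ?case
    proof
      fix x assume x: "x \<in> s"
      show "\<exists>F \<delta>. finite F \<and> F \<subseteq> P \<and> 0 < \<delta> \<and> (\<forall>y\<in>S. (\<forall>p\<in>F. p (y - x) < \<delta>) \<longrightarrow> y \<in> s)"
      proof (cases "s = S")
        case True
        then show ?thesis by (intro exI[of _ "{}"] exI[of _ 1]) auto
      next
        case False
        then obtain p z e where s: "s = {y \<in> S. p (y - z) < e}" "p \<in> P" "z \<in> S" "0 < e"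
          using Basis by blast
        have "y \<in> s" if "y \<in> S" "p (y - x) < e - p (x - z)" for y
          using seminorm_on_diff_triangle[OF S P[OF s(2)] that(1) _ s(3), of x] that x s by auto
        then show ?thesis using x s
          by (intro exI[of _ "{p}"] exI[of _ "e - p (x - z)"] conjI ballI impI) auto
      qed
    qed
  qed
  from bspec[OF this x] obtain F \<delta> where "finite F" "F \<subseteq> P" "0 < \<delta>"
    "\<forall>y\<in>S. (\<forall>p\<in>F. p (y - x) < \<delta>) \<longrightarrow> y \<in> U" by blast
  then show ?thesis using that[of F \<delta>] by blast
qed

lemma openin_seminorm_ball:
  assumes "finite F" "F \<subseteq> P" "x \<in> S" "0 < \<delta>"
  shows "openin (seminorm_topology S P) {y \<in> S. \<forall>p\<in>F. p (y - x) < \<delta>}"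
  using assms(1,2)
proof induction
  case empty
  then show ?case using openin_topspace[of "seminorm_topology S P"] by simp
next
  case (insert p F)
  have "openin (seminorm_topology S P) {y \<in> S. p (y - x) < \<delta>}"
    unfolding seminorm_topology_def
    by (rule topology_generated_by_Basis) (use insert assms(3,4) in blast)
  with insert have "openin (seminorm_topology S P)
      ({y \<in> S. p (y - x) < \<delta>} \<inter> {y \<in> S. \<forall>p\<in>F. p (y - x) < \<delta>})" by auto
  moreover have "{y \<in> S. p (y - x) < \<delta>} \<inter> {y \<in> S. \<forall>p\<in>F. p (y - x) < \<delta>} =
      {y \<in> S. \<forall>q\<in>insert p F. q (y - x) < \<delta>}" by auto
  ultimately show ?case by simp
qed

text \<open>Continuity can be tested on balls centred at the image point, since a ball around
  another centre contains such a ball around each of its points. The criterion serves the inclusions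
  as well as the inverse map out of the projective limit.\<close>

lemma continuous_map_into_seminorm_topology:
  assumes S: "csubspace S" and P: "\<And>p. p \<in> P \<Longrightarrow> seminorm_on S p"
    and f: "f \<in> topspace X \<rightarrow> S"
    and cont: "\<And>p x e. p \<in> P \<Longrightarrow> x \<in> topspace X \<Longrightarrow> 0 < e \<Longrightarrow>
      \<exists>W. openin X W \<and> x \<in> W \<and> (\<forall>y\<in>W. p (f y - f x) < e)"
  shows "continuous_map X (seminorm_topology S P) f"
  unfolding seminorm_topology_def
proof (rule continuous_on_generated_topo)
  fix U assume U: "U \<in> insert S {{y \<in> S. p (y - x) < e} | p x e. p \<in> P \<and> x \<in> S \<and> 0 < e}"
  show "openin X (f -` U \<inter> topspace X)"
  proof (cases "U = S")
    case True
    then have "f -` U \<inter> topspace X = topspace X" using f by auto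
    then show ?thesis by simp
  next
    case False
    then obtain p z e where s: "U = {y \<in> S. p (y - z) < e}" "p \<in> P" "z \<in> S" "0 < e"
      using U by blast
    show ?thesis
    proof (subst openin_subopen, intro ballI)
      fix x assume x: "x \<in> f -` U \<inter> topspace X"
      then obtain W where W: "openin X W" "x \<in> W" "\<forall>y\<in>W. p (f y - f x) < e - p (f x - z)"
        using cont[OF s(2), of x "e - p (f x - z)"] s by auto
      have "W \<subseteq> f -` U \<inter> topspace X"
      proof
        fix y assume y: "y \<in> W"
        then have "y \<in> topspace X" using W openin_subset by blast
        moreover have "p (f y - z) \<le> p (f y - f x) + p (f x - z)"
          using seminorm_on_diff_triangle[OF S P[OF s(2)]] f x s \<open>y \<in> topspace X\<close> by auto
        ultimately show "y \<in> f -` U \<inter> topspace X" using s W y f by force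
      qed
      then show "\<exists>T. openin X T \<and> x \<in> T \<and> T \<subseteq> f -` U \<inter> topspace X" using W by blast
    qed
  qed
next
  show "f ` topspace X \<subseteq> \<Union> (insert S {{y \<in> S. p (y - x) < e} | p x e. p \<in> P \<and> x \<in> S \<and> 0 < e})"
    using f by auto
qed

lemma seminorm_bound_ball:
  assumes "csubspace S" "\<And>p. p \<in> F \<Longrightarrow> seminorm_on S p" "finite F" "q0 \<ge> 0"
    and "\<And>x. x \<in> S \<Longrightarrow> q x \<le> q0 * (\<Sum>p\<in>F. p x)" and "0 < (e::real)"
  obtains \<delta> where "0 < \<delta>" "\<And>x. x \<in> S \<Longrightarrow> (\<And>p. p \<in> F \<Longrightarrow> p x < \<delta>) \<Longrightarrow> q x < e"
proof
  \<comment> \<open>The two summands \<open>1\<close> keep the denominator positive and make the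
    final estimate strict even when \<open>q0 = 0\<close> or \<open>F\<close> is empty.\<close>
  define d where "d = e / ((q0 + 1) * (real (card F) + 1))"
  show d: "0 < d" using assms by (auto simp: d_def)
  fix x assume x: "x \<in> S" "\<And>p. p \<in> F \<Longrightarrow> p x < d"
  have "(\<Sum>p\<in>F. p x) \<le> (\<Sum>p\<in>F. d)" by (rule sum_mono) (use x in force)
  then have s: "(\<Sum>p\<in>F. p x) \<le> real (card F) * d" by simp
  have "q x \<le> q0 * (real (card F) * d)"
    using assms(5)[OF x(1)] mult_left_mono[OF s assms(4)] by linarith
  also have "\<dots> < (q0 + 1) * (real (card F) + 1) * d"
    using d assms(4) by (simp add: algebra_simps) (smt (verit) mult_nonneg_nonneg of_nat_0_le_iff)
  also have "\<dots> = e" using assms(4) by (simp add: d_def)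
  finally show "q x < e" .
qed

lemma continuous_map_seminorm:
  assumes S: "csubspace S" and P: "\<And>p. p \<in> P \<Longrightarrow> seminorm_on S p" and q: "q \<in> P"
  shows "continuous_map (seminorm_topology S P) euclideanreal q"
proof -
  have "\<exists>T. openin (seminorm_topology S P) T \<and> x \<in> T \<and> T \<subseteq> {x \<in> S. q x \<in> U}"
    if U: "open U" and x: "x \<in> S" "q x \<in> U" for U x
  proof -
    obtain e where e: "e > 0" "ball (q x) e \<subseteq> U" using U x openE by blast
    let ?T = "{y \<in> S. \<forall>p\<in>{q}. p (y - x) < e}"
    have "openin (seminorm_topology S P) ?T" by (rule openin_seminorm_ball) (use q x e in auto)
    moreover have "x \<in> ?T" using x e seminorm_on_zero[OF S P[OF q]] by simp
    moreover have "?T \<subseteq> {x \<in> S. q x \<in> U}"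
    proof
      fix y assume y: "y \<in> ?T"
      have "q y \<le> q (y - x) + q x" "q x \<le> q (x - y) + q y"
        using seminorm_on_diff_triangle[OF S P[OF q], of y x 0]
          seminorm_on_diff_triangle[OF S P[OF q], of x y 0] y x S
        by (auto simp: csubspace_def)
      moreover have "q (x - y) = q (y - x)"
        using seminorm_on_minus[OF P[OF q] csubspace_diff[OF S, of x y]] x y by simp
      ultimately have "dist (q x) (q y) < e" using y by (simp add: dist_real_def abs_less_iff)
      then show "y \<in> {x \<in> S. q x \<in> U}" using e y by auto
    qed
    ultimately show ?thesis by blast
  qed
  then show ?thesis
    unfolding continuous_map_def by (auto simp: openin_subopen[where S = "{x \<in> S. q x \<in> _}"])
qed

text \<open>The set \<open>q < 1\<close> contains a finite intersection of balls around
  \<open>0\<close>, and homogeneity turns this inclusion into a linear estimate. It is applied on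
  the Frechet spaces of supported sections and on the (LF) space.\<close>

lemma continuous_seminorm_bound:
  assumes S: "csubspace S" and P: "\<And>p. p \<in> P \<Longrightarrow> seminorm_on S p"
    and q: "seminorm_on S q" "continuous_map (seminorm_topology S P) euclideanreal q"
  obtains F C where "finite F" "F \<subseteq> P" "0 \<le> C" "\<And>x. x \<in> S \<Longrightarrow> q x \<le> C * (\<Sum>p\<in>F. p x)"
proof -
  let ?U = "{x \<in> S. q x \<in> {..<1}}"
  have "openin (seminorm_topology S P) ?U"
    using openin_continuous_map_preimage[OF q(2), of "{..<1}"] by simp
  moreover have "0 \<in> ?U" using S seminorm_on_zero[OF S q(1)] by (simp add: csubspace_def)
  ultimately have U: "openin (seminorm_topology S P) ?U" "0 \<in> ?U" by auto
  obtain F \<delta> where F: "finite F" "F \<subseteq> P" "0 < \<delta>"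
    and U: "\<And>y. y \<in> S \<Longrightarrow> (\<And>p. p \<in> F \<Longrightarrow> p y < \<delta>) \<Longrightarrow> q y < 1"
    using openin_seminorm_topologyD[OF S P U] by auto
  have "q x \<le> 2 / \<delta> * (\<Sum>p\<in>F. p x)" if x: "x \<in> S" for x
  proof -
    let ?s = "\<Sum>p\<in>F. p x"
    have pos: "0 \<le> p x" if "p \<in> F" for p using seminorm_on_nonneg[OF S P x] F that by blast
    have ps: "p x \<le> ?s" if "p \<in> F" for p using member_le_sum[OF that, of "\<lambda>p. p x"] pos F by auto
    have s0: "0 \<le> ?s" using pos by (rule sum_nonneg)
    \<comment> \<open>The multiple \<open>t x\<close> lies in the intersection of balls as soon as
      \<open>t\<close> times the sum is below \<open>\<delta>\<close>.\<close>
    have *: "q x < 1 / t" if t: "0 < t" "t * ?s < \<delta>" for t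
    proof -
      have "q (complex_of_real t *\<^sub>C x) < 1"
      proof (rule U)
        show "complex_of_real t *\<^sub>C x \<in> S" using S x by (simp add: csubspace_def)
        fix p assume p: "p \<in> F"
        have "p (complex_of_real t *\<^sub>C x) = t * p x"
          using P[of p] p F x t unfolding seminorm_on_def by auto
        also have "\<dots> \<le> t * ?s" using ps[OF p] t by simp
        finally show "p (complex_of_real t *\<^sub>C x) < \<delta>" using t by simp
      qed
      moreover have "q (complex_of_real t *\<^sub>C x) = t * q x"
        using q(1) x t unfolding seminorm_on_def by auto
      ultimately show ?thesis using t by (simp add: field_simps)
    qed
    show ?thesis
    proof (cases "?s = 0")
      case True
      \<comment> \<open>If the sum vanishes, every positive \<open>t\<close> is allowed, so
        \<open>q x\<close> is below every positive number.\<close>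
      have "q x \<le> 0 + e" if "e > 0" for e using *[of "1 / e"] True that F by simp
      then show ?thesis using True field_le_epsilon[of "q x" 0] by auto
    next
      case False
      then have "?s > 0" using s0 by simp
      then show ?thesis using *[of "\<delta> / (2 * ?s)"] F by (simp add: field_simps)
    qed
  qed
  then show ?thesis using that[of F "2 / \<delta>"] F by auto
qed

lemma bounded_subset_seminorm_topology:
  assumes S: "csubspace S" and P: "\<And>p. p \<in> P \<Longrightarrow> seminorm_on S p"
    and B: "B \<subseteq> S" "\<And>p. p \<in> P \<Longrightarrow> bdd_above (p ` B)"
  shows "bounded_subset (seminorm_topology S P) B"
  unfolding bounded_subset_def
proof (intro conjI allI impI)
  show "B \<subseteq> topspace (seminorm_topology S P)" using B by simp
  fix U assume "openin (seminorm_topology S P) U \<and> 0 \<in> U"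
  then have U: "openin (seminorm_topology S P) U" "0 \<in> U" by auto
  obtain F \<delta> where F: "finite F" "F \<subseteq> P" "0 < \<delta>"
    and U: "\<And>y. y \<in> S \<Longrightarrow> (\<And>p. p \<in> F \<Longrightarrow> p y < \<delta>) \<Longrightarrow> y \<in> U"
    using openin_seminorm_topologyD[OF S P U] by auto
  have "\<forall>p\<in>F. \<exists>b. \<forall>x\<in>B. p x \<le> b" using B(2) F unfolding bdd_above_def by blast
  then obtain b where b: "\<And>p x. p \<in> F \<Longrightarrow> x \<in> B \<Longrightarrow> p x \<le> b p" by metis
  define r where "r = 1 + (\<Sum>p\<in>F. \<bar>b p\<bar>) / \<delta>"
  have sn: "0 \<le> (\<Sum>p\<in>F. \<bar>b p\<bar>)" by (rule sum_nonneg) simp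
  show "\<exists>r. \<forall>c. r \<le> cmod c \<longrightarrow> B \<subseteq> (*\<^sub>C) c ` U"
  proof (intro exI[of _ r] allI impI subsetI)
    fix c x assume c: "r \<le> cmod c" and x: "x \<in> B"
    have r1: "r \<ge> 1" using sn F by (simp add: r_def)
    then have c0: "c \<noteq> 0" "cmod c > 0" using c by auto
    have "inverse c *\<^sub>C x \<in> U"
    proof (rule U)
      show "inverse c *\<^sub>C x \<in> S" using S x B by (auto simp: csubspace_def)
      fix p assume p: "p \<in> F"
      have "p x \<le> (\<Sum>p\<in>F. \<bar>b p\<bar>)"
        using b[OF p x] member_le_sum[OF p, of "\<lambda>p. \<bar>b p\<bar>"] F by force
      also have "\<dots> < r * \<delta>" using F by (simp add: r_def field_simps)
      also have "\<dots> \<le> cmod c * \<delta>" using c F by simp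
      finally have "inverse (cmod c) * p x < \<delta>" using c0 by (simp add: field_simps)
      moreover have "p (inverse c *\<^sub>C x) = inverse (cmod c) * p x"
        using P[of p] p F subsetD[OF B(1) x] unfolding seminorm_on_def by (auto simp: norm_inverse)
      ultimately show "p (inverse c *\<^sub>C x) < \<delta>" by simp
    qed
    moreover have "x = c *\<^sub>C (inverse c *\<^sub>C x)" using c0 by (simp add: scaleC_scaleC scaleC_one)
    ultimately show "x \<in> (*\<^sub>C) c ` U" by blast
  qed
qed

text \<open>The neighbourhood of \<open>0\<close> on which \<open>\<bar>u\<bar> < 1\<close> absorbs
  \<open>B\<close>, and the absorbing factor bounds \<open>u\<close> on \<open>B\<close>. This makes
  the supremum in \<open>strong_dual\<close> an honest one rather than an unspecified real
  number.\<close>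

lemma continuous_dual_bounded:
  assumes u: "u \<in> continuous_dual X" and B: "bounded_subset X B" and X: "csubspace (topspace X)"
  shows "bdd_above ((\<lambda>x. cmod (u x)) ` B)"
proof -
  have c: "continuous_map X euclidean u" and l: "linear_on (topspace X) u"
    using u unfolding continuous_dual_def by auto
  let ?U = "{x \<in> topspace X. u x \<in> ball 0 1}"
  have z: "u 0 = 0"
  proof -
    have "u (0 *\<^sub>C 0) = 0 *\<^sub>C u 0" using l X unfolding linear_on_def csubspace_def by blast
    then show ?thesis by simp
  qed
  have "openin X ?U" using openin_continuous_map_preimage[OF c, of "ball 0 1"] by simp
  moreover have "0 \<in> ?U" using z X by (simp add: csubspace_def)
  ultimately obtain r where r: "\<And>c. r \<le> cmod c \<Longrightarrow> B \<subseteq> (*\<^sub>C) c ` ?U"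
    using B unfolding bounded_subset_def by blast
  have "cmod (u x) \<le> max r 0" if "x \<in> B" for x
  proof -
    have "\<exists>y\<in>?U. x = complex_of_real (max r 0) *\<^sub>C y"
    proof -
      have "x \<in> (*\<^sub>C) (complex_of_real (max r 0)) ` ?U"
        by (rule subsetD[OF r that]) simp
      then show ?thesis by blast
    qed
    then obtain y where y: "y \<in> ?U" "x = complex_of_real (max r 0) *\<^sub>C y" by blast
    have "u x = complex_of_real (max r 0) * u y"
      using l y unfolding linear_on_def by (simp add: scaleC_complex_def)
    then have "cmod (u x) = max r 0 * cmod (u y)" by (simp add: norm_mult)
    also have "\<dots> \<le> max r 0 * 1" by (rule mult_left_mono) (use y in auto)
    finally show ?thesis by simp
  qed
  then show ?thesis by (intro bdd_aboveI2)
qed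

lemma csubspace_continuous_dual: "csubspace (continuous_dual X)"
proof -
  have "u + v \<in> continuous_dual X" if "u \<in> continuous_dual X" "v \<in> continuous_dual X" for u v
    using that unfolding continuous_dual_def linear_on_def
    by (auto simp: scaleC_add_right plus_fun_def intro: continuous_map_add)
  moreover have "c *\<^sub>C u \<in> continuous_dual X" if "u \<in> continuous_dual X" for c u
  proof -
    have "continuous_map X euclidean (\<lambda>x. c * u x)"
      using continuous_map_compose[of X euclidean u euclidean "\<lambda>z. c * z"] that
      by (auto simp: continuous_dual_def o_def intro!: continuous_intros)
    then show ?thesis using that unfolding continuous_dual_def linear_on_def
      by (auto simp: scaleC_fun_def scaleC_complex_def algebra_simps)
  qed
  moreover have "0 \<in> continuous_dual X"
    unfolding continuous_dual_def linear_on_def by (auto simp: zero_fun_def)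
  ultimately show ?thesis unfolding csubspace_def by blast
qed

lemma seminorm_on_dual:
  assumes B: "bounded_subset X B" "B \<noteq> {}" and X: "csubspace (topspace X)"
  shows "seminorm_on (continuous_dual X) (\<lambda>u. SUP x\<in>B. cmod (u x))"
  unfolding seminorm_on_def
proof (intro conjI ballI allI)
  note bd = continuous_dual_bounded[OF _ B(1) X]
  fix u assume u: "u \<in> continuous_dual X"
  {
    fix v assume v: "v \<in> continuous_dual X"
    show "(SUP x\<in>B. cmod ((u + v) x)) \<le> (SUP x\<in>B. cmod (u x)) + (SUP x\<in>B. cmod (v x))"
    proof (rule cSUP_least[OF B(2)])
      fix x assume x: "x \<in> B"
      have "cmod ((u + v) x) \<le> cmod (u x) + cmod (v x)" by (simp add: norm_triangle_ineq)
      also have "\<dots> \<le> (SUP x\<in>B. cmod (u x)) + (SUP x\<in>B. cmod (v x))"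
        by (intro add_mono cSUP_upper x bd u v)
      finally show "cmod ((u + v) x) \<le> (SUP x\<in>B. cmod (u x)) + (SUP x\<in>B. cmod (v x))" .
    qed
  }
  fix c :: complex
  \<comment> \<open>Only this inequality uses the definition of the supremum; the reverse one
    follows by applying it to \<open>c u\<close> and \<open>inverse c\<close>.\<close>
  have le: "(SUP x\<in>B. cmod ((c *\<^sub>C u) x)) \<le> cmod c * (SUP x\<in>B. cmod (u x))"
    if u: "u \<in> continuous_dual X" for c u
    by (rule cSUP_least[OF B(2)])
      (auto simp: scaleC_fun_def scaleC_complex_def norm_mult intro!: mult_left_mono cSUP_upper bd that)
  show "(SUP x\<in>B. cmod ((c *\<^sub>C u) x)) = cmod c * (SUP x\<in>B. cmod (u x))"
  proof (cases "c = 0")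
    case True
    then show ?thesis using B by simp
  next
    case False
    have "c *\<^sub>C u \<in> continuous_dual X" using u csubspace_continuous_dual unfolding csubspace_def by blast
    from le[OF this, of "inverse c"] False
    have "(SUP x\<in>B. cmod (u x)) \<le> inverse (cmod c) * (SUP x\<in>B. cmod ((c *\<^sub>C u) x))"
      by (simp add: scaleC_scaleC scaleC_one norm_inverse)
    then have "cmod c * (SUP x\<in>B. cmod (u x)) \<le> (SUP x\<in>B. cmod ((c *\<^sub>C u) x))"
      using False by (simp add: field_simps)
    then show ?thesis using le[OF u, of c] by simp
  qed
qed

lemma strong_dual_seminorm_continuous:
  assumes B: "bounded_subset X B" "B \<noteq> {}" and X: "csubspace (topspace X)"
  shows "(\<lambda>u. SUP x\<in>B. cmod (u x)) \<in> continuous_seminorms (strong_dual X)"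
proof -
  have "continuous_map (strong_dual X) euclideanreal (\<lambda>u. SUP x\<in>B. cmod (u x))"
    unfolding strong_dual_def
    by (rule continuous_map_seminorm[OF csubspace_continuous_dual]) (use seminorm_on_dual B X in blast)+
  then show ?thesis using seminorm_on_dual[OF assms]
    unfolding continuous_seminorms_def by (simp add: strong_dual_def)
qed

section \<open>Test functions and local distributions\<close>

lemma test_functionsD:
  assumes "\<phi> \<in> test_functions U"
  shows "smooth_on UNIV \<phi>" "compact (closure {y. \<phi> y \<noteq> 0})" "closure {y. \<phi> y \<noteq> 0} \<subseteq> U"
  using assms unfolding test_functions_def by auto

lemma test_functions_subset:
  assumes "smooth_on UNIV \<psi>" "\<phi> \<in> test_functions U" "{y. \<psi> y \<noteq> 0} \<subseteq> {y. \<phi> y \<noteq> 0}"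
  shows "\<psi> \<in> test_functions U"
proof -
  have *: "closure {y. \<psi> y \<noteq> 0} \<subseteq> closure {y. \<phi> y \<noteq> 0}" by (rule closure_mono[OF assms(3)])
  then have eq: "closure {y. \<psi> y \<noteq> 0} = closure {y. \<phi> y \<noteq> 0} \<inter> closure {y. \<psi> y \<noteq> 0}" by blast
  have "compact (closure {y. \<psi> y \<noteq> 0})"
    by (rule ssubst[where P = compact, OF eq compact_Int_closed[OF test_functionsD(2)[OF assms(2)] closed_closure]])
  then show ?thesis using assms(1) * test_functionsD[OF assms(2)] unfolding test_functions_def by blast
qed

lemma test_functions_mult:
  assumes "\<phi> \<in> test_functions U" "smooth_on UNIV \<rho>"
  shows "(\<lambda>y. \<phi> y * \<rho> y) \<in> test_functions U"
  by (rule test_functions_subset[OF smooth_on_mult[OF open_UNIV test_functionsD(1)[OF assms(1)] assms(2)] assms(1)])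
    auto

lemma test_functions_add:
  assumes "\<phi> \<in> test_functions U" "\<psi> \<in> test_functions U"
  shows "(\<lambda>y. \<phi> y + \<psi> y) \<in> test_functions U"
proof -
  let ?S = "closure {y. \<phi> y \<noteq> 0} \<union> closure {y. \<psi> y \<noteq> 0}"
  have "compact ?S" by (intro compact_Un test_functionsD(2)[OF assms(1)] test_functionsD(2)[OF assms(2)])
  have S: "?S \<subseteq> U" using test_functionsD(3)[OF assms(1)] test_functionsD(3)[OF assms(2)] by blast
  have *: "closure {y. \<phi> y + \<psi> y \<noteq> 0} \<subseteq> ?S"
  proof -
    have "{y. \<phi> y + \<psi> y \<noteq> 0} \<subseteq> {y. \<phi> y \<noteq> 0} \<union> {y. \<psi> y \<noteq> 0}" by auto
    from closure_mono[OF this] show ?thesis by (simp only: closure_Un)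
  qed
  then have eq: "closure {y. \<phi> y + \<psi> y \<noteq> 0} = ?S \<inter> closure {y. \<phi> y + \<psi> y \<noteq> 0}" by blast
  have c1: "compact (closure {y. \<phi> y + \<psi> y \<noteq> 0})"
    by (rule ssubst[where P = compact, OF eq compact_Int_closed[OF \<open>compact ?S\<close> closed_closure]])
  have c2: "closure {y. \<phi> y + \<psi> y \<noteq> 0} \<subseteq> U" by (rule order.trans[OF * S])
  show ?thesis
    unfolding test_functions_def
    by (intro CollectI conjI c1 c2 smooth_on_add[OF open_UNIV test_functionsD(1)[OF assms(1)] test_functionsD(1)[OF assms(2)]])
qed

lemma test_functions_zero: "(\<lambda>_. 0) \<in> test_functions U"
  unfolding test_functions_def by (simp add: smooth_on_const)

lemma test_functions_sum:
  assumes "\<And>j. j \<in> J \<Longrightarrow> \<phi> j \<in> test_functions U"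
  shows "(\<lambda>y. \<Sum>j\<in>J. \<phi> j y) \<in> test_functions U"
  using assms
proof (induction J rule: infinite_finite_induct)
  case (insert j J)
  then show ?case using test_functions_add[of "\<phi> j" U "\<lambda>y. \<Sum>j\<in>J. \<phi> j y"] by simp
qed (simp_all add: test_functions_zero)

text \<open>The product is smooth on \<open>W\<close> and vanishes on the open complement of the
  support of \<open>\<phi>\<close>, and these two sets cover the space. The purpose is division of
  \<open>\<phi>\<close> by a function without zeros on its support.\<close>

lemma test_functions_mult_local:
  assumes \<phi>: "\<phi> \<in> test_functions U" and g: "open W" "smooth_on W g" "closure {y. \<phi> y \<noteq> 0} \<subseteq> W"
  shows "(\<lambda>y. \<phi> y * g y) \<in> test_functions U"
proof (rule test_functions_subset[OF _ \<phi>])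
  let ?N = "- closure {y. \<phi> y \<noteq> 0}"
  have N: "open ?N" by (rule open_Compl[OF closed_closure])
  have "smooth_on W (\<lambda>y. \<phi> y * g y)"
    by (rule smooth_on_mult[OF g(1) smooth_on_subset[OF test_functionsD(1)[OF \<phi>]] g(2)]) simp
  moreover have "smooth_on ?N (\<lambda>y. \<phi> y * g y)"
  proof -
    have "\<phi> y * g y = 0" if "y \<in> ?N" for y using that closure_subset[of "{y. \<phi> y \<noteq> 0}"] by auto
    then show ?thesis using smooth_on_cong[OF N, of "\<lambda>y. \<phi> y * g y" "\<lambda>_. 0"] smooth_on_const by blast
  qed
  ultimately show "smooth_on UNIV (\<lambda>y. \<phi> y * g y)"
    using g(3) by (intro smooth_on_local) blast
qed auto

section \<open>Plane waves and the bracket weight\<close>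

definition wave :: "real^'m::finite \<Rightarrow> real^'m \<Rightarrow> complex" where
  "wave \<xi> y = exp (- \<i> * of_real (y \<bullet> \<xi>))"

lemma norm_wave [simp]: "cmod (wave \<xi> y) = 1"
  unfolding wave_def by (simp add: norm_exp_eq_Re)

lemma wave_add: "wave (\<xi> + \<eta>) y = wave \<xi> y * wave \<eta> y"
  unfolding wave_def by (simp add: inner_add_right algebra_simps flip: exp_add)

lemma wave_add_arg: "wave \<xi> (x + y) = wave \<xi> x * wave \<xi> y"
  unfolding wave_def by (simp add: inner_add_left algebra_simps flip: exp_add)

lemma continuous_on_wave [continuous_intros]:
  "continuous_on S f \<Longrightarrow> continuous_on S g \<Longrightarrow> continuous_on S (\<lambda>x. wave (f x) (g x))"
  unfolding wave_def by (intro continuous_intros)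

lemma wave_has_derivative:
  "(wave \<xi> has_derivative (\<lambda>v. - \<i> * of_real (v \<bullet> \<xi>) * wave \<xi> y)) (at y)"
proof -
  have "((\<lambda>y. - \<i> * of_real (y \<bullet> \<xi>)) has_derivative (\<lambda>v. - \<i> * of_real (v \<bullet> \<xi>))) (at y)"
    by (auto intro!: derivative_eq_intros)
  from has_derivative_compose[OF this DERIV_exp[unfolded has_field_derivative_def]] show ?thesis
    unfolding wave_def by (simp add: mult_ac)
qed

text \<open>The factor \<open>(-i \<xi>)^\<alpha>\<close> by which differentiation multiplies the
  wave of frequency \<open>\<xi>\<close>.\<close>

definition monomial :: "'m::finite list \<Rightarrow> real^'m \<Rightarrow> complex" where
  "monomial is \<xi> = (\<Prod>i\<leftarrow>is. - \<i> * of_real (\<xi> $ i))"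

lemma partial_derivs_wave: "partial_derivs is (wave \<xi>) y = monomial is \<xi> * wave \<xi> y"
proof (induction "is" arbitrary: y)
  case (Cons i "is")
  have "partial_derivs (i # is) (wave \<xi>) y = partial_deriv i (\<lambda>y. monomial is \<xi> * wave \<xi> y) y"
    unfolding partial_derivs_Cons using Cons by presburger
  also have "\<dots> = monomial (i # is) \<xi> * wave \<xi> y"
    unfolding partial_deriv_eq[OF has_derivative_mult_right[OF wave_has_derivative]]
    by (simp add: monomial_def inner_commute inner_axis)
  finally show ?case .
qed (simp add: monomial_def)

lemma smooth_on_wave: "smooth_on U (wave \<xi>)"
proof -
  have "smooth_on UNIV (wave \<xi>)"
  proof (rule smooth_on_coinduct[OF open_UNIV, where Q = "range (\<lambda>c y. c * wave \<xi> y)"])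
    show "wave \<xi> \<in> range (\<lambda>c y. c * wave \<xi> y)" by (rule image_eqI[of _ _ 1]) auto
    show "g differentiable at y" if "g \<in> range (\<lambda>c y. c * wave \<xi> y)" for g y
      using that has_derivative_mult_right[OF wave_has_derivative] by (auto simp: differentiable_def)
    show "\<exists>h\<in>range (\<lambda>c y. c * wave \<xi> y). \<forall>y\<in>UNIV. partial_deriv i g y = h y"
      if g: "g \<in> range (\<lambda>c y. c * wave \<xi> y)" for g i
    proof -
      obtain c where c: "g = (\<lambda>y. c * wave \<xi> y)" using g by auto
      have "partial_deriv i g y = (c * (- \<i> * of_real (axis i 1 \<bullet> \<xi>))) * wave \<xi> y" for y
        unfolding c partial_deriv_eq[OF has_derivative_mult_right[OF wave_has_derivative]]
        by (simp add: mult_ac)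
      then have "\<forall>y\<in>UNIV. partial_deriv i g y = (c * (- \<i> * of_real (axis i 1 \<bullet> \<xi>))) * wave \<xi> y"
        by (intro ballI)
      moreover have "(\<lambda>y. (c * (- \<i> * of_real (axis i 1 \<bullet> \<xi>))) * wave \<xi> y) \<in> range (\<lambda>c y. c * wave \<xi> y)"
        by (rule rangeI)
      ultimately show ?thesis by (rule bexI)
    qed
  qed
  then show ?thesis using smooth_on_subset by blast
qed

lemma bracket_sq: "bracket \<xi> ^ 2 = 1 + (norm \<xi>)\<^sup>2"
proof -
  have "0 < 1 + (norm \<xi>)\<^sup>2" by (simp add: add_pos_nonneg)
  then show ?thesis unfolding bracket_def
    by (metis powr_half_sqrt less_imp_le real_sqrt_pow2)
qed

lemma bracket_pos [simp]: "0 < bracket \<xi>"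
  unfolding bracket_def by (simp add: add_pos_nonneg powr_gt_zero) (smt (verit) zero_le_power2)

lemma bracket_nonneg [simp]: "0 \<le> bracket \<xi>" using bracket_pos less_imp_le by blast

lemma bracket_ge_1 [simp]: "1 \<le> bracket \<xi>"
  by (rule power2_le_imp_le) (simp_all add: bracket_sq)

lemma norm_le_bracket: "norm \<xi> \<le> bracket \<xi>"
  by (rule power2_le_imp_le) (simp_all add: bracket_sq)

lemma bracket_le: "bracket \<xi> \<le> 1 + norm \<xi>"
  by (rule power2_le_imp_le) (simp_all add: bracket_sq power2_sum)

lemma bracket_minus [simp]: "bracket (- \<xi>) = bracket \<xi>"
  by (simp add: bracket_def)

text \<open>A form of Peetre's inequality; the factor \<open>2\<close> is crude and comes from
  \<open>(a + b)^2 \<le> 2 a^2 + 2 b^2\<close>.\<close>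

lemma bracket_add: "bracket (\<xi> + \<eta>) \<le> 2 * bracket \<xi> * bracket \<eta>"
proof (rule power2_le_imp_le)
  have "(norm (\<xi> + \<eta>))\<^sup>2 \<le> (norm \<xi> + norm \<eta>)\<^sup>2"
    by (intro power_mono norm_triangle_ineq) simp
  also have "\<dots> \<le> 2 * (norm \<xi>)\<^sup>2 + 2 * (norm \<eta>)\<^sup>2"
    using sum_squares_bound[of "norm \<xi>" "norm \<eta>"] by (simp add: power2_eq_square algebra_simps)
  finally show "(bracket (\<xi> + \<eta>))\<^sup>2 \<le> (2 * bracket \<xi> * bracket \<eta>)\<^sup>2"
    unfolding power_mult_distrib bracket_sq
    by (simp add: algebra_simps) (smt (verit) zero_le_power2 mult_nonneg_nonneg)
qed simp

lemma continuous_on_bracket [continuous_intros]: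
  "continuous_on S f \<Longrightarrow> continuous_on S (\<lambda>x. bracket (f x))"
  unfolding bracket_def
  by (intro continuous_intros) (auto, smt (verit) zero_le_power2)

lemma bracket_measurable [measurable]: "bracket \<in> borel_measurable borel"
  by (intro borel_measurable_continuous_onI continuous_intros)

lemma norm_monomial: "cmod (monomial is \<xi>) \<le> bracket \<xi> ^ length is"
proof (induction "is")
  case (Cons i "is")
  have "cmod (monomial (i # is) \<xi>) = \<bar>\<xi> $ i\<bar> * cmod (monomial is \<xi>)"
    by (simp add: monomial_def norm_mult)
  also have "\<dots> \<le> bracket \<xi> * bracket \<xi> ^ length is"
    using Cons component_le_norm_cart[of \<xi> i] norm_le_bracket[of \<xi>] by (intro mult_mono) auto
  finally show ?case by simp
qed (simp add: monomial_def)

lemma continuous_on_monomial [continuous_intros]: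
  "continuous_on S f \<Longrightarrow> continuous_on S (\<lambda>x. monomial is (f x))"
proof (induction "is")
  case (Cons i "is")
  then have "continuous_on S (\<lambda>x. - \<i> * of_real (f x $ i) * monomial is (f x))"
    by (intro continuous_intros) auto
  then show ?case by (simp add: monomial_def)
qed (simp add: monomial_def)

lemma jet_norm_wave:
  "jet_norm n (wave \<xi> :: real^'m::finite \<Rightarrow> complex) x
    \<le> real (card {is :: 'm list. length is \<le> n}) * bracket \<xi> ^ n"
proof -
  have "jet_norm n (wave \<xi>) x \<le> (\<Sum>is | length (is :: 'm list) \<le> n. bracket \<xi> ^ n)"
    unfolding jet_norm_def
  proof (rule sum_mono)
    fix "is" :: "'m list" assume "is \<in> {is. length is \<le> n}"
    then have "bracket \<xi> ^ length is \<le> bracket \<xi> ^ n" by (intro power_increasing) auto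
    then show "cmod (partial_derivs is (wave \<xi>) x) \<le> bracket \<xi> ^ n"
      using norm_monomial[of "is" \<xi>] by (simp add: partial_derivs_wave norm_mult)
  qed
  then show ?thesis by simp
qed

text \<open>Each of the finitely many derivatives of a wave is uniformly continuous in frequency and
  position on the compact product, and the smallest modulus serves all of them. This yields the
  continuity of Fourier transforms and the convergence of Riemann sums over frequencies.\<close>

lemma wave_uniform:
  fixes S Q :: "(real^'m::finite) set"
  assumes "compact S" "compact Q" "0 < e"
  obtains d where "0 < d" "\<And>\<theta> \<theta>' x is. \<theta> \<in> Q \<Longrightarrow> \<theta>' \<in> Q \<Longrightarrow> x \<in> S \<Longrightarrow> dist \<theta> \<theta>' < d \<Longrightarrow>
    length is \<le> n \<Longrightarrow> cmod (monomial is \<theta> * wave \<theta> x - monomial is \<theta>' * wave \<theta>' x) < e"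
proof -
  have "\<exists>d>0. \<forall>\<theta>\<in>Q. \<forall>\<theta>'\<in>Q. \<forall>x\<in>S. dist \<theta> \<theta>' < d \<longrightarrow>
      cmod (monomial is \<theta> * wave \<theta> x - monomial is \<theta>' * wave \<theta>' x) < e" for "is"
  proof -
    have "continuous_on (Q \<times> S) (\<lambda>z. monomial is (fst z) * wave (fst z) (snd z))"
      by (intro continuous_intros)
    then have "uniformly_continuous_on (Q \<times> S) (\<lambda>z. monomial is (fst z) * wave (fst z) (snd z))"
      using compact_uniformly_continuous compact_Times assms by blast
    then obtain d where d: "d > 0" "\<And>z z'. z \<in> Q \<times> S \<Longrightarrow> z' \<in> Q \<times> S \<Longrightarrow> dist z' z < d \<Longrightarrow>
      dist (monomial is (fst z') * wave (fst z') (snd z')) (monomial is (fst z) * wave (fst z) (snd z)) < e"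
      using assms(3) unfolding uniformly_continuous_on_def by blast
    have "cmod (monomial is \<theta> * wave \<theta> x - monomial is \<theta>' * wave \<theta>' x) < e"
      if "\<theta> \<in> Q" "\<theta>' \<in> Q" "x \<in> S" "dist \<theta> \<theta>' < d" for \<theta> \<theta>' x
      using d(2)[of "(\<theta>', x)" "(\<theta>, x)"] that by (simp add: dist_Pair_Pair dist_norm)
    then show ?thesis using d(1) by blast
  qed
  then obtain d where d: "\<And>is. 0 < d is" "\<And>is \<theta> \<theta>' x. \<theta> \<in> Q \<Longrightarrow> \<theta>' \<in> Q \<Longrightarrow> x \<in> S \<Longrightarrow>
    dist \<theta> \<theta>' < d is \<Longrightarrow> cmod (monomial is \<theta> * wave \<theta> x - monomial is \<theta>' * wave \<theta>' x) < e"
    by metis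
  let ?J = "{is :: 'm list. length is \<le> n}"
  have ne: "?J \<noteq> {}" by (auto intro: exI[of _ "[]"])
  show ?thesis
  proof (rule that[of "Min (d ` ?J)"])
    show "0 < Min (d ` ?J)" using ne d(1) by simp
    fix \<theta> \<theta>' x and "is" :: "'m list" assume *: "\<theta> \<in> Q" "\<theta>' \<in> Q" "x \<in> S" "dist \<theta> \<theta>' < Min (d ` ?J)" "length is \<le> n"
    have "Min (d ` ?J) \<le> d is" by (rule Min_le) (use * in auto)
    then show "cmod (monomial is \<theta> * wave \<theta> x - monomial is \<theta>' * wave \<theta>' x) < e"
      by (rule d(2)[OF *(1-3) less_le_trans[OF *(4)]])
  qed
qed

text \<open>The bound quantifies over all smooth \<open>\<rho>\<close> but involves the values of \<open>\<rho>\<close> on the support of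
  \<open>\<phi>\<close> only. For fixed \<open>\<phi>\<close> this is the continuity of \<open>\<phi> v\<close>, in the form in which it is inherited from
  sections of the bundle.\<close>

definition local_distribution :: "(real^'m::finite) set \<Rightarrow> ((real^'m \<Rightarrow> complex) \<Rightarrow> complex) \<Rightarrow> bool" where
  "local_distribution U v \<longleftrightarrow>
     (\<forall>\<phi>\<in>test_functions U. \<forall>\<psi>\<in>test_functions U. v (\<lambda>y. \<phi> y + \<psi> y) = v \<phi> + v \<psi>)
     \<and> (\<forall>c. \<forall>\<phi>\<in>test_functions U. v (\<lambda>y. c * \<phi> y) = c * v \<phi>)
     \<and> (\<forall>\<phi>\<in>test_functions U. \<exists>K n. 0 \<le> K \<and> (\<forall>\<rho> M. smooth_on UNIV \<rho> \<longrightarrow> 0 \<le> M \<longrightarrow>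
          (\<forall>x\<in>closure {y. \<phi> y \<noteq> 0}. jet_norm n \<rho> x \<le> M) \<longrightarrow> cmod (v (\<lambda>y. \<phi> y * \<rho> y)) \<le> K * M))"

lemma local_distribution_add:
  "local_distribution U v \<Longrightarrow> \<phi> \<in> test_functions U \<Longrightarrow> \<psi> \<in> test_functions U \<Longrightarrow>
    v (\<lambda>y. \<phi> y + \<psi> y) = v \<phi> + v \<psi>"
  unfolding local_distribution_def by blast

lemma local_distribution_cmult:
  "local_distribution U v \<Longrightarrow> \<phi> \<in> test_functions U \<Longrightarrow> v (\<lambda>y. c * \<phi> y) = c * v \<phi>"
  unfolding local_distribution_def by blast

lemma local_distribution_bound:
  assumes "local_distribution U v" "\<phi> \<in> test_functions U"
  obtains K n where "0 \<le> K" "\<And>\<rho> M. smooth_on UNIV \<rho> \<Longrightarrow> 0 \<le> M \<Longrightarrow>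
    (\<And>x. x \<in> closure {y. \<phi> y \<noteq> 0} \<Longrightarrow> jet_norm n \<rho> x \<le> M) \<Longrightarrow> cmod (v (\<lambda>y. \<phi> y * \<rho> y)) \<le> K * M"
proof -
  obtain K n where "0 \<le> K" "\<forall>\<rho> M. smooth_on UNIV \<rho> \<longrightarrow> 0 \<le> M \<longrightarrow>
      (\<forall>x\<in>closure {y. \<phi> y \<noteq> 0}. jet_norm n \<rho> x \<le> M) \<longrightarrow> cmod (v (\<lambda>y. \<phi> y * \<rho> y)) \<le> K * M"
    using assms unfolding local_distribution_def by blast
  then show ?thesis using that[of K n] by blast
qed

lemma local_distribution_zero:
  assumes "local_distribution U v" shows "v (\<lambda>_. 0) = 0"
  using local_distribution_cmult[OF assms test_functions_zero, of 0] by simp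

lemma local_distribution_sum:
  assumes v: "local_distribution U v" and "\<And>j. j \<in> J \<Longrightarrow> \<phi> j \<in> test_functions U"
  shows "v (\<lambda>y. \<Sum>j\<in>J. \<phi> j y) = (\<Sum>j\<in>J. v (\<phi> j))"
  using assms(2)
proof (induction J rule: infinite_finite_induct)
  case (insert j J)
  then show ?case
    using local_distribution_add[OF v _ test_functions_sum, of "\<phi> j" J \<phi>] by simp
qed (simp_all add: local_distribution_zero[OF v])

lemma local_distribution_diff:
  assumes v: "local_distribution U v" and "\<phi> \<in> test_functions U" "\<psi> \<in> test_functions U"
  shows "v (\<lambda>y. \<phi> y - \<psi> y) = v \<phi> - v \<psi>"
proof -
  have "(\<lambda>y. -1 * \<psi> y) \<in> test_functions U"
    using test_functions_mult[OF assms(3) smooth_on_const[of UNIV "-1"]] by (simp add: mult.commute)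
  from local_distribution_add[OF v assms(2) this] local_distribution_cmult[OF v assms(3), of "-1"]
  show ?thesis by simp
qed

section \<open>Fourier transforms of cut-off distributions\<close>

lemma fourier_cutoff_wave: "fourier_cutoff \<phi> v \<xi> = v (\<lambda>y. \<phi> y * wave \<xi> y)"
  by (simp add: fourier_cutoff_def wave_def)

text \<open>The distribution sees at most \<open>n\<close> derivatives of the wave on the support,
  and each costs one factor of the bracket. This a priori bound later pays for the frequencies at
  which a translate leaves the cone.\<close>

lemma fourier_cutoff_growth:
  assumes v: "local_distribution U v" and \<phi>: "\<phi> \<in> test_functions U"
  obtains C N where "0 \<le> C" "\<And>\<xi>. cmod (fourier_cutoff \<phi> v \<xi>) \<le> C * bracket \<xi> ^ N"
proof -
  obtain K n where K: "0 \<le> K" "\<And>\<rho> M. smooth_on UNIV \<rho> \<Longrightarrow> 0 \<le> M \<Longrightarrow>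
    (\<And>x. x \<in> closure {y. \<phi> y \<noteq> 0} \<Longrightarrow> jet_norm n \<rho> x \<le> M) \<Longrightarrow> cmod (v (\<lambda>y. \<phi> y * \<rho> y)) \<le> K * M"
    using local_distribution_bound[OF v \<phi>] by blast
  define c where "c = real (card {is :: 'a list. length is \<le> n})"
  show ?thesis
  proof (rule that[of "K * c" n])
    show "0 \<le> K * c" using K by (simp add: c_def)
    fix \<xi> :: "real^'a"
    have "cmod (fourier_cutoff \<phi> v \<xi>) \<le> K * (c * bracket \<xi> ^ n)"
      unfolding fourier_cutoff_wave
      by (rule K(2)[OF smooth_on_wave]) (auto simp: c_def jet_norm_wave)
    then show "cmod (fourier_cutoff \<phi> v \<xi>) \<le> K * c * bracket \<xi> ^ n" by (simp add: mult.assoc)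
  qed
qed

text \<open>The difference of two waves with close frequencies is a smooth factor that is small on
  the support together with its derivatives up to the order of the distribution. Continuity makes
  the transforms measurable, and integrable over cubes.\<close>

lemma continuous_fourier_cutoff:
  assumes v: "local_distribution U v" and \<phi>: "\<phi> \<in> test_functions U"
  shows "continuous_on UNIV (fourier_cutoff \<phi> v)"
  unfolding continuous_on_iff
proof (intro ballI allI impI)
  fix \<xi> :: "real^'a" and e :: real assume e: "0 < e"
  obtain K n where K: "0 \<le> K" "\<And>\<rho> M. smooth_on UNIV \<rho> \<Longrightarrow> 0 \<le> M \<Longrightarrow>
    (\<And>x. x \<in> closure {y. \<phi> y \<noteq> 0} \<Longrightarrow> jet_norm n \<rho> x \<le> M) \<Longrightarrow> cmod (v (\<lambda>y. \<phi> y * \<rho> y)) \<le> K * M"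
    using local_distribution_bound[OF v \<phi>] by blast
  define c where "c = real (card {is :: 'a list. length is \<le> n})"
  define e' where "e' = e / ((K + 1) * (c + 1))"
  have c: "0 \<le> c" by (simp add: c_def)
  have e': "0 < e'" using e K c by (simp add: e'_def)
  obtain d where d: "0 < d" "\<And>\<theta> \<theta>' x is. \<theta> \<in> cball \<xi> 1 \<Longrightarrow> \<theta>' \<in> cball \<xi> 1 \<Longrightarrow> x \<in> closure {y. \<phi> y \<noteq> 0} \<Longrightarrow>
    dist \<theta> \<theta>' < d \<Longrightarrow> length is \<le> n \<Longrightarrow> cmod (monomial is \<theta> * wave \<theta> x - monomial is \<theta>' * wave \<theta>' x) < e'"
    using wave_uniform[OF test_functionsD(2)[OF \<phi>] compact_cball e'] by blast
  show "\<exists>d>0. \<forall>\<xi>'\<in>UNIV. dist \<xi>' \<xi> < d \<longrightarrow> dist (fourier_cutoff \<phi> v \<xi>') (fourier_cutoff \<phi> v \<xi>) < e"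
  proof (intro exI[of _ "min d 1"] conjI ballI impI)
    show "0 < min d 1" using d by simp
    fix \<xi>' :: "real^'a" assume \<xi>': "dist \<xi>' \<xi> < min d 1"
    have s: "smooth_on UNIV (\<lambda>y. wave \<xi>' y - wave \<xi> y)"
      by (rule smooth_on_diff[OF open_UNIV smooth_on_wave smooth_on_wave])
    have pd: "partial_derivs is (\<lambda>y. wave \<xi>' y - wave \<xi> y) x =
        monomial is \<xi>' * wave \<xi>' x - monomial is \<xi> * wave \<xi> x" for "is" x
    proof -
      have "partial_derivs is (\<lambda>y. wave \<xi>' y + (-1) * wave \<xi> y) x =
          partial_derivs is (wave \<xi>') x + partial_derivs is (\<lambda>y. (-1) * wave \<xi> y) x"
        by (rule partial_derivs_add[OF open_UNIV smooth_on_wave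
              smooth_on_mult[OF open_UNIV smooth_on_const smooth_on_wave]]) simp
      also have "partial_derivs is (\<lambda>y. (-1) * wave \<xi> y) x = (-1) * partial_derivs is (wave \<xi>) x"
        by (rule partial_derivs_cmult[OF open_UNIV smooth_on_wave]) simp
      finally show ?thesis by (simp add: partial_derivs_wave)
    qed
    have "fourier_cutoff \<phi> v \<xi>' - fourier_cutoff \<phi> v \<xi> = v (\<lambda>y. \<phi> y * (wave \<xi>' y - wave \<xi> y))"
      unfolding fourier_cutoff_wave right_diff_distrib
      by (rule local_distribution_diff[OF v test_functions_mult[OF \<phi> smooth_on_wave]
            test_functions_mult[OF \<phi> smooth_on_wave], symmetric])
    also have "cmod \<dots> \<le> K * (c * e')"
    proof (rule K(2)[OF s])
      show "0 \<le> c * e'" using c e' by simp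
      fix x assume x: "x \<in> closure {y. \<phi> y \<noteq> 0}"
      have "jet_norm n (\<lambda>y. wave \<xi>' y - wave \<xi> y) x \<le> (\<Sum>is | length (is :: 'a list) \<le> n. e')"
        unfolding jet_norm_def pd
        by (rule sum_mono, rule less_imp_le, rule d(2)) (use x \<xi>' in \<open>auto simp: dist_commute\<close>)
      then show "jet_norm n (\<lambda>y. wave \<xi>' y - wave \<xi> y) x \<le> c * e'" by (simp add: c_def)
    qed
    also have "\<dots> < (K + 1) * ((c + 1) * e')"
    proof -
      have "K * (c * e') \<le> K * ((c + 1) * e')" using K c e' by (intro mult_left_mono) auto
      also have "\<dots> < (K + 1) * ((c + 1) * e')" using c e' by (intro mult_strict_right_mono) auto
      finally show ?thesis .
    qed
    also have "\<dots> = e" using K c by (simp add: e'_def)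
    finally show "dist (fourier_cutoff \<phi> v \<xi>') (fourier_cutoff \<phi> v \<xi>) < e"
      by (simp add: dist_norm)
  qed
qed

lemma fourier_cutoff_measurable:
  assumes "local_distribution U v" "\<phi> \<in> test_functions U"
  shows "fourier_cutoff \<phi> v \<in> borel_measurable borel"
  by (rule borel_measurable_continuous_onI[OF continuous_fourier_cutoff[OF assms]])

section \<open>Bump functions\<close>

text \<open>Differentiation of \<open>exp (-1/s)\<close> produces negative powers of
  \<open>s\<close>; carrying them as the index \<open>k\<close> makes the linear span of the family
  closed under differentiation.\<close>

definition flat :: "nat \<Rightarrow> real \<Rightarrow> real" where
  "flat k s = (if s > 0 then exp (- 1 / s) / s ^ k else 0)"

text \<open>The inequality \<open>t \<le> exp t\<close> at \<open>t = 1/(s n)\<close> with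
  \<open>n = k + 2\<close>, raised to the power \<open>n\<close>, gives
  \<open>exp (-1/s) \<le> (s n)^n\<close>. Division by \<open>s^k\<close> leaves two powers of
  \<open>s\<close>, one more than the difference quotient at \<open>0\<close> consumes, so this
  quotient tends to \<open>0\<close>.\<close>

lemma flat_bound: "\<bar>flat k s\<bar> \<le> real (k + 2) ^ (k + 2) * s\<^sup>2"
proof (cases "s > 0")
  case True
  let ?n = "k + 2"
  have "(1 / (s * ?n)) ^ ?n \<le> exp (1 / (s * ?n)) ^ ?n"
  proof (rule power_mono)
    show "1 / (s * ?n) \<le> exp (1 / (s * ?n))" using exp_ge_add_one_self[of "1 / (s * ?n)"] by linarith
  qed (use True in simp)
  also have "\<dots> = exp (real ?n * (1 / (s * ?n)))" by (rule exp_of_nat_mult[symmetric])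
  also have "real ?n * (1 / (s * ?n)) = 1 / s" using True by (simp add: divide_simps)
  finally have "inverse (exp (1 / s)) \<le> inverse ((1 / (s * ?n)) ^ ?n)"
    by (rule le_imp_inverse_le) (use True in simp)
  also have "inverse ((1 / (s * ?n)) ^ ?n) = (s * ?n) ^ ?n"
    by (simp only: power_one_over inverse_eq_divide) simp
  finally have "exp (- 1 / s) \<le> (s * ?n) ^ ?n"
    by (simp only: exp_minus[symmetric] minus_divide_left)
  then have "exp (- 1 / s) / s ^ k \<le> (s * ?n) ^ ?n / s ^ k"
    using True by (intro divide_right_mono) auto
  also have "\<dots> = ?n ^ ?n * s\<^sup>2"
    using True unfolding power_mult_distrib by (simp add: power_add power2_eq_square) (simp add: algebra_simps)
  finally show ?thesis using True by (simp add: flat_def algebra_simps)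
qed (simp add: flat_def)

lemma flat_has_derivative:
  "(flat k has_real_derivative (flat (k + 2) s - real k * flat (k + 1) s)) (at s)"
proof (cases s "0 :: real" rule: linorder_cases)
  case less
  have "((\<lambda>_. 0) has_real_derivative 0) (at s)" by simp
  then have "(flat k has_real_derivative 0) (at s)"
    by (rule has_field_derivative_transform_within_open[of _ _ _ "{..<0}"]) (use less in \<open>auto simp: flat_def\<close>)
  then show ?thesis using less by (simp add: flat_def)
next
  case greater
  have "((\<lambda>s. exp (- 1 / s) / s ^ k) has_real_derivative (flat (k + 2) s - real k * flat (k + 1) s)) (at s)"
    using greater
    by (auto intro!: derivative_eq_intros simp: flat_def field_simps power_add power2_eq_square)
      (cases k; simp add: field_simps)+
  then show ?thesis
    by (rule has_field_derivative_transform_within_open[of _ _ _ "{0<..}"]) (use greater in \<open>auto simp: flat_def\<close>)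
next
  case equal
  let ?C = "real (k + 2) ^ (k + 2)"
  have "(\<lambda>h. (flat k (0 + h) - flat k 0) / h) \<midarrow>0\<rightarrow> 0"
  proof (rule tendsto_0_le[where K = "1" and f = "\<lambda>h. ?C * h"])
    show "(\<lambda>h. ?C * h) \<midarrow>0\<rightarrow> 0" by (auto intro!: tendsto_eq_intros)
    show "\<forall>\<^sub>F h in at 0. norm ((flat k (0 + h) - flat k 0) / h) \<le> norm (?C * h) * 1"
    proof (rule always_eventually, intro allI)
      fix h :: real
      have "\<bar>flat k h\<bar> / \<bar>h\<bar> \<le> ?C * h\<^sup>2 / \<bar>h\<bar>" by (intro divide_right_mono flat_bound) simp
      also have "\<dots> = ?C * \<bar>h\<bar>" by (simp add: power2_eq_square abs_if)
      finally show "norm ((flat k (0 + h) - flat k 0) / h) \<le> norm (?C * h) * 1"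
        by (simp add: flat_def[of k 0] abs_mult)
    qed
  qed
  then show ?thesis using equal by (simp add: DERIV_def flat_def)
qed

lemma smooth_on_norm_sq: "smooth_on UNIV (\<lambda>y::real^'m::finite. complex_of_real (R - (norm (y - z))\<^sup>2))"
proof -
  have coord: "smooth_on UNIV (\<lambda>y::real^'m. complex_of_real (y $ i))" for i
  proof (rule smooth_on_coinduct[OF open_UNIV, where
        Q = "insert (\<lambda>y::real^'m. complex_of_real (y $ i)) (range (\<lambda>c _. c))"])
    have d: "((\<lambda>y::real^'m. complex_of_real (y $ i)) has_derivative (\<lambda>v. complex_of_real (v $ i))) (at y)" for y
      by (rule bounded_linear_imp_has_derivative[OF
            bounded_linear_compose[OF bounded_linear_of_real bounded_linear_vec_nth]])
    show "g differentiable at y"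
      if "g \<in> insert (\<lambda>y::real^'m. complex_of_real (y $ i)) (range (\<lambda>c _. c))" for g y
      using that d[of y] differentiable_const[of _ "at y"] unfolding differentiable_def by blast
    show "\<exists>h\<in>insert (\<lambda>y::real^'m. complex_of_real (y $ i)) (range (\<lambda>c _. c)). \<forall>y\<in>UNIV. partial_deriv j g y = h y"
      if "g \<in> insert (\<lambda>y::real^'m. complex_of_real (y $ i)) (range (\<lambda>c _. c))" for g j
      using that by (auto simp: partial_deriv_eq[OF d] partial_deriv_eq[OF has_derivative_const])
  qed simp
  have "smooth_on UNIV (\<lambda>y::real^'m. complex_of_real R - (\<Sum>i\<in>UNIV.
      (complex_of_real (y $ i) - complex_of_real (z $ i)) * (complex_of_real (y $ i) - complex_of_real (z $ i))))"
    by (intro smooth_on_diff[OF open_UNIV] smooth_on_sum[OF open_UNIV] smooth_on_mult[OF open_UNIV]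
        coord smooth_on_const)
  moreover have "complex_of_real (R - (norm (y - z))\<^sup>2) = complex_of_real R - (\<Sum>i\<in>UNIV.
      (complex_of_real (y $ i) - complex_of_real (z $ i)) * (complex_of_real (y $ i) - complex_of_real (z $ i)))" for y :: "real^'m"
    unfolding power2_norm_eq_inner inner_vec_def by simp
  ultimately show ?thesis by presburger
qed

text \<open>The function \<open>flat 0\<close> of \<open>r^2 - \<bar>y - z\<bar>^2\<close> is
  positive at \<open>z\<close> and vanishes off the ball. Its smoothness is obtained by taking the
  compositions with all \<open>flat k\<close> as generators of a smooth algebra: the derivative of
  each is the smooth derivative of the inner function times a combination of two others.\<close>

lemma exists_test_function:
  fixes z :: "real^'m::finite"
  assumes "open U" "z \<in> U"
  obtains \<phi> where "\<phi> \<in> test_functions U" "\<phi> z \<noteq> 0"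
proof -
  obtain r where r: "r > 0" "cball z r \<subseteq> U" using assms open_contains_cball by blast
  let ?t = "\<lambda>y. r\<^sup>2 - (norm (y - z))\<^sup>2"
  let ?f = "\<lambda>k y. complex_of_real (flat k (?t y))"
  let ?G = "range ?f"
  have t: "smooth_on UNIV (\<lambda>y. complex_of_real (?t y))" by (rule smooth_on_norm_sq)
  have dt: "\<exists>D. (?t has_derivative D) (at y) \<and> (\<forall>i. complex_of_real (D (axis i 1)) =
      partial_deriv i (\<lambda>y. complex_of_real (?t y)) y)" for y
  proof -
    have D: "(?t has_derivative (\<lambda>v. - (2 * (v \<bullet> (y - z))))) (at y)"
      unfolding power2_norm_eq_inner
      by (auto intro!: derivative_eq_intros simp: inner_commute)
    have E: "((\<lambda>y. complex_of_real (?t y)) has_derivative (\<lambda>v. complex_of_real (- (2 * (v \<bullet> (y - z)))))) (at y)"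
      by (rule has_derivative_of_real[OF D])
    show ?thesis by (intro exI conjI allI, rule D) (rule partial_deriv_eq[OF E, symmetric])
  qed
  have f: "(?f k has_derivative (\<lambda>v. complex_of_real (D v * (flat (k + 2) (?t y) - real k * flat (k + 1) (?t y))))) (at y)"
    if "(?t has_derivative D) (at y)" for k y D
    using has_derivative_of_real[OF has_derivative_compose[OF that
        flat_has_derivative[of k "?t y", unfolded has_field_derivative_def]]]
    by (simp add: mult.commute)
  have "smooth_on UNIV (?f 0)"
  proof (rule smooth_algebra_smooth_on[where G = ?G, OF open_UNIV smooth_algebra.gen])
    show "?f 0 \<in> ?G" by blast
    fix g assume "g \<in> ?G"
    then obtain k where k: "g = ?f k" by blast
    show "(\<forall>y\<in>UNIV. g differentiable at y) \<and>
        (\<forall>i. \<exists>h\<in>smooth_algebra UNIV ?G. \<forall>y\<in>UNIV. partial_deriv i g y = h y)"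
    proof (intro conjI ballI allI)
      show "g differentiable at y" for y
        using dt[of y] f unfolding k differentiable_def by blast
      fix i
      let ?h = "\<lambda>y. partial_deriv i (\<lambda>y. complex_of_real (?t y)) y
        * (?f (k + 2) y + complex_of_real (- real k) * ?f (k + 1) y)"
      have "?h \<in> smooth_algebra UNIV ?G"
        by (intro smooth_algebra.mult smooth_algebra.add smooth_algebra.base[OF smooth_on_const]
            smooth_algebra.base[OF smooth_on_partial_deriv[OF t]] smooth_algebra.gen) auto
      moreover have "partial_deriv i g y = ?h y" for y
      proof -
        obtain D where D: "(?t has_derivative D) (at y)"
          "\<forall>i. complex_of_real (D (axis i 1)) = partial_deriv i (\<lambda>y. complex_of_real (?t y)) y"
          using dt by blast
        have "partial_deriv i g y = complex_of_real (D (axis i 1)) *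
            complex_of_real (flat (k + 2) (?t y) - real k * flat (k + 1) (?t y))"
          using partial_deriv_eq[OF f[OF D(1), of k], of i] by (simp add: k)
        then show ?thesis unfolding D(2)[rule_format] by simp
      qed
      ultimately show "\<exists>h\<in>smooth_algebra UNIV ?G. \<forall>y\<in>UNIV. partial_deriv i g y = h y"
        by (intro bexI[of _ ?h] ballI)
    qed
  qed
  moreover have "closure {y. ?f 0 y \<noteq> 0} \<subseteq> cball z r"
  proof (rule closure_minimal)
    show "{y. ?f 0 y \<noteq> 0} \<subseteq> cball z r"
    proof
      fix y assume "y \<in> {y. ?f 0 y \<noteq> 0}"
      then have "(norm (y - z))\<^sup>2 < r\<^sup>2" by (auto simp: flat_def split: if_splits)
      then have "norm (y - z) < r" using r power2_less_imp_less by force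
      then show "y \<in> cball z r" by (simp add: dist_norm norm_minus_commute)
    qed
  qed simp
  moreover then have "compact (closure {y. ?f 0 y \<noteq> 0})"
    using compact_cball compact_closure bounded_subset bounded_cball
    by (metis (no_types, lifting) bounded_closure_image closure_closure compact_eq_bounded_closed closed_closure)
  ultimately have "?f 0 \<in> test_functions U" using r unfolding test_functions_def by blast
  moreover have "?f 0 z \<noteq> 0" using r by (simp add: flat_def)
  ultimately show ?thesis using that by blast
qed

section \<open>Approximation of test functions by trigonometric polynomials\<close>

lemma integrable_compact_support:
  fixes f :: "'a::euclidean_space \<Rightarrow> 'b::{banach, second_countable_topology}"
  assumes "continuous_on UNIV f" "compact K" "\<And>x. x \<notin> K \<Longrightarrow> f x = 0"
  shows "integrable lborel f"
proof -
  have "integrable lborel (\<lambda>x. indicator K x *\<^sub>R f x)"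
    by (rule borel_integrable_compact[OF assms(2) continuous_on_subset[OF assms(1)]]) simp
  moreover have "(\<lambda>x. indicator K x *\<^sub>R f x) = f"
    using assms(3) by (auto simp: fun_eq_iff indicator_def)
  ultimately show ?thesis by simp
qed

lemma lborel_integral_translate:
  fixes f :: "'a::euclidean_space \<Rightarrow> 'b::{banach, second_countable_topology}"
  assumes "f \<in> borel_measurable borel"
  shows "(LINT x|lborel. f (t + x)) = (LINT x|lborel. f x)"
proof -
  have "(LINT x|lborel. f x) = (LINT x|distr lborel borel ((+) t). f x)"
    by (simp only: lborel_distr_plus)
  also have "\<dots> = (LINT x|lborel. f (t + x))"
    by (rule integral_distr) (use assms in auto)
  finally show ?thesis by simp
qed

lemma lborel_integral_reflect:
  fixes f :: "'a::euclidean_space \<Rightarrow> 'b::{banach, second_countable_topology}"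
  assumes "f \<in> borel_measurable borel"
  shows "(LINT x|lborel. f (t - x)) = (LINT x|lborel. f x)"
proof -
  have "lborel = distr lborel borel (\<lambda>x. t + (- 1) *\<^sub>R x :: 'a)"
    using lborel_affine[of "- 1" t] by (simp add: density_1 del: scaleR_minus_left)
  then have "(LINT x|lborel. f x) = (LINT x|distr lborel borel (\<lambda>x. t + (- 1) *\<^sub>R x). f x)"
    by (rule arg_cong)
  also have "\<dots> = (LINT x|lborel. f (t + (- 1) *\<^sub>R x))"
    by (rule integral_distr) (use assms in auto)
  finally show ?thesis by simp
qed

lemma smooth_on_imp_measurable:
  "smooth_on UNIV (f :: real^'m::finite \<Rightarrow> complex) \<Longrightarrow> f \<in> borel_measurable borel"
  by (rule borel_measurable_continuous_onI[OF smooth_on_imp_continuous_on])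

lemma partial_deriv_zero_outside:
  fixes F :: "real^'m::finite \<Rightarrow> complex"
  assumes "x \<notin> closure {y. F y \<noteq> 0}" shows "partial_deriv i F x = 0"
proof -
  have z: "F y = 0" if "y \<in> - closure {y. F y \<noteq> 0}" for y
    using that closure_subset[of "{y. F y \<noteq> 0}"] by blast
  have "partial_deriv i F x = partial_deriv i (\<lambda>_. 0) x"
    by (rule partial_deriv_cong[OF open_Compl[OF closed_closure] iffD2[OF Compl_iff assms] z])
  also have "\<dots> = 0" by (rule partial_deriv_eq[OF has_derivative_const])
  finally show ?thesis .
qed

lemma test_functions_partial_deriv:
  assumes "F \<in> test_functions U" shows "partial_deriv i F \<in> test_functions U"
proof -
  have sub: "{y. partial_deriv i F y \<noteq> 0} \<subseteq> closure {y. F y \<noteq> 0}"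
    using partial_deriv_zero_outside by blast
  then have *: "closure {y. partial_deriv i F y \<noteq> 0} \<subseteq> closure {y. F y \<noteq> 0}"
    by (rule closure_minimal) simp
  then have eq: "closure {y. partial_deriv i F y \<noteq> 0} =
      closure {y. F y \<noteq> 0} \<inter> closure {y. partial_deriv i F y \<noteq> 0}" by blast
  have "compact (closure {y. partial_deriv i F y \<noteq> 0})"
    by (rule ssubst[where P = compact, OF eq compact_Int_closed[OF test_functionsD(2)[OF assms] closed_closure]])
  then show ?thesis
    using smooth_on_partial_deriv[OF test_functionsD(1)[OF assms]] * test_functionsD(3)[OF assms]
    unfolding test_functions_def by blast
qed

lemma test_functions_partial_derivs:
  assumes "F \<in> test_functions U" shows "partial_derivs is F \<in> test_functions U"
  by (induction "is") (auto simp: assms partial_derivs_Cons test_functions_partial_deriv)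

lemma test_functions_zero_outside:
  "x \<notin> closure {y. F y \<noteq> 0} \<Longrightarrow> F x = 0"
  using closure_subset[of "{y. F y \<noteq> 0}"] by blast

lemma test_functions_integrable:
  "F \<in> test_functions U \<Longrightarrow> integrable lborel F"
  by (rule integrable_compact_support[OF smooth_on_imp_continuous_on[OF test_functionsD(1)] test_functionsD(2)
        test_functions_zero_outside])

lemma test_functions_bounded:
  assumes "F \<in> test_functions U"
  obtains B where "0 \<le> B" "\<And>x. cmod (F x) \<le> B"
proof -
  let ?K = "closure {y. F y \<noteq> 0}"
  have "bounded (F ` ?K)"
    using compact_continuous_image[OF continuous_on_subset[OF
        smooth_on_imp_continuous_on[OF test_functionsD(1)[OF assms]]] test_functionsD(2)[OF assms]]
    by (simp add: compact_imp_bounded)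
  then obtain B where B: "\<And>x. x \<in> ?K \<Longrightarrow> cmod (F x) \<le> B" unfolding bounded_iff by auto
  have "cmod (F x) \<le> max B 0" for x
    using B[of x] test_functions_zero_outside[of x F] by (cases "x \<in> ?K") auto
  then show ?thesis using that[of "max B 0"] by simp
qed

lemma has_derivative_along_axis:
  fixes F :: "real^'m::finite \<Rightarrow> complex"
  assumes "F differentiable (at (x + t *\<^sub>R axis i 1))"
  shows "((\<lambda>t. F (x + t *\<^sub>R axis i 1)) has_derivative
    (\<lambda>s. s *\<^sub>R partial_deriv i F (x + t *\<^sub>R axis i 1))) (at t)"
proof -
  have D: "(F has_derivative frechet_derivative F (at (x + t *\<^sub>R axis i 1))) (at (x + t *\<^sub>R axis i 1))"
    using assms frechet_derivative_works by blast
  have "((\<lambda>t. x + t *\<^sub>R axis i 1) has_derivative (\<lambda>s. s *\<^sub>R axis i 1)) (at t)"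
    by (auto intro!: derivative_eq_intros)
  from has_derivative_compose[OF this D] show ?thesis
    using linear_cmul[OF has_derivative_linear[OF D]] by (simp add: partial_deriv_def)
qed

text \<open>By translation invariance all difference quotients have integral \<open>0\<close>.\<close>

lemma integral_partial_deriv:
  fixes F :: "real^'m::finite \<Rightarrow> complex"
  assumes F: "F \<in> test_functions U"
  shows "(LINT x|lborel. partial_deriv i F x) = 0"
proof -
  let ?e = "axis i 1 :: real^'m"
  define h where "h n = inverse (real (Suc n))" for n
  define s where "s n x = (F (h n *\<^sub>R ?e + x) - F x) / of_real (h n)" for n x
  have h: "0 < h n" "h n \<le> 1" for n by (simp_all add: h_def inverse_le_1_iff)
  have h0: "h \<longlonglongrightarrow> 0" unfolding h_def by (rule LIMSEQ_inverse_real_of_nat)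
  note sm = test_functionsD(1)[OF F]
  note meas = smooth_on_imp_measurable[OF sm]
  have cont: "continuous_on UNIV F" by (rule smooth_on_imp_continuous_on[OF sm])
  obtain B where B: "0 \<le> B" "\<And>x. cmod (partial_deriv i F x) \<le> B"
    using test_functions_bounded[OF test_functions_partial_deriv[OF F]] by blast
  obtain R where R: "closure {y. F y \<noteq> 0} \<subseteq> cball 0 R"
    using bounded_subset_ballD[OF compact_imp_bounded[OF test_functionsD(2)[OF F]], of 0] ball_subset_cball
    by (meson order_trans)
  have int: "integrable lborel F" by (rule test_functions_integrable[OF F])
  have int': "integrable lborel (\<lambda>x. F (t + x))" for t
  proof (rule integrable_compact_support[where K = "cball (- t) R"])
    show "continuous_on UNIV (\<lambda>x. F (t + x))"
      by (rule continuous_on_compose2[OF cont]) (auto intro!: continuous_intros)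
    show "F (t + x) = 0" if "x \<notin> cball (- t) R" for x
    proof (rule test_functions_zero_outside[of "t + x" F])
      show "t + x \<notin> closure {y. F y \<noteq> 0}" using that R by (auto simp: dist_norm norm_minus_commute add.commute)
    qed
  qed simp
  have zero: "(LINT x|lborel. s n x) = 0" for n
    unfolding s_def using int int' lborel_integral_translate[OF meas] by simp
  have lim: "(\<lambda>n. s n x) \<longlonglongrightarrow> partial_deriv i F x" for x
  proof -
    have l: "((\<lambda>t. F (x + t *\<^sub>R ?e)) has_derivative (\<lambda>s. s *\<^sub>R partial_deriv i F x)) (at 0)"
      using has_derivative_along_axis[of F x 0 i] smooth_on_differentiable[OF sm] by simp
    let ?D = "partial_deriv i F x"
    have "((\<lambda>t. (F (x + t *\<^sub>R ?e) - F (x + 0 *\<^sub>R ?e) - (t - 0) *\<^sub>R ?D) /\<^sub>R norm (t - 0)) \<longlongrightarrow> 0) (at 0)"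
      using l unfolding has_derivative_at_within by blast
    then have "((\<lambda>t. norm ((F (x + t *\<^sub>R ?e) - F (x + 0 *\<^sub>R ?e) - (t - 0) *\<^sub>R ?D) /\<^sub>R norm (t - 0))) \<longlongrightarrow> 0) (at 0)"
      by (rule tendsto_norm_zero)
    moreover have "\<forall>\<^sub>F t in at 0. norm ((F (x + t *\<^sub>R ?e) - F (x + 0 *\<^sub>R ?e) - (t - 0) *\<^sub>R ?D) /\<^sub>R norm (t - 0))
        = norm ((F (x + t *\<^sub>R ?e) - F x) /\<^sub>R t - ?D)"
      unfolding eventually_at_filter
    proof (rule always_eventually, intro allI impI)
      fix t :: real assume t: "t \<noteq> 0"
      have "(F (x + t *\<^sub>R ?e) - F x) /\<^sub>R t - ?D = (F (x + t *\<^sub>R ?e) - F x - t *\<^sub>R ?D) /\<^sub>R t"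
        using t by (simp add: scaleR_diff_right)
      then show "norm ((F (x + t *\<^sub>R ?e) - F (x + 0 *\<^sub>R ?e) - (t - 0) *\<^sub>R ?D) /\<^sub>R norm (t - 0))
        = norm ((F (x + t *\<^sub>R ?e) - F x) /\<^sub>R t - ?D)" by simp
    qed
    ultimately have "((\<lambda>t. norm ((F (x + t *\<^sub>R ?e) - F x) /\<^sub>R t - ?D)) \<longlongrightarrow> 0) (at 0)"
      by (rule Lim_transform_eventually)
    then have "((\<lambda>t. (F (x + t *\<^sub>R ?e) - F x) /\<^sub>R t) \<longlongrightarrow> ?D) (at 0)"
      by (rule LIM_zero_cancel[OF tendsto_norm_zero_cancel])
    moreover have "filterlim h (at 0) sequentially"
      unfolding filterlim_at using h0 h(1) by (simp add: less_imp_neq[THEN not_sym])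
    ultimately have "(\<lambda>n. (F (x + h n *\<^sub>R ?e) - F x) /\<^sub>R h n) \<longlonglongrightarrow> partial_deriv i F x"
      by (rule filterlim_compose)
    then show ?thesis
      by (simp add: s_def add.commute scaleR_conv_of_real divide_inverse mult.commute)
  qed
  \<comment> \<open>The mean value theorem bounds the quotients inside the ball of radius
    \<open>R + 1\<close>. The shifts have length at most \<open>1\<close>, so outside this ball both
    values of \<open>F\<close> vanish, and the domination is integrable.\<close>
  have bound: "cmod (s n x) \<le> indicator (cball 0 (R + 1)) x * B" for n x
  proof (cases "x \<in> cball 0 (R + 1)")
    case True
    have "norm (F (x + h n *\<^sub>R ?e) - F (x + 0 *\<^sub>R ?e)) \<le> B * norm (h n - 0)"
    proof (rule differentiable_bound[where S = UNIV and f' = "\<lambda>t s. s *\<^sub>R partial_deriv i F (x + t *\<^sub>R ?e)" and f = "\<lambda>t. F (x + t *\<^sub>R ?e)"])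
      fix t :: real
      show "((\<lambda>t. F (x + t *\<^sub>R ?e)) has_derivative (\<lambda>s. s *\<^sub>R partial_deriv i F (x + t *\<^sub>R ?e))) (at t within UNIV)"
        using has_derivative_along_axis[OF smooth_on_differentiable[OF sm]] by simp
      show "onorm (\<lambda>s::real. s *\<^sub>R partial_deriv i F (x + t *\<^sub>R ?e)) \<le> B"
        by (rule onorm_bound[OF B(1)]) (simp add: mult.commute[of _ "cmod _"] mult_right_mono B(2))
    qed auto
    then show ?thesis using h[of n] True
      by (simp add: s_def norm_divide field_simps add.commute)
  next
    case False
    have "norm (h n *\<^sub>R ?e) \<le> 1" using h[of n] by simp
    then have "norm x \<le> norm (h n *\<^sub>R ?e + x) + 1"
      using norm_triangle_ineq4[of "h n *\<^sub>R ?e + x" "h n *\<^sub>R ?e"] by simp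
    then have "h n *\<^sub>R ?e + x \<notin> cball 0 R" "x \<notin> cball 0 R" using False by auto
    then have "F (h n *\<^sub>R ?e + x) = 0" "F x = 0" using R test_functions_zero_outside by blast+
    then show ?thesis using B(1) by (simp add: s_def)
  qed
  have "(\<lambda>n. LINT x|lborel. s n x) \<longlonglongrightarrow> (LINT x|lborel. partial_deriv i F x)"
  proof (rule integral_dominated_convergence[where w = "\<lambda>x. indicator (cball 0 (R + 1)) x * B"])
    show "integrable lborel (\<lambda>x. indicator (cball 0 (R + 1)) x * B :: real)"
      using borel_integrable_compact[OF compact_cball, of 0 "R + 1" "\<lambda>_. B"] by simp
    show "partial_deriv i F \<in> borel_measurable lborel"
      using smooth_on_imp_measurable[OF smooth_on_partial_deriv[OF sm]] by simp
    show "s n \<in> borel_measurable lborel" for n unfolding s_def using meas by measurable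
  qed (use lim bound in auto)
  then show ?thesis unfolding zero using LIMSEQ_unique tendsto_const by blast
qed

section \<open>Decay of Fourier integrals of test functions\<close>

definition fourier_integral :: "(real^'m::finite \<Rightarrow> complex) \<Rightarrow> real^'m \<Rightarrow> complex" where
  "fourier_integral \<psi> \<zeta> = (LINT x|lborel. \<psi> x * wave \<zeta> x)"

text \<open>Integration by parts, since the derivative of \<open>\<psi>\<close> times a wave has
  integral \<open>0\<close>. The argument is negated throughout because the coefficient of
  \<open>wave \<zeta>\<close> in a trigonometric expansion pairs \<open>\<psi>\<close> with the
  conjugate wave.\<close>

lemma fourier_integral_partial_deriv:
  assumes \<psi>: "\<psi> \<in> test_functions U"
  shows "fourier_integral (partial_deriv i \<psi>) (- \<zeta>) = - \<i> * of_real (\<zeta> $ i) * fourier_integral \<psi> (- \<zeta>)"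
proof -
  have t: "(\<lambda>x. \<psi> x * wave (- \<zeta>) x) \<in> test_functions U"
    "(\<lambda>x. partial_deriv i \<psi> x * wave (- \<zeta>) x) \<in> test_functions U"
    by (intro test_functions_mult smooth_on_wave \<psi> test_functions_partial_deriv)+
  have "partial_deriv i (\<lambda>x. \<psi> x * wave (- \<zeta>) x) x =
      partial_deriv i \<psi> x * wave (- \<zeta>) x + \<i> * of_real (\<zeta> $ i) * (\<psi> x * wave (- \<zeta>) x)" for x
  proof -
    have "\<psi> differentiable (at x)" "wave (- \<zeta>) differentiable (at x)"
      using smooth_on_differentiable[OF test_functionsD(1)[OF \<psi>]]
        smooth_on_differentiable[OF smooth_on_wave] by blast+
    from partial_deriv_mult[OF this, of i] partial_derivs_wave[of "[i]" "- \<zeta>" x] show ?thesis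
      by (simp add: partial_derivs_Cons monomial_def)
  qed
  then have "0 = (LINT x|lborel. partial_deriv i \<psi> x * wave (- \<zeta>) x
      + \<i> * of_real (\<zeta> $ i) * (\<psi> x * wave (- \<zeta>) x))"
    using integral_partial_deriv[OF t(1), of i] by simp
  also have "\<dots> = fourier_integral (partial_deriv i \<psi>) (- \<zeta>)
      + \<i> * of_real (\<zeta> $ i) * fourier_integral \<psi> (- \<zeta>)"
    unfolding fourier_integral_def
    using test_functions_integrable[OF t(1)] test_functions_integrable[OF t(2)] by simp
  finally show ?thesis by (simp add: eq_neg_iff_add_eq_0)
qed

lemma fourier_integral_partial_derivs:
  assumes "\<psi> \<in> test_functions U"
  shows "fourier_integral (partial_derivs is \<psi>) (- \<zeta>) = monomial is \<zeta> * fourier_integral \<psi> (- \<zeta>)"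
proof (induction "is")
  case (Cons i "is")
  then show ?case
    using fourier_integral_partial_deriv[OF test_functions_partial_derivs[OF assms, of "is"], of i \<zeta>]
    by (simp add: partial_derivs_Cons monomial_def)
qed (simp add: monomial_def)

text \<open>One more factor of the bracket is at most
  \<open>1 + \<Sum>\<bar>\<zeta>_i\<bar>\<close>, and a factor \<open>\<zeta>_i\<close> is absorbed
  by passing from \<open>\<psi>\<close> to a partial derivative. The induction on \<open>M\<close>
  therefore ranges over all test functions.\<close>

lemma fourier_integral_decay:
  assumes "\<psi> \<in> test_functions U"
  shows "\<exists>C. \<forall>\<zeta>. cmod (fourier_integral \<psi> (- \<zeta>)) * bracket \<zeta> ^ M \<le> C"
  using assms
proof (induction M arbitrary: \<psi>)
  case 0
  have "cmod (fourier_integral \<psi> (- \<zeta>)) \<le> (LINT x|lborel. cmod (\<psi> x))" for \<zeta>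
  proof -
    have "cmod (fourier_integral \<psi> (- \<zeta>)) \<le> (LINT x|lborel. cmod (\<psi> x * wave (- \<zeta>) x))"
      unfolding fourier_integral_def by (rule integral_norm_bound)
    then show ?thesis by (simp add: norm_mult)
  qed
  then show ?case by auto
next
  case (Suc M)
  obtain C where C: "\<And>\<zeta>. cmod (fourier_integral \<psi> (- \<zeta>)) * bracket \<zeta> ^ M \<le> C"
    using Suc.IH[OF Suc.prems] by blast
  have "\<forall>i. \<exists>C. \<forall>\<zeta>. cmod (fourier_integral (partial_deriv i \<psi>) (- \<zeta>)) * bracket \<zeta> ^ M \<le> C"
    using Suc.IH[OF test_functions_partial_deriv[OF Suc.prems]] by blast
  then obtain D where D: "\<And>i \<zeta>. cmod (fourier_integral (partial_deriv i \<psi>) (- \<zeta>)) * bracket \<zeta> ^ M \<le> D i"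
    by metis
  have "cmod (fourier_integral \<psi> (- \<zeta>)) * bracket \<zeta> ^ Suc M \<le> C + (\<Sum>i\<in>UNIV. D i)" for \<zeta>
  proof -
    let ?a = "cmod (fourier_integral \<psi> (- \<zeta>)) * bracket \<zeta> ^ M"
    have a: "0 \<le> ?a" by simp
    have "cmod (fourier_integral \<psi> (- \<zeta>)) * bracket \<zeta> ^ Suc M = ?a * bracket \<zeta>" by simp
    also have "\<dots> \<le> ?a * (1 + (\<Sum>i\<in>UNIV. \<bar>\<zeta> $ i\<bar>))"
      using bracket_le[of \<zeta>] norm_le_l1_cart[of \<zeta>] by (intro mult_left_mono a) linarith
    also have "\<dots> = ?a + (\<Sum>i\<in>UNIV. \<bar>\<zeta> $ i\<bar> * ?a)"
      by (simp add: distrib_left sum_distrib_left sum_distrib_right mult_ac)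
    also have "\<dots> \<le> C + (\<Sum>i\<in>UNIV. D i)"
    proof (intro add_mono C sum_mono)
      fix i
      have "\<bar>\<zeta> $ i\<bar> * ?a = cmod (fourier_integral (partial_deriv i \<psi>) (- \<zeta>)) * bracket \<zeta> ^ M"
        by (simp only: fourier_integral_partial_deriv[OF Suc.prems] norm_mult) (simp add: norm_mult)
      then show "\<bar>\<zeta> $ i\<bar> * ?a \<le> D i" using D[of i \<zeta>] by (simp only:)
    qed
    finally show ?thesis .
  qed
  then show ?case by blast
qed

section \<open>Sums over the integer lattice\<close>

definition lattice_point :: "int^'m::finite \<Rightarrow> real^'m" where
  "lattice_point n = (\<chi> i. of_int (n $ i))"

lemma sum_inverse_squares_bound:
  obtains C where "0 \<le> C" "\<And>F. finite F \<Longrightarrow> (\<Sum>l\<in>F. 1 / (1 + (real_of_int l)\<^sup>2)) \<le> C"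
proof -
  let ?f = "\<lambda>k::nat. 1 / (1 + (real k)\<^sup>2)"
  have sm: "summable ?f"
  proof (rule summable_comparison_test_ev)
    show "summable (\<lambda>k. inverse (real k ^ 2))" by (rule inverse_power_summable) simp
    show "\<forall>\<^sub>F k in sequentially. norm (?f k) \<le> inverse (real k ^ 2)"
      using eventually_gt_at_top[of 0]
    proof eventually_elim
      case (elim k)
      have "1 / (1 + (real k)\<^sup>2) \<le> 1 / (real k)\<^sup>2"
        by (rule divide_left_mono) (use elim in \<open>auto simp: add_pos_nonneg\<close>)
      then show ?case by (simp add: inverse_eq_divide)
    qed
  qed
  have nn: "0 \<le> ?f k" for k by simp
  \<comment> \<open>Nonnegative and negative integers are treated separately, because the absolute
    value is injective on each of the two kinds.\<close>
  have half: "(\<Sum>l\<in>F. 1 / (1 + (real_of_int l)\<^sup>2)) \<le> suminf ?f"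
    if "finite F" and inj: "inj_on (\<lambda>l. nat \<bar>l\<bar>) F" for F
  proof -
    have "(\<Sum>l\<in>F. 1 / (1 + (real_of_int l)\<^sup>2)) = (\<Sum>l\<in>F. ?f (nat \<bar>l\<bar>))"
      by (rule sum.cong) auto
    also have "\<dots> = sum ?f ((\<lambda>l. nat \<bar>l\<bar>) ` F)" by (simp add: sum.reindex[OF inj])
    also have "\<dots> \<le> suminf ?f" by (rule sum_le_suminf[OF sm]) (use that nn in auto)
    finally show ?thesis .
  qed
  have "(\<Sum>l\<in>F. 1 / (1 + (real_of_int l)\<^sup>2)) \<le> suminf ?f + suminf ?f" if F: "finite F" for F
  proof -
    have "(\<Sum>l\<in>F. 1 / (1 + (real_of_int l)\<^sup>2)) =
        (\<Sum>l\<in>F \<inter> {0..}. 1 / (1 + (real_of_int l)\<^sup>2)) + (\<Sum>l\<in>F \<inter> {..<0}. 1 / (1 + (real_of_int l)\<^sup>2))"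
      by (subst sum.union_disjoint[symmetric]) (use F in \<open>auto intro!: sum.cong\<close>)
    also have "\<dots> \<le> suminf ?f + suminf ?f"
      by (intro add_mono half) (use F in \<open>auto simp: inj_on_def\<close>)
    finally show ?thesis .
  qed
  moreover have "0 \<le> suminf ?f + suminf ?f" using suminf_nonneg[OF sm nn] by simp
  ultimately show ?thesis using that by blast
qed

text \<open>A finite set of lattice points lies in a finite cube, and the sum over the cube
  factorises into one-dimensional sums with a uniform bound. The weight is a product for the sake of
  this factorisation.\<close>

lemma lattice_sum_bound:
  obtains C where "\<And>F :: (int^'m::finite) set. finite F \<Longrightarrow>
    (\<Sum>n\<in>F. \<Prod>i\<in>UNIV. 1 / (1 + (real_of_int (n $ i))\<^sup>2)) \<le> C"
proof -
  obtain C where C: "0 \<le> C" "\<And>F. finite F \<Longrightarrow> (\<Sum>l\<in>F. 1 / (1 + (real_of_int l)\<^sup>2)) \<le> C"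
    using sum_inverse_squares_bound by blast
  let ?f = "\<lambda>l::int. 1 / (1 + (real_of_int l)\<^sup>2)"
  have "(\<Sum>n\<in>F. \<Prod>i\<in>UNIV. ?f (n $ i)) \<le> C ^ CARD('m)" if F: "finite F" for F :: "(int^'m) set"
  proof -
    define B where "B = (\<Union>n\<in>F. range (vec_nth n))"
    have B: "finite B" using F by (auto simp: B_def)
    have inj: "inj_on (vec_nth :: int^'m \<Rightarrow> _) F" by (auto simp: inj_on_def vec_nth_inject)
    have "(\<Sum>n\<in>F. \<Prod>i\<in>UNIV. ?f (n $ i)) = (\<Sum>g\<in>vec_nth ` F. \<Prod>i\<in>UNIV. ?f (g i))"
      by (simp add: sum.reindex[OF inj])
    also have "\<dots> \<le> (\<Sum>g\<in>PiE (UNIV :: 'm set) (\<lambda>_. B). \<Prod>i\<in>UNIV. ?f (g i))"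
    proof (intro sum_mono2)
      show "finite (PiE (UNIV :: 'm set) (\<lambda>_. B))" using B by (intro finite_PiE) auto
      show "vec_nth ` F \<subseteq> PiE UNIV (\<lambda>_. B)" by (auto simp: B_def)
    qed (auto intro!: prod_nonneg)
    also have "\<dots> = (\<Prod>i\<in>(UNIV :: 'm set). \<Sum>l\<in>B. ?f l)"
      by (rule prod_sum_PiE[symmetric]) (use B in auto)
    also have "\<dots> \<le> (\<Prod>i\<in>(UNIV :: 'm set). C)"
      by (rule prod_mono) (use C(2)[OF B] in \<open>auto intro!: sum_nonneg\<close>)
    finally show ?thesis by simp
  qed
  then show ?thesis using that by blast
qed

lemma lattice_prod_le_bracket:
  "(\<Prod>i\<in>UNIV. 1 + (real_of_int (n $ i))\<^sup>2) \<le> bracket (lattice_point (n :: int^'m::finite)) ^ (2 * CARD('m))"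
proof -
  have "(\<Prod>i\<in>(UNIV :: 'm set). 1 + (real_of_int (n $ i))\<^sup>2) \<le> (\<Prod>i\<in>(UNIV :: 'm set). (bracket (lattice_point n))\<^sup>2)"
  proof (rule prod_mono)
    fix i :: 'm
    have "\<bar>real_of_int (n $ i)\<bar> \<le> norm (lattice_point n)"
      using component_le_norm_cart[of "lattice_point n" i] by (simp add: lattice_point_def)
    then have "(real_of_int (n $ i))\<^sup>2 \<le> (norm (lattice_point n))\<^sup>2"
      using power_mono[of "\<bar>real_of_int (n $ i)\<bar>" _ 2] by simp
    then show "0 \<le> 1 + (real_of_int (n $ i))\<^sup>2 \<and> 1 + (real_of_int (n $ i))\<^sup>2 \<le> (bracket (lattice_point n))\<^sup>2"
      by (simp add: bracket_sq)
  qed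
  then show ?thesis by (simp add: power_mult)
qed

text \<open>Decay of order \<open>M + 2m\<close>, with \<open>m\<close> the dimension, leaves a
  factor \<open>bracket ^ (-2m)\<close> after multiplication with the weight, and this is dominated
  by the summable product weight. The sum is written as an integral over the counting measure, so
  that Cauchy-Schwarz and Tonelli can be applied later.\<close>

lemma lattice_nn_integral_finite:
  fixes A :: "int^'m::finite \<Rightarrow> real"
  assumes h: "0 < h" and A: "\<And>n. 0 \<le> A n"
    and decay: "\<And>M. \<exists>C. \<forall>n. A n * bracket (h *\<^sub>R lattice_point n) ^ M \<le> C"
  shows "(\<integral>\<^sup>+n. ennreal (A n * bracket (h *\<^sub>R lattice_point n) ^ M) \<partial>count_space UNIV) < \<infinity>"
proof -
  let ?p = "2 * CARD('m)"
  let ?w = "\<lambda>n::int^'m. \<Prod>i\<in>UNIV. 1 / (1 + (real_of_int (n $ i))\<^sup>2)"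
  \<comment> \<open>This constant compares the bracket of \<open>n\<close> with that of
    \<open>h n\<close>; the maximum covers both \<open>h \<ge> 1\<close> and
    \<open>h < 1\<close>.\<close>
  define k where "k = max 1 (1 / h)"
  have k: "0 < k" by (simp add: k_def)
  have br: "bracket (lattice_point n) \<le> k * bracket (h *\<^sub>R lattice_point n)" for n :: "int^'m"
  proof (rule power2_le_imp_le)
    have "1 / h * h \<le> k * h" by (rule mult_right_mono) (use h in \<open>auto simp: k_def\<close>)
    then have "1 \<le> (k * h)\<^sup>2" using h by (intro one_le_power) simp
    moreover have "1 \<le> k\<^sup>2" by (intro one_le_power) (simp add: k_def)
    ultimately have "1 \<le> k\<^sup>2" "1 \<le> k\<^sup>2 * h\<^sup>2" by (simp_all add: power_mult_distrib)
    then show "(bracket (lattice_point n))\<^sup>2 \<le> (k * bracket (h *\<^sub>R lattice_point n))\<^sup>2"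
      using mult_right_mono[of 1 "k\<^sup>2 * h\<^sup>2" "(norm (lattice_point n))\<^sup>2"]
      by (simp add: power_mult_distrib bracket_sq distrib_left mult.assoc)
  qed (use k in simp)
  obtain C where C: "\<And>n. A n * bracket (h *\<^sub>R lattice_point n) ^ (M + ?p) \<le> C"
    using decay by blast
  obtain D where D: "\<And>F :: (int^'m) set. finite F \<Longrightarrow> (\<Sum>n\<in>F. ?w n) \<le> D"
    using lattice_sum_bound by blast
  have w0: "0 \<le> ?w n" for n by (rule prod_nonneg) simp
  have bd: "A n * bracket (h *\<^sub>R lattice_point n) ^ M \<le> (max C 0 * k ^ ?p) * ?w n" for n
  proof -
    let ?b = "bracket (h *\<^sub>R lattice_point n)"
    let ?P = "\<Prod>i\<in>UNIV. 1 + (real_of_int (n $ i))\<^sup>2"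
    have P: "0 < ?P" by (rule prod_pos) (simp add: add_pos_nonneg)
    have "?P \<le> bracket (lattice_point n) ^ ?p" by (rule lattice_prod_le_bracket)
    also have "\<dots> \<le> (k * ?b) ^ ?p" by (rule power_mono[OF br]) simp
    finally have "(A n * ?b ^ M) * ?P \<le> (A n * ?b ^ M) * (k * ?b) ^ ?p"
      by (rule mult_left_mono) (use A in simp)
    also have "\<dots> = A n * ?b ^ (M + ?p) * k ^ ?p"
      by (simp add: power_add power_mult_distrib)
    also have "\<dots> \<le> max C 0 * k ^ ?p"
      by (rule mult_right_mono) (use C[of n] k in auto)
    finally have "A n * ?b ^ M \<le> max C 0 * k ^ ?p / ?P" using P by (simp add: field_simps)
    also have "\<dots> = (max C 0 * k ^ ?p) * ?w n" by (simp add: prod_dividef)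
    finally show ?thesis .
  qed
  have "?w summable_on UNIV"
    by (rule nonneg_bdd_above_summable_on) (use w0 D in \<open>auto simp: bdd_above_def\<close>)
  then have "Infinite_Sum.abs_summable_on ?w UNIV" using w0 by simp
  then have "integrable (count_space UNIV) ?w"
    using abs_summable_equivalent unfolding Infinite_Set_Sum.abs_summable_on_def by blast
  then have "integrable (count_space UNIV) (\<lambda>n. (max C 0 * k ^ ?p) * ?w n)" by simp
  then have "(\<integral>\<^sup>+n. ennreal (norm ((max C 0 * k ^ ?p) * ?w n)) \<partial>count_space UNIV) < \<infinity>"
    unfolding integrable_iff_bounded by blast
  moreover have "(\<integral>\<^sup>+n. ennreal (A n * bracket (h *\<^sub>R lattice_point n) ^ M) \<partial>count_space UNIV)
      \<le> (\<integral>\<^sup>+n. ennreal (norm ((max C 0 * k ^ ?p) * ?w n)) \<partial>count_space UNIV)"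
    by (intro nn_integral_mono ennreal_leI) (use bd in \<open>simp add: order.trans[OF _ abs_ge_self]\<close>)
  ultimately show ?thesis by (rule le_less_trans[rotated])
qed

section \<open>The de la Vallee Poussin kernel\<close>

definition cos_kernel :: "nat \<Rightarrow> real^'m::finite \<Rightarrow> real" where
  "cos_kernel N y = (\<Prod>i\<in>UNIV. ((1 + cos (y $ i)) / 2) ^ N)"

text \<open>Since \<open>(1 + cos t) / 2 = cos (t/2) ^ 2\<close>, multiplication by this ratio gives
  \<open>(2 cos (t/2)) ^ (2N)\<close> over the central binomial coefficient, a trigonometric
  polynomial with constant coefficient \<open>1\<close>. The size of the ratio matters twice: from
  below for the mass of the kernel, from above against geometric decay.\<close>

definition central_ratio :: "nat \<Rightarrow> real" where
  "central_ratio N = 4 ^ N / real (2 * N choose N)"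

lemma central_ratio_pos: "0 < central_ratio N"
  by (simp add: central_ratio_def)

lemma central_binomial_Suc:
  "(real N + 1) * real (2 * Suc N choose Suc N) = 2 * (2 * real N + 1) * real (2 * N choose N)"
proof -
  have "Suc N * (Suc (Suc (2 * N)) choose Suc N) = Suc (Suc (2 * N)) * (Suc (2 * N) choose N)"
    by (rule Suc_times_binomial)
  then have "Suc N * (Suc (Suc (2 * N)) choose Suc N) = Suc N * (2 * (Suc (2 * N) choose N))" by simp
  then have 1: "(Suc (Suc (2 * N)) choose Suc N) = 2 * (Suc (2 * N) choose N)"
    by (simp only: mult_cancel1) simp
  have 2: "(Suc (2 * N) choose N) = (Suc (2 * N) choose Suc N)"
    using binomial_symmetric[of N "Suc (2 * N)"] by simp
  have "Suc N * (Suc (2 * N) choose Suc N) = Suc (2 * N) * (2 * N choose N)"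
    by (rule Suc_times_binomial)
  then have "Suc N * (Suc (2 * N) choose N) = Suc (2 * N) * (2 * N choose N)" by (simp only: 2)
  then have "real (Suc N * (Suc (2 * N) choose N)) = real (Suc (2 * N) * (2 * N choose N))"
    by (rule arg_cong)
  moreover have "2 * Suc N = Suc (Suc (2 * N))" by simp
  ultimately show ?thesis by (simp only: 1 of_nat_mult of_nat_Suc) (simp add: distrib_right distrib_left)
qed

text \<open>By induction, the square of the central binomial coefficient times \<open>2N + 1\<close>
  is at most \<open>16^N\<close>; the step amounts to
  \<open>(2N + 1)(2N + 3) \<le> 4 (N + 1)^2\<close>. The order \<open>sqrt N\<close> is the one that
  cancels the shrinking side of the cube on which the kernel is large.\<close>

lemma central_ratio_lower: "sqrt (real N) \<le> central_ratio N"
proof -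
  have *: "(real (2 * N choose N))\<^sup>2 * (2 * real N + 1) \<le> 16 ^ N"
  proof (induction N)
    case (Suc N)
    let ?c = "real (2 * N choose N)" and ?c' = "real (2 * Suc N choose Suc N)" and ?n = "real N"
    have eq: "(?n + 1) * ?c' = 2 * (2 * ?n + 1) * ?c" by (rule central_binomial_Suc)
    have "(?n + 1)\<^sup>2 * (?c'\<^sup>2 * (2 * real (Suc N) + 1)) = ((?n + 1) * ?c')\<^sup>2 * (2 * ?n + 3)"
      by (simp add: power_mult_distrib)
    also have "\<dots> = 4 * (?c\<^sup>2 * (2 * ?n + 1)) * ((2 * ?n + 1) * (2 * ?n + 3))"
      unfolding eq by (simp add: power_mult_distrib power2_eq_square) (simp add: algebra_simps)
    also have "\<dots> \<le> 4 * 16 ^ N * (4 * (?n + 1)\<^sup>2)"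
    proof (rule mult_mono)
      show "(2 * ?n + 1) * (2 * ?n + 3) \<le> 4 * (?n + 1)\<^sup>2" by (simp add: power2_eq_square algebra_simps)
    qed (use Suc.IH in auto)
    also have "\<dots> = (?n + 1)\<^sup>2 * 16 ^ Suc N" by simp
    finally show ?case by (simp add: mult_le_cancel_left)
  qed simp
  have c: "0 < real (2 * N choose N)" by simp
  have "real N \<le> (central_ratio N)\<^sup>2"
  proof -
    have "(real (2 * N choose N))\<^sup>2 * real N \<le> (real (2 * N choose N))\<^sup>2 * (2 * real N + 1)"
      by (intro mult_left_mono) auto
    also note *
    also have "(16::real) ^ N = (4 ^ N)\<^sup>2"
      unfolding power_mult[symmetric] mult.commute[of N] by (simp add: power_mult)
    finally show ?thesis using c by (simp add: central_ratio_def power_divide field_simps)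
  qed
  then show ?thesis by (rule real_le_lsqrt[rotated -1]) (use central_ratio_pos[of N] in auto)
qed

lemma central_ratio_upper: "0 < N \<Longrightarrow> central_ratio N \<le> 2 * real N"
  using central_binomial_lower_bound[of N] by (simp add: central_ratio_def field_simps)

text \<open>The quantity \<open>(1 + cos t) / 2\<close> is the square of the mean of
  \<open>exp (-i t/2)\<close> and \<open>exp (i t/2)\<close>, and the binomial theorem applies to
  the power \<open>2N\<close>.\<close>

lemma cos_power_expansion:
  "complex_of_real (central_ratio N * ((1 + cos t) / 2) ^ N) =
    (\<Sum>k\<le>2 * N. of_real (real (2 * N choose k) / real (2 * N choose N)) * exp (- \<i> * of_real ((real k - real N) * t)))"
proof -
  let ?a = "exp (- \<i> * of_real (t / 2))" and ?b = "exp (\<i> * of_real (t / 2))"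
  have "?a + ?b = 2 * of_real (cos (t / 2))"
    by (simp add: exp_Euler cos_of_real sin_of_real flip: cis_conv_exp) (simp add: complex_eq_iff exp_minus cis_conv_exp[symmetric] exp_Euler Re_exp Im_exp)
  then have sq: "(?a + ?b) ^ 2 = of_real (4 * ((1 + cos t) / 2))"
    using cos_double_cos[of "t / 2"] by (simp add: power_mult_distrib flip: of_real_power)
  have "of_real (4 ^ N * ((1 + cos t) / 2) ^ N) = ((?a + ?b) ^ 2) ^ N"
    unfolding sq by (simp only: power_mult_distrib of_real_power[symmetric])
  also have "\<dots> = (?a + ?b) ^ (2 * N)" by (simp add: power_mult)
  also have "\<dots> = (\<Sum>k\<le>2 * N. of_nat (2 * N choose k) * ?a ^ k * ?b ^ (2 * N - k))"
    by (rule binomial_ring)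
  also have "\<dots> = (\<Sum>k\<le>2 * N. of_nat (2 * N choose k) * exp (- \<i> * of_real ((real k - real N) * t)))"
  proof (rule sum.cong)
    fix k assume k: "k \<in> {..2 * N}"
    have "?a ^ k * ?b ^ (2 * N - k) = exp (of_nat k * (- \<i> * of_real (t / 2)) + of_nat (2 * N - k) * (\<i> * of_real (t / 2)))"
      by (simp only: exp_add exp_of_nat_mult)
    also have "of_nat k * (- \<i> * of_real (t / 2)) + of_nat (2 * N - k) * (\<i> * of_real (t / 2)) =
        - \<i> * of_real ((real k - real N) * t)"
      using k by (simp add: of_nat_diff algebra_simps)
    finally show "of_nat (2 * N choose k) * ?a ^ k * ?b ^ (2 * N - k) =
        of_nat (2 * N choose k) * exp (- \<i> * of_real ((real k - real N) * t))" by simp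
  qed simp
  finally have "of_real (4 ^ N * ((1 + cos t) / 2) ^ N) / of_real (real (2 * N choose N)) =
      (\<Sum>k\<le>2 * N. of_nat (2 * N choose k) * exp (- \<i> * of_real ((real k - real N) * t))) / of_real (real (2 * N choose N))"
    by simp
  then show ?thesis by (simp add: central_ratio_def sum_divide_distrib)
qed

text \<open>Multiplying out the one-dimensional expansions gives one frequency per lattice point of
  a cube. The coefficients are products of binomial coefficients divided by the central, largest
  one, so they stay between \<open>0\<close> and \<open>1\<close> for every \<open>N\<close>. This
  is what later makes the dominating sequence independent of the accuracy.\<close>

lemma cos_kernel_expansion:
  obtains F :: "(int^'m::finite) set" and q where "finite F" "\<And>n. 0 \<le> q n" "\<And>n. q n \<le> (1::real)"
    "\<And>y. complex_of_real (central_ratio N ^ CARD('m) * cos_kernel N y) =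
      (\<Sum>n\<in>F. of_real (q n) * wave (lattice_point n) y)"
proof -
  let ?r = "\<lambda>k. real (2 * N choose k) / real (2 * N choose N)"
  let ?G = "PiE (UNIV :: 'm set) (\<lambda>_. {..2 * N})"
  let ?v = "\<lambda>g. (\<chi> i. int (g i) - int N) :: int^'m"
  have inj: "inj_on ?v ?G" by (auto simp: inj_on_def vec_eq_iff fun_eq_iff)
  define q where "q n = (\<Prod>i\<in>UNIV. ?r (nat (n $ i + int N)))" for n :: "int^'m"
  have r: "0 \<le> ?r k" "?r k \<le> 1" for k
    using binomial_maximum'[of N k] by (auto simp: divide_le_eq)
  show ?thesis
  proof (rule that[of "?v ` ?G" q])
    show "finite (?v ` ?G)" by (intro finite_imageI finite_PiE) auto
    show "0 \<le> q n" for n unfolding q_def by (rule prod_nonneg) (use r in auto)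
    show "q n \<le> 1" for n unfolding q_def by (rule prod_le_1) (use r in auto)
    fix y :: "real^'m"
    have "complex_of_real (central_ratio N ^ CARD('m) * cos_kernel N y) =
        (\<Prod>i\<in>UNIV. complex_of_real (central_ratio N * ((1 + cos (y $ i)) / 2) ^ N))"
      unfolding cos_kernel_def by (simp add: prod.distrib)
    also have "\<dots> = (\<Prod>i\<in>UNIV. \<Sum>k\<le>2 * N. of_real (?r k) * exp (- \<i> * of_real ((real k - real N) * y $ i)))"
      unfolding cos_power_expansion ..
    also have "\<dots> = (\<Sum>g\<in>?G. \<Prod>i\<in>UNIV. of_real (?r (g i)) * exp (- \<i> * of_real ((real (g i) - real N) * y $ i)))"
      by (rule prod_sum_PiE) auto
    also have "\<dots> = (\<Sum>g\<in>?G. of_real (q (?v g)) * wave (lattice_point (?v g)) y)"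
    proof (rule sum.cong)
      fix g assume "g \<in> ?G"
      have qg: "q (?v g) = (\<Prod>i\<in>UNIV. ?r (g i))" by (simp add: q_def)
      have "wave (lattice_point (?v g)) y = exp (\<Sum>i\<in>UNIV. - \<i> * of_real ((real (g i) - real N) * y $ i))"
        unfolding wave_def inner_vec_def lattice_point_def
        by (simp add: sum_distrib_left mult_ac)
      also have "\<dots> = (\<Prod>i\<in>UNIV. exp (- \<i> * of_real ((real (g i) - real N) * y $ i)))"
        by (rule exp_sum) simp
      finally show "(\<Prod>i\<in>UNIV. of_real (?r (g i)) * exp (- \<i> * of_real ((real (g i) - real N) * y $ i))) =
          of_real (q (?v g)) * wave (lattice_point (?v g)) y"
        by (simp only: qg prod.distrib of_real_prod)
    qed simp
    also have "\<dots> = (\<Sum>n\<in>?v ` ?G. of_real (q n) * wave (lattice_point n) y)"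
      by (simp add: sum.reindex[OF inj])
    finally show "complex_of_real (central_ratio N ^ CARD('m) * cos_kernel N y) =
        (\<Sum>n\<in>?v ` ?G. of_real (q n) * wave (lattice_point n) y)" .
  qed
qed

lemma cos_half_bounds:
  fixes t :: real
  shows "0 \<le> (1 + cos t) / 2" "(1 + cos t) / 2 \<le> 1"
proof -
  have "- 1 \<le> cos t" by (rule cos_ge_minus_one)
  then have "0 \<le> 1 + cos t" using add_left_mono[of "- 1" "cos t" 1] by simp
  then show "0 \<le> (1 + cos t) / 2" by simp
  show "(1 + cos t) / 2 \<le> 1" using add_left_mono[OF cos_le_one[of t], of 1] by simp
qed

lemma cos_kernel_nonneg: "0 \<le> cos_kernel N y"
  unfolding cos_kernel_def
  by (intro prod_nonneg zero_le_power ballI cos_half_bounds)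

lemma cos_kernel_power: "cos_kernel N y = cos_kernel 1 y ^ N"
  unfolding cos_kernel_def by (simp add: prod_power_distrib)

lemma continuous_on_cos_kernel [continuous_intros]:
  fixes f :: "'a::t2_space \<Rightarrow> real^'m::finite"
  assumes "continuous_on S f" shows "continuous_on S (\<lambda>x. cos_kernel N (f x))"
proof -
  have "continuous_on S (\<lambda>x. cos (f x $ i))" for i
    by (rule continuous_on_cos[OF bounded_linear.continuous_on[OF bounded_linear_vec_nth assms]])
  then show ?thesis
    unfolding cos_kernel_def by (intro continuous_on_prod continuous_on_power continuous_on_divide
      continuous_on_add continuous_on_const) auto
qed

lemma cos_kernel_less_1:
  fixes y :: "real^'m::finite"
  assumes "y \<noteq> 0" "\<And>i. \<bar>y $ i\<bar> \<le> 2"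
  shows "cos_kernel 1 y < 1"
proof -
  obtain j where j: "y $ j \<noteq> 0" using assms(1) by (auto simp: vec_eq_iff)
  note c = cos_half_bounds
  have "\<bar>y $ j\<bar> < pi" using assms(2)[of j] pi_gt3 by linarith
  then have "cos \<bar>y $ j\<bar> < cos 0" using j by (intro cos_monotone_0_pi) auto
  then have lt: "(1 + cos (y $ j)) / 2 < 1" by (simp add: abs_if split: if_splits)
  have "cos_kernel 1 y = (1 + cos (y $ j)) / 2 * (\<Prod>i\<in>UNIV - {j}. (1 + cos (y $ i)) / 2)"
    unfolding cos_kernel_def by (simp add: prod.remove[of UNIV j])
  also have "\<dots> \<le> (1 + cos (y $ j)) / 2 * 1"
    by (intro mult_left_mono c prod_le_1) (use c in auto)
  finally show ?thesis using lt by simp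
qed

text \<open>In each coordinate \<open>(1 + cos t) / 2 = 1 - sin (t/2)^2 \<ge> 1 - 1/(4N)\<close>,
  and Bernoulli's inequality bounds the \<open>N\<close>-th power from below by
  \<open>3/4\<close>.\<close>

lemma cos_kernel_lower:
  fixes y :: "real^'m::finite"
  assumes N: "0 < N" and y: "\<And>i. \<bar>y $ i\<bar> \<le> 1 / sqrt (real N)"
  shows "(3 / 4) ^ CARD('m) \<le> cos_kernel N y"
proof -
  have "3 / 4 \<le> ((1 + cos (y $ i)) / 2) ^ N" for i
  proof -
    let ?t = "y $ i"
    have "\<bar>?t\<bar>\<^sup>2 \<le> (1 / sqrt (real N))\<^sup>2" by (rule power_mono[OF y]) simp
    then have t: "?t\<^sup>2 \<le> 1 / real N" by (simp add: power_divide)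
    have "(sin (?t / 2))\<^sup>2 \<le> (?t / 2)\<^sup>2"
      using abs_sin_x_le_abs_x[of "?t / 2"] by (rule abs_le_square_iff[THEN iffD1])
    then have c: "1 - 1 / (4 * real N) \<le> (1 + cos ?t) / 2"
      using cos_double_sin[of "?t / 2"] t by (simp add: power_divide)
    have "3 / 4 = 1 + real N * (- (1 / (4 * real N)))" using N by simp
    also have "\<dots> \<le> (1 + - (1 / (4 * real N))) ^ N"
    proof (rule Bernoulli_inequality)
      have "1 / (4 * real N) \<le> 1" using N by (simp add: field_simps)
      then show "- 1 \<le> - (1 / (4 * real N))" by linarith
    qed
    also have "\<dots> \<le> ((1 + cos ?t) / 2) ^ N"
    proof (rule power_mono)
      show "0 \<le> 1 + - (1 / (4 * real N))" using N by (simp add: field_simps)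
    qed (use c in simp)
    finally show ?thesis .
  qed
  then have "(\<Prod>i\<in>(UNIV :: 'm set). 3 / 4 :: real) \<le> cos_kernel N y"
    unfolding cos_kernel_def by (intro prod_mono) auto
  then show ?thesis by simp
qed

text \<open>Writing \<open>q = p^m\<close> reduces the claim to the convergence of
  \<open>N p^N\<close> to \<open>0\<close>, of which the \<open>m\<close>-th power is taken.\<close>

lemma power_times_geometric_tendsto_0: "0 \<le> q \<Longrightarrow> q < 1 \<Longrightarrow> (\<lambda>N. (2 * real N) ^ m * q ^ N) \<longlonglongrightarrow> 0"
proof (cases "m = 0")
  case True
  assume "0 \<le> q" "q < 1"
  then show ?thesis using True LIMSEQ_realpow_zero[of q] by simp
next
  case False
  assume q: "0 \<le> q" "q < 1"
  define p where "p = root m q"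
  have p: "0 \<le> p" "p < 1" "p ^ m = q"
    using q False by (auto simp: p_def real_root_lt_1_iff)
  have lim: "(\<lambda>N. (2 * (of_nat N * p ^ N)) ^ m) \<longlonglongrightarrow> (2 * 0) ^ m"
    using p by (intro tendsto_power tendsto_mult tendsto_const powser_times_n_limit_0) auto
  have "(2 * (of_nat N * p ^ N)) ^ m = (2 * real N) ^ m * q ^ N" for N
  proof -
    have "(p ^ N) ^ m = q ^ N" unfolding p(3)[symmetric] power_mult[symmetric] mult.commute[of N] ..
    then show ?thesis by (simp add: power_mult_distrib)
  qed
  then have eq: "(\<lambda>N. (2 * (of_nat N * p ^ N)) ^ m) = (\<lambda>N. (2 * real N) ^ m * q ^ N)" by (rule ext)
  have "(2 * 0 :: real) ^ m = 0" using False by simp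
  then show ?thesis using lim unfolding eq by (simp only:)
qed

text \<open>The kernel concentrates at the origin; since \<open>\<bar>h z\<^sub>i\<bar> \<le> 2 < \<pi>\<close> on the cube, no periodicity
  enters.\<close>

lemma cos_kernel_concentration:
  fixes R :: real and B :: "(real^'m::finite) set"
  defines "B \<equiv> cbox (\<chi> i. - 2 * R) (\<chi> i. 2 * R)"
  assumes R: "0 < R" and \<delta>: "0 < \<delta>"
  obtains q where "0 \<le> q" "q < 1"
    "\<And>N z. z \<in> B \<Longrightarrow> \<delta> \<le> norm z \<Longrightarrow> cos_kernel N ((1 / R) *\<^sub>R z) \<le> q ^ N"
proof -
  let ?D = "B - ball 0 \<delta>"
  let ?k = "\<lambda>z :: real^'m. cos_kernel 1 ((1 / R) *\<^sub>R z)"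
  have D: "compact ?D" unfolding B_def by (intro compact_diff compact_cbox open_ball)
  have lt: "?k z < 1" if "z \<in> ?D" for z
  proof (rule cos_kernel_less_1)
    show "(1 / R) *\<^sub>R z \<noteq> 0" using that R \<delta> by auto
    fix i
    have "\<bar>z $ i\<bar> \<le> 2 * R" using that by (auto simp: B_def mem_box_cart abs_le_iff) (metis minus_le_iff)
    then show "\<bar>((1 / R) *\<^sub>R z) $ i\<bar> \<le> 2" using R by (simp add: field_simps)
  qed
  show ?thesis
  proof (cases "?D = {}")
    case True
    have "z \<notin> B" if "\<delta> \<le> norm z" for z using True that by auto
    then show ?thesis using that[of 0] by auto
  next
    case False
    have "continuous_on ?D ?k" by (intro continuous_intros)
    then obtain z0 where z0: "z0 \<in> ?D" "\<And>z. z \<in> ?D \<Longrightarrow> ?k z \<le> ?k z0"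
      using continuous_attains_sup[OF D False] by blast
    show ?thesis
    proof (rule that[of "?k z0"])
      show "0 \<le> ?k z0" by (rule cos_kernel_nonneg)
      show "?k z0 < 1" by (rule lt[OF z0(1)])
      fix N z assume "z \<in> B" "\<delta> \<le> norm z"
      then have "?k z \<le> ?k z0" by (intro z0) auto
      then have "?k z ^ N \<le> ?k z0 ^ N" by (rule power_mono) (rule cos_kernel_nonneg)
      then show "cos_kernel N ((1 / R) *\<^sub>R z) \<le> ?k z0 ^ N" by (subst cos_kernel_power)
    qed
  qed
qed

text \<open>On the cube of side \<open>2R / sqrt N\<close> the kernel is at least
  \<open>(3/4)^m\<close>, where \<open>m\<close> is the dimension. The factor
  \<open>central_ratio N \<ge> sqrt N\<close> per coordinate compensates for the volume and leaves
  \<open>(3/4) (2R) = 3R/2\<close> per coordinate. The normalised mass is thus bounded below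
  independently of \<open>N\<close>.\<close>

lemma cos_kernel_mass_lower:
  fixes R :: real and B :: "(real^'m::finite) set"
  defines "B \<equiv> cbox (\<chi> i. - 2 * R) (\<chi> i. 2 * R)"
  assumes R: "0 < R" and N: "0 < N"
  shows "(3 * R / 2) ^ CARD('m) \<le>
    central_ratio N ^ CARD('m) * (LINT z|lborel. indicator B z * cos_kernel N ((1 / R) *\<^sub>R z))"
proof -
  let ?r = "R / sqrt (real N)"
  let ?D = "cbox (\<chi> i. - ?r) (\<chi> i. ?r) :: (real^'m) set"
  have sN: "1 \<le> sqrt (real N)" "0 < sqrt (real N)" using N by auto
  have "?r \<le> R / 1" by (rule divide_left_mono) (use R sN in auto)
  then have r: "0 < ?r" "?r \<le> 2 * R" using R sN by auto
  have int: "integrable lborel (\<lambda>z. indicator B z * cos_kernel N ((1 / R) *\<^sub>R z))"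
    using borel_integrable_compact[of B "\<lambda>z. cos_kernel N ((1 / R) *\<^sub>R z)"]
    by (simp add: B_def continuous_intros)
  have "(3 / 4) ^ CARD('m) * (2 * ?r) ^ CARD('m) = (LINT z|lborel. indicator ?D z * (3 / 4) ^ CARD('m))"
  proof -
    have "measure lborel ?D = (2 * ?r) ^ CARD('m)"
      using content_cbox_cart[of "(\<chi> i. - ?r) :: real^'m" "(\<chi> i. ?r) :: real^'m"] r by (simp add: interval_ne_empty_cart)
    then show ?thesis by simp
  qed
  also have "\<dots> \<le> (LINT z|lborel. indicator B z * cos_kernel N ((1 / R) *\<^sub>R z))"
  proof (rule integral_mono[OF _ int])
    show "integrable lborel (\<lambda>z. indicator ?D z * (3 / 4) ^ CARD('m) :: real)"
      using borel_integrable_compact[of ?D "\<lambda>_. (3 / 4) ^ CARD('m) :: real"] by simp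
    fix z :: "real^'m"
    show "indicator ?D z * (3 / 4) ^ CARD('m) \<le> indicator B z * cos_kernel N ((1 / R) *\<^sub>R z)"
    proof (cases "z \<in> ?D")
      case True
      then have zi: "\<bar>z $ i\<bar> \<le> ?r" for i by (auto simp: mem_box_cart abs_le_iff) (metis minus_le_iff)
      have "z $ i \<le> 2 * R" "- (z $ i) \<le> 2 * R" for i using zi[of i] r by linarith+
      then have "z \<in> B" unfolding B_def mem_box_cart by (auto simp: minus_le_iff)
      moreover have "(3 / 4) ^ CARD('m) \<le> cos_kernel N ((1 / R) *\<^sub>R z)"
        by (rule cos_kernel_lower[OF N]) (use zi R in \<open>simp add: field_simps\<close>)
      ultimately show ?thesis using True by simp
    qed (simp add: cos_kernel_nonneg)
  qed
  finally have le: "(3 / 4) ^ CARD('m) * (2 * ?r) ^ CARD('m) \<le>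
    (LINT z|lborel. indicator B z * cos_kernel N ((1 / R) *\<^sub>R z))" .
  have "(3 * R / 2) ^ CARD('m) = sqrt (real N) ^ CARD('m) * ((3 / 4) ^ CARD('m) * (2 * ?r) ^ CARD('m))"
    using sN by (simp flip: power_mult_distrib)
  also have "\<dots> \<le> central_ratio N ^ CARD('m) * (LINT z|lborel. indicator B z * cos_kernel N ((1 / R) *\<^sub>R z))"
    by (intro mult_mono power_mono central_ratio_lower le) (use r central_ratio_pos[of N] in auto)
  finally show ?thesis .
qed

lemma test_functions_shift_uniform:
  fixes \<phi> :: "real^'m::finite \<Rightarrow> complex"
  assumes \<phi>: "\<phi> \<in> test_functions U" and S: "compact S" and e: "0 < e"
  obtains \<delta> where "0 < \<delta>" "\<And>x z. x \<in> S \<Longrightarrow> norm z < \<delta> \<Longrightarrow> cmod (\<phi> (x - z) - \<phi> x) \<le> e"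
proof -
  let ?T = "{x + y |x y. x \<in> S \<and> y \<in> cball 0 (1::real)}"
  have T: "compact ?T" by (rule compact_sums[OF S compact_cball])
  have "uniformly_continuous_on ?T \<phi>"
    by (rule compact_uniformly_continuous[OF continuous_on_subset[OF
          smooth_on_imp_continuous_on[OF test_functionsD(1)[OF \<phi>]]] T]) simp
  then obtain d where d: "0 < d" "\<forall>x\<in>?T. \<forall>x'\<in>?T. dist x' x < d \<longrightarrow> dist (\<phi> x') (\<phi> x) < e"
    using e unfolding uniformly_continuous_on_def by blast
  show ?thesis
  proof (rule that[of "min d 1"])
    show "0 < min d 1" using d by simp
    fix x z :: "real^'m" assume x: "x \<in> S" "norm z < min d 1"
    have "x + 0 \<in> ?T" using x by (intro CollectI exI conjI refl) auto
    moreover have "x + (- z) \<in> ?T" using x by (intro CollectI exI conjI refl) auto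
    ultimately have "dist (\<phi> (x + (- z))) (\<phi> (x + 0)) < e"
      by (rule d(2)[rule_format]) (use x in \<open>simp add: dist_norm\<close>)
    then show "cmod (\<phi> (x - z) - \<phi> x) \<le> e" by (simp add: dist_norm)
  qed
qed

text \<open>The error is measured relative to the mass \<open>I N\<close>. Near the origin uniform
  continuity of \<open>\<phi>\<close> contributes at most \<open>\<epsilon>/2\<close> times the
  mass; away from it the kernel is geometrically small, while the mass decreases at most like a
  power of \<open>N\<close>.\<close>

lemma cos_kernel_approximation:
  fixes \<phi> :: "real^'m::finite \<Rightarrow> complex" and R :: real and B :: "(real^'m) set"
  defines "B \<equiv> cbox (\<chi> i. - 2 * R) (\<chi> i. 2 * R)"
  defines "I \<equiv> \<lambda>N. LINT z|lborel. indicator B z * cos_kernel N ((1 / R) *\<^sub>R z)"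
  assumes R: "0 < R" and \<phi>: "\<phi> \<in> test_functions U" and S: "compact S" and \<epsilon>: "0 < \<epsilon>"
  shows "\<forall>\<^sub>F N in sequentially. \<forall>x\<in>S.
    cmod ((LINT z|lborel. of_real (indicator B z * cos_kernel N ((1 / R) *\<^sub>R z)) * \<phi> (x - z)) - of_real (I N) * \<phi> x)
      \<le> \<epsilon> * I N"
proof -
  let ?k = "\<lambda>N z. indicator B z * cos_kernel N ((1 / R) *\<^sub>R z)"
  let ?m = "CARD('m)"
  obtain \<delta> where \<delta>: "0 < \<delta>" "\<And>x z. x \<in> S \<Longrightarrow> norm z < \<delta> \<Longrightarrow> cmod (\<phi> (x - z) - \<phi> x) \<le> \<epsilon> / 2"
    using test_functions_shift_uniform[OF \<phi> S, of "\<epsilon> / 2"] \<epsilon> by auto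
  obtain Bd where Bd: "0 \<le> Bd" "\<And>x. cmod (\<phi> x) \<le> Bd" using test_functions_bounded[OF \<phi>] by blast
  obtain q where q: "0 \<le> q" "q < 1" "\<And>N z. z \<in> B \<Longrightarrow> \<delta> \<le> norm z \<Longrightarrow> cos_kernel N ((1 / R) *\<^sub>R z) \<le> q ^ N"
    using cos_kernel_concentration[OF R \<delta>(1)] unfolding B_def by blast
  define c where "c = 2 * Bd * measure lborel B"
  define c0 where "c0 = (3 * R / 2) ^ ?m"
  have c0: "0 < c0" using R by (simp add: c0_def)
  have cB: "compact B" by (simp add: B_def)
  have int: "integrable lborel (?k N)" for N
    using borel_integrable_compact[OF cB, of "\<lambda>z. cos_kernel N ((1 / R) *\<^sub>R z)"] by (simp add: continuous_intros)
  have intB: "integrable lborel (\<lambda>z. indicator B z * a :: real)" for a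
    using borel_integrable_compact[OF cB, of "\<lambda>_. a"] by simp
  have kn: "0 \<le> ?k N z" for N z by (simp add: cos_kernel_nonneg)
  have "(\<lambda>N. c / c0 * ((2 * real N) ^ ?m * q ^ N)) \<longlonglongrightarrow> c / c0 * 0"
    by (intro tendsto_mult tendsto_const power_times_geometric_tendsto_0 q)
  then have "\<forall>\<^sub>F N in sequentially. c / c0 * ((2 * real N) ^ ?m * q ^ N) < \<epsilon> / 2"
    using \<epsilon> by (intro order_tendstoD(2)) auto
  then show ?thesis
    using eventually_gt_at_top[of 0]
  proof eventually_elim
    case (elim N)
    have IN: "c0 \<le> central_ratio N ^ ?m * I N"
      using cos_kernel_mass_lower[OF R elim(2), where 'm = 'm] unfolding c0_def I_def B_def .
    have I0: "0 \<le> I N" unfolding I_def by (rule integral_nonneg_AE) (use kn in auto)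
    have "c0 \<le> (2 * real N) ^ ?m * I N"
      using IN mult_right_mono[OF power_mono[OF central_ratio_upper[OF elim(2)]] I0, of ?m] central_ratio_pos[of N]
      by (meson order.trans less_imp_le)
    then have "c * q ^ N \<le> c / c0 * ((2 * real N) ^ ?m * q ^ N) * I N"
    proof -
      assume a: "c0 \<le> (2 * real N) ^ ?m * I N"
      have "c * q ^ N = c / c0 * q ^ N * c0" using c0 by simp
      also have "\<dots> \<le> c / c0 * q ^ N * ((2 * real N) ^ ?m * I N)"
        by (rule mult_left_mono[OF a]) (use c0 q Bd in \<open>auto simp: c_def\<close>)
      finally show ?thesis by (simp add: mult_ac)
    qed
    also have "\<dots> \<le> \<epsilon> / 2 * I N" by (rule mult_right_mono) (use elim I0 in auto)
    finally have tail: "c * q ^ N \<le> \<epsilon> / 2 * I N" .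
    show ?case
    proof
      fix x assume x: "x \<in> S"
      have cont: "continuous_on UNIV \<phi>" by (rule smooth_on_imp_continuous_on[OF test_functionsD(1)[OF \<phi>]])
      have int1: "integrable lborel (\<lambda>z. of_real (?k N z) * \<phi> (x - z))"
      proof -
        have "continuous_on B (\<lambda>z. of_real (cos_kernel N ((1 / R) *\<^sub>R z)) * \<phi> (x - z))"
          by (intro continuous_intros continuous_on_compose2[OF cont]) auto
        from borel_integrable_compact[OF cB this] show ?thesis
          by (simp add: scaleR_conv_of_real mult.assoc)
      qed
      have int2: "integrable lborel (\<lambda>z. of_real (?k N z) * \<phi> x)"
        by (intro integrable_mult_left integrable_of_real int)
      have "of_real (I N) * \<phi> x = (LINT z|lborel. of_real (?k N z) * \<phi> x)"
        by (simp only: integral_mult_left_zero integral_complex_of_real I_def)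
      then have "(LINT z|lborel. of_real (?k N z) * \<phi> (x - z)) - of_real (I N) * \<phi> x =
          (LINT z|lborel. of_real (?k N z) * \<phi> (x - z) - of_real (?k N z) * \<phi> x)"
        by (simp only: Bochner_Integration.integral_diff[OF int1 int2])
      also have "cmod \<dots> \<le> (LINT z|lborel. \<epsilon> / 2 * ?k N z + indicator B z * (2 * Bd * q ^ N))"
      proof (rule order.trans[OF integral_norm_bound integral_mono])
        show "integrable lborel (\<lambda>z. cmod (of_real (?k N z) * \<phi> (x - z) - of_real (?k N z) * \<phi> x))"
          by (intro integrable_norm Bochner_Integration.integrable_diff int1 int2)
        show "integrable lborel (\<lambda>z. \<epsilon> / 2 * ?k N z + indicator B z * (2 * Bd * q ^ N))"
          by (intro Bochner_Integration.integrable_add integrable_mult_right int intB)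
        fix z
        have eq: "cmod (of_real (?k N z) * \<phi> (x - z) - of_real (?k N z) * \<phi> x) = ?k N z * cmod (\<phi> (x - z) - \<phi> x)"
          using kn[of z N] by (simp only: norm_mult norm_of_real abs_of_nonneg flip: right_diff_distrib)
        show "cmod (of_real (?k N z) * \<phi> (x - z) - of_real (?k N z) * \<phi> x) \<le>
            \<epsilon> / 2 * ?k N z + indicator B z * (2 * Bd * q ^ N)"
        proof (cases "norm z < \<delta>")
          case True
          have "?k N z * cmod (\<phi> (x - z) - \<phi> x) \<le> ?k N z * (\<epsilon> / 2)"
            by (rule mult_left_mono[OF \<delta>(2)[OF x True] kn])
          moreover have "0 \<le> indicator B z * (2 * Bd * q ^ N)" using Bd q by simp
          ultimately show ?thesis
            unfolding eq mult.commute[of "\<epsilon> / 2"] by (rule add_increasing2[rotated])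
        next
          case False
          have "?k N z \<le> indicator B z * q ^ N" using q(3)[of z N] False by (simp add: indicator_def)
          moreover have "cmod (\<phi> (x - z) - \<phi> x) \<le> 2 * Bd"
            using norm_triangle_ineq4[of "\<phi> (x - z)" "\<phi> x"] Bd(2)[of x] Bd(2)[of "x - z"] by linarith
          ultimately have "?k N z * cmod (\<phi> (x - z) - \<phi> x) \<le> (indicator B z * q ^ N) * (2 * Bd)"
            by (rule mult_mono) (use q in auto)
          moreover have "0 \<le> \<epsilon> / 2 * ?k N z" using \<epsilon> kn[of z N] by simp
          ultimately show ?thesis unfolding eq by (simp add: mult_ac)
        qed
      qed
      also have "\<dots> = \<epsilon> / 2 * I N + c * q ^ N"
        using int[of N] intB[of "2 * Bd * q ^ N"] by (simp add: I_def c_def)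
      also have "\<dots> \<le> \<epsilon> * I N" using tail by simp
      finally show "cmod ((LINT z|lborel. of_real (?k N z) * \<phi> (x - z)) - of_real (I N) * \<phi> x) \<le> \<epsilon> * I N" .
    qed
  qed
qed

text \<open>Convolution with the dilated kernel gives a combination of waves whose coefficients are
  \<open>q n\<close> times Fourier integrals of \<open>\<psi>\<close>, divided by the normalisation
  \<open>b * I N\<close>. Since \<open>q n \<le> 1\<close> and the normalisation is at least
  \<open>c0\<close>, the sequence \<open>A\<close> bounds them for every accuracy and every order,
  and it decays rapidly because \<open>\<psi>\<close> is a test function. Derivatives are put on
  \<open>\<psi>\<close>, which multiplies the coefficients by monomials only, so one polynomial
  serves all orders up to \<open>k\<close>.\<close>

lemma test_function_trigonometric_approximation:
  fixes \<psi> :: "real^'m::finite \<Rightarrow> complex"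
  assumes \<psi>: "\<psi> \<in> test_functions U" and S: "compact S"
  obtains h :: real and A :: "int^'m \<Rightarrow> real" where "0 < h" "\<And>n. 0 \<le> A n"
    "\<And>M. \<exists>C. \<forall>n. A n * bracket (h *\<^sub>R lattice_point n) ^ M \<le> C"
    "\<And>\<epsilon> k. 0 < \<epsilon> \<Longrightarrow> \<exists>F a. finite F \<and> (\<forall>n\<in>F. cmod (a n) \<le> A n) \<and> (\<forall>x\<in>S. \<forall>is. length is \<le> k \<longrightarrow>
      cmod (partial_derivs is \<psi> x - (\<Sum>n\<in>F. a n * (monomial is (h *\<^sub>R lattice_point n) * wave (h *\<^sub>R lattice_point n) x))) \<le> \<epsilon>)"
proof -
  obtain R where R: "0 < R" "S \<union> closure {y. \<psi> y \<noteq> 0} \<subseteq> ball 0 R"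
    using bounded_subset_ballD[OF compact_imp_bounded[OF compact_Un[OF S test_functionsD(2)[OF \<psi>]]], of 0] by blast
  define h where "h = 1 / R"
  define B :: "(real^'m) set" where "B = cbox (\<chi> i. - 2 * R) (\<chi> i. 2 * R)"
  define I where "I N = (LINT z|lborel. indicator B z * cos_kernel N (h *\<^sub>R z))" for N
  define c0 where "c0 = (3 * R / 2) ^ CARD('m)"
  define A where "A n = cmod (fourier_integral \<psi> (- (h *\<^sub>R lattice_point n))) / c0" for n :: "int^'m"
  have h: "0 < h" using R by (simp add: h_def)
  have c0: "0 < c0" using R by (simp add: c0_def)
  show ?thesis
  proof (rule that[OF h, of A])
    show "0 \<le> A n" for n using c0 by (simp add: A_def)
    show "\<exists>C. \<forall>n. A n * bracket (h *\<^sub>R lattice_point n) ^ M \<le> C" for M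
    proof -
      obtain C where "\<And>\<zeta>. cmod (fourier_integral \<psi> (- \<zeta>)) * bracket \<zeta> ^ M \<le> C"
        using fourier_integral_decay[OF \<psi>, of M] by blast
      then have "A n * bracket (h *\<^sub>R lattice_point n) ^ M \<le> C / c0" for n
        using c0 by (simp add: A_def divide_right_mono)
      then show ?thesis by blast
    qed
    fix \<epsilon> :: real and k :: nat assume \<epsilon>: "0 < \<epsilon>"
    have "\<forall>\<^sub>F N in sequentially. \<forall>is\<in>{is. length is \<le> k}. \<forall>x\<in>S.
        cmod ((LINT z|lborel. of_real (indicator B z * cos_kernel N (h *\<^sub>R z)) * partial_derivs is \<psi> (x - z))
          - of_real (I N) * partial_derivs is \<psi> x) \<le> \<epsilon> * I N"
      unfolding h_def B_def I_def
      by (rule eventually_ball_finite[OF finite_multi_indices], rule ballI)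
        (rule cos_kernel_approximation[OF R(1) test_functions_partial_derivs[OF \<psi>] S \<epsilon>])
    from eventually_happens'[OF sequentially_bot eventually_conj[OF this eventually_gt_at_top[of 0]]]
    obtain N where N': "\<forall>is\<in>{is. length is \<le> k}. \<forall>x\<in>S.
        cmod ((LINT z|lborel. of_real (indicator B z * cos_kernel N (h *\<^sub>R z)) * partial_derivs is \<psi> (x - z))
          - of_real (I N) * partial_derivs is \<psi> x) \<le> \<epsilon> * I N" and N: "0 < N"
      by (elim exE conjE)
    have ap: "cmod ((LINT z|lborel. of_real (indicator B z * cos_kernel N (h *\<^sub>R z)) * partial_derivs is \<psi> (x - z))
          - of_real (I N) * partial_derivs is \<psi> x) \<le> \<epsilon> * I N"
      if "length is \<le> k" "x \<in> S" for "is" x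
      by (rule bspec[OF bspec[OF N'] that(2)]) (use that in simp)
    define b where "b = central_ratio N ^ CARD('m)"
    have b: "0 < b" using central_ratio_pos[of N] by (simp add: b_def)
    have J: "c0 \<le> b * I N"
      using cos_kernel_mass_lower[OF R(1) N, where 'm = 'm] unfolding c0_def I_def B_def b_def h_def .
    then have I: "0 < I N" using c0 b by (metis less_le_trans zero_less_mult_pos)
    obtain F :: "(int^'m) set" and q where F: "finite F" "\<And>n. 0 \<le> q n" "\<And>n. q n \<le> (1::real)"
      "\<And>y. complex_of_real (b * cos_kernel N y) = (\<Sum>n\<in>F. of_real (q n) * wave (lattice_point n) y)"
      by (rule cos_kernel_expansion[of N, where 'm = 'm, folded b_def]) (rule that)
    define a where "a n = of_real (q n / (b * I N)) * fourier_integral \<psi> (- (h *\<^sub>R lattice_point n))" for n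
    have aA: "cmod (a n) \<le> A n" for n
    proof -
      have "q n / (b * I N) \<le> 1 / c0"
        by (rule frac_le) (use F c0 J in auto)
      moreover have "0 \<le> q n / (b * I N)" using F(2) b I by simp
      ultimately have "cmod (of_real (q n / (b * I N))) \<le> 1 / c0"
        by (simp only: norm_of_real abs_of_nonneg)
      from mult_right_mono[OF this norm_ge_zero[of "fourier_integral \<psi> (- (h *\<^sub>R lattice_point n))"]]
      show ?thesis unfolding a_def A_def norm_mult by simp
    qed
    have main: "(LINT z|lborel. of_real (indicator B z * cos_kernel N (h *\<^sub>R z)) * partial_derivs is \<psi> (x - z)) =
        of_real (I N) * (\<Sum>n\<in>F. a n * (monomial is (h *\<^sub>R lattice_point n) * wave (h *\<^sub>R lattice_point n) x))"
      if x: "x \<in> S" for "is" x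
    proof -
      let ?\<phi> = "partial_derivs is \<psi>"
      let ?z = "\<lambda>n. h *\<^sub>R lattice_point n :: real^'m"
      have \<phi>: "?\<phi> \<in> test_functions U" by (rule test_functions_partial_derivs[OF \<psi>])
      \<comment> \<open>The point \<open>x\<close>, and \<open>x - z\<close> when it is in the
        support, both lie in the ball of radius \<open>R\<close>. So the restriction to the cube
        \<open>B\<close> removes nothing, and the convolution runs over the whole space.\<close>
      have outside: "?\<phi> (x - z) = 0" if "z \<notin> B" for z
      proof (rule ccontr)
        assume "?\<phi> (x - z) \<noteq> 0"
        have "x - z \<in> closure {y. \<psi> y \<noteq> 0}"
        proof (rule ccontr)
          assume o: "x - z \<notin> closure {y. \<psi> y \<noteq> 0}"
          have "partial_derivs is \<psi> (x - z) = partial_derivs is (\<lambda>_. 0) (x - z)"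
          proof (rule partial_derivs_cong[OF open_Compl[OF closed_closure, of "{y. \<psi> y \<noteq> 0}"]])
            show "\<psi> y = 0" if "y \<in> - closure {y. \<psi> y \<noteq> 0}" for y
              using that by (intro test_functions_zero_outside) simp
            show "x - z \<in> - closure {y. \<psi> y \<noteq> 0}" using o by simp
          qed
          then show False using \<open>?\<phi> (x - z) \<noteq> 0\<close> by simp
        qed
        then have n: "norm (x - z) < R" "norm x < R" using R x by auto
        have "\<bar>z $ i\<bar> \<le> 2 * R" for i
        proof -
          have "norm z \<le> norm x + norm (x - z)" using norm_triangle_ineq4[of x "x - z"] by simp
          then show ?thesis using component_le_norm_cart[of z i] n by linarith
        qed
        then have "z \<in> B" unfolding B_def mem_box_cart by (auto simp: abs_le_iff minus_le_iff)
        then show False using that by simp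
      qed
      have t: "(\<lambda>y. ?\<phi> y * wave (- ?z n) y) \<in> test_functions U" for n
        by (rule test_functions_mult[OF \<phi> smooth_on_wave])
      have ker: "complex_of_real (b * cos_kernel N (h *\<^sub>R (x - y))) =
          (\<Sum>n\<in>F. of_real (q n) * (wave (?z n) x * wave (- ?z n) y))" for y
      proof -
        have "wave (lattice_point n) (h *\<^sub>R (x - y)) = wave (?z n) x * wave (- ?z n) y" for n
          by (simp add: wave_def algebra_simps inner_diff_left flip: exp_add)
        then show ?thesis unfolding F(4) by simp
      qed
      have "of_real b * (LINT z|lborel. of_real (indicator B z * cos_kernel N (h *\<^sub>R z)) * ?\<phi> (x - z)) =
          of_real b * (LINT z|lborel. of_real (cos_kernel N (h *\<^sub>R z)) * ?\<phi> (x - z))"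
      proof -
        have "of_real (indicator B z * cos_kernel N (h *\<^sub>R z)) * ?\<phi> (x - z) = of_real (cos_kernel N (h *\<^sub>R z)) * ?\<phi> (x - z)" for z
          by (cases "z \<in> B") (simp_all add: outside)
        then show ?thesis by (simp only:)
      qed
      also have "\<dots> = of_real b * (LINT z|lborel. (\<lambda>y. of_real (cos_kernel N (h *\<^sub>R (x - y))) * ?\<phi> y) (x - z))"
        by simp
      also have "\<dots> = of_real b * (LINT y|lborel. of_real (cos_kernel N (h *\<^sub>R (x - y))) * ?\<phi> y)"
      proof -
        have "continuous_on UNIV (\<lambda>y. of_real (cos_kernel N (h *\<^sub>R (x - y))) * ?\<phi> y)"
          by (intro continuous_intros smooth_on_imp_continuous_on[OF test_functionsD(1)[OF \<phi>]])
        from lborel_integral_reflect[OF borel_measurable_continuous_onI[OF this], of x]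
        show ?thesis by simp
      qed
      also have "\<dots> = (LINT y|lborel. of_real (b * cos_kernel N (h *\<^sub>R (x - y))) * ?\<phi> y)"
        by (simp add: mult.assoc)
      also have "\<dots> = (LINT y|lborel. (\<Sum>n\<in>F. (of_real (q n) * wave (?z n) x) * (?\<phi> y * wave (- ?z n) y)))"
        unfolding ker by (simp add: sum_distrib_right sum_distrib_left mult_ac)
      also have "\<dots> = (\<Sum>n\<in>F. (of_real (q n) * wave (?z n) x) * fourier_integral ?\<phi> (- ?z n))"
        unfolding fourier_integral_def
        using test_functions_integrable[OF t] by (subst Bochner_Integration.integral_sum) auto
      also have "\<dots> = of_real b * (of_real (I N) * (\<Sum>n\<in>F. a n * (monomial is (?z n) * wave (?z n) x)))"
        unfolding fourier_integral_partial_derivs[OF \<psi>] a_def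
        using b I by (simp add: sum_distrib_left) (intro sum.cong, auto simp: field_simps)
      finally show ?thesis using b by simp
    qed
    show "\<exists>F a. finite F \<and> (\<forall>n\<in>F. cmod (a n) \<le> A n) \<and> (\<forall>x\<in>S. \<forall>is. length is \<le> k \<longrightarrow>
      cmod (partial_derivs is \<psi> x - (\<Sum>n\<in>F. a n * (monomial is (h *\<^sub>R lattice_point n) * wave (h *\<^sub>R lattice_point n) x))) \<le> \<epsilon>)"
    proof (intro exI[of _ F] exI[of _ a] conjI ballI allI impI F(1) aA)
      fix x "is" assume x: "x \<in> S" and l: "length (is :: 'm list) \<le> k"
      let ?s = "\<Sum>n\<in>F. a n * (monomial is (h *\<^sub>R lattice_point n) * wave (h *\<^sub>R lattice_point n) x)"
      have "I N * cmod (partial_derivs is \<psi> x - ?s) = cmod (of_real (I N) * ?s - of_real (I N) * partial_derivs is \<psi> x)"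
        using I by (simp add: norm_mult norm_minus_commute flip: right_diff_distrib)
      also have "\<dots> \<le> \<epsilon> * I N" using ap[OF l x] unfolding main[OF x] .
      finally show "cmod (partial_derivs is \<psi> x - ?s) \<le> \<epsilon>" using I by (simp add: mult.commute)
    qed
  qed
qed

section \<open>Weighted square integrals of Fourier transforms\<close>

lemma bracket_powr_le_power: "\<bar>s\<bar> \<le> real p \<Longrightarrow> bracket \<xi> powr s \<le> bracket \<xi> ^ p"
  using powr_mono[of s "real p" "bracket \<xi>"] powr_realpow[OF bracket_pos[of \<xi>], of p] by simp

text \<open>Peetre's inequality for exponents of either sign; for negative \<open>s\<close> the
  roles of \<open>\<xi>\<close> and \<open>\<xi> + \<zeta>\<close> are exchanged. The natural number
  \<open>p\<close> yields integer powers of \<open>bracket \<zeta>\<close>, the form in which decay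
  of the lattice coefficients is available.\<close>

lemma bracket_powr_translate:
  assumes "\<bar>s\<bar> \<le> real p"
  shows "bracket \<xi> powr s \<le> (2 * bracket \<zeta>) ^ p * bracket (\<xi> + \<zeta>) powr s"
proof -
  have b: "1 \<le> 2 * bracket \<zeta>" "0 < 2 * bracket \<zeta>"
    using bracket_ge_1[of \<zeta>] by (linarith, simp)
  have pw: "(2 * bracket \<zeta>) powr \<bar>s\<bar> \<le> (2 * bracket \<zeta>) ^ p"
    using powr_mono[OF assms b(1)] powr_realpow[OF b(2), of p] by simp
  have "bracket \<xi> powr s \<le> (2 * bracket \<zeta>) powr \<bar>s\<bar> * bracket (\<xi> + \<zeta>) powr s"
  proof (cases "0 \<le> s")
    case True
    have "bracket ((\<xi> + \<zeta>) + (- \<zeta>)) \<le> 2 * bracket (\<xi> + \<zeta>) * bracket (- \<zeta>)" by (rule bracket_add)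
    then have "bracket \<xi> \<le> (2 * bracket \<zeta>) * bracket (\<xi> + \<zeta>)" by (simp add: mult_ac)
    then have "bracket \<xi> powr s \<le> ((2 * bracket \<zeta>) * bracket (\<xi> + \<zeta>)) powr s"
      by (rule powr_mono2[OF True bracket_nonneg])
    also have "\<dots> = (2 * bracket \<zeta>) powr s * bracket (\<xi> + \<zeta>) powr s"
      by (rule powr_mult)
    finally show ?thesis using True by simp
  next
    case False
    have "bracket (\<xi> + \<zeta>) \<le> 2 * bracket \<xi> * bracket \<zeta>" by (rule bracket_add)
    then have "bracket (\<xi> + \<zeta>) / (2 * bracket \<zeta>) \<le> bracket \<xi>"
      using b by (simp add: divide_le_eq mult_ac)
    then have "bracket \<xi> powr s \<le> (bracket (\<xi> + \<zeta>) / (2 * bracket \<zeta>)) powr s"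
      using False b by (intro powr_mono2') auto
    also have "\<dots> = bracket (\<xi> + \<zeta>) powr s * (2 * bracket \<zeta>) powr - s"
      using b by (simp add: powr_divide powr_minus_divide)
    finally show ?thesis using False by (simp add: mult.commute)
  qed
  also have "\<dots> \<le> (2 * bracket \<zeta>) ^ p * bracket (\<xi> + \<zeta>) powr s"
    by (rule mult_right_mono[OF pw]) simp
  finally show ?thesis .
qed

lemma lattice_prod_nn_integral_finite:
  "(\<integral>\<^sup>+n. ennreal (\<Prod>i\<in>UNIV. 1 / (1 + (real_of_int (n $ i))\<^sup>2)) \<partial>count_space (UNIV :: (int^'m::finite) set)) < \<infinity>"
proof -
  let ?w = "\<lambda>n::int^'m. \<Prod>i\<in>UNIV. 1 / (1 + (real_of_int (n $ i))\<^sup>2)"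
  obtain D where D: "\<And>F :: (int^'m) set. finite F \<Longrightarrow> (\<Sum>n\<in>F. ?w n) \<le> D"
    using lattice_sum_bound by blast
  have w0: "0 \<le> ?w n" for n by (rule prod_nonneg) simp
  have "?w summable_on UNIV"
    by (rule nonneg_bdd_above_summable_on) (use w0 D in \<open>auto simp: bdd_above_def\<close>)
  then have "Infinite_Sum.abs_summable_on ?w UNIV" using w0 by simp
  then have "integrable (count_space UNIV) ?w"
    using abs_summable_equivalent unfolding Infinite_Set_Sum.abs_summable_on_def by blast
  then have "(\<integral>\<^sup>+n. ennreal (norm (?w n)) \<partial>count_space UNIV) < \<infinity>"
    unfolding integrable_iff_bounded by blast
  then show ?thesis using w0 by simp
qed

lemma count_space_lborel_Tonelli:
  fixes f :: "'i::countable \<Rightarrow> 'a::euclidean_space \<Rightarrow> ennreal"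
  assumes [measurable]: "\<And>n. f n \<in> borel_measurable borel"
  shows "(\<integral>\<^sup>+\<xi>. (\<integral>\<^sup>+n. f n \<xi> \<partial>count_space UNIV) \<partial>lborel) = (\<integral>\<^sup>+n. (\<integral>\<^sup>+\<xi>. f n \<xi> \<partial>lborel) \<partial>count_space UNIV)"
proof -
  interpret pair_sigma_finite "count_space (UNIV :: 'i set)" "lborel :: 'a measure"
    by (intro pair_sigma_finite.intro sigma_finite_measure_count_space lborel.sigma_finite_measure_axioms)
  show ?thesis
    by (rule Fubini'[of f]) (rule measurable_pair_measure_countable1; simp)
qed

lemma nn_integral_translate:
  fixes f :: "'a::euclidean_space \<Rightarrow> ennreal"
  assumes "f \<in> borel_measurable borel"
  shows "(\<integral>\<^sup>+x. f (x + t) \<partial>lborel) = (\<integral>\<^sup>+x. f x \<partial>lborel)"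
proof -
  have "(\<integral>\<^sup>+x. f x \<partial>lborel) = (\<integral>\<^sup>+x. f x \<partial>distr lborel borel ((+) t))"
    by (simp only: lborel_distr_plus)
  also have "\<dots> = (\<integral>\<^sup>+x. f (t + x) \<partial>lborel)" by (rule nn_integral_distr) (use assms in auto)
  finally show ?thesis by (simp add: add.commute)
qed

text \<open>Every \<open>\<xi>\<close> lies in the unit cube at its integer part, on which its
  bracket is comparable to that of the corner. Integration cube by cube reduces the claim to the
  lattice sum with product weight.\<close>

lemma bracket_weight_finite:
  "(\<integral>\<^sup>+\<xi>. ennreal (1 / bracket (\<xi> :: real^'m::finite) ^ (2 * CARD('m))) \<partial>lborel) < \<infinity>"
proof -
  let ?p = "2 * CARD('m)"
  let ?w = "\<lambda>n::int^'m. \<Prod>i\<in>UNIV. 1 / (1 + (real_of_int (n $ i))\<^sup>2)"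
  let ?Q = "\<lambda>n::int^'m. cbox (lattice_point n) (lattice_point n + (\<chi> i. 1))"
  define c where "c = (2 * (1 + real CARD('m))) ^ ?p"
  have w0: "0 \<le> ?w n" for n by (rule prod_nonneg) simp
  have pt: "ennreal (1 / bracket \<xi> ^ ?p) \<le> (\<integral>\<^sup>+n. ennreal (c * ?w n) * indicator (?Q n) \<xi> \<partial>count_space UNIV)" for \<xi> :: "real^'m"
  proof -
    define n where "n = (\<chi> i. \<lfloor>\<xi> $ i\<rfloor>)"
    have \<xi>: "\<xi> \<in> ?Q n" by (simp add: mem_box_cart n_def lattice_point_def)
    have d: "bracket (lattice_point n - \<xi>) \<le> 1 + real CARD('m)"
    proof -
      have "\<bar>(lattice_point n - \<xi>) $ i\<bar> \<le> 1" for i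
        using \<xi> by (simp add: mem_box_cart abs_le_iff) (metis add.commute diff_le_eq le_diff_eq order.trans zero_le_one diff_ge_0_iff_ge)
      then have "(\<Sum>i\<in>UNIV. \<bar>(lattice_point n - \<xi>) $ i\<bar>) \<le> (\<Sum>i\<in>(UNIV::'m set). 1)" by (intro sum_mono)
      then show ?thesis using norm_le_l1_cart[of "lattice_point n - \<xi>"] bracket_le[of "lattice_point n - \<xi>"] by simp
    qed
    have "bracket (lattice_point n) \<le> 2 * bracket \<xi> * bracket (lattice_point n - \<xi>)"
      using bracket_add[of \<xi> "lattice_point n - \<xi>"] by simp
    also have "\<dots> \<le> 2 * bracket \<xi> * (1 + real CARD('m))" by (rule mult_left_mono[OF d]) simp
    finally have "bracket (lattice_point n) ^ ?p \<le> (2 * bracket \<xi> * (1 + real CARD('m))) ^ ?p"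
      by (rule power_mono) simp
    then have "(\<Prod>i\<in>UNIV. 1 + (real_of_int (n $ i))\<^sup>2) \<le> c * bracket \<xi> ^ ?p"
      using lattice_prod_le_bracket[of n] by (simp add: c_def power_mult_distrib mult_ac)
    moreover have "0 < (\<Prod>i\<in>UNIV. 1 + (real_of_int (n $ i))\<^sup>2)" by (rule prod_pos) (simp add: add_pos_nonneg)
    ultimately have "1 / bracket \<xi> ^ ?p \<le> c * (1 / (\<Prod>i\<in>UNIV. 1 + (real_of_int (n $ i))\<^sup>2))"
      by (simp add: field_simps)
    also have "\<dots> = c * ?w n" by (simp add: prod_dividef)
    finally have "ennreal (1 / bracket \<xi> ^ ?p) \<le> ennreal (c * ?w n) * indicator (?Q n) \<xi>"
      using \<xi> by (simp add: ennreal_leI)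
    also have "\<dots> = (\<integral>\<^sup>+k. (ennreal (c * ?w k) * indicator (?Q k) \<xi>) * indicator {n} k \<partial>count_space UNIV)"
      by (subst nn_integral_count_space'[of "{n}"]) (auto simp: indicator_def)
    also have "\<dots> \<le> (\<integral>\<^sup>+k. ennreal (c * ?w k) * indicator (?Q k) \<xi> \<partial>count_space UNIV)"
      by (rule nn_integral_mono) (auto simp: indicator_def)
    finally show ?thesis .
  qed
  have vol: "emeasure lborel (?Q n) = 1" for n :: "int^'m"
  proof -
    have "measure lborel (?Q n) = 1"
      using content_cbox_cart[of "lattice_point n" "lattice_point n + (\<chi> i. 1)"] by (simp add: interval_ne_empty_cart)
    then show ?thesis
      using emeasure_eq_ennreal_measure[of lborel "?Q n"] emeasure_lborel_cbox_finite[of "lattice_point n"]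
      by (simp add: less_top[symmetric])
  qed
  have "(\<integral>\<^sup>+\<xi>. ennreal (1 / bracket (\<xi> :: real^'m) ^ ?p) \<partial>lborel) \<le>
      (\<integral>\<^sup>+\<xi>. (\<integral>\<^sup>+n. ennreal (c * ?w n) * indicator (?Q n) \<xi> \<partial>count_space UNIV) \<partial>lborel)"
    by (rule nn_integral_mono) (rule pt)
  also have "\<dots> = (\<integral>\<^sup>+n. (\<integral>\<^sup>+\<xi>. ennreal (c * ?w n) * indicator (?Q n) \<xi> \<partial>lborel) \<partial>count_space UNIV)"
    by (rule count_space_lborel_Tonelli) simp
  also have "\<dots> = (\<integral>\<^sup>+n. ennreal c * ennreal (?w n) \<partial>count_space UNIV)"
    using w0 by (simp add: nn_integral_cmult vol c_def ennreal_mult)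
  also have "\<dots> = ennreal c * (\<integral>\<^sup>+n. ennreal (?w n) \<partial>count_space UNIV)"
    by (rule nn_integral_cmult) simp
  also have "\<dots> < \<infinity>"
    using lattice_prod_nn_integral_finite[where 'm = 'm] by (simp add: ennreal_mult_less_top)
  finally show ?thesis .
qed

text \<open>The integral is taken in the extended nonnegative numbers so that finiteness carries
  information: the Bochner integral in the seminorm is \<open>0\<close> for a function that is not
  integrable. For measurable data the two agree when the mass is finite.\<close>

definition sobolev_mass :: "(real^'m::finite) set \<Rightarrow> real \<Rightarrow> (real^'m \<Rightarrow> complex) \<Rightarrow> ennreal" where
  "sobolev_mass V r f = (\<integral>\<^sup>+\<xi>. ennreal ((cmod (f \<xi>))\<^sup>2 * bracket \<xi> powr (2 * r)) * indicator V \<xi> \<partial>lborel)"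

lemma sobolev_mass_integrable:
  assumes [measurable]: "f \<in> borel_measurable borel" "V \<in> sets borel"
  shows "set_integrable lborel V (\<lambda>\<xi>. (cmod (f \<xi>))\<^sup>2 * bracket \<xi> powr (2 * r)) \<longleftrightarrow> sobolev_mass V r f < \<infinity>"
proof -
  have "sobolev_mass V r f = (\<integral>\<^sup>+\<xi>. ennreal (norm (indicator V \<xi> *\<^sub>R ((cmod (f \<xi>))\<^sup>2 * bracket \<xi> powr (2 * r)))) \<partial>lborel)"
    unfolding sobolev_mass_def by (intro nn_integral_cong) (auto simp: indicator_def)
  then show ?thesis unfolding set_integrable_def integrable_iff_bounded by simp
qed

lemma sobolev_mass_integral:
  assumes [measurable]: "f \<in> borel_measurable borel" "V \<in> sets borel" and "sobolev_mass V r f < \<infinity>"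
  shows "ennreal (LINT \<xi>:V|lborel. (cmod (f \<xi>))\<^sup>2 * bracket \<xi> powr (2 * r)) = sobolev_mass V r f"
proof -
  have i: "integrable lborel (\<lambda>\<xi>. indicator V \<xi> *\<^sub>R ((cmod (f \<xi>))\<^sup>2 * bracket \<xi> powr (2 * r)))"
    using assms(3) sobolev_mass_integrable[OF assms(1,2)] unfolding set_integrable_def by blast
  have "ennreal (LINT \<xi>:V|lborel. (cmod (f \<xi>))\<^sup>2 * bracket \<xi> powr (2 * r)) =
      (\<integral>\<^sup>+\<xi>. ennreal (indicator V \<xi> *\<^sub>R ((cmod (f \<xi>))\<^sup>2 * bracket \<xi> powr (2 * r))) \<partial>lborel)"
    unfolding set_lebesgue_integral_def by (rule nn_integral_eq_integral[symmetric, OF i]) (auto simp: indicator_def)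
  also have "\<dots> = sobolev_mass V r f"
    unfolding sobolev_mass_def by (intro nn_integral_cong) (auto simp: indicator_def)
  finally show ?thesis .
qed

lemma sobolev_mass_subset:
  assumes "V \<subseteq> V'" shows "sobolev_mass V r f \<le> sobolev_mass V' r f"
  unfolding sobolev_mass_def using assms by (intro nn_integral_mono mult_left_mono) (auto simp: indicator_def)

lemma sobolev_mass_mono:
  assumes "r \<le> s" shows "sobolev_mass V r f \<le> sobolev_mass V s f"
  unfolding sobolev_mass_def
  using assms by (intro nn_integral_mono mult_right_mono ennreal_leI mult_left_mono powr_mono) auto

lemma sobolev_mass_add:
  assumes [measurable]: "f \<in> borel_measurable borel" "g \<in> borel_measurable borel" "V \<in> sets borel"
    and "sobolev_mass V r f < \<infinity>" "sobolev_mass V r g < \<infinity>"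
  shows "sobolev_mass V r (\<lambda>\<xi>. f \<xi> + g \<xi>) < \<infinity>"
proof -
  have le: "(cmod (f \<xi> + g \<xi>))\<^sup>2 * bracket \<xi> powr (2 * r) \<le>
      2 * ((cmod (f \<xi>))\<^sup>2 * bracket \<xi> powr (2 * r)) + 2 * ((cmod (g \<xi>))\<^sup>2 * bracket \<xi> powr (2 * r))" for \<xi>
  proof -
    have "(cmod (f \<xi> + g \<xi>))\<^sup>2 \<le> (cmod (f \<xi>) + cmod (g \<xi>))\<^sup>2"
      by (rule power_mono[OF norm_triangle_ineq]) simp
    also have "\<dots> \<le> 2 * (cmod (f \<xi>))\<^sup>2 + 2 * (cmod (g \<xi>))\<^sup>2"
      using sum_squares_bound[of "cmod (f \<xi>)" "cmod (g \<xi>)"] by (simp add: power2_sum)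
    finally have "(cmod (f \<xi> + g \<xi>))\<^sup>2 * bracket \<xi> powr (2 * r) \<le>
        (2 * (cmod (f \<xi>))\<^sup>2 + 2 * (cmod (g \<xi>))\<^sup>2) * bracket \<xi> powr (2 * r)" by (rule mult_right_mono) simp
    then show ?thesis by (simp add: distrib_right mult.assoc)
  qed
  have "sobolev_mass V r (\<lambda>\<xi>. f \<xi> + g \<xi>) \<le>
      (\<integral>\<^sup>+\<xi>. 2 * (ennreal ((cmod (f \<xi>))\<^sup>2 * bracket \<xi> powr (2 * r)) * indicator V \<xi>)
        + 2 * (ennreal ((cmod (g \<xi>))\<^sup>2 * bracket \<xi> powr (2 * r)) * indicator V \<xi>) \<partial>lborel)"
    unfolding sobolev_mass_def
  proof (rule nn_integral_mono)
    fix \<xi> :: "real^'a"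
    let ?a = "(cmod (f \<xi>))\<^sup>2 * bracket \<xi> powr (2 * r)" and ?b = "(cmod (g \<xi>))\<^sup>2 * bracket \<xi> powr (2 * r)"
    have "ennreal ((cmod (f \<xi> + g \<xi>))\<^sup>2 * bracket \<xi> powr (2 * r)) \<le> ennreal (2 * ?a + 2 * ?b)"
      by (rule ennreal_leI[OF le])
    also have "\<dots> = 2 * ennreal ?a + 2 * ennreal ?b" by (simp add: ennreal_plus ennreal_mult)
    finally show "ennreal ((cmod (f \<xi> + g \<xi>))\<^sup>2 * bracket \<xi> powr (2 * r)) * indicator V \<xi> \<le>
        2 * (ennreal ?a * indicator V \<xi>) + 2 * (ennreal ?b * indicator V \<xi>)"
      by (auto simp: indicator_def)
  qed
  also have "\<dots> = 2 * sobolev_mass V r f + 2 * sobolev_mass V r g"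
    unfolding sobolev_mass_def by (simp add: nn_integral_add nn_integral_cmult)
  also have "\<dots> < \<infinity>" using assms(4,5) by (simp add: ennreal_mult_less_top)
  finally show ?thesis .
qed

text \<open>For \<open>\<bar>\<zeta>\<bar> \<le> \<kappa> \<bar>\<xi>\<bar>\<close> the translate
  stays in \<open>V\<close>, and the mass over \<open>V\<close> controls it. For the remaining
  \<open>\<xi>\<close> the bound \<open>\<bar>\<xi>\<bar> < \<bar>\<zeta>\<bar> / \<kappa>\<close>
  converts polynomial growth in \<open>\<xi>\<close> into powers of \<open>bracket \<zeta>\<close>.
  The result grows polynomially in the shift, which rapidly decreasing coefficients can sum.\<close>

lemma sobolev_mass_translate_bound:
  fixes f :: "real^'m::finite \<Rightarrow> complex"
  assumes [measurable]: "f \<in> borel_measurable borel" "V \<in> sets borel" "V' \<in> sets borel"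
    and grow: "0 \<le> C" "\<And>\<xi>. cmod (f \<xi>) \<le> C * bracket \<xi> ^ N"
    and \<kappa>: "0 < \<kappa>" "\<And>\<xi> \<zeta>. \<xi> \<in> V' \<Longrightarrow> norm \<zeta> \<le> \<kappa> * norm \<xi> \<Longrightarrow> \<xi> + \<zeta> \<in> V"
    and fin: "sobolev_mass V r f < \<infinity>"
  obtains D M where "0 \<le> D" "\<And>\<zeta>. sobolev_mass V' r (\<lambda>\<xi>. f (\<xi> + \<zeta>)) \<le> ennreal (D * bracket \<zeta> ^ M)"
proof -
  let ?m = "2 * CARD('m)"
  let ?u = "\<lambda>\<xi>. (cmod (f \<xi>))\<^sup>2 * bracket \<xi> powr (2 * r)"
  define p where "p = nat \<lceil>\<bar>2 * r\<bar>\<rceil>"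
  have p: "\<bar>2 * r\<bar> \<le> real p" unfolding p_def by (simp add: real_nat_ceiling_ge)
  define c where "c = 1 + 1 / \<kappa>"
  have c: "1 \<le> c" using \<kappa> by (simp add: c_def)
  \<comment> \<open>The part \<open>4 * N\<close> comes from the squared growth bound, where
    \<open>bracket (\<xi> + \<zeta>)\<close> is at most a multiple of the square of
    \<open>bracket \<zeta>\<close>; \<open>p\<close> comes from the Sobolev weight, and
    \<open>?m\<close> from the integrable weight that is split off.\<close>
  define M where "M = 4 * N + p + ?m"
  define D0 where "D0 = C\<^sup>2 * (2 * c) ^ (2 * N) * c ^ (p + ?m)"
  have D0: "0 \<le> D0" using c by (simp add: D0_def)
  obtain \<mu> where \<mu>: "0 \<le> \<mu>" "sobolev_mass V r f = ennreal \<mu>"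
    using fin by (cases "sobolev_mass V r f") auto
  obtain W where W: "0 \<le> W" "(\<integral>\<^sup>+\<xi>. ennreal (1 / bracket (\<xi> :: real^'m) ^ ?m) \<partial>lborel) = ennreal W"
    using bracket_weight_finite[where 'm = 'm] by (cases "\<integral>\<^sup>+\<xi>. ennreal (1 / bracket (\<xi> :: real^'m) ^ ?m) \<partial>lborel") auto
  show ?thesis
  proof (rule that[of "2 ^ p * \<mu> + D0 * W" M])
    show "0 \<le> 2 ^ p * \<mu> + D0 * W" using \<mu> W D0 by simp
    fix \<zeta> :: "real^'m"
    let ?b = "bracket \<zeta>"
    have pt: "ennreal ((cmod (f (\<xi> + \<zeta>)))\<^sup>2 * bracket \<xi> powr (2 * r)) * indicator V' \<xi> \<le>
        ennreal ((2 * ?b) ^ p) * (ennreal (?u (\<xi> + \<zeta>)) * indicator V (\<xi> + \<zeta>))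
        + ennreal (D0 * ?b ^ M) * ennreal (1 / bracket \<xi> ^ ?m)" for \<xi>
    proof (cases "\<xi> \<in> V'")
      case True
      show ?thesis
      proof (cases "norm \<zeta> \<le> \<kappa> * norm \<xi>")
        case T: True
        have "(cmod (f (\<xi> + \<zeta>)))\<^sup>2 * bracket \<xi> powr (2 * r) \<le> (cmod (f (\<xi> + \<zeta>)))\<^sup>2 * ((2 * ?b) ^ p * bracket (\<xi> + \<zeta>) powr (2 * r))"
          by (rule mult_left_mono[OF bracket_powr_translate[OF p]]) simp
        then have "ennreal ((cmod (f (\<xi> + \<zeta>)))\<^sup>2 * bracket \<xi> powr (2 * r)) \<le> ennreal ((2 * ?b) ^ p * ?u (\<xi> + \<zeta>))"
          by (intro ennreal_leI) (simp add: mult_ac)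
        also have "\<dots> = ennreal ((2 * ?b) ^ p) * ennreal (?u (\<xi> + \<zeta>))" by (rule ennreal_mult) auto
        finally show ?thesis using True \<kappa>(2)[OF True T] by (auto intro: add_increasing2)
      next
        case F: False
        have "norm \<xi> \<le> norm \<zeta> / \<kappa>" using F \<kappa>(1) by (simp add: field_simps)
        also have "\<dots> \<le> ?b / \<kappa>" by (rule divide_right_mono[OF norm_le_bracket]) (use \<kappa>(1) in simp)
        finally have n: "norm \<xi> \<le> ?b / \<kappa>" .
        have "c * ?b = ?b + ?b / \<kappa>" by (simp add: c_def distrib_right)
        then have bx: "bracket \<xi> \<le> c * ?b"
          using n bracket_le[of \<xi>] bracket_ge_1[of \<zeta>] by linarith
        have "cmod (f (\<xi> + \<zeta>)) \<le> C * (2 * bracket \<xi> * ?b) ^ N"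
          by (rule order.trans[OF grow(2) mult_left_mono[OF power_mono[OF bracket_add] grow(1)]]) simp
        also have "\<dots> \<le> C * (2 * (c * ?b) * ?b) ^ N"
          by (intro mult_left_mono power_mono mult_right_mono bx grow) auto
        finally have "(cmod (f (\<xi> + \<zeta>)))\<^sup>2 \<le> (C * (2 * (c * ?b) * ?b) ^ N)\<^sup>2"
          by (rule power_mono) simp
        also have "\<dots> = C\<^sup>2 * (2 * c) ^ (2 * N) * ?b ^ (4 * N)"
          by (simp add: power_mult_distrib power_mult[symmetric] power_add[symmetric] mult_ac flip: mult_2)
        finally have f2: "(cmod (f (\<xi> + \<zeta>)))\<^sup>2 \<le> C\<^sup>2 * (2 * c) ^ (2 * N) * ?b ^ (4 * N)" .
        have "bracket \<xi> powr (2 * r) * bracket \<xi> ^ ?m \<le> bracket \<xi> ^ p * bracket \<xi> ^ ?m"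
          by (rule mult_right_mono[OF bracket_powr_le_power[OF p]]) simp
        also have "\<dots> = bracket \<xi> ^ (p + ?m)" by (simp add: power_add)
        also have "\<dots> \<le> (c * ?b) ^ (p + ?m)" by (rule power_mono[OF bx]) simp
        finally have b2: "bracket \<xi> powr (2 * r) * bracket \<xi> ^ ?m \<le> c ^ (p + ?m) * ?b ^ (p + ?m)"
          by (simp add: power_mult_distrib)
        have "(cmod (f (\<xi> + \<zeta>)))\<^sup>2 * (bracket \<xi> powr (2 * r) * bracket \<xi> ^ ?m) \<le>
            (C\<^sup>2 * (2 * c) ^ (2 * N) * ?b ^ (4 * N)) * (c ^ (p + ?m) * ?b ^ (p + ?m))"
          by (rule mult_mono[OF f2 b2]) (use c in auto)
        also have "\<dots> = D0 * ?b ^ M" by (simp add: D0_def M_def power_add mult_ac)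
        finally have "(cmod (f (\<xi> + \<zeta>)))\<^sup>2 * bracket \<xi> powr (2 * r) \<le> D0 * ?b ^ M * (1 / bracket \<xi> ^ ?m)"
          by (simp add: field_simps)
        then have "ennreal ((cmod (f (\<xi> + \<zeta>)))\<^sup>2 * bracket \<xi> powr (2 * r)) \<le> ennreal (D0 * ?b ^ M * (1 / bracket \<xi> ^ ?m))"
          by (rule ennreal_leI)
        also have "\<dots> = ennreal (D0 * ?b ^ M) * ennreal (1 / bracket \<xi> ^ ?m)"
          by (rule ennreal_mult) (use D0 in auto)
        finally show ?thesis using True by (auto intro: add_increasing)
      qed
    qed simp
    have "sobolev_mass V' r (\<lambda>\<xi>. f (\<xi> + \<zeta>)) \<le> (\<integral>\<^sup>+\<xi>. ennreal ((2 * ?b) ^ p) * (ennreal (?u (\<xi> + \<zeta>)) * indicator V (\<xi> + \<zeta>))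
        + ennreal (D0 * ?b ^ M) * ennreal (1 / bracket \<xi> ^ ?m) \<partial>lborel)"
      unfolding sobolev_mass_def by (rule nn_integral_mono) (rule pt)
    also have "\<dots> = ennreal ((2 * ?b) ^ p) * (\<integral>\<^sup>+\<xi>. ennreal (?u (\<xi> + \<zeta>)) * indicator V (\<xi> + \<zeta>) \<partial>lborel)
        + ennreal (D0 * ?b ^ M) * ennreal W"
      unfolding W(2)[symmetric] by (simp add: nn_integral_add nn_integral_cmult)
    also have "(\<integral>\<^sup>+\<xi>. ennreal (?u (\<xi> + \<zeta>)) * indicator V (\<xi> + \<zeta>) \<partial>lborel) = ennreal \<mu>"
      unfolding \<mu>(2)[symmetric] sobolev_mass_def
      by (rule nn_integral_translate[of "\<lambda>\<xi>. ennreal (?u \<xi>) * indicator V \<xi>"]) simp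
    also have "ennreal ((2 * ?b) ^ p) * ennreal \<mu> + ennreal (D0 * ?b ^ M) * ennreal W = ennreal ((2 * ?b) ^ p * \<mu> + D0 * ?b ^ M * W)"
      using \<mu> W D0 by (simp add: ennreal_mult ennreal_plus)
    also have "\<dots> \<le> ennreal ((2 ^ p * \<mu> + D0 * W) * ?b ^ M)"
    proof (rule ennreal_leI)
      have "?b ^ p \<le> ?b ^ M" by (rule power_increasing) (auto simp: M_def)
      then have "2 ^ p * \<mu> * ?b ^ p \<le> 2 ^ p * \<mu> * ?b ^ M" by (rule mult_left_mono) (use \<mu> in simp)
      then show "(2 * ?b) ^ p * \<mu> + D0 * ?b ^ M * W \<le> (2 ^ p * \<mu> + D0 * W) * ?b ^ M"
        by (simp add: power_mult_distrib algebra_simps)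
    qed
    finally show "sobolev_mass V' r (\<lambda>\<xi>. f (\<xi> + \<zeta>)) \<le> ennreal ((2 ^ p * \<mu> + D0 * W) * ?b ^ M)" .
  qed
qed

lemma jet_norm_le:
  assumes "\<And>is. length is \<le> k \<Longrightarrow> cmod (partial_derivs is \<rho> (x :: real^'m::finite)) \<le> e"
  shows "jet_norm k \<rho> x \<le> real (card {is :: 'm list. length is \<le> k}) * e"
  using sum_mono[of "{is :: 'm list. length is \<le> k}" "\<lambda>is. cmod (partial_derivs is \<rho> x)" "\<lambda>_. e"] assms
  by (simp add: jet_norm_def)

text \<open>Multiplication by a test function \<open>\<psi>\<close> convolves the Fourier transform with a rapidly decreasing
  measure. The \<open>a\<^sub>n\<close> of the approximating trigonometric polynomials are dominated by \<open>A\<^sub>n\<close>, which turns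
  this into a pointwise bound.\<close>

lemma fourier_cutoff_mult_bound:
  fixes \<psi> :: "real^'m::finite \<Rightarrow> complex"
  assumes v: "local_distribution U v" and \<phi>: "\<phi> \<in> test_functions U" and \<psi>: "\<psi> \<in> test_functions UNIV"
  obtains h :: real and A :: "int^'m \<Rightarrow> real" where "0 < h" "\<And>n. 0 \<le> A n"
    "\<And>M. \<exists>C. \<forall>n. A n * bracket (h *\<^sub>R lattice_point n) ^ M \<le> C"
    "\<And>\<xi>. ennreal (cmod (fourier_cutoff (\<lambda>y. \<phi> y * \<psi> y) v \<xi>)) \<le>
      (\<integral>\<^sup>+n. ennreal (A n) * ennreal (cmod (fourier_cutoff \<phi> v (\<xi> + h *\<^sub>R lattice_point n))) \<partial>count_space UNIV)"
proof -
  let ?S = "closure {y. \<phi> y \<noteq> 0}"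
  obtain h A where h: "0 < h" and A: "\<And>n. 0 \<le> A n"
    "\<And>M. \<exists>C. \<forall>n. A n * bracket (h *\<^sub>R lattice_point n) ^ M \<le> C" and
    ap: "\<And>\<epsilon> k. 0 < \<epsilon> \<Longrightarrow> \<exists>F a. finite F \<and> (\<forall>n\<in>F. cmod (a n) \<le> A n) \<and> (\<forall>x\<in>?S. \<forall>is. length is \<le> k \<longrightarrow>
      cmod (partial_derivs is \<psi> x - (\<Sum>n\<in>F. a n * (monomial is (h *\<^sub>R lattice_point n) * wave (h *\<^sub>R lattice_point n) x))) \<le> \<epsilon>)"
    by (rule test_function_trigonometric_approximation[OF \<psi> test_functionsD(2)[OF \<phi>]]) (rule that)
  let ?z = "\<lambda>n. h *\<^sub>R lattice_point n :: real^'m"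
  let ?f = "fourier_cutoff \<phi> v" and ?g = "fourier_cutoff (\<lambda>y. \<phi> y * \<psi> y) v"
  have "ennreal (cmod (?g \<xi>)) \<le> (\<integral>\<^sup>+n. ennreal (A n) * ennreal (cmod (?f (\<xi> + ?z n))) \<partial>count_space UNIV)" for \<xi>
  proof (rule ennreal_le_epsilon)
    fix e :: real assume e: "0 < e"
    have \<phi>': "(\<lambda>y. \<phi> y * wave \<xi> y) \<in> test_functions U" by (rule test_functions_mult[OF \<phi> smooth_on_wave])
    \<comment> \<open>The wave is made part of the cutoff, so \<open>K\<close> and \<open>k\<close>
      may depend on \<open>\<xi>\<close>. This is harmless: the polynomial is chosen afterwards, and
      \<open>A\<close> depends neither on it nor on \<open>\<xi>\<close>.\<close>
    obtain K k where K: "0 \<le> K" "\<And>\<rho> M. smooth_on UNIV \<rho> \<Longrightarrow> 0 \<le> M \<Longrightarrow>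
      (\<And>x. x \<in> closure {y. \<phi> y * wave \<xi> y \<noteq> 0} \<Longrightarrow> jet_norm k \<rho> x \<le> M) \<Longrightarrow> cmod (v (\<lambda>y. \<phi> y * wave \<xi> y * \<rho> y)) \<le> K * M"
      using local_distribution_bound[OF v \<phi>'] by blast
    have supp: "closure {y. \<phi> y * wave \<xi> y \<noteq> 0} \<subseteq> ?S" by (rule closure_mono) auto
    define c where "c = real (card {is :: 'm list. length is \<le> k})"
    have c: "0 \<le> c" by (simp add: c_def)
    define \<epsilon> where "\<epsilon> = e / ((K + 1) * (c + 1))"
    have \<epsilon>: "0 < \<epsilon>" using e K c by (simp add: \<epsilon>_def)
    obtain F a where F: "finite F" "\<And>n. n \<in> F \<Longrightarrow> cmod (a n) \<le> A n" and
      app: "\<And>x is. x \<in> ?S \<Longrightarrow> length is \<le> k \<Longrightarrow>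
      cmod (partial_derivs is \<psi> x - (\<Sum>n\<in>F. a n * (monomial is (?z n) * wave (?z n) x))) \<le> \<epsilon>"
      using ap[OF \<epsilon>, of k] by blast
    define \<rho> where "\<rho> x = \<psi> x - (\<Sum>n\<in>F. a n * wave (?z n) x)" for x
    have sw: "smooth_on UNIV (\<lambda>x. a n * wave (?z n) x)" for n
      by (rule smooth_on_mult[OF open_UNIV smooth_on_const smooth_on_wave])
    have ss: "smooth_on UNIV (\<lambda>x. \<Sum>n\<in>F. a n * wave (?z n) x)" by (rule smooth_on_sum[OF open_UNIV sw])
    have s\<psi>: "smooth_on UNIV \<psi>" by (rule test_functionsD(1)[OF \<psi>])
    have s\<rho>: "smooth_on UNIV \<rho>" unfolding \<rho>_def by (rule smooth_on_diff[OF open_UNIV s\<psi> ss])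
    have pd: "partial_derivs is \<rho> x = partial_derivs is \<psi> x - (\<Sum>n\<in>F. a n * (monomial is (?z n) * wave (?z n) x))" for "is" x
    proof -
      have "partial_derivs is \<psi> x = partial_derivs is (\<lambda>x. \<rho> x + (\<Sum>n\<in>F. a n * wave (?z n) x)) x"
        by (simp add: \<rho>_def)
      also have "\<dots> = partial_derivs is \<rho> x + partial_derivs is (\<lambda>x. \<Sum>n\<in>F. a n * wave (?z n) x) x"
        by (rule partial_derivs_add[OF open_UNIV s\<rho> ss]) simp
      also have "partial_derivs is (\<lambda>x. \<Sum>n\<in>F. a n * wave (?z n) x) x = (\<Sum>n\<in>F. partial_derivs is (\<lambda>x. a n * wave (?z n) x) x)"
        by (rule partial_derivs_sum[OF open_UNIV sw]) simp
      also have "\<dots> = (\<Sum>n\<in>F. a n * (monomial is (?z n) * wave (?z n) x))"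
        by (simp only: partial_derivs_cmult[OF open_UNIV smooth_on_wave UNIV_I] partial_derivs_wave)
      finally show ?thesis by simp
    qed
    have "cmod (v (\<lambda>y. \<phi> y * wave \<xi> y * \<rho> y)) \<le> K * (c * \<epsilon>)"
    proof (rule K(2)[OF s\<rho>])
      show "0 \<le> c * \<epsilon>" using c \<epsilon> by simp
      fix x assume "x \<in> closure {y. \<phi> y * wave \<xi> y \<noteq> 0}"
      then have "x \<in> ?S" using supp by blast
      then show "jet_norm k \<rho> x \<le> c * \<epsilon>"
        unfolding c_def by (intro jet_norm_le) (simp add: pd app)
    qed
    also have "\<dots> \<le> (K + 1) * ((c + 1) * \<epsilon>)" using K c \<epsilon> by (intro mult_mono) auto
    also have "\<dots> = e" using K c by (simp add: \<epsilon>_def)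
    finally have rem: "cmod (v (\<lambda>y. \<phi> y * wave \<xi> y * \<rho> y)) \<le> e" .
    have t: "(\<lambda>y. \<phi> y * wave (\<xi> + ?z n) y) \<in> test_functions U" for n
      by (rule test_functions_mult[OF \<phi> smooth_on_wave])
    have t': "(\<lambda>y. a n * (\<phi> y * wave (\<xi> + ?z n) y)) \<in> test_functions U" for n
      using test_functions_mult[OF t smooth_on_const, of n "a n"] by (simp add: mult.commute)
    have "(\<lambda>y. \<phi> y * \<psi> y * wave \<xi> y) = (\<lambda>y. \<phi> y * wave \<xi> y * \<rho> y + (\<Sum>n\<in>F. a n * (\<phi> y * wave (\<xi> + ?z n) y)))"
    proof
      fix y
      have "(\<Sum>n\<in>F. a n * (\<phi> y * wave (\<xi> + ?z n) y)) = \<phi> y * wave \<xi> y * (\<Sum>n\<in>F. a n * wave (?z n) y)"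
        unfolding wave_add sum_distrib_left by (intro sum.cong) (auto simp: mult_ac)
      then show "\<phi> y * \<psi> y * wave \<xi> y = \<phi> y * wave \<xi> y * \<rho> y + (\<Sum>n\<in>F. a n * (\<phi> y * wave (\<xi> + ?z n) y))"
        by (simp add: \<rho>_def algebra_simps)
    qed
    then have "?g \<xi> = v (\<lambda>y. \<phi> y * wave \<xi> y * \<rho> y + (\<Sum>n\<in>F. a n * (\<phi> y * wave (\<xi> + ?z n) y)))"
      by (simp add: fourier_cutoff_wave)
    also have "\<dots> = v (\<lambda>y. \<phi> y * wave \<xi> y * \<rho> y) + v (\<lambda>y. \<Sum>n\<in>F. a n * (\<phi> y * wave (\<xi> + ?z n) y))"
      by (rule local_distribution_add[OF v test_functions_mult[OF \<phi>' s\<rho>] test_functions_sum[OF t']])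
    also have "v (\<lambda>y. \<Sum>n\<in>F. a n * (\<phi> y * wave (\<xi> + ?z n) y)) = (\<Sum>n\<in>F. a n * ?f (\<xi> + ?z n))"
      by (simp only: local_distribution_sum[OF v t'] local_distribution_cmult[OF v t] fourier_cutoff_wave)
    finally have eq: "?g \<xi> = v (\<lambda>y. \<phi> y * wave \<xi> y * \<rho> y) + (\<Sum>n\<in>F. a n * ?f (\<xi> + ?z n))" .
    have "cmod (?g \<xi>) \<le> e + cmod (\<Sum>n\<in>F. a n * ?f (\<xi> + ?z n))"
      unfolding eq using rem norm_triangle_ineq[of "v (\<lambda>y. \<phi> y * wave \<xi> y * \<rho> y)" "\<Sum>n\<in>F. a n * ?f (\<xi> + ?z n)"] by linarith
    also have "cmod (\<Sum>n\<in>F. a n * ?f (\<xi> + ?z n)) \<le> (\<Sum>n\<in>F. A n * cmod (?f (\<xi> + ?z n)))"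
      by (rule order.trans[OF norm_sum sum_mono]) (use F(2) in \<open>auto simp: norm_mult intro!: mult_right_mono\<close>)
    finally have "ennreal (cmod (?g \<xi>)) \<le> ennreal (e + (\<Sum>n\<in>F. A n * cmod (?f (\<xi> + ?z n))))"
      by (intro ennreal_leI) simp
    also have "\<dots> = ennreal e + (\<Sum>n\<in>F. ennreal (A n) * ennreal (cmod (?f (\<xi> + ?z n))))"
      using e A(1) by (simp add: ennreal_plus sum_nonneg ennreal_mult sum_ennreal[symmetric])
    also have "(\<Sum>n\<in>F. ennreal (A n) * ennreal (cmod (?f (\<xi> + ?z n)))) =
        (\<integral>\<^sup>+n. (ennreal (A n) * ennreal (cmod (?f (\<xi> + ?z n)))) * indicator F n \<partial>count_space UNIV)"
      by (subst nn_integral_count_space'[OF F(1)]) auto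
    also have "ennreal e + \<dots> \<le> ennreal e + (\<integral>\<^sup>+n. ennreal (A n) * ennreal (cmod (?f (\<xi> + ?z n))) \<partial>count_space UNIV)"
      by (intro add_left_mono nn_integral_mono) (auto simp: indicator_def)
    finally show "ennreal (cmod (?g \<xi>)) \<le> (\<integral>\<^sup>+n. ennreal (A n) * ennreal (cmod (?f (\<xi> + ?z n))) \<partial>count_space UNIV) + ennreal e"
      by (simp only: add.commute)
  qed
  then show ?thesis using that[OF h A] by blast
qed

text \<open>Cauchy-Schwarz with \<open>A n\<close> split into two square roots bounds the square of
  the sum by the total of \<open>A\<close> times a weighted sum of squares. Tonelli then gives a sum
  of masses of translates, each of polynomial size in the shift, against the rapidly decreasing
  \<open>A\<close>.\<close>

lemma sobolev_mass_mult_test_function: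
  assumes v: "local_distribution U v" and \<phi>: "\<phi> \<in> test_functions U" and \<psi>: "\<psi> \<in> test_functions UNIV"
    and [measurable]: "V \<in> sets borel" "V' \<in> sets borel"
    and \<kappa>: "0 < \<kappa>" "\<And>\<xi> \<zeta>. \<xi> \<in> V' \<Longrightarrow> norm \<zeta> \<le> \<kappa> * norm \<xi> \<Longrightarrow> \<xi> + \<zeta> \<in> V"
    and fin: "sobolev_mass V r (fourier_cutoff \<phi> v) < \<infinity>"
  shows "sobolev_mass V' r (fourier_cutoff (\<lambda>y. \<phi> y * \<psi> y) v) < \<infinity>"
proof -
  let ?f = "fourier_cutoff \<phi> v" and ?g = "fourier_cutoff (\<lambda>y. \<phi> y * \<psi> y) v"
  have [measurable]: "?f \<in> borel_measurable borel" by (rule fourier_cutoff_measurable[OF v \<phi>])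
  obtain h A where h: "0 < h" and A: "\<And>n. 0 \<le> A n"
    "\<And>M. \<exists>C. \<forall>n. A n * bracket (h *\<^sub>R lattice_point n) ^ M \<le> C" and
    bd: "\<And>\<xi>. ennreal (cmod (?g \<xi>)) \<le>
      (\<integral>\<^sup>+n. ennreal (A n) * ennreal (cmod (?f (\<xi> + h *\<^sub>R lattice_point n))) \<partial>count_space UNIV)"
    by (rule fourier_cutoff_mult_bound[OF v \<phi> \<psi>]) (rule that)
  let ?z = "\<lambda>n. h *\<^sub>R lattice_point n :: real^'a"
  obtain C N where "0 \<le> C" "\<And>\<xi>. cmod (?f \<xi>) \<le> C * bracket \<xi> ^ N"
    using fourier_cutoff_growth[OF v \<phi>] by blast
  then obtain D M where D: "0 \<le> D" "\<And>\<zeta>. sobolev_mass V' r (\<lambda>\<xi>. ?f (\<xi> + \<zeta>)) \<le> ennreal (D * bracket \<zeta> ^ M)"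
    using sobolev_mass_translate_bound[of ?f V V' C N \<kappa> r, OF _ _ _ _ _ \<kappa> fin] by (metis assms(4,5) \<open>?f \<in> borel_measurable borel\<close>)
  define a where "a = (\<integral>\<^sup>+n. ennreal (A n) \<partial>count_space (UNIV :: (int^'a) set))"
  have a: "a < \<infinity>" using lattice_nn_integral_finite[OF h A, of 0] by (simp add: a_def)
  have pt: "ennreal ((cmod (?g \<xi>))\<^sup>2 * bracket \<xi> powr (2 * r)) * indicator V' \<xi> \<le>
      (\<integral>\<^sup>+n. (a * ennreal (A n)) * (ennreal ((cmod (?f (\<xi> + ?z n)))\<^sup>2 * bracket \<xi> powr (2 * r)) * indicator V' \<xi>) \<partial>count_space UNIV)" for \<xi>
  proof -
    let ?w = "ennreal (bracket \<xi> powr (2 * r)) * indicator V' \<xi>"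
    have "(ennreal (cmod (?g \<xi>)))\<^sup>2 \<le> (\<integral>\<^sup>+n. ennreal (A n) * ennreal (cmod (?f (\<xi> + ?z n))) \<partial>count_space UNIV)\<^sup>2"
      by (rule power_mono[OF bd]) simp
    also have "\<dots> = (\<integral>\<^sup>+n. ennreal (sqrt (A n)) * ennreal (sqrt (A n) * cmod (?f (\<xi> + ?z n))) \<partial>count_space UNIV)\<^sup>2"
      using A(1) by (simp add: ennreal_mult[symmetric] mult.assoc[symmetric])
    also have "\<dots> \<le> (\<integral>\<^sup>+n. (ennreal (sqrt (A n)))\<^sup>2 \<partial>count_space UNIV) * (\<integral>\<^sup>+n. (ennreal (sqrt (A n) * cmod (?f (\<xi> + ?z n))))\<^sup>2 \<partial>count_space UNIV)"
      by (rule Cauchy_Schwarz_nn_integral) auto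
    also have "\<dots> = a * (\<integral>\<^sup>+n. ennreal (A n) * ennreal ((cmod (?f (\<xi> + ?z n)))\<^sup>2) \<partial>count_space UNIV)"
      using A(1) by (simp add: a_def ennreal_power power_mult_distrib ennreal_mult)
    finally have sq: "(ennreal (cmod (?g \<xi>)))\<^sup>2 \<le> a * (\<integral>\<^sup>+n. ennreal (A n) * ennreal ((cmod (?f (\<xi> + ?z n)))\<^sup>2) \<partial>count_space UNIV)" .
    have "ennreal ((cmod (?g \<xi>))\<^sup>2 * bracket \<xi> powr (2 * r)) * indicator V' \<xi> = (ennreal (cmod (?g \<xi>)))\<^sup>2 * ?w"
      by (simp add: ennreal_mult ennreal_power mult.assoc)
    also have "\<dots> \<le> (a * (\<integral>\<^sup>+n. ennreal (A n) * ennreal ((cmod (?f (\<xi> + ?z n)))\<^sup>2) \<partial>count_space UNIV)) * ?w"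
      by (rule mult_right_mono[OF sq]) simp
    also have "\<dots> = (\<integral>\<^sup>+n. a * (ennreal (A n) * ennreal ((cmod (?f (\<xi> + ?z n)))\<^sup>2)) * ?w \<partial>count_space UNIV)"
      by (simp add: nn_integral_cmult[symmetric] nn_integral_multc[symmetric])
    also have "\<dots> = (\<integral>\<^sup>+n. (a * ennreal (A n)) * (ennreal ((cmod (?f (\<xi> + ?z n)))\<^sup>2 * bracket \<xi> powr (2 * r)) * indicator V' \<xi>) \<partial>count_space UNIV)"
      by (intro nn_integral_cong) (simp add: ennreal_mult mult_ac)
    finally show ?thesis .
  qed
  have "sobolev_mass V' r ?g \<le> (\<integral>\<^sup>+\<xi>. (\<integral>\<^sup>+n. (a * ennreal (A n)) * (ennreal ((cmod (?f (\<xi> + ?z n)))\<^sup>2 * bracket \<xi> powr (2 * r)) * indicator V' \<xi>) \<partial>count_space UNIV) \<partial>lborel)"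
    unfolding sobolev_mass_def by (rule nn_integral_mono) (rule pt)
  also have "\<dots> = (\<integral>\<^sup>+n. (\<integral>\<^sup>+\<xi>. (a * ennreal (A n)) * (ennreal ((cmod (?f (\<xi> + ?z n)))\<^sup>2 * bracket \<xi> powr (2 * r)) * indicator V' \<xi>) \<partial>lborel) \<partial>count_space UNIV)"
    by (rule count_space_lborel_Tonelli) measurable
  also have "\<dots> = (\<integral>\<^sup>+n. (a * ennreal (A n)) * sobolev_mass V' r (\<lambda>\<xi>. ?f (\<xi> + ?z n)) \<partial>count_space UNIV)"
    unfolding sobolev_mass_def by (intro nn_integral_cong nn_integral_cmult) measurable
  also have "\<dots> \<le> (\<integral>\<^sup>+n. (a * ennreal D) * ennreal (A n * bracket (?z n) ^ M) \<partial>count_space UNIV)"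
  proof (rule nn_integral_mono)
    fix n
    have "(a * ennreal (A n)) * sobolev_mass V' r (\<lambda>\<xi>. ?f (\<xi> + ?z n)) \<le> (a * ennreal (A n)) * ennreal (D * bracket (?z n) ^ M)"
      by (rule mult_left_mono[OF D(2)]) simp
    also have "\<dots> = (a * ennreal D) * ennreal (A n * bracket (?z n) ^ M)"
      using A(1) D(1) by (simp add: ennreal_mult mult_ac)
    finally show "(a * ennreal (A n)) * sobolev_mass V' r (\<lambda>\<xi>. ?f (\<xi> + ?z n)) \<le> (a * ennreal D) * ennreal (A n * bracket (?z n) ^ M)" .
  qed
  also have "\<dots> = (a * ennreal D) * (\<integral>\<^sup>+n. ennreal (A n * bracket (?z n) ^ M) \<partial>count_space UNIV)"
    by (rule nn_integral_cmult) simp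
  also have "\<dots> < \<infinity>"
    using lattice_nn_integral_finite[OF h A, of M] a by (simp add: ennreal_mult_less_top)
  finally show ?thesis .
qed

lemma sobolev_mass_sum:
  assumes "finite J" "V \<in> sets borel" "\<And>j. j \<in> J \<Longrightarrow> f j \<in> borel_measurable borel"
    "\<And>j. j \<in> J \<Longrightarrow> sobolev_mass V r (f j) < \<infinity>"
  shows "sobolev_mass V r (\<lambda>\<xi>. \<Sum>j\<in>J. f j \<xi>) < \<infinity>"
  using assms(1,3,4)
proof (induction J)
  case empty
  then show ?case by (simp add: sobolev_mass_def)
next
  case (insert j J)
  have "sobolev_mass V r (\<lambda>\<xi>. f j \<xi> + (\<Sum>j\<in>J. f j \<xi>)) < \<infinity>"
    by (rule sobolev_mass_add) (use insert assms(2) in auto)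
  then show ?case using insert by simp
qed

text \<open>Sectors cover nonzero vectors only. The origin is a null set, so it joins the finite
  cover without cost.\<close>

lemma sobolev_mass_cone_cover:
  fixes f :: "real^'m::finite \<Rightarrow> complex"
  assumes f: "f \<in> borel_measurable borel" and H: "finite H" "\<And>\<eta>. \<eta> \<in> H \<Longrightarrow> W \<eta> \<in> sets borel"
    "\<And>\<eta>. \<eta> \<in> H \<Longrightarrow> sobolev_mass (W \<eta>) r f < \<infinity>" and V: "V - {0} \<subseteq> (\<Union>\<eta>\<in>H. W \<eta>)" "V \<in> sets borel"
  shows "sobolev_mass V r f < \<infinity>"
proof -
  have "sobolev_mass {0} r f = (\<integral>\<^sup>+\<xi>. ennreal ((cmod (f 0))\<^sup>2 * bracket (0 :: real^'m) powr (2 * r)) * indicator {0 :: real^'m} \<xi> \<partial>lborel)"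
    unfolding sobolev_mass_def by (rule nn_integral_cong) (auto simp: indicator_def)
  also have "\<dots> = 0" by (simp add: nn_integral_cmult_indicator)
  finally have "sobolev_mass {0} r f < \<infinity>" by simp
  then have 0: "set_integrable lborel {0} (\<lambda>\<xi>. (cmod (f \<xi>))\<^sup>2 * bracket \<xi> powr (2 * r))"
    using sobolev_mass_integrable[OF f, of "{0}"] by simp
  have un: "set_integrable lborel (\<Union>\<eta>\<in>H. W \<eta>) (\<lambda>\<xi>. (cmod (f \<xi>))\<^sup>2 * bracket \<xi> powr (2 * r))"
    by (rule set_integrable_UN) (use H sobolev_mass_integrable[OF f] in auto)
  have m: "(\<Union>\<eta>\<in>H. W \<eta>) \<in> sets borel" by (rule sets.finite_UN) (use H in auto)
  have "set_integrable lborel ({0} \<union> (\<Union>\<eta>\<in>H. W \<eta>)) (\<lambda>\<xi>. (cmod (f \<xi>))\<^sup>2 * bracket \<xi> powr (2 * r))"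
    by (rule set_integrable_Un[OF 0 un]) (use m in simp_all)
  then have "set_integrable lborel V (\<lambda>\<xi>. (cmod (f \<xi>))\<^sup>2 * bracket \<xi> powr (2 * r))"
    by (rule set_integrable_subset) (use V in auto)
  then show ?thesis using sobolev_mass_integrable[OF f V(2)] by simp
qed

section \<open>Regularity near a point and in a sector\<close>

lemma test_functions_subset_domain: "\<phi> \<in> test_functions U \<Longrightarrow> U \<subseteq> U' \<Longrightarrow> \<phi> \<in> test_functions U'"
  unfolding test_functions_def by blast

text \<open>The ball of radius \<open>2 \<delta>\<close> inside \<open>W\<close> leaves room for a
  sector of aperture \<open>\<delta>\<close> whose small relative translates remain in
  \<open>W\<close>.\<close>

lemma WF_sobolev_local_D:
  assumes "local_distribution U v" "y \<in> U" "\<eta> \<noteq> 0" "(y, \<eta>) \<notin> WF_sobolev_local U r v"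
  shows "\<exists>\<phi> W \<delta>. \<phi> \<in> test_functions U \<and> \<phi> y \<noteq> 0 \<and> open W \<and> is_cone W \<and> 0 < \<delta> \<and> \<delta> \<le> (1::real) \<and> ball \<eta> (2 * \<delta>) \<subseteq> W
    \<and> sobolev_mass W r (fourier_cutoff \<phi> v) < \<infinity>"
proof -
  obtain W \<phi> where W: "open W" "is_cone W" "\<eta> \<in> W" "\<phi> \<in> test_functions U" "\<phi> y \<noteq> 0"
    "set_integrable lborel W (\<lambda>\<xi>. (cmod (fourier_cutoff \<phi> v \<xi>))\<^sup>2 * bracket \<xi> powr (2 * r))"
    using assms unfolding WF_sobolev_local_def by blast
  obtain e where e: "0 < e" "ball \<eta> e \<subseteq> W" using W openE by blast
  let ?\<delta> = "min 1 (e / 2)"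
  have "ball \<eta> (2 * ?\<delta>) \<subseteq> ball \<eta> e" by (rule subset_ball) simp
  moreover have "sobolev_mass W r (fourier_cutoff \<phi> v) < \<infinity>"
    using W sobolev_mass_integrable[OF fourier_cutoff_measurable[OF assms(1) W(4)], of W] by simp
  ultimately show ?thesis using W e by (intro exI[of _ \<phi>] exI[of _ W] exI[of _ ?\<delta>]) auto
qed

text \<open>The condition on \<open>\<xi>\<close> describes the sector of aperture
  \<open>\<delta>\<close> around the unit vector \<open>\<eta>\<close>. Adding
  \<open>\<zeta>\<close> changes the vector and its norm by at most \<open>\<delta>/8\<close> each,
  relative to \<open>norm \<xi>\<close>, so the deviation is below
  \<open>(5/4) \<delta> norm \<xi>\<close>. As \<open>norm (\<xi> + \<zeta>)\<close> is at least
  \<open>7/8\<close> of \<open>norm \<xi>\<close>, the deviation relative to the new norm is below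
  \<open>(10/7) \<delta>\<close>, hence below \<open>2 \<delta>\<close>.\<close>

lemma cone_ball_translate:
  fixes \<eta> \<xi> \<zeta> :: "real^'m::finite"
  assumes W: "is_cone W" "ball \<eta> (2 * \<delta>) \<subseteq> W" and \<delta>: "0 < \<delta>" "\<delta> \<le> 1"
    and \<xi>: "norm (\<xi> - norm \<xi> *\<^sub>R \<eta>) < \<delta> * norm \<xi>" and \<zeta>: "norm \<zeta> \<le> \<delta> / 8 * norm \<xi>" and \<eta>: "norm \<eta> = 1"
  shows "\<xi> + \<zeta> \<in> W"
proof -
  let ?x = "\<xi> + \<zeta>"
  have x0: "0 < norm \<xi>" using \<xi> \<delta> by (metis less_eq_real_def mult_zero_right norm_ge_zero not_less)
  have "norm \<xi> - norm \<zeta> \<le> norm ?x" using norm_triangle_ineq4[of ?x \<zeta>] by simp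
  then have lo: "(1 - \<delta> / 8) * norm \<xi> \<le> norm ?x" using \<zeta> by (simp add: algebra_simps)
  have "(7 / 8) * norm \<xi> \<le> (1 - \<delta> / 8) * norm \<xi>" by (rule mult_right_mono) (use \<delta> in auto)
  then have lo2: "(7 / 8) * norm \<xi> \<le> norm ?x" using lo by linarith
  then have pos: "0 < norm ?x" using x0 by linarith
  have "?x - norm ?x *\<^sub>R \<eta> = (\<xi> - norm \<xi> *\<^sub>R \<eta>) + \<zeta> + (norm \<xi> - norm ?x) *\<^sub>R \<eta>"
    by (simp add: algebra_simps)
  then have "norm (?x - norm ?x *\<^sub>R \<eta>) = norm ((\<xi> - norm \<xi> *\<^sub>R \<eta>) + \<zeta> + (norm \<xi> - norm ?x) *\<^sub>R \<eta>)"
    by (rule arg_cong)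
  moreover have "norm ((norm \<xi> - norm ?x) *\<^sub>R \<eta>) = \<bar>norm \<xi> - norm ?x\<bar>" using \<eta> by simp
  ultimately have "norm (?x - norm ?x *\<^sub>R \<eta>) \<le> norm (\<xi> - norm \<xi> *\<^sub>R \<eta>) + norm \<zeta> + \<bar>norm \<xi> - norm ?x\<bar>"
    using norm_triangle_ineq[of "\<xi> - norm \<xi> *\<^sub>R \<eta> + \<zeta>" "(norm \<xi> - norm ?x) *\<^sub>R \<eta>"]
      norm_triangle_ineq[of "\<xi> - norm \<xi> *\<^sub>R \<eta>" \<zeta>] by linarith
  also have "\<bar>norm \<xi> - norm ?x\<bar> \<le> norm \<zeta>"
    using norm_triangle_ineq3[of \<xi> ?x] by simp
  finally have "norm (?x - norm ?x *\<^sub>R \<eta>) < \<delta> * norm \<xi> + \<delta> / 4 * norm \<xi>" using \<xi> \<zeta> by simp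
  also have "\<dots> = (10 / 7) * \<delta> * ((7 / 8) * norm \<xi>)" by simp
  also have "\<dots> \<le> (10 / 7) * \<delta> * norm ?x" by (rule mult_left_mono[OF lo2]) (use \<delta> in simp)
  also have "\<dots> \<le> 2 * \<delta> * norm ?x" by (rule mult_right_mono) (use \<delta> in auto)
  finally have "norm (?x - norm ?x *\<^sub>R \<eta>) < 2 * \<delta> * norm ?x" .
  moreover have "(1 / norm ?x) *\<^sub>R ?x - \<eta> = (1 / norm ?x) *\<^sub>R (?x - norm ?x *\<^sub>R \<eta>)"
    unfolding scaleR_diff_right using pos by simp
  then have "norm ((1 / norm ?x) *\<^sub>R ?x - \<eta>) = (1 / norm ?x) * norm (?x - norm ?x *\<^sub>R \<eta>)"
    using pos by simp
  ultimately have "norm ((1 / norm ?x) *\<^sub>R ?x - \<eta>) < 2 * \<delta>" using pos by (simp add: divide_less_eq)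
  then have "(1 / norm ?x) *\<^sub>R ?x \<in> ball \<eta> (2 * \<delta>)" by (simp add: dist_norm norm_minus_commute)
  then have "(1 / norm ?x) *\<^sub>R ?x \<in> W" using W(2) by blast
  then have "norm ?x *\<^sub>R ((1 / norm ?x) *\<^sub>R ?x) \<in> W" using W(1) pos unfolding is_cone_def by blast
  then show ?thesis using pos by simp
qed

text \<open>Compactness of the unit directions in \<open>V\<close> leaves finitely many cutoffs
  \<open>\<phi> \<eta>\<close>, each good in one sector. The product of their squared moduli
  contains every one of them as a factor, so the remaining factors act as a multiplying test
  function in that sector. Squared moduli make the product nonnegative, which prevents cancellation
  when several such functions are added.\<close>

lemma sobolev_regular_point:
  fixes V :: "(real^'m::finite) set"
  assumes v: "local_distribution U v" and V: "closed V" "is_cone V" and y: "y \<in> U"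
    and reg: "\<And>\<eta>. \<eta> \<in> V \<Longrightarrow> \<eta> \<noteq> 0 \<Longrightarrow> (y, \<eta>) \<notin> WF_sobolev_local U r v"
  shows "\<exists>\<theta> :: real^'m \<Rightarrow> real. smooth_on UNIV (\<lambda>x. complex_of_real (\<theta> x)) \<and> (\<forall>x. 0 \<le> \<theta> x) \<and> 0 < \<theta> y \<and>
    (\<forall>\<rho>\<in>test_functions U. sobolev_mass V r (fourier_cutoff (\<lambda>x. \<rho> x * complex_of_real (\<theta> x)) v) < \<infinity>)"
proof -
  let ?S = "V \<inter> sphere 0 1"
  have S: "compact ?S" by (rule closed_Int_compact[OF V(1) compact_sphere])
  have "\<forall>\<eta>\<in>?S. \<exists>\<phi> W \<delta>. \<phi> \<in> test_functions U \<and> \<phi> y \<noteq> 0 \<and> open W \<and> is_cone W \<and> 0 < \<delta> \<and> \<delta> \<le> (1::real)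
    \<and> ball \<eta> (2 * \<delta>) \<subseteq> W \<and> sobolev_mass W r (fourier_cutoff \<phi> v) < \<infinity>"
  proof
    fix \<eta> assume "\<eta> \<in> ?S"
    then have e: "\<eta> \<in> V" "\<eta> \<noteq> 0" by auto
    show "\<exists>\<phi> W \<delta>. \<phi> \<in> test_functions U \<and> \<phi> y \<noteq> 0 \<and> open W \<and> is_cone W \<and> 0 < \<delta> \<and> \<delta> \<le> (1::real)
      \<and> ball \<eta> (2 * \<delta>) \<subseteq> W \<and> sobolev_mass W r (fourier_cutoff \<phi> v) < \<infinity>"
      by (rule WF_sobolev_local_D[OF v y e(2) reg[OF e]])
  qed
  from bchoice[OF this] obtain \<phi> where "\<forall>\<eta>\<in>?S. \<exists>W \<delta>. \<phi> \<eta> \<in> test_functions U \<and> \<phi> \<eta> y \<noteq> 0 \<and> open W \<and> is_cone W \<and> 0 < \<delta> \<and> \<delta> \<le> (1::real)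
    \<and> ball \<eta> (2 * \<delta>) \<subseteq> W \<and> sobolev_mass W r (fourier_cutoff (\<phi> \<eta>) v) < \<infinity>" ..
  from bchoice[OF this] obtain W where "\<forall>\<eta>\<in>?S. \<exists>\<delta>. \<phi> \<eta> \<in> test_functions U \<and> \<phi> \<eta> y \<noteq> 0 \<and> open (W \<eta>) \<and> is_cone (W \<eta>) \<and> 0 < \<delta> \<and> \<delta> \<le> (1::real)
    \<and> ball \<eta> (2 * \<delta>) \<subseteq> W \<eta> \<and> sobolev_mass (W \<eta>) r (fourier_cutoff (\<phi> \<eta>) v) < \<infinity>" ..
  from bchoice[OF this] obtain \<delta> where *: "\<forall>\<eta>\<in>?S. \<phi> \<eta> \<in> test_functions U \<and> \<phi> \<eta> y \<noteq> 0 \<and> open (W \<eta>) \<and> is_cone (W \<eta>) \<and> 0 < \<delta> \<eta> \<and> \<delta> \<eta> \<le> (1::real)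
    \<and> ball \<eta> (2 * \<delta> \<eta>) \<subseteq> W \<eta> \<and> sobolev_mass (W \<eta>) r (fourier_cutoff (\<phi> \<eta>) v) < \<infinity>" ..
  have "?S \<subseteq> (\<Union>\<eta>\<in>?S. ball \<eta> (\<delta> \<eta>))" using * by auto
  then obtain H where H: "H \<subseteq> ?S" "finite H" "?S \<subseteq> (\<Union>\<eta>\<in>H. ball \<eta> (\<delta> \<eta>))"
    using compactE_image[OF S, of ?S "\<lambda>\<eta>. ball \<eta> (\<delta> \<eta>)"] by blast
  define C where "C \<eta> = {\<xi>. norm (\<xi> - norm \<xi> *\<^sub>R \<eta>) < \<delta> \<eta> * norm \<xi>}" for \<eta>
  define \<theta> where "\<theta> x = (\<Prod>\<eta>\<in>H. (cmod (\<phi> \<eta> x))\<^sup>2)" for x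
  have \<theta>: "complex_of_real (\<theta> x) = (\<Prod>\<eta>\<in>H. \<phi> \<eta> x * cnj (\<phi> \<eta> x))" for x
    by (simp only: \<theta>_def of_real_prod complex_norm_square)
  have sm: "smooth_on UNIV (\<phi> \<eta>)" "smooth_on UNIV (\<lambda>x. cnj (\<phi> \<eta> x))" if "\<eta> \<in> H" for \<eta>
  proof -
    show s: "smooth_on UNIV (\<phi> \<eta>)" using test_functionsD(1) * H that by blast
    show "smooth_on UNIV (\<lambda>x. cnj (\<phi> \<eta> x))" by (rule smooth_on_bounded_linear[OF bounded_linear_cnj open_UNIV s])
  qed
  have sprod: "smooth_on UNIV (\<lambda>x. \<Prod>\<eta>\<in>J. \<phi> \<eta> x * cnj (\<phi> \<eta> x))" if "J \<subseteq> H" for J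
    by (rule smooth_on_prod[OF open_UNIV smooth_on_mult[OF open_UNIV]]) (use sm that in auto)
  show ?thesis
  proof (intro exI[of _ \<theta>] conjI allI ballI)
    show "smooth_on UNIV (\<lambda>x. complex_of_real (\<theta> x))" unfolding \<theta> by (rule sprod) simp
    show "0 \<le> \<theta> x" for x unfolding \<theta>_def by (rule prod_nonneg) simp
    show "0 < \<theta> y" unfolding \<theta>_def by (rule prod_pos) (use * H in auto)
    fix \<rho> assume \<rho>: "\<rho> \<in> test_functions U"
    let ?f = "\<lambda>x. \<rho> x * complex_of_real (\<theta> x)"
    have f: "?f \<in> test_functions U"
      unfolding \<theta> by (rule test_functions_mult[OF \<rho> sprod]) simp
    show "sobolev_mass V r (fourier_cutoff ?f v) < \<infinity>"
    proof (rule sobolev_mass_cone_cover[OF fourier_cutoff_measurable[OF v f] H(2), where W = C])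
      have oC: "open (C \<eta>)" for \<eta>
        unfolding C_def by (intro open_Collect_less continuous_intros)
      show "C \<eta> \<in> sets borel" for \<eta> using oC by simp
      show "V \<in> sets borel" using V(1) by simp
      show "V - {0} \<subseteq> (\<Union>\<eta>\<in>H. C \<eta>)"
      proof
        fix \<xi> assume \<xi>: "\<xi> \<in> V - {0}"
        then have n: "0 < norm \<xi>" by simp
        have "(1 / norm \<xi>) *\<^sub>R \<xi> \<in> V" using V(2) \<xi> n unfolding is_cone_def by simp
        then have "(1 / norm \<xi>) *\<^sub>R \<xi> \<in> ?S" using n by simp
        then obtain \<eta> where \<eta>: "\<eta> \<in> H" "norm (\<eta> - (1 / norm \<xi>) *\<^sub>R \<xi>) < \<delta> \<eta>"
          using H(3) by (auto simp: dist_norm)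
        have "\<xi> - norm \<xi> *\<^sub>R \<eta> = norm \<xi> *\<^sub>R ((1 / norm \<xi>) *\<^sub>R \<xi> - \<eta>)"
          unfolding scaleR_diff_right using n by simp
        then have "norm (\<xi> - norm \<xi> *\<^sub>R \<eta>) = norm \<xi> * norm (\<eta> - (1 / norm \<xi>) *\<^sub>R \<xi>)"
          by (simp add: norm_minus_commute)
        also have "\<dots> < norm \<xi> * \<delta> \<eta>" using \<eta>(2) n by (rule mult_strict_left_mono)
        finally show "\<xi> \<in> (\<Union>\<eta>\<in>H. C \<eta>)" using \<eta>(1) by (auto simp: C_def mult.commute)
      qed
      fix \<eta> assume \<eta>: "\<eta> \<in> H"
      have \<eta>S: "\<eta> \<in> ?S" using \<eta> H by blast
      \<comment> \<open>Everything in \<open>\<rho> \<theta>\<close> except one factor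
        \<open>\<phi> \<eta>\<close>; its conjugate remains from the squared modulus.\<close>
      let ?\<psi> = "\<lambda>x. \<rho> x * (cnj (\<phi> \<eta> x) * (\<Prod>\<eta>\<in>H - {\<eta>}. \<phi> \<eta> x * cnj (\<phi> \<eta> x)))"
      have \<psi>: "?\<psi> \<in> test_functions UNIV"
        by (rule test_functions_mult[OF test_functions_subset_domain[OF \<rho>] smooth_on_mult[OF open_UNIV sm(2)[OF \<eta>] sprod]]) auto
      have eq: "?f = (\<lambda>x. \<phi> \<eta> x * ?\<psi> x)"
        unfolding \<theta> by (rule ext, subst prod.remove[OF H(2) \<eta>]) (simp add: mult_ac)
      show "sobolev_mass (C \<eta>) r (fourier_cutoff ?f v) < \<infinity>"
        unfolding eq
      proof (rule sobolev_mass_mult_test_function[OF v _ \<psi>, where V = "W \<eta>" and \<kappa> = "\<delta> \<eta> / 8"])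
        show "\<phi> \<eta> \<in> test_functions U" "W \<eta> \<in> sets borel" "0 < \<delta> \<eta> / 8"
          "sobolev_mass (W \<eta>) r (fourier_cutoff (\<phi> \<eta>) v) < \<infinity>" using * \<eta>S by auto
        show "C \<eta> \<in> sets borel" using oC by simp
        show "\<xi> + \<zeta> \<in> W \<eta>" if "\<xi> \<in> C \<eta>" "norm \<zeta> \<le> \<delta> \<eta> / 8 * norm \<xi>" for \<xi> \<zeta>
          by (rule cone_ball_translate[of "W \<eta>" \<eta> "\<delta> \<eta>"]) (use * \<eta>S that in \<open>auto simp: C_def\<close>)
      qed
    qed
  qed
qed

text \<open>A finite subcover of the support gives functions \<open>\<theta>\<^sub>y \<ge> 0\<close> with \<open>\<Sum>\<theta>\<^sub>y > 0\<close> on it, and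
  \<open>\<phi> = \<Sum>(\<phi> / \<Sum>\<theta>\<^sub>y) \<theta>\<^sub>y\<close> replaces a partition of unity.\<close>

lemma sobolev_mass_regular:
  fixes V :: "(real^'m::finite) set"
  assumes v: "local_distribution U v" and \<phi>: "\<phi> \<in> test_functions U" and V: "closed V" "is_cone V"
    and reg: "\<And>y \<eta>. y \<in> closure {y. \<phi> y \<noteq> 0} \<Longrightarrow> \<eta> \<in> V \<Longrightarrow> \<eta> \<noteq> 0 \<Longrightarrow> (y, \<eta>) \<notin> WF_sobolev_local U r v"
  shows "sobolev_mass V r (fourier_cutoff \<phi> v) < \<infinity>"
proof -
  let ?K = "closure {y. \<phi> y \<noteq> 0}"
  have K: "compact ?K" "?K \<subseteq> U" using test_functionsD[OF \<phi>] by auto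
  have "\<forall>y\<in>?K. \<exists>\<theta> :: real^'m \<Rightarrow> real. smooth_on UNIV (\<lambda>x. complex_of_real (\<theta> x)) \<and> (\<forall>x. 0 \<le> \<theta> x) \<and> 0 < \<theta> y \<and>
    (\<forall>\<rho>\<in>test_functions U. sobolev_mass V r (fourier_cutoff (\<lambda>x. \<rho> x * complex_of_real (\<theta> x)) v) < \<infinity>)"
    using sobolev_regular_point[OF v V] K(2) reg by blast
  from bchoice[OF this] obtain \<theta> where \<theta>: "\<forall>y\<in>?K. smooth_on UNIV (\<lambda>x. complex_of_real (\<theta> y x)) \<and> (\<forall>x. 0 \<le> \<theta> y x) \<and> 0 < \<theta> y y \<and>
    (\<forall>\<rho>\<in>test_functions U. sobolev_mass V r (fourier_cutoff (\<lambda>x. \<rho> x * complex_of_real (\<theta> y x)) v) < \<infinity>)" ..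
  have op: "open {x. complex_of_real (\<theta> y x) \<noteq> 0}" if "y \<in> ?K" for y
    by (rule open_Collect_neq[OF smooth_on_imp_continuous_on continuous_on_const]) (use \<theta> that in blast)
  have "?K \<subseteq> (\<Union>y\<in>?K. {x. complex_of_real (\<theta> y x) \<noteq> 0})" using \<theta> by force
  then obtain Y where Y: "Y \<subseteq> ?K" "finite Y" "?K \<subseteq> (\<Union>y\<in>Y. {x. complex_of_real (\<theta> y x) \<noteq> 0})"
    using compactE_image[OF K(1), of ?K "\<lambda>y. {x. complex_of_real (\<theta> y x) \<noteq> 0}"] op by blast
  define \<Psi> where "\<Psi> x = (\<Sum>y\<in>Y. complex_of_real (\<theta> y x))" for x
  have s\<Psi>: "smooth_on UNIV \<Psi>" unfolding \<Psi>_def by (rule smooth_on_sum[OF open_UNIV]) (use \<theta> Y in blast)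
  have \<Psi>0: "\<Psi> x \<noteq> 0" if "x \<in> ?K" for x
  proof -
    from subsetD[OF Y(3) that] obtain y where "y \<in> Y" "complex_of_real (\<theta> y x) \<noteq> 0" by blast
    then have y: "y \<in> Y" "\<theta> y x \<noteq> 0" by auto
    have "0 \<le> \<theta> y x" using \<theta> subsetD[OF Y(1) y(1)] by blast
    then have "0 < \<theta> y x" using y(2) by simp
    then have "0 < (\<Sum>y\<in>Y. \<theta> y x)"
      by (intro sum_pos2[OF Y(2) y(1)]) (use \<theta> Y(1) in auto)
    moreover have "\<Psi> x = complex_of_real (\<Sum>y\<in>Y. \<theta> y x)" by (simp add: \<Psi>_def)
    ultimately show ?thesis by (simp only: of_real_eq_0_iff)
  qed
  let ?W = "{x. \<Psi> x \<noteq> 0}"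
  have W: "open ?W" by (rule open_Collect_neq[OF smooth_on_imp_continuous_on[OF s\<Psi>] continuous_on_const])
  define \<rho> where "\<rho> x = \<phi> x * (1 / \<Psi> x)" for x
  have \<rho>: "\<rho> \<in> test_functions U"
    unfolding \<rho>_def
  proof (rule test_functions_mult_local[OF \<phi> W])
    show "smooth_on ?W (\<lambda>x. 1 / \<Psi> x)"
      by (rule smooth_on_divide[OF W smooth_on_const smooth_on_subset[OF s\<Psi>]]) auto
    show "?K \<subseteq> ?W" using \<Psi>0 by blast
  qed
  have t: "(\<lambda>x. \<rho> x * complex_of_real (\<theta> y x)) \<in> test_functions U" if "y \<in> Y" for y
    by (rule test_functions_mult[OF \<rho>]) (use \<theta> Y that in blast)
  have "\<phi> x = (\<Sum>y\<in>Y. \<rho> x * complex_of_real (\<theta> y x))" for x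
  proof (cases "x \<in> ?K")
    case True
    have "(\<Sum>y\<in>Y. \<rho> x * complex_of_real (\<theta> y x)) = \<rho> x * \<Psi> x" by (simp add: \<Psi>_def sum_distrib_left)
    then show ?thesis using \<Psi>0[OF True] by (simp add: \<rho>_def)
  next
    case False
    then have "\<phi> x = 0" by (rule test_functions_zero_outside)
    then show ?thesis by (simp add: \<rho>_def)
  qed
  then have eq: "fourier_cutoff \<phi> v \<xi> = (\<Sum>y\<in>Y. fourier_cutoff (\<lambda>x. \<rho> x * complex_of_real (\<theta> y x)) v \<xi>)" for \<xi>
  proof -
    assume *: "\<And>x. \<phi> x = (\<Sum>y\<in>Y. \<rho> x * complex_of_real (\<theta> y x))"
    have "(\<lambda>x. \<phi> x * wave \<xi> x) = (\<lambda>x. \<Sum>y\<in>Y. \<rho> x * complex_of_real (\<theta> y x) * wave \<xi> x)"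
      unfolding *[abs_def] sum_distrib_right ..
    then show ?thesis
      unfolding fourier_cutoff_wave
      by (simp only: local_distribution_sum[OF v test_functions_mult[OF t smooth_on_wave]])
  qed
  show ?thesis
    unfolding eq[abs_def]
    by (rule sobolev_mass_sum[OF Y(2)]) (use V(1) \<theta> \<rho> Y(1) fourier_cutoff_measurable[OF v t] in auto)
qed

section \<open>Averages over cubes\<close>

text \<open>The Fourier transform of \<open>q\<close> restricted to the cube. The aim is
  \<open>q = 1\<close>; a general \<open>q\<close> is carried along because differentiation
  multiplies it by coordinates of \<open>\<theta>\<close>.\<close>

definition box_transform :: "real^'m::finite \<Rightarrow> (real^'m \<Rightarrow> complex) \<Rightarrow> real^'m \<Rightarrow> complex" where
  "box_transform b q x = integral (cbox 0 b) (\<lambda>\<theta>. q \<theta> * wave \<theta> x)"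

lemma box_integrable:
  fixes f :: "'a::euclidean_space \<Rightarrow> 'b::banach"
  shows "continuous_on UNIV f \<Longrightarrow> f integrable_on cbox a b"
  by (rule integrable_continuous[OF continuous_on_subset]) auto

lemma norm_exp_minus_one: "cmod (exp (- \<i> * of_real t) - 1) \<le> \<bar>t\<bar>"
proof -
  have "exp (- \<i> * of_real t) = exp (\<i> * complex_of_real (- t))" by simp
  then have "cmod (exp (- \<i> * of_real t) - 1) = cmod (exp (\<i> * complex_of_real (- t)) - 1)" by (simp only:)
  also have "\<dots> = 2 * \<bar>sin (- t / 2)\<bar>"
    using dist_exp_i_1[of "- t"] by (simp only: norm_minus_commute)
  also have "\<dots> \<le> \<bar>t\<bar>" using abs_sin_x_le_abs_x[of "- t / 2"] by simp
  finally show ?thesis .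
qed

lemma wave_taylor: "cmod (wave \<theta> (x + v) - wave \<theta> x - (- \<i> * of_real (v \<bullet> \<theta>)) * wave \<theta> x) \<le> (v \<bullet> \<theta>)\<^sup>2"
proof -
  let ?s = "v \<bullet> \<theta>"
  have "wave \<theta> (x + v) - wave \<theta> x - (- \<i> * of_real ?s) * wave \<theta> x = wave \<theta> x * (exp (- \<i> * of_real ?s) - 1 + \<i> * of_real ?s)"
    by (simp add: wave_add_arg) (simp add: wave_def algebra_simps)
  then have "cmod (wave \<theta> (x + v) - wave \<theta> x - (- \<i> * of_real ?s) * wave \<theta> x) = cmod (exp (- \<i> * of_real ?s) - 1 + \<i> * of_real ?s)"
    by (simp add: norm_mult)
  also have "\<dots> \<le> ?s\<^sup>2"
  proof -
    define g where "g t = exp (- \<i> * of_real t) - 1 + \<i> * of_real t" for t :: real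
    have d: "(g has_derivative (\<lambda>h. h *\<^sub>R (- \<i> * (exp (- \<i> * of_real t) - 1)))) (at t within T)" for t T
    proof -
      have l: "((\<lambda>t. - \<i> * complex_of_real t) has_derivative (\<lambda>h. - \<i> * complex_of_real h)) (at t within T)"
        by (auto intro!: derivative_eq_intros)
      have "((\<lambda>t. exp (- \<i> * complex_of_real t)) has_derivative
          (\<lambda>h. exp (- \<i> * of_real t) * (- \<i> * complex_of_real h))) (at t within T)"
        by (rule has_derivative_compose[OF l DERIV_exp[unfolded has_field_derivative_def]])
      then show ?thesis
        unfolding g_def by (auto intro!: derivative_eq_intros simp: scaleR_conv_of_real algebra_simps)
    qed
    have "norm (g ?s - g 0) \<le> \<bar>?s\<bar> * norm (?s - 0)"
    proof (rule differentiable_bound[where S = "closed_segment 0 ?s" and f' = "\<lambda>t h. h *\<^sub>R (- \<i> * (exp (- \<i> * of_real t) - 1))"])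
      show "(g has_derivative (\<lambda>h. h *\<^sub>R (- \<i> * (exp (- \<i> * of_real t) - 1)))) (at t within closed_segment 0 ?s)" for t
        by (rule d)
      fix t assume t: "t \<in> closed_segment 0 ?s"
      have "\<bar>t\<bar> \<le> \<bar>?s\<bar>" using t by (auto simp: closed_segment_eq_real_ivl split: if_splits)
      then have b: "cmod (- \<i> * (exp (- \<i> * of_real t) - 1)) \<le> \<bar>?s\<bar>"
        using norm_exp_minus_one[of t] unfolding norm_mult by simp
      show "onorm (\<lambda>h::real. h *\<^sub>R (- \<i> * (exp (- \<i> * of_real t) - 1))) \<le> \<bar>?s\<bar>"
        by (rule onorm_bound) (use b in \<open>auto simp: mult.commute[of _ "norm _"] norm_mult intro!: mult_right_mono\<close>)
    qed auto
    then show ?thesis by (simp add: g_def power2_eq_square abs_mult_self_eq)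
  qed
  finally show ?thesis .
qed

text \<open>Differentiation under the integral: the second-order remainder of the wave is at most
  \<open>(v \<bullet> \<theta>)^2\<close>, uniformly in \<open>x\<close>, and both \<open>q\<close>
  and \<open>\<theta>\<close> are bounded on the cube.\<close>

lemma box_transform_has_derivative:
  fixes q :: "real^'m::finite \<Rightarrow> complex"
  assumes q: "continuous_on UNIV q"
  shows "(box_transform b q has_derivative
    (\<lambda>v. \<Sum>i\<in>UNIV. v $ i *\<^sub>R box_transform b (\<lambda>\<theta>. q \<theta> * (- \<i> * of_real (\<theta> $ i))) x)) (at x)"
proof -
  let ?Q = "cbox 0 b"
  let ?D = "\<lambda>v. \<Sum>i\<in>UNIV. v $ i *\<^sub>R box_transform b (\<lambda>\<theta>. q \<theta> * (- \<i> * of_real (\<theta> $ i))) x"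
  have ci: "continuous_on UNIV (\<lambda>\<theta>. q \<theta> * (- \<i> * of_real (\<theta> $ i)))" for i
    by (intro continuous_intros q)
  have bd: "bounded (q ` ?Q)" "bounded ?Q"
    using compact_continuous_image[OF continuous_on_subset[OF q] compact_cbox] by (simp_all add: compact_imp_bounded)
  obtain B where B: "\<And>\<theta>. \<theta> \<in> ?Q \<Longrightarrow> cmod (q \<theta>) \<le> B" using bd(1) unfolding bounded_iff by auto
  obtain L where L: "\<And>\<theta>. \<theta> \<in> ?Q \<Longrightarrow> norm \<theta> \<le> L" using bd(2) unfolding bounded_iff by auto
  define C where "C = \<bar>B\<bar> * L\<^sup>2 * measure lborel ?Q"
  have D: "?D v = integral ?Q (\<lambda>\<theta>. q \<theta> * ((- \<i> * of_real (v \<bullet> \<theta>)) * wave \<theta> x))" for v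
  proof -
    have "?D v = (\<Sum>i\<in>UNIV. integral ?Q (\<lambda>\<theta>. v $ i *\<^sub>R (q \<theta> * (- \<i> * of_real (\<theta> $ i)) * wave \<theta> x)))"
      by (simp add: box_transform_def)
    also have "\<dots> = integral ?Q (\<lambda>\<theta>. \<Sum>i\<in>UNIV. v $ i *\<^sub>R (q \<theta> * (- \<i> * of_real (\<theta> $ i)) * wave \<theta> x))"
      by (rule integral_sum[symmetric]) (auto intro!: box_integrable continuous_intros q)
    also have "(\<lambda>\<theta>. \<Sum>i\<in>UNIV. v $ i *\<^sub>R (q \<theta> * (- \<i> * of_real (\<theta> $ i)) * wave \<theta> x)) =
        (\<lambda>\<theta>. q \<theta> * ((- \<i> * of_real (v \<bullet> \<theta>)) * wave \<theta> x))"
      by (simp add: fun_eq_iff inner_vec_def scaleR_conv_of_real sum_distrib_left sum_distrib_right sum_negf mult_ac)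
    finally show ?thesis .
  qed
  have rem: "cmod (box_transform b q y - box_transform b q x - ?D (y - x)) \<le> C * (norm (y - x))\<^sup>2" for y
  proof -
    let ?v = "y - x"
    let ?R = "\<lambda>\<theta>. q \<theta> * (wave \<theta> (x + ?v) - wave \<theta> x - (- \<i> * of_real (?v \<bullet> \<theta>)) * wave \<theta> x)"
    let ?r = "\<lambda>\<theta>. q \<theta> * ((- \<i> * of_real (?v \<bullet> \<theta>)) * wave \<theta> x)"
    have i: "(\<lambda>\<theta>. q \<theta> * wave \<theta> z) integrable_on ?Q" "?r integrable_on ?Q" for z
      by (rule box_integrable, intro continuous_intros q)+
    have "box_transform b q y - box_transform b q x - ?D ?v =
        integral ?Q (\<lambda>\<theta>. q \<theta> * wave \<theta> y) - integral ?Q (\<lambda>\<theta>. q \<theta> * wave \<theta> x) - integral ?Q ?r"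
      unfolding D by (simp only: box_transform_def)
    also have "\<dots> = integral ?Q (\<lambda>\<theta>. q \<theta> * wave \<theta> y - q \<theta> * wave \<theta> x - ?r \<theta>)"
      by (simp only: integral_diff integrable_diff i)
    also have "\<dots> = integral ?Q ?R" by (simp add: right_diff_distrib distrib_left)
    also have "cmod \<dots> \<le> (\<bar>B\<bar> * (L\<^sup>2 * (norm ?v)\<^sup>2)) * measure lborel ?Q"
    proof (rule integrable_bound)
      show "0 \<le> \<bar>B\<bar> * (L\<^sup>2 * (norm ?v)\<^sup>2)" by simp
      show "?R integrable_on ?Q" by (intro box_integrable continuous_intros q)
      fix \<theta> assume \<theta>: "\<theta> \<in> ?Q"
      have "\<bar>?v \<bullet> \<theta>\<bar> \<le> L * norm ?v"
        using Cauchy_Schwarz_ineq2[of ?v \<theta>] mult_left_mono[OF L[OF \<theta>] norm_ge_zero[of ?v]] by (simp add: mult.commute)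
      then have "(?v \<bullet> \<theta>)\<^sup>2 \<le> (L * norm ?v)\<^sup>2" using power_mono[of "\<bar>?v \<bullet> \<theta>\<bar>" "L * norm ?v" 2] by simp
      then have "cmod (wave \<theta> (x + ?v) - wave \<theta> x - (- \<i> * of_real (?v \<bullet> \<theta>)) * wave \<theta> x) \<le> L\<^sup>2 * (norm ?v)\<^sup>2"
        using wave_taylor[of \<theta> x ?v] by (simp add: power_mult_distrib)
      then show "cmod (?R \<theta>) \<le> \<bar>B\<bar> * (L\<^sup>2 * (norm ?v)\<^sup>2)"
        unfolding norm_mult using B[OF \<theta>] by (intro mult_mono) auto
    qed
    finally show ?thesis by (simp add: C_def mult_ac)
  qed
  show ?thesis
  proof (rule has_derivativeI_sandwich[where e = 1 and H = "\<lambda>y. C * norm (y - x)"])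
    show "bounded_linear ?D"
      by (intro bounded_linear_sum bounded_linear_scaleR_const bounded_linear_vec_nth)
    show "((\<lambda>y. C * norm (y - x)) \<longlongrightarrow> 0) (at x within UNIV)"
      by (auto intro!: tendsto_eq_intros)
    fix y assume "y \<noteq> x"
    then have "cmod (box_transform b q y - box_transform b q x - ?D (y - x)) / norm (y - x) \<le> (C * (norm (y - x))\<^sup>2) / norm (y - x)"
      by (intro divide_right_mono rem) simp
    then show "cmod (box_transform b q y - box_transform b q x - ?D (y - x)) / norm (y - x) \<le> C * norm (y - x)"
      using \<open>y \<noteq> x\<close> by (simp add: power2_eq_square)
  qed simp
qed

lemma partial_deriv_box_transform:
  assumes "continuous_on UNIV q"
  shows "partial_deriv i (box_transform b q) = box_transform b (\<lambda>\<theta>. q \<theta> * (- \<i> * of_real (\<theta> $ i)))"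
proof
  fix x
  show "partial_deriv i (box_transform b q) x = box_transform b (\<lambda>\<theta>. q \<theta> * (- \<i> * of_real (\<theta> $ i))) x"
    unfolding partial_deriv_eq[OF box_transform_has_derivative[OF assms]]
    by (simp add: axis_def if_distrib[of "\<lambda>c. c *\<^sub>R _"] cong: if_cong)
qed

lemma smooth_on_box_transform:
  assumes "continuous_on UNIV q" shows "smooth_on UNIV (box_transform b q)"
proof (rule smooth_on_coinduct[OF open_UNIV, where Q = "{box_transform b q | q. continuous_on UNIV q}"])
  show "box_transform b q \<in> {box_transform b q | q. continuous_on UNIV q}" using assms by blast
  show "g differentiable at y" if "g \<in> {box_transform b q | q. continuous_on UNIV q}" for g y
    using that box_transform_has_derivative unfolding differentiable_def by blast
  show "\<exists>h\<in>{box_transform b q | q. continuous_on UNIV q}. \<forall>y\<in>UNIV. partial_deriv i g y = h y"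
    if g: "g \<in> {box_transform b q | q. continuous_on UNIV q}" for g i
  proof -
    obtain q where q: "g = box_transform b q" "continuous_on UNIV q" using g by blast
    have "continuous_on UNIV (\<lambda>\<theta>. q \<theta> * (- \<i> * of_real (\<theta> $ i)))" by (intro continuous_intros q(2))
    then have "partial_deriv i g \<in> {box_transform b q | q. continuous_on UNIV q}"
      unfolding q(1) partial_deriv_box_transform[OF q(2)] by blast
    then show ?thesis by blast
  qed
qed

lemma partial_derivs_box_transform:
  "partial_derivs is (box_transform b (\<lambda>_. 1)) = box_transform b (monomial is)"
proof (induction "is")
  case Nil
  show ?case by (simp add: monomial_def box_transform_def fun_eq_iff)
next
  case (Cons i "is")
  have c: "continuous_on UNIV (monomial is)" by (intro continuous_intros)
  have "(\<lambda>\<theta>. monomial is \<theta> * (- \<i> * of_real (\<theta> $ i))) = monomial (i # is)"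
    by (simp add: monomial_def fun_eq_iff)
  then show ?case unfolding partial_derivs_Cons Cons.IH partial_deriv_box_transform[OF c] by (simp only:)
qed

lemma Riemann_sum_bound:
  fixes G :: "'a::euclidean_space \<Rightarrow> 'b::banach"
  assumes G: "continuous_on UNIV G" and p: "p tagged_division_of cbox a b" and e: "0 \<le> e"
    and close: "\<And>t k \<theta>. (t, k) \<in> p \<Longrightarrow> \<theta> \<in> k \<Longrightarrow> norm (G \<theta> - G t) \<le> e"
  shows "norm (integral (cbox a b) G - (\<Sum>(t, k)\<in>p. measure lborel k *\<^sub>R G t)) \<le> e * measure lborel (cbox a b)"
proof -
  have "integral (cbox a b) G = (\<Sum>(t, k)\<in>p. integral k G)"
    by (rule integral_combine_tagged_division_topdown[OF box_integrable[OF G] p])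
  then have "integral (cbox a b) G - (\<Sum>(t, k)\<in>p. measure lborel k *\<^sub>R G t) = (\<Sum>(t, k)\<in>p. integral k G - measure lborel k *\<^sub>R G t)"
    by (simp add: sum_subtractf case_prod_unfold)
  also have "norm \<dots> \<le> (\<Sum>(t, k)\<in>p. e * measure lborel k)"
  proof (rule sum_norm_le, clarsimp)
    fix t k assume tk: "(t, k) \<in> p"
    obtain c d where k: "k = cbox c d" using tagged_division_ofD(4)[OF p tk] by blast
    have "integral k G - measure lborel k *\<^sub>R G t = integral k (\<lambda>\<theta>. G \<theta> - G t)"
      unfolding k by (subst integral_diff[OF box_integrable[OF G]]) auto
    also have "norm \<dots> \<le> e * measure lborel k"
      unfolding k by (rule integrable_bound[OF e box_integrable])
        (use G close[OF tk] k in \<open>auto intro!: continuous_intros\<close>)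
    finally show "norm (integral k G - measure lborel k *\<^sub>R G t) \<le> e * measure lborel k" .
  qed
  also have "\<dots> = e * measure lborel (cbox a b)"
    using additive_content_tagged_division[OF p] by (simp add: sum_distrib_left[symmetric] case_prod_unfold)
  finally show ?thesis .
qed

text \<open>The functional passes through the integral over \<open>\<theta>\<close> because Riemann
  sums of waves converge to the box transform with all derivatives up to the order of the
  distribution, uniformly on the support. One tagged division is fine enough both for this limit and
  for the integral of the continuous Fourier transform.\<close>

lemma fourier_cutoff_box_transform:
  fixes \<phi> :: "real^'m::finite \<Rightarrow> complex"
  assumes v: "local_distribution U v" and \<phi>: "\<phi> \<in> test_functions U"
  shows "fourier_cutoff (\<lambda>y. \<phi> y * box_transform b (\<lambda>_. 1) y) v \<xi> =
    integral (cbox 0 b) (\<lambda>\<theta>. fourier_cutoff \<phi> v (\<xi> + \<theta>))"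
proof -
  let ?Q = "cbox 0 b" and ?k = "box_transform b (\<lambda>_. 1)" and ?f = "fourier_cutoff \<phi> v"
  let ?L = "fourier_cutoff (\<lambda>y. \<phi> y * ?k y) v \<xi>" and ?R = "integral ?Q (\<lambda>\<theta>. ?f (\<xi> + \<theta>))"
  have \<phi>': "(\<lambda>y. \<phi> y * wave \<xi> y) \<in> test_functions U" by (rule test_functions_mult[OF \<phi> smooth_on_wave])
  let ?S = "closure {y. \<phi> y * wave \<xi> y \<noteq> 0}"
  obtain K n where K: "0 \<le> K" "\<And>\<rho> M. smooth_on UNIV \<rho> \<Longrightarrow> 0 \<le> M \<Longrightarrow>
    (\<And>x. x \<in> ?S \<Longrightarrow> jet_norm n \<rho> x \<le> M) \<Longrightarrow> cmod (v (\<lambda>y. \<phi> y * wave \<xi> y * \<rho> y)) \<le> K * M"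
    using local_distribution_bound[OF v \<phi>'] by blast
  define c where "c = real (card {is :: 'm list. length is \<le> n})"
  have c: "0 \<le> c" by (simp add: c_def)
  have cf: "continuous_on UNIV (\<lambda>\<theta>. ?f (\<xi> + \<theta>))"
    by (rule continuous_on_compose2[OF continuous_fourier_cutoff[OF v \<phi>]]) (auto intro!: continuous_intros)
  have sk: "smooth_on UNIV ?k" by (rule smooth_on_box_transform) simp
  have "cmod (?L - ?R) \<le> 0"
  proof (rule field_le_epsilon)
    fix \<epsilon> :: real assume \<epsilon>: "0 < \<epsilon>"
    define e where "e = \<epsilon> / ((K * c + 1) * (measure lborel ?Q + 1))"
    have pos: "0 < K * c + 1" "0 < measure lborel ?Q + 1" using K c by (auto intro: add_nonneg_pos)
    have e: "0 < e" using \<epsilon> pos by (simp add: e_def)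
    obtain d where d: "0 < d" "\<And>\<theta> \<theta>' x is. \<theta> \<in> ?Q \<Longrightarrow> \<theta>' \<in> ?Q \<Longrightarrow> x \<in> ?S \<Longrightarrow> dist \<theta> \<theta>' < d \<Longrightarrow>
      length is \<le> n \<Longrightarrow> cmod (monomial is \<theta> * wave \<theta> x - monomial is \<theta>' * wave \<theta>' x) < e"
      using wave_uniform[OF test_functionsD(2)[OF \<phi>'] compact_cbox e] by blast
    have "uniformly_continuous_on ?Q (\<lambda>\<theta>. ?f (\<xi> + \<theta>))"
      by (rule compact_uniformly_continuous[OF continuous_on_subset[OF cf] compact_cbox]) simp
    then obtain d' where d': "0 < d'" "\<forall>\<theta>\<in>?Q. \<forall>\<theta>'\<in>?Q. dist \<theta>' \<theta> < d' \<longrightarrow> dist (?f (\<xi> + \<theta>')) (?f (\<xi> + \<theta>)) < e"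
      using e unfolding uniformly_continuous_on_def by blast
    have "gauge (\<lambda>x :: real^'m. ball x (min d d'))" using d(1) d'(1) by (intro gauge_ball) simp
    then obtain p where p: "p tagged_division_of ?Q" "(\<lambda>x. ball x (min d d')) fine p"
      using fine_division_exists by blast
    have near: "\<theta> \<in> ?Q \<and> t \<in> ?Q \<and> dist \<theta> t < d \<and> dist \<theta> t < d'" if "(t, k) \<in> p" "\<theta> \<in> k" for t k \<theta>
    proof -
      have "k \<subseteq> ?Q" "t \<in> k" using tagged_division_ofD[OF p(1)] that(1) by blast+
      moreover have "k \<subseteq> ball t (min d d')" using p(2) that(1) unfolding fine_def by blast
      ultimately show ?thesis using that(2) by (auto simp: dist_commute)
    qed
    have fin: "finite p" using p(1) by (rule tagged_division_of_finite)
    let ?s = "\<lambda>x. \<Sum>(t, k)\<in>p. complex_of_real (measure lborel k) * wave t x"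
    have sw: "smooth_on UNIV (\<lambda>x. complex_of_real (measure lborel (snd z)) * wave (fst z) x)" for z :: "(real^'m) \<times> (real^'m) set"
      by (rule smooth_on_mult[OF open_UNIV smooth_on_const smooth_on_wave])
    have ss: "smooth_on UNIV ?s"
      unfolding case_prod_unfold by (rule smooth_on_sum[OF open_UNIV sw])
    define \<rho> where "\<rho> x = ?k x - ?s x" for x
    have s\<rho>: "smooth_on UNIV \<rho>" unfolding \<rho>_def by (rule smooth_on_diff[OF open_UNIV sk ss])
    have pd: "partial_derivs is \<rho> x = box_transform b (monomial is) x - (\<Sum>(t, k)\<in>p. measure lborel k *\<^sub>R (monomial is t * wave t x))" for "is" x
    proof -
      have "partial_derivs is ?k x = partial_derivs is (\<lambda>x. \<rho> x + ?s x) x" by (simp add: \<rho>_def)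
      also have "\<dots> = partial_derivs is \<rho> x + partial_derivs is ?s x"
        by (rule partial_derivs_add[OF open_UNIV s\<rho> ss]) simp
      also have "partial_derivs is ?s x = (\<Sum>z\<in>p. partial_derivs is (\<lambda>x. complex_of_real (measure lborel (snd z)) * wave (fst z) x) x)"
        unfolding case_prod_unfold by (rule partial_derivs_sum[OF open_UNIV sw]) simp
      also have "\<dots> = (\<Sum>z\<in>p. measure lborel (snd z) *\<^sub>R (monomial is (fst z) * wave (fst z) x))"
        by (simp only: partial_derivs_cmult[OF open_UNIV smooth_on_wave UNIV_I] partial_derivs_wave scaleR_conv_of_real)
      finally show ?thesis unfolding partial_derivs_box_transform by (simp add: case_prod_unfold)
    qed
    have 1: "cmod (v (\<lambda>y. \<phi> y * wave \<xi> y * \<rho> y)) \<le> K * (c * (e * measure lborel ?Q))"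
    proof (rule K(2)[OF s\<rho>])
      show "0 \<le> c * (e * measure lborel ?Q)" using c e by simp
      fix x assume x: "x \<in> ?S"
      show "jet_norm n \<rho> x \<le> c * (e * measure lborel ?Q)"
        unfolding c_def
      proof (rule jet_norm_le)
        fix "is" :: "'m list" assume l: "length is \<le> n"
        show "cmod (partial_derivs is \<rho> x) \<le> e * measure lborel ?Q"
          unfolding pd box_transform_def
        proof (rule Riemann_sum_bound[OF _ p(1)])
          show "continuous_on UNIV (\<lambda>\<theta>. monomial is \<theta> * wave \<theta> x)" by (intro continuous_intros)
          show "norm (monomial is \<theta> * wave \<theta> x - monomial is t * wave t x) \<le> e" if "(t, k) \<in> p" "\<theta> \<in> k" for t k \<theta>
            using d(2)[of \<theta> t x "is"] near[OF that] x l by simp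
        qed (use e in simp)
      qed
    qed
    have 2: "cmod (?R - (\<Sum>(t, k)\<in>p. measure lborel k *\<^sub>R ?f (\<xi> + t))) \<le> e * measure lborel ?Q"
    proof (rule Riemann_sum_bound[OF cf p(1)])
      show "norm (?f (\<xi> + \<theta>) - ?f (\<xi> + t)) \<le> e" if "(t, k) \<in> p" "\<theta> \<in> k" for t k \<theta>
        using d'(2) near[OF that] by (simp add: dist_norm less_imp_le)
    qed (use e in simp)
    have t: "(\<lambda>y. \<phi> y * wave (\<xi> + \<theta>) y) \<in> test_functions U" for \<theta>
      by (rule test_functions_mult[OF \<phi> smooth_on_wave])
    have t': "(\<lambda>y. a * (\<phi> y * wave (\<xi> + \<theta>) y)) \<in> test_functions U" for a \<theta>
      using test_functions_mult[OF t smooth_on_const, of \<theta> a] by (simp add: mult.commute)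
    let ?g = "\<lambda>z y. complex_of_real (measure lborel (snd z)) * (\<phi> y * wave (\<xi> + fst z) y)"
    have "(\<lambda>y. \<phi> y * ?k y * wave \<xi> y) = (\<lambda>y. \<phi> y * wave \<xi> y * \<rho> y + (\<Sum>z\<in>p. ?g z y))"
    proof
      fix y
      have "(\<Sum>z\<in>p. ?g z y) = \<phi> y * wave \<xi> y * ?s y"
        unfolding wave_add sum_distrib_left case_prod_unfold by (intro sum.cong) (auto simp: mult_ac)
      then show "\<phi> y * ?k y * wave \<xi> y = \<phi> y * wave \<xi> y * \<rho> y + (\<Sum>z\<in>p. ?g z y)"
        by (simp add: \<rho>_def algebra_simps)
    qed
    then have "?L = v (\<lambda>y. \<phi> y * wave \<xi> y * \<rho> y + (\<Sum>z\<in>p. ?g z y))" by (simp only: fourier_cutoff_wave)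
    also have "\<dots> = v (\<lambda>y. \<phi> y * wave \<xi> y * \<rho> y) + v (\<lambda>y. \<Sum>z\<in>p. ?g z y)"
      by (rule local_distribution_add[OF v test_functions_mult[OF \<phi>' s\<rho>] test_functions_sum[OF t']])
    also have "v (\<lambda>y. \<Sum>z\<in>p. ?g z y) = (\<Sum>(t, k)\<in>p. measure lborel k *\<^sub>R ?f (\<xi> + t))"
      by (simp only: local_distribution_sum[OF v t'] local_distribution_cmult[OF v t] fourier_cutoff_wave
          scaleR_conv_of_real case_prod_unfold)
    finally have L: "?L = v (\<lambda>y. \<phi> y * wave \<xi> y * \<rho> y) + (\<Sum>(t, k)\<in>p. measure lborel k *\<^sub>R ?f (\<xi> + t))" .
    have "?L - ?R = v (\<lambda>y. \<phi> y * wave \<xi> y * \<rho> y) - (?R - (\<Sum>(t, k)\<in>p. measure lborel k *\<^sub>R ?f (\<xi> + t)))"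
      unfolding L by simp
    then have "cmod (?L - ?R) \<le> cmod (v (\<lambda>y. \<phi> y * wave \<xi> y * \<rho> y)) + cmod (?R - (\<Sum>(t, k)\<in>p. measure lborel k *\<^sub>R ?f (\<xi> + t)))"
      by (simp only: norm_triangle_ineq4)
    also have "\<dots> \<le> K * (c * (e * measure lborel ?Q)) + e * measure lborel ?Q" by (rule add_mono[OF 1 2])
    also have "\<dots> = (K * c + 1) * measure lborel ?Q * e" by (simp add: algebra_simps)
    also have "\<dots> \<le> (K * c + 1) * (measure lborel ?Q + 1) * e"
      using pos e by (intro mult_right_mono mult_left_mono) auto
    also have "\<dots> = \<epsilon>" using pos by (simp add: e_def)
    finally show "cmod (?L - ?R) \<le> 0 + \<epsilon>" by simp
  qed
  then show ?thesis by simp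
qed

text \<open>On the support a small cube keeps the wave within \<open>1/2\<close> of
  \<open>1\<close>, so the box transform differs from the volume by at most half the volume and has
  no zeros there; dividing by it gives \<open>\<phi>'\<close>. Neither the cube nor
  \<open>\<phi>'\<close> depends on the distribution, as an estimate between seminorms
  requires.\<close>

lemma fourier_cutoff_average:
  fixes \<phi> :: "real^'m::finite \<Rightarrow> complex"
  assumes \<phi>: "\<phi> \<in> test_functions U"
  shows "\<exists>b \<phi>'. \<phi>' \<in> test_functions U \<and> {y. \<phi>' y \<noteq> 0} \<subseteq> {y. \<phi> y \<noteq> 0} \<and>
    (\<forall>v \<xi>. local_distribution U v \<longrightarrow>
      fourier_cutoff \<phi> v \<xi> = integral (cbox 0 b) (\<lambda>\<theta>. fourier_cutoff \<phi>' v (\<xi> + \<theta>)))"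
proof -
  let ?S = "closure {y. \<phi> y \<noteq> 0}"
  have "bounded ?S" using test_functionsD(2)[OF \<phi>] by (rule compact_imp_bounded)
  then obtain R where R: "\<And>x. x \<in> ?S \<Longrightarrow> norm x \<le> R" unfolding bounded_iff by blast
  \<comment> \<open>The side is fitted to \<open>\<bar>x \<bullet> \<theta>\<bar> \<le> norm x *
    norm \<theta> \<le> 1/2\<close>, where the l1 norm bounds \<open>norm \<theta>\<close> by the
    dimension times \<open>c\<close>. The summand \<open>1\<close> keeps the denominator
    positive.\<close>
  define c where "c = 1 / (2 * (\<bar>R\<bar> + 1) * real CARD('m))"
  have c: "0 < c" "(\<bar>R\<bar> + 1) * (real CARD('m) * c) = 1 / 2"
    by (auto simp: c_def divide_simps)
  define b :: "real^'m" where "b = (\<chi> i. c)"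
  let ?Q = "cbox 0 b" and ?k = "box_transform b (\<lambda>_. 1)"
  have vol: "0 < measure lborel ?Q"
  proof (rule content_pos_lt, rule ballI)
    fix i :: "real^'m" assume "i \<in> Basis"
    then show "0 \<bullet> i < b \<bullet> i" using c by (auto simp: Basis_vec_def b_def inner_axis)
  qed
  have nz: "?k x \<noteq> 0" if x: "x \<in> ?S" for x
  proof
    assume k0: "?k x = 0"
    have i: "(\<lambda>\<theta>. wave \<theta> x) integrable_on ?Q" by (intro box_integrable continuous_intros)
    have i1: "(\<lambda>\<theta>. 1 :: complex) integrable_on ?Q" by (intro box_integrable continuous_intros)
    have "integral ?Q (\<lambda>\<theta>. wave \<theta> x - 1) = ?k x - of_real (measure lborel ?Q)"
      by (simp add: integral_diff[OF i i1] box_transform_def integral_const scaleR_conv_of_real)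
    moreover have "cmod (integral ?Q (\<lambda>\<theta>. wave \<theta> x - 1)) \<le> 1 / 2 * measure lborel ?Q"
    proof (rule integrable_bound)
      show "(\<lambda>\<theta>. wave \<theta> x - 1) integrable_on ?Q" by (rule integrable_diff[OF i i1])
      fix \<theta> assume \<theta>: "\<theta> \<in> ?Q"
      then have \<theta>i: "0 \<le> \<theta> $ i" "\<theta> $ i \<le> c" for i by (auto simp: mem_box_cart b_def)
      have "norm \<theta> \<le> (\<Sum>i\<in>UNIV. \<bar>\<theta> $ i\<bar>)" by (rule norm_le_l1_cart)
      also have "\<dots> \<le> (\<Sum>i\<in>(UNIV :: 'm set). c)" by (rule sum_mono) (use \<theta>i in simp)
      finally have n\<theta>: "norm \<theta> \<le> real CARD('m) * c" by simp
      have "\<bar>x \<bullet> \<theta>\<bar> \<le> norm x * norm \<theta>" by (rule Cauchy_Schwarz_ineq2)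
      also have "\<dots> \<le> (\<bar>R\<bar> + 1) * (real CARD('m) * c)" using R[OF x] n\<theta> by (intro mult_mono) auto
      finally have "\<bar>x \<bullet> \<theta>\<bar> \<le> 1 / 2" unfolding c(2) .
      then show "cmod (wave \<theta> x - 1) \<le> 1 / 2"
        using norm_exp_minus_one[of "x \<bullet> \<theta>"] unfolding wave_def by linarith
    qed simp
    ultimately show False using k0 vol by simp
  qed
  let ?W = "{x. ?k x \<noteq> 0}"
  have sk: "smooth_on UNIV ?k" by (rule smooth_on_box_transform) simp
  have W: "open ?W"
    by (rule open_Collect_neq[OF smooth_on_imp_continuous_on[OF sk] continuous_on_const])
  have sW: "smooth_on ?W (\<lambda>y. 1 / ?k y)"
    by (rule smooth_on_divide[OF W smooth_on_const smooth_on_subset[OF sk]]) auto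
  define \<phi>' where "\<phi>' y = \<phi> y * (1 / ?k y)" for y
  have \<phi>': "\<phi>' \<in> test_functions U"
    unfolding \<phi>'_def by (rule test_functions_mult_local[OF \<phi> W sW]) (use nz in blast)
  have eq: "\<phi> = (\<lambda>y. \<phi>' y * ?k y)"
  proof
    fix y
    show "\<phi> y = \<phi>' y * ?k y"
    proof (cases "\<phi> y = 0")
      case False
      then have "?k y \<noteq> 0" using nz closure_subset[of "{y. \<phi> y \<noteq> 0}"] by blast
      then show ?thesis by (simp add: \<phi>'_def)
    qed (simp add: \<phi>'_def)
  qed
  have sub: "{y. \<phi>' y \<noteq> 0} \<subseteq> {y. \<phi> y \<noteq> 0}" by (auto simp: \<phi>'_def)
  have "fourier_cutoff \<phi> v \<xi> = integral ?Q (\<lambda>\<theta>. fourier_cutoff \<phi>' v (\<xi> + \<theta>))"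
    if "local_distribution U v" for v \<xi>
    by (subst eq) (rule fourier_cutoff_box_transform[OF that \<phi>'])
  then show ?thesis using \<phi>' sub by (intro exI[of _ b] exI[of _ \<phi>']) auto
qed

section \<open>From square integrals to pointwise bounds and back\<close>

lemma integral_square_le:
  fixes g :: "'a::euclidean_space \<Rightarrow> real"
  assumes "continuous_on UNIV g"
  shows "(integral (cbox a b) g)\<^sup>2 \<le> measure lborel (cbox a b) * integral (cbox a b) (\<lambda>x. (g x)\<^sup>2)"
proof (cases "measure lborel (cbox a b) = 0")
  case True
  then show ?thesis using integral_null[of a b g] by simp
next
  case False
  let ?Q = "cbox a b" and ?m = "measure lborel (cbox a b)"
  have m: "0 < ?m" using False by (simp add: less_le)
  have i: "g integrable_on ?Q" "(\<lambda>x. (g x)\<^sup>2) integrable_on ?Q"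
    by (intro box_integrable continuous_intros assms)+
  define I where "I = integral ?Q g"
  \<comment> \<open>Expanding this square and integrating gives the volume times the difference of
    the two sides of the claim.\<close>
  have "0 \<le> integral ?Q (\<lambda>x. (?m * g x - I)\<^sup>2)"
    by (rule integral_nonneg) (auto intro!: box_integrable continuous_intros assms)
  also have "(\<lambda>x. (?m * g x - I)\<^sup>2) = (\<lambda>x. ?m\<^sup>2 * (g x)\<^sup>2 - (2 * ?m * I) * g x + I\<^sup>2)"
    by (simp add: fun_eq_iff power2_eq_square algebra_simps)
  also have "integral ?Q \<dots> = ?m\<^sup>2 * integral ?Q (\<lambda>x. (g x)\<^sup>2) - (2 * ?m * I) * I + I\<^sup>2 * ?m"
  proof -
    have h: "((\<lambda>x. ?m\<^sup>2 * (g x)\<^sup>2 - (2 * ?m * I) * g x + I\<^sup>2) has_integral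
        (?m\<^sup>2 * integral ?Q (\<lambda>x. (g x)\<^sup>2) - (2 * ?m * I) * I + ?m *\<^sub>R I\<^sup>2)) ?Q"
      unfolding I_def
      by (intro has_integral_add has_integral_diff has_integral_mult_right has_integral_const
          integrable_integral i)
    show ?thesis using integral_unique[OF h] by (simp add: mult.commute)
  qed
  also have "\<dots> = ?m * (?m * integral ?Q (\<lambda>x. (g x)\<^sup>2) - I\<^sup>2)" by (simp add: power2_eq_square algebra_simps)
  finally show ?thesis using m by (simp add: zero_le_mult_iff I_def)
qed

lemma box_integral_le_sobolev_mass:
  fixes f :: "real^'m::finite \<Rightarrow> complex"
  assumes f: "continuous_on UNIV f" and V: "V \<in> sets borel" and fin: "sobolev_mass V r f < \<infinity>"
    and sub: "\<And>\<theta>. \<theta> \<in> cbox 0 b \<Longrightarrow> \<xi> + \<theta> \<in> V"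
  shows "integral (cbox 0 b) (\<lambda>\<theta>. (cmod (f (\<xi> + \<theta>)) * bracket (\<xi> + \<theta>) powr r)\<^sup>2) \<le> enn2real (sobolev_mass V r f)"
proof -
  let ?Q = "cbox 0 b"
  let ?g = "\<lambda>\<zeta>. (cmod (f \<zeta>) * bracket \<zeta> powr r)\<^sup>2"
  have g: "?g \<zeta> = (cmod (f \<zeta>))\<^sup>2 * bracket \<zeta> powr (2 * r)" for \<zeta>
    by (simp add: power_mult_distrib power2_eq_square powr_add[symmetric])
  have c: "continuous_on UNIV (\<lambda>\<theta>. ?g (\<xi> + \<theta>))"
  proof -
    have "continuous_on UNIV (\<lambda>\<theta>. f (\<xi> + \<theta>))"
      by (rule continuous_on_compose2[OF f]) (auto intro!: continuous_intros)
    moreover have "bracket (\<xi> + \<theta>) \<noteq> 0" for \<theta> using bracket_ge_1[of "\<xi> + \<theta>"] by linarith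
    ultimately show ?thesis by (intro continuous_intros) auto
  qed
  have [measurable]: "f \<in> borel_measurable borel" using f by (rule borel_measurable_continuous_onI)
  have s: "set_integrable lborel ?Q (\<lambda>\<theta>. ?g (\<xi> + \<theta>))"
    unfolding set_integrable_def
    by (rule borel_integrable_compact[OF compact_cbox continuous_on_subset[OF c]]) simp
  have "ennreal (integral ?Q (\<lambda>\<theta>. ?g (\<xi> + \<theta>))) = ennreal (LINT \<theta>:?Q|lborel. ?g (\<xi> + \<theta>))"
    using set_borel_integral_eq_integral(2)[OF s] by simp
  also have "\<dots> = (\<integral>\<^sup>+\<theta>. ennreal (indicator ?Q \<theta> *\<^sub>R ?g (\<xi> + \<theta>)) \<partial>lborel)"
    unfolding set_lebesgue_integral_def
    by (rule nn_integral_eq_integral[symmetric]) (use s in \<open>auto simp: set_integrable_def\<close>)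
  also have "\<dots> \<le> (\<integral>\<^sup>+\<theta>. ennreal ((cmod (f (\<theta> + \<xi>)))\<^sup>2 * bracket (\<theta> + \<xi>) powr (2 * r)) * indicator V (\<theta> + \<xi>) \<partial>lborel)"
    unfolding g using sub by (intro nn_integral_mono) (auto simp: indicator_def add.commute)
  also have "\<dots> = sobolev_mass V r f"
    unfolding sobolev_mass_def
    by (rule nn_integral_translate[where f = "\<lambda>\<xi>. ennreal ((cmod (f \<xi>))\<^sup>2 * bracket \<xi> powr (2 * r)) * indicator V \<xi>"]) (use V in measurable)
  finally have "ennreal (integral ?Q (\<lambda>\<theta>. ?g (\<xi> + \<theta>))) \<le> sobolev_mass V r f" .
  then have "enn2real (ennreal (integral ?Q (\<lambda>\<theta>. ?g (\<xi> + \<theta>)))) \<le> enn2real (sobolev_mass V r f)"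
    using fin by (intro enn2real_mono) auto
  moreover have "0 \<le> integral ?Q (\<lambda>\<theta>. ?g (\<xi> + \<theta>))"
    by (rule integral_nonneg[OF box_integrable[OF c]]) simp
  ultimately show ?thesis by simp
qed

text \<open>Over a bounded cube the weights at \<open>\<xi>\<close> and
  \<open>\<xi> + \<theta>\<close> are comparable, and Cauchy-Schwarz replaces the integral by a
  square integral. The constant depends on the cube and on \<open>\<nu>\<close> only, so it is
  uniform in \<open>f\<close>, \<open>V\<close> and \<open>\<xi>\<close>, and the order
  \<open>\<nu>\<close> is the same on both sides.\<close>

lemma average_sup_bound:
  fixes b :: "real^'m::finite" and \<nu> :: real
  shows "\<exists>C\<ge>0. \<forall>f V \<xi>. continuous_on UNIV f \<longrightarrow> V \<in> sets borel \<longrightarrow> sobolev_mass V \<nu> f < \<infinity> \<longrightarrow>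
    (\<forall>\<theta>\<in>cbox 0 b. \<xi> + \<theta> \<in> V) \<longrightarrow>
    bracket \<xi> powr \<nu> * cmod (integral (cbox 0 b) (\<lambda>\<theta>. f (\<xi> + \<theta>))) \<le> C * sqrt (enn2real (sobolev_mass V \<nu> f))"
proof -
  let ?Q = "cbox 0 b"
  obtain p :: nat where p: "\<bar>\<nu>\<bar> \<le> real p" using real_arch_simple by blast
  have "bounded ?Q" by (rule bounded_cbox)
  then obtain L where L: "\<And>\<theta>. \<theta> \<in> ?Q \<Longrightarrow> norm \<theta> \<le> L" unfolding bounded_iff by blast
  define K where "K = (2 * (1 + \<bar>L\<bar>)) ^ p"
  have K0: "0 \<le> K" by (simp add: K_def)
  have K: "bracket \<xi> powr \<nu> \<le> K * bracket (\<xi> + \<theta>) powr \<nu>" if "\<theta> \<in> ?Q" for \<xi> \<theta> :: "real^'m"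
  proof -
    have "bracket \<theta> \<le> 1 + \<bar>L\<bar>" using bracket_le[of \<theta>] L[OF that] by linarith
    then have "(2 * bracket \<theta>) ^ p \<le> K"
      unfolding K_def using bracket_ge_1[of \<theta>] by (intro power_mono) auto
    then have "(2 * bracket \<theta>) ^ p * bracket (\<xi> + \<theta>) powr \<nu> \<le> K * bracket (\<xi> + \<theta>) powr \<nu>"
      by (rule mult_right_mono) simp
    then show ?thesis using bracket_powr_translate[OF p, of \<xi> \<theta>] by linarith
  qed
  show ?thesis
  proof (intro exI[of _ "K * sqrt (measure lborel ?Q)"] conjI allI impI)
    show "0 \<le> K * sqrt (measure lborel ?Q)" using K0 by simp
    fix f :: "real^'m \<Rightarrow> complex" and V \<xi>
    assume f: "continuous_on UNIV f" and V: "V \<in> sets borel" "sobolev_mass V \<nu> f < \<infinity>" "\<forall>\<theta>\<in>?Q. \<xi> + \<theta> \<in> V"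
    let ?g = "\<lambda>\<theta>. cmod (f (\<xi> + \<theta>)) * bracket (\<xi> + \<theta>) powr \<nu>"
    have cf: "continuous_on UNIV (\<lambda>\<theta>. f (\<xi> + \<theta>))"
      by (rule continuous_on_compose2[OF f]) (auto intro!: continuous_intros)
    have nz: "bracket (\<xi> + \<theta>) \<noteq> 0" for \<theta> using bracket_ge_1[of "\<xi> + \<theta>"] by linarith
    have cg: "continuous_on UNIV ?g" using cf nz by (intro continuous_intros) auto
    have g0: "0 \<le> integral ?Q ?g" by (rule integral_nonneg[OF box_integrable[OF cg]]) simp
    have "bracket \<xi> powr \<nu> * cmod (integral ?Q (\<lambda>\<theta>. f (\<xi> + \<theta>))) = cmod (integral ?Q (\<lambda>\<theta>. of_real (bracket \<xi> powr \<nu>) * f (\<xi> + \<theta>)))"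
      by (simp add: norm_mult)
    also have "\<dots> \<le> integral ?Q (\<lambda>\<theta>. K * ?g \<theta>)"
    proof (rule integral_norm_bound_integral)
      show "(\<lambda>\<theta>. of_real (bracket \<xi> powr \<nu>) * f (\<xi> + \<theta>)) integrable_on ?Q" by (intro box_integrable continuous_intros cf)
      show "(\<lambda>\<theta>. K * ?g \<theta>) integrable_on ?Q" by (intro box_integrable continuous_intros cg)
      fix \<theta> assume \<theta>: "\<theta> \<in> ?Q"
      have "cmod (f (\<xi> + \<theta>)) * bracket \<xi> powr \<nu> \<le> cmod (f (\<xi> + \<theta>)) * (K * bracket (\<xi> + \<theta>) powr \<nu>)"
        by (rule mult_left_mono[OF K[OF \<theta>]]) simp
      then show "norm (of_real (bracket \<xi> powr \<nu>) * f (\<xi> + \<theta>)) \<le> K * ?g \<theta>" by (simp add: norm_mult mult_ac)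
    qed
    also have "\<dots> = K * integral ?Q ?g" by simp
    also have "integral ?Q ?g \<le> sqrt (measure lborel ?Q * enn2real (sobolev_mass V \<nu> f))"
    proof (rule real_le_rsqrt)
      have "(integral ?Q ?g)\<^sup>2 \<le> measure lborel ?Q * integral ?Q (\<lambda>\<theta>. (?g \<theta>)\<^sup>2)" by (rule integral_square_le[OF cg])
      also have "\<dots> \<le> measure lborel ?Q * enn2real (sobolev_mass V \<nu> f)"
        by (rule mult_left_mono[OF box_integral_le_sobolev_mass[OF f V(1,2)]]) (use V(3) in auto)
      finally show "(integral ?Q ?g)\<^sup>2 \<le> measure lborel ?Q * enn2real (sobolev_mass V \<nu> f)" .
    qed
    finally show "bracket \<xi> powr \<nu> * cmod (integral ?Q (\<lambda>\<theta>. f (\<xi> + \<theta>))) \<le> K * sqrt (measure lborel ?Q) * sqrt (enn2real (sobolev_mass V \<nu> f))"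
      using K0 by (simp add: real_sqrt_mult mult_left_mono mult.assoc)
  qed
qed

text \<open>Writing \<open>m\<close> for the dimension, the surplus of at least \<open>m\<close> in
  the order of decay becomes a factor \<open>bracket ^ (-2m)\<close> after squaring, and this factor
  is integrable.\<close>

lemma sobolev_mass_decay:
  fixes f :: "real^'m::finite \<Rightarrow> complex"
  assumes f: "f \<in> borel_measurable borel" "V \<in> sets borel"
    and le: "\<And>\<xi>. \<xi> \<in> V \<Longrightarrow> bracket \<xi> powr \<nu> * cmod (f \<xi>) \<le> q" and \<nu>: "r + real CARD('m) \<le> \<nu>"
  shows "sobolev_mass V r f \<le> ennreal (q\<^sup>2) * (\<integral>\<^sup>+\<xi>. ennreal (1 / bracket (\<xi> :: real^'m) ^ (2 * CARD('m))) \<partial>lborel)"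
proof -
  have pt: "(cmod (f \<xi>))\<^sup>2 * bracket \<xi> powr (2 * r) \<le> q\<^sup>2 * (1 / bracket \<xi> ^ (2 * CARD('m)))" if \<xi>: "\<xi> \<in> V" for \<xi>
  proof -
    have b: "1 \<le> bracket \<xi>" "0 < bracket \<xi>" using bracket_ge_1[of \<xi>] by linarith+
    have "bracket \<xi> powr (2 * r) * bracket \<xi> ^ (2 * CARD('m)) = bracket \<xi> powr (2 * r + 2 * real CARD('m))"
      using b by (simp add: powr_add powr_realpow[symmetric])
    also have "\<dots> \<le> bracket \<xi> powr (2 * \<nu>)" using b \<nu> by (intro powr_mono) auto
    also have "\<dots> = (bracket \<xi> powr \<nu>)\<^sup>2" by (simp add: power2_eq_square powr_add[symmetric])
    finally have "(cmod (f \<xi>))\<^sup>2 * (bracket \<xi> powr (2 * r) * bracket \<xi> ^ (2 * CARD('m))) \<le> (cmod (f \<xi>))\<^sup>2 * (bracket \<xi> powr \<nu>)\<^sup>2"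
      by (rule mult_left_mono) simp
    also have "\<dots> = (bracket \<xi> powr \<nu> * cmod (f \<xi>))\<^sup>2" by (simp add: power_mult_distrib)
    also have "\<dots> \<le> q\<^sup>2" by (rule power_mono[OF le[OF \<xi>]]) simp
    finally show ?thesis using b by (simp add: pos_le_divide_eq mult.assoc)
  qed
  have "sobolev_mass V r f \<le> (\<integral>\<^sup>+\<xi>. ennreal (q\<^sup>2) * ennreal (1 / bracket (\<xi> :: real^'m) ^ (2 * CARD('m))) \<partial>lborel)"
    unfolding sobolev_mass_def
  proof (rule nn_integral_mono)
    fix \<xi> :: "real^'m"
    show "ennreal ((cmod (f \<xi>))\<^sup>2 * bracket \<xi> powr (2 * r)) * indicator V \<xi> \<le> ennreal (q\<^sup>2) * ennreal (1 / bracket \<xi> ^ (2 * CARD('m)))"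
    proof (cases "\<xi> \<in> V")
      case True
      have "ennreal (q\<^sup>2) * ennreal (1 / bracket \<xi> ^ (2 * CARD('m))) = ennreal (q\<^sup>2 * (1 / bracket \<xi> ^ (2 * CARD('m))))"
        by (rule ennreal_mult'[symmetric]) simp
      then show ?thesis using ennreal_leI[OF pt[OF True]] True by (simp only: indicator_simps mult_1_right)
    qed simp
  qed
  also have "\<dots> = ennreal (q\<^sup>2) * (\<integral>\<^sup>+\<xi>. ennreal (1 / bracket (\<xi> :: real^'m) ^ (2 * CARD('m))) \<partial>lborel)"
    by (rule nn_integral_cmult) measurable
  finally show ?thesis .
qed

section \<open>Distributional sections in local coordinates\<close>

text \<open>The reverse of the scaling inequality follows by applying it to \<open>1 / c\<close>;
  for \<open>c = 0\<close> the two assumptions at \<open>0\<close> give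
  \<open>p 0 = 0\<close>.\<close>

lemma seminorm_onI:
  assumes S: "csubspace S" and add: "\<And>x y. x \<in> S \<Longrightarrow> y \<in> S \<Longrightarrow> p (x + y) \<le> p x + p y"
    and scale: "\<And>c x. x \<in> S \<Longrightarrow> p (c *\<^sub>C x) \<le> cmod c * p x"
  shows "seminorm_on S p"
  unfolding seminorm_on_def
proof (intro conjI ballI allI add)
  fix c x assume x: "x \<in> S"
  show "p (c *\<^sub>C x) = cmod c * p x"
  proof (cases "c = 0")
    case True
    have z: "0 \<in> S" using S unfolding csubspace_def by blast
    have "p 0 \<le> 0" using scale[OF x, of 0] by simp
    moreover have "0 \<le> p 0" using add[OF z z] by simp
    ultimately show ?thesis using True by simp
  next
    case False
    have cx: "c *\<^sub>C x \<in> S" using S x unfolding csubspace_def by blast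
    have "p x = p ((1 / c) *\<^sub>C (c *\<^sub>C x))" using False by (simp add: scaleC_scaleC scaleC_one)
    also have "\<dots> \<le> cmod (1 / c) * p (c *\<^sub>C x)" by (rule scale[OF cx])
    finally have "cmod c * p x \<le> p (c *\<^sub>C x)" using False by (simp add: norm_divide field_simps)
    then show ?thesis using scale[OF x, of c] by linarith
  qed
qed

lemma seminorm_on_SUP:
  assumes S: "csubspace S" and D: "D \<noteq> {}" and p: "\<And>i. i \<in> D \<Longrightarrow> seminorm_on S (p i)"
    and bdd: "\<And>x. x \<in> S \<Longrightarrow> bdd_above ((\<lambda>i. p i x) ` D)"
  shows "seminorm_on S (\<lambda>x. SUP i\<in>D. p i x)"
proof (rule seminorm_onI[OF S])
  fix x y assume xy: "x \<in> S" "y \<in> S"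
  show "(SUP i\<in>D. p i (x + y)) \<le> (SUP i\<in>D. p i x) + (SUP i\<in>D. p i y)"
  proof (rule cSUP_least[OF D])
    fix i assume i: "i \<in> D"
    have "p i (x + y) \<le> p i x + p i y" using p[OF i] xy unfolding seminorm_on_def by blast
    then show "p i (x + y) \<le> (SUP i\<in>D. p i x) + (SUP i\<in>D. p i y)"
      using cSUP_upper[OF i bdd[OF xy(1)]] cSUP_upper[OF i bdd[OF xy(2)]] by linarith
  qed
next
  fix c x assume x: "x \<in> S"
  show "(SUP i\<in>D. p i (c *\<^sub>C x)) \<le> cmod c * (SUP i\<in>D. p i x)"
  proof (rule cSUP_least[OF D])
    fix i assume i: "i \<in> D"
    have "p i (c *\<^sub>C x) = cmod c * p i x" using p[OF i] x unfolding seminorm_on_def by blast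
    then show "p i (c *\<^sub>C x) \<le> cmod c * (SUP i\<in>D. p i x)"
      using cSUP_upper[OF i bdd[OF x]] by (simp add: mult_left_mono)
  qed
qed

section \<open>Bundle data in coordinates\<close>

locale vector_bundle_on_manifold =
  fixes A :: "('a::{t2_space, second_countable_topology}, 'm::finite) chart set"
    and E :: "('a, 'e, 'k::finite) cvbundle"
  assumes manifold: "smooth_manifold A" and vbundle: "vector_bundle A E"
begin

lemma chart:
  assumes "c \<in> A"
  shows "open (fst c)" "open (chart_image c)" "homeomorphism (fst c) (chart_image c) (snd c) (chart_inv c)"
  using manifold assms unfolding smooth_manifold_def is_chart_def by blast+

lemma chart_simps:
  assumes "c \<in> A"
  shows "p \<in> fst c \<Longrightarrow> chart_inv c (snd c p) = p" "p \<in> fst c \<Longrightarrow> snd c p \<in> chart_image c"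
    "y \<in> chart_image c \<Longrightarrow> snd c (chart_inv c y) = y" "y \<in> chart_image c \<Longrightarrow> chart_inv c y \<in> fst c"
  using chart(3)[OF assms] unfolding homeomorphism_def by blast+

lemma overlap_eq:
  assumes "c \<in> A"
  shows "snd c ` (fst c \<inter> W) = {y \<in> chart_image c. chart_inv c y \<in> W}"
proof (intro equalityI subsetI)
  fix y assume "y \<in> snd c ` (fst c \<inter> W)"
  then show "y \<in> {y \<in> chart_image c. chart_inv c y \<in> W}" using chart_simps[OF assms] by auto
next
  fix y assume "y \<in> {y \<in> chart_image c. chart_inv c y \<in> W}"
  then show "y \<in> snd c ` (fst c \<inter> W)"
    using chart_simps(3,4)[OF assms, of y] by (intro image_eqI[where x = "chart_inv c y"]) auto
qed

lemma compact_chart_inv: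
  assumes "c \<in> A" "compact S" "S \<subseteq> chart_image c"
  shows "compact (chart_inv c ` S)" "chart_inv c ` S \<subseteq> fst c"
proof -
  have "continuous_on (chart_image c) (chart_inv c)"
    using chart(3)[OF assms(1)] unfolding homeomorphism_def by blast
  from compact_continuous_image[OF continuous_on_subset[OF this assms(3)] assms(2)]
  show "compact (chart_inv c ` S)" .
  show "chart_inv c ` S \<subseteq> fst c" using assms chart_simps(4) by blast
qed

lemma compact_chart_image:
  assumes "c \<in> A" "compact K" "K \<subseteq> fst c"
  shows "compact (snd c ` K)"
proof -
  have "continuous_on (fst c) (snd c)"
    using chart(3)[OF assms(1)] unfolding homeomorphism_def by blast
  from compact_continuous_image[OF continuous_on_subset[OF this assms(3)] assms(2)]
  show ?thesis .
qed

lemma transition: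
  assumes "c \<in> A" "d \<in> A"
  shows "smooth_on (snd c ` (fst c \<inter> fst d)) (snd d \<circ> chart_inv c)"
  using manifold assms unfolding smooth_manifold_def compatible_charts_def by blast

text \<open>The rows are the images of the basis vectors under the derivative of the change of
  charts, and the derivative of the reverse change is a left inverse of it.\<close>

lemma det_coord_vectors_nonzero:
  assumes c: "c \<in> A" "p \<in> fst c" and d: "d \<in> A" "p \<in> fst d"
  shows "det (\<chi> k. coord_vector A c p k d) \<noteq> 0"
proof -
  let ?D = "frechet_derivative (snd d \<circ> chart_inv c) (at (snd c p))"
  have l: "linear ?D"
    by (rule linear_frechet_derivative[OF transition_differentiable[OF manifold c(1) d(1) c(2) d(2)]])
  have "frechet_derivative (snd c \<circ> chart_inv d) (at (snd d p)) (?D w) = w" for w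
    using transition_chain[OF manifold c(1) d(1) c(1) c(2) d(2) c(2), of w] transition_self[OF manifold c, of w] by simp
  then have "inj ?D" by (rule inj_on_inverseI)
  then have "det (matrix ?D) \<noteq> 0" using det_nz_iff_inj[OF l] by simp
  moreover have "(\<chi> k. coord_vector A c p k d) = transpose (matrix ?D)"
    using d by (simp add: vec_eq_iff coord_vector_def transpose_def matrix_def)
  ultimately show ?thesis by (simp add: det_transpose)
qed

text \<open>The modulus is not smooth at \<open>0\<close>, but the Jacobian determinant of a change
  of charts has no zeros. Near each point its modulus is the determinant or its negative.\<close>

lemma smooth_on_abs_det:
  assumes c: "c \<in> A" and d: "d \<in> A"
  shows "smooth_on (snd c ` (fst c \<inter> fst d)) (\<lambda>y. complex_of_real \<bar>det (\<chi> k. coord_vector A c (chart_inv c y) k d)\<bar>)"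
proof -
  let ?O = "snd c ` (fst c \<inter> fst d)" and ?T = "snd d \<circ> chart_inv c"
  let ?det = "\<lambda>y. det (\<chi> k. coord_vector A c (chart_inv c y) k d)"
  have O: "open ?O" by (rule open_chart_image[OF manifold c chart(1)[OF d]])
  have entry: "smooth_on ?O (\<lambda>y. complex_of_real (partial_deriv k ?T y $ l))" for k l
    by (rule smooth_on_bounded_linear[OF _ O smooth_on_partial_deriv[OF transition[OF c d]]])
      (rule bounded_linear_compose[OF bounded_linear_of_real bounded_linear_vec_nth])
  have eq: "complex_of_real (?det y) = (\<Sum>p | p permutes (UNIV :: 'm set). of_int (sign p) *
      (\<Prod>k\<in>UNIV. complex_of_real (partial_deriv k ?T y $ p k)))" if "y \<in> ?O" for y
  proof -
    have y: "y \<in> chart_image c" "chart_inv c y \<in> fst d" using that unfolding overlap_eq[OF c] by auto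
    have "coord_vector A c (chart_inv c y) k d = partial_deriv k ?T y" for k
      using y d chart_simps[OF c] by (simp add: coord_vector_def partial_deriv_def)
    then show ?thesis by (simp add: det_def)
  qed
  have sm: "smooth_on ?O (\<lambda>y. complex_of_real (?det y))"
  proof (subst smooth_on_cong[OF O eq])
    show "smooth_on ?O (\<lambda>y. \<Sum>p | p permutes (UNIV :: 'm set). of_int (sign p) *
        (\<Prod>k\<in>UNIV. complex_of_real (partial_deriv k ?T y $ p k)))"
      by (rule smooth_on_sum[OF O smooth_on_mult[OF O smooth_on_const smooth_on_prod[OF O entry]]])
  qed
  have cd: "continuous_on ?O ?det"
    using continuous_on_Re[OF smooth_on_imp_continuous_on[OF sm]] by simp
  have nz: "?det y \<noteq> 0" if "y \<in> ?O" for y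
    using that det_coord_vectors_nonzero[OF c _ d] chart_simps(4)[OF c] unfolding overlap_eq[OF c] by auto
  show ?thesis
  proof (rule smooth_on_local)
    fix y assume y: "y \<in> ?O"
    show "\<exists>W. y \<in> W \<and> smooth_on W (\<lambda>y. complex_of_real \<bar>?det y\<bar>)"
    proof (cases "0 < ?det y")
      case True
      let ?W = "?O \<inter> ?det -` {0<..}"
      have W: "open ?W" using cd O by (rule continuous_open_preimage) simp
      have "smooth_on ?W (\<lambda>y. complex_of_real \<bar>?det y\<bar>)"
        by (subst smooth_on_cong[OF W, where g = "\<lambda>y. complex_of_real (?det y)"]) (use smooth_on_subset[OF sm] in auto)
      then show ?thesis using y True by (intro exI[of _ ?W]) simp
    next
      case False
      let ?W = "?O \<inter> ?det -` {..<0}"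
      have W: "open ?W" using cd O by (rule continuous_open_preimage) simp
      have "smooth_on ?W (\<lambda>y. (- 1) * complex_of_real (?det y))"
        by (rule smooth_on_mult[OF W smooth_on_const smooth_on_subset[OF sm]]) simp
      then have "smooth_on ?W (\<lambda>y. complex_of_real \<bar>?det y\<bar>)"
        by (subst smooth_on_cong[OF W, where g = "\<lambda>y. (- 1) * complex_of_real (?det y)"]) auto
      then show ?thesis using y False nz[OF y] by (intro exI[of _ ?W]) simp
    qed
  qed
qed

lemma triv_chartD:
  assumes "triv_chart A E c \<Phi>"
  shows "c \<in> A" "(fst c, \<Phi>) \<in> trivs E" "is_triv E (fst c, \<Phi>)"
  using assms vbundle unfolding triv_chart_def vector_bundle_def by blast+

lemma frame_in_fibre:
  assumes "triv_chart A E c \<Phi>" "p \<in> fst c"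
  shows "frame E \<Phi> p i \<in> fibre E p"
proof -
  have "bij_betw \<Phi> (fibre E p) UNIV"
    using triv_chartD(3)[OF assms(1)] assms(2) unfolding is_triv_def by simp
  then have "\<Phi> ` fibre E p = UNIV" by (rule bij_betw_imp_surj_on)
  then show ?thesis unfolding frame_def by (intro inv_into_into) simp
qed

lemma csubspace_density_space: "csubspace (density_space A p)"
  unfolding csubspace_def density_space_def
  by (simp add: plus_fun_def zero_fun_def scaleC_fun_def scaleC_complex_def distrib_left)

lemma csubspace_dual_fibre: "csubspace (dual_fibre A E p)"
proof -
  note d = csubspace_density_space[of p, unfolded csubspace_def]
  show ?thesis
    unfolding csubspace_def
  proof (intro conjI ballI allI)
    show "0 \<in> dual_fibre A E p" using d by (simp add: dual_fibre_def)
    show "f + g \<in> dual_fibre A E p" if "f \<in> dual_fibre A E p" "g \<in> dual_fibre A E p" for f g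
      using that d by (auto simp: dual_fibre_def scaleC_add_right)
    show "a *\<^sub>C f \<in> dual_fibre A E p" if "f \<in> dual_fibre A E p" for a f
      using that d by (auto simp: dual_fibre_def scaleC_fun_def[of a f] scaleC_add_right scaleC_scaleC mult.commute)
  qed
qed

lemma dual_frame_in_fibre:
  assumes t: "triv_chart A E c \<Phi>"
  shows "dual_frame A E c \<Phi> j p \<in> dual_fibre A E p"
proof (cases "p \<in> fst c")
  case False
  then have "dual_frame A E c \<Phi> j p = 0" by (simp add: dual_frame_def zero_fun_def)
  then show ?thesis using csubspace_dual_fibre unfolding csubspace_def by simp
next
  case True
  have closed: "fadd E e f \<in> fibre E p" "fscale E a e \<in> fibre E p" if "e \<in> fibre E p" "f \<in> fibre E p" for e f a
    using vbundle that unfolding vector_bundle_def by blast+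
  have lin: "\<Phi> (fadd E e f) = \<Phi> e + \<Phi> f" "\<Phi> (fscale E a e) = a *s \<Phi> e" if "e \<in> fibre E p" "f \<in> fibre E p" for e f a
    using triv_chartD(3)[OF t] True that unfolding is_triv_def by simp_all
  have "coord_density A c p \<in> density_space A p"
    using coord_density_unique[OF manifold triv_chartD(1)[OF t] True] by blast
  then have "a *\<^sub>C coord_density A c p \<in> density_space A p" for a
    using csubspace_density_space unfolding csubspace_def by blast
  then show ?thesis
    unfolding dual_fibre_def dual_frame_def
    using True closed lin by (simp add: scaleC_add_left scaleC_scaleC)
qed

lemma section_comp_add: "section_comp A E c \<Phi> j (s + t) = (\<lambda>y. section_comp A E c \<Phi> j s y + section_comp A E c \<Phi> j t y)"
  by (simp add: section_comp_def Let_def)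

lemma section_comp_scaleC: "section_comp A E c \<Phi> j (a *\<^sub>C s) = (\<lambda>y. a * section_comp A E c \<Phi> j s y)"
  by (simp add: section_comp_def Let_def scaleC_fun_def scaleC_complex_def)

lemma compact_sectionsI:
  "(\<And>p. s p \<in> dual_fibre A E p) \<Longrightarrow>
    (\<And>c \<Phi> j. triv_chart A E c \<Phi> \<Longrightarrow> smooth_on (chart_image c) (section_comp A E c \<Phi> j s)) \<Longrightarrow>
    compact (section_support s) \<Longrightarrow> s \<in> compact_sections A E"
  unfolding compact_sections_def by blast

lemma compact_sections_smooth:
  "s \<in> compact_sections A E \<Longrightarrow> triv_chart A E c \<Phi> \<Longrightarrow> smooth_on (chart_image c) (section_comp A E c \<Phi> j s)"
  unfolding compact_sections_def by blast

lemma csubspace_compact_sections: "csubspace (compact_sections A E)"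
proof -
  note d = csubspace_dual_fibre[unfolded csubspace_def]
  have o: "open (chart_image c)" if "triv_chart A E c \<Phi>" for c \<Phi>
    using chart(2) triv_chartD(1)[OF that] by blast
  show ?thesis
    unfolding csubspace_def
  proof (intro conjI ballI allI)
    have "section_comp A E c \<Phi> j 0 = (\<lambda>y. 0)" for c \<Phi> j
      by (simp add: section_comp_def Let_def)
    then have "smooth_on (chart_image c) (section_comp A E c \<Phi> j 0)" for c \<Phi> j
      using smooth_on_const[of _ "0 :: complex"] by simp
    moreover have "(0 :: ('a, 'm, 'e) dual_section) p \<in> dual_fibre A E p" for p using d by simp
    moreover have "compact (section_support (0 :: ('a, 'm, 'e) dual_section))" by (simp add: section_support_def)
    ultimately show "0 \<in> compact_sections A E" unfolding compact_sections_def by blast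
    fix s assume s: "s \<in> compact_sections A E"
    have fs: "s p \<in> dual_fibre A E p" for p using s by (simp add: compact_sections_def)
    have ss: "smooth_on (chart_image c) (section_comp A E c \<Phi> j s)" if "triv_chart A E c \<Phi>" for c \<Phi> j
      using s that by (rule compact_sections_smooth)
    have cs: "compact (section_support s)" using s by (simp add: compact_sections_def)
    show "s + t \<in> compact_sections A E" if t: "t \<in> compact_sections A E" for t
    proof -
      have ft: "t p \<in> dual_fibre A E p" for p using t by (simp add: compact_sections_def)
      have st: "smooth_on (chart_image c) (section_comp A E c \<Phi> j t)" if "triv_chart A E c \<Phi>" for c \<Phi> j
        using t that by (rule compact_sections_smooth)
      have ct: "compact (section_support t)" using t by (simp add: compact_sections_def)
      have "section_support (s + t) \<subseteq> section_support s \<union> section_support t"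
        unfolding section_support_def closure_Un[symmetric] by (rule closure_mono) auto
      moreover have "closed (section_support (s + t))" by (simp add: section_support_def)
      ultimately have "compact (section_support (s + t))"
        using compact_Int_closed[OF compact_Un[OF cs ct], of "section_support (s + t)"] by (simp add: Int_absorb1)
      moreover have "(s + t) p \<in> dual_fibre A E p" for p using d fs ft by simp
      moreover have "smooth_on (chart_image c) (section_comp A E c \<Phi> j (s + t))" if "triv_chart A E c \<Phi>" for c \<Phi> j
        unfolding section_comp_add by (rule smooth_on_add[OF o[OF that] ss[OF that] st[OF that]])
      ultimately show ?thesis by (intro compact_sectionsI)
    qed
    show "a *\<^sub>C s \<in> compact_sections A E" for a
    proof -
      have "section_support (a *\<^sub>C s) \<subseteq> section_support s"
        unfolding section_support_def by (rule closure_mono) (auto simp: scaleC_fun_def[of a s])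
      moreover have "closed (section_support (a *\<^sub>C s))" by (simp add: section_support_def)
      ultimately have "compact (section_support (a *\<^sub>C s))"
        using compact_Int_closed[OF cs, of "section_support (a *\<^sub>C s)"] by (simp add: Int_absorb1)
      moreover have "(a *\<^sub>C s) p \<in> dual_fibre A E p" for p using d fs by (simp add: scaleC_fun_def[of a s])
      moreover have "smooth_on (chart_image c) (section_comp A E c \<Phi> j (a *\<^sub>C s))" if "triv_chart A E c \<Phi>" for c \<Phi> j
        unfolding section_comp_scaleC by (rule smooth_on_mult[OF o[OF that] smooth_on_const ss[OF that]])
      ultimately show ?thesis by (intro compact_sectionsI)
    qed
  qed
qed

text \<open>For closed \<open>K\<close> the condition on the support amounts to vanishing outside
  \<open>K\<close>, which is stable under linear combinations.\<close>

lemma csubspace_sections_supported: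
  assumes "closed K"
  shows "csubspace {s \<in> compact_sections A E. section_support s \<subseteq> K}"
proof -
  have i: "section_support s \<subseteq> K \<longleftrightarrow> (\<forall>p. p \<notin> K \<longrightarrow> s p = 0)" for s :: "('a, 'm, 'e) dual_section"
  proof -
    have "closure X \<subseteq> K \<longleftrightarrow> X \<subseteq> K" for X
      by (metis assms closure_minimal closure_subset order_trans)
    then show ?thesis unfolding section_support_def by auto
  qed
  show ?thesis
    unfolding csubspace_def i
  proof (intro conjI ballI allI)
    note c = csubspace_compact_sections[unfolded csubspace_def]
    let ?T = "{s \<in> compact_sections A E. \<forall>p. p \<notin> K \<longrightarrow> s p = 0}"
    show "0 \<in> ?T" using c by simp
    fix s assume s: "s \<in> ?T"
    have "(a *\<^sub>C s) p = a *\<^sub>C s p" for a p by (simp add: scaleC_fun_def)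
    then show "a *\<^sub>C s \<in> ?T" for a using c s by simp
    show "s + t \<in> ?T" if "t \<in> ?T" for t
      using s that c by simp
  qed
qed

lemma seminorm_on_frechet:
  assumes t: "triv_chart A E c \<Phi>" and C: "compact C" "C \<noteq> {}" "C \<subseteq> fst c" and K: "closed K"
  shows "seminorm_on {s \<in> compact_sections A E. section_support s \<subseteq> K}
    (\<lambda>s. SUP y\<in>snd c ` C. cmod (partial_derivs is (section_comp A E c \<Phi> j s) y))"
proof (rule seminorm_on_SUP[OF csubspace_sections_supported[OF K]])
  note cA = triv_chartD(1)[OF t]
  have o: "open (chart_image c)" by (rule chart(2)[OF cA])
  show "snd c ` C \<noteq> {}" using C by simp
  have sm: "smooth_on (chart_image c) (section_comp A E c \<Phi> j s)" if "s \<in> compact_sections A E" for s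
    using that t by (rule compact_sections_smooth)
  have sub: "snd c ` C \<subseteq> chart_image c" using C by (auto simp: chart_image_def)
  show "seminorm_on {s \<in> compact_sections A E. section_support s \<subseteq> K}
      (\<lambda>s. cmod (partial_derivs is (section_comp A E c \<Phi> j s) y))" if y: "y \<in> snd c ` C" for y
  proof -
    have y': "y \<in> chart_image c" using y sub by blast
    show ?thesis
      unfolding seminorm_on_def section_comp_add section_comp_scaleC
      by (simp add: partial_derivs_add[OF o sm sm y'] partial_derivs_cmult[OF o sm y'] norm_triangle_ineq norm_mult)
  qed
  show "bdd_above ((\<lambda>y. cmod (partial_derivs is (section_comp A E c \<Phi> j s) y)) ` snd c ` C)"
    if s: "s \<in> {s \<in> compact_sections A E. section_support s \<subseteq> K}" for s
  proof -
    have "continuous_on (snd c ` C) (\<lambda>y. cmod (partial_derivs is (section_comp A E c \<Phi> j s) y))"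
      using smooth_on_imp_continuous_on[OF smooth_on_partial_derivs[OF sm]] s sub
      by (intro continuous_intros) (auto intro: continuous_on_subset)
    from compact_continuous_image[OF this compact_chart_image[OF cA C(1,3)]]
    show ?thesis by (rule bounded_imp_bdd_above[OF compact_imp_bounded])
  qed
qed

end

section \<open>Sections spanned by a local frame\<close>

definition frame_section :: "('a, 'm::finite) chart set \<Rightarrow> ('a, 'e, 'k::finite) cvbundle
    \<Rightarrow> ('a, 'm) chart \<Rightarrow> ('e \<Rightarrow> complex^'k) \<Rightarrow> 'k \<Rightarrow> (real^'m \<Rightarrow> complex) \<Rightarrow> ('a, 'm, 'e) dual_section" where
  "frame_section A E c \<Phi> j \<phi> = (\<lambda>p. \<phi> (snd c p) *\<^sub>C dual_frame A E c \<Phi> j p)"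

lemma local_rep_frame_section: "local_rep A E c \<Phi> j u \<phi> = u (frame_section A E c \<Phi> j \<phi>)"
  by (simp add: local_rep_def frame_section_def)

lemma frame_section_add:
  "frame_section A E c \<Phi> j (\<lambda>y. \<phi> y + \<psi> y) = frame_section A E c \<Phi> j \<phi> + frame_section A E c \<Phi> j \<psi>"
  by (rule ext) (simp add: frame_section_def scaleC_add_left)

lemma frame_section_cmult:
  "frame_section A E c \<Phi> j (\<lambda>y. a * \<phi> y) = a *\<^sub>C frame_section A E c \<Phi> j \<phi>"
  by (rule ext) (simp add: frame_section_def scaleC_scaleC scaleC_fun_def[of a "\<lambda>p. \<phi> (snd c p) *\<^sub>C dual_frame A E c \<Phi> j p"])

context vector_bundle_on_manifold
begin

text \<open>The factor \<open>b\<close> is an entry of the transition matrix of the bundle times the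
  Jacobian modulus that the density contributes. It does not involve \<open>\<phi>\<close>, which
  makes estimates uniform in \<open>\<phi>\<close> possible.\<close>

lemma section_comp_frame_section:
  assumes t: "triv_chart A E c \<Phi>" and t': "triv_chart A E d \<Psi>"
  shows "\<exists>b. smooth_on (snd d ` (fst d \<inter> fst c)) b \<and>
    (\<forall>\<phi>. \<forall>y\<in>snd d ` (fst d \<inter> fst c). section_comp A E d \<Psi> i (frame_section A E c \<Phi> j \<phi>) y = \<phi> ((snd c \<circ> chart_inv d) y) * b y)"
proof -
  note cA = triv_chartD(1)[OF t] and dA = triv_chartD(1)[OF t']
  let ?O = "snd d ` (fst d \<inter> fst c)"
  have O: "open ?O" by (rule open_chart_image[OF manifold dA chart(1)[OF cA]])
  let ?b = "\<lambda>y. \<Phi> (frame E \<Psi> (chart_inv d y) i) $ j * complex_of_real \<bar>det (\<chi> k. coord_vector A d (chart_inv d y) k c)\<bar>"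
  have "smooth_transition A E (fst d, \<Psi>) (fst c, \<Phi>)"
    using vbundle triv_chartD(2)[OF t] triv_chartD(2)[OF t'] unfolding vector_bundle_def by blast
  from this[unfolded smooth_transition_def, rule_format, OF dA, of i j]
  have "smooth_on ?O (\<lambda>y. \<Phi> (frame E \<Psi> (chart_inv d y) i) $ j)" by simp
  then have "smooth_on ?O ?b" by (rule smooth_on_mult[OF O _ smooth_on_abs_det[OF dA cA]])
  moreover have "section_comp A E d \<Psi> i (frame_section A E c \<Phi> j \<phi>) y = \<phi> ((snd c \<circ> chart_inv d) y) * ?b y" if y: "y \<in> ?O" for \<phi> y
  proof -
    have p: "chart_inv d y \<in> fst d" "chart_inv d y \<in> fst c"
      using y chart_simps(4)[OF dA] unfolding overlap_eq[OF dA] by auto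
    have "frame E \<Psi> (chart_inv d y) i \<in> fibre E (chart_inv d y)" by (rule frame_in_fibre[OF t' p(1)])
    moreover have "range (coord_vector A d (chart_inv d y)) \<subseteq> tangent_space A (chart_inv d y)"
      using coord_vector_tangent[OF manifold dA p(1)] by blast
    ultimately show ?thesis
      using p by (simp add: section_comp_def frame_section_def dual_frame_def coord_density_def
        scaleC_fun_def scaleC_complex_def Let_def)
  qed
  ultimately show ?thesis by blast
qed

lemma section_comp_frame_section_zero:
  assumes t': "triv_chart A E d \<Psi>" and y: "y \<in> snd d ` (fst d \<inter> - chart_inv c ` S)"
    and c: "c \<in> A" and S: "\<And>y. y \<notin> S \<Longrightarrow> \<phi> y = 0"
  shows "section_comp A E d \<Psi> i (frame_section A E c \<Phi> j \<phi>) y = 0"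
proof -
  have p: "chart_inv d y \<notin> chart_inv c ` S" using y unfolding overlap_eq[OF triv_chartD(1)[OF t']] by simp
  have "frame_section A E c \<Phi> j \<phi> (chart_inv d y) = 0"
  proof (cases "chart_inv d y \<in> fst c")
    case True
    have "snd c (chart_inv d y) \<notin> S"
    proof
      assume "snd c (chart_inv d y) \<in> S"
      then have "chart_inv c (snd c (chart_inv d y)) \<in> chart_inv c ` S" by (rule imageI)
      then show False using p chart_simps(1)[OF c True] by simp
    qed
    then show ?thesis using S by (simp add: frame_section_def)
  next
    case False
    then have "dual_frame A E c \<Phi> j (chart_inv d y) = 0" by (simp add: dual_frame_def zero_fun_def)
    then show ?thesis by (simp add: frame_section_def)
  qed
  then show ?thesis by (simp add: section_comp_def Let_def)
qed

text \<open>Each component is smooth on the overlap by the product formula, and it vanishes off the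
  compact image of the support. These two open sets cover the chart image because that compact set
  lies in the domain of \<open>c\<close>.\<close>

lemma frame_section_compact:
  assumes t: "triv_chart A E c \<Phi>" and \<phi>: "\<phi> \<in> test_functions (chart_image c)"
  shows "frame_section A E c \<Phi> j \<phi> \<in> compact_sections A E"
    "section_support (frame_section A E c \<Phi> j \<phi>) \<subseteq> chart_inv c ` closure {y. \<phi> y \<noteq> 0}"
proof -
  note cA = triv_chartD(1)[OF t]
  let ?S = "closure {y. \<phi> y \<noteq> 0}" and ?s = "frame_section A E c \<Phi> j \<phi>"
  let ?K = "chart_inv c ` ?S"
  note \<phi>D = test_functionsD[OF \<phi>]
  have K: "compact ?K" "?K \<subseteq> fst c" using compact_chart_inv[OF cA \<phi>D(2,3)] by blast+
  have cK: "closed ?K" by (rule compact_imp_closed[OF K(1)])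
  have S: "\<phi> y = 0" if "y \<notin> ?S" for y using that closure_subset[of "{y. \<phi> y \<noteq> 0}"] by blast
  have "{p. ?s p \<noteq> 0} \<subseteq> ?K"
  proof
    fix p assume "p \<in> {p. ?s p \<noteq> 0}"
    then have p: "\<phi> (snd c p) *\<^sub>C dual_frame A E c \<Phi> j p \<noteq> 0" by (simp add: frame_section_def)
    have pc: "p \<in> fst c"
    proof (rule ccontr)
      assume "p \<notin> fst c"
      then have "dual_frame A E c \<Phi> j p = 0" by (simp add: dual_frame_def zero_fun_def)
      then show False using p by simp
    qed
    have "snd c p \<in> ?S"
    proof (rule ccontr)
      assume "snd c p \<notin> ?S"
      then have "\<phi> (snd c p) = 0" by (rule S)
      then show False using p by simp
    qed
    then have "chart_inv c (snd c p) \<in> ?K" by (rule imageI)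
    then show "p \<in> ?K" by (simp only: chart_simps(1)[OF cA pc])
  qed
  then show sub: "section_support ?s \<subseteq> ?K" unfolding section_support_def by (rule closure_minimal[OF _ cK])
  show "?s \<in> compact_sections A E"
  proof (rule compact_sectionsI)
    show "?s p \<in> dual_fibre A E p" for p
      using csubspace_dual_fibre[of p, unfolded csubspace_def] dual_frame_in_fibre[OF t] by (simp add: frame_section_def)
    show "compact (section_support ?s)"
      using compact_Int_closed[OF K(1), of "section_support ?s"] sub
      by (simp add: Int_absorb1 section_support_def)
    fix d \<Psi> i assume t': "triv_chart A E d \<Psi>"
    note dA = triv_chartD(1)[OF t']
    let ?O = "snd d ` (fst d \<inter> fst c)" and ?N = "snd d ` (fst d \<inter> - ?K)"
    have O: "open ?O" by (rule open_chart_image[OF manifold dA chart(1)[OF cA]])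
    have N: "open ?N" by (rule open_chart_image[OF manifold dA open_Compl[OF cK]])
    obtain b where b: "smooth_on ?O b" and
      "\<forall>\<phi>. \<forall>y\<in>?O. section_comp A E d \<Psi> i (frame_section A E c \<Phi> j \<phi>) y = \<phi> ((snd c \<circ> chart_inv d) y) * b y"
      using section_comp_frame_section[OF t t', of i j] by (elim exE conjE)
    then have bs: "section_comp A E d \<Psi> i ?s y = \<phi> ((snd c \<circ> chart_inv d) y) * b y" if "y \<in> ?O" for y
      using that by blast
    have "smooth_on ?O (\<lambda>y. \<phi> ((snd c \<circ> chart_inv d) y) * b y)"
      by (rule smooth_on_mult[OF O smooth_on_compose[OF O \<phi>D(1) transition[OF dA cA]] b]) simp
    then have 1: "smooth_on ?O (section_comp A E d \<Psi> i ?s)"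
      by (subst smooth_on_cong[OF O bs])
    have 2: "smooth_on ?N (section_comp A E d \<Psi> i ?s)"
    proof (subst smooth_on_cong[OF N])
      show "section_comp A E d \<Psi> i ?s y = 0" if "y \<in> ?N" for y
        by (rule section_comp_frame_section_zero[OF t' that cA S])
    qed (rule smooth_on_const)
    show "smooth_on (chart_image d) (section_comp A E d \<Psi> i ?s)"
    proof (rule smooth_on_local)
      fix y assume y: "y \<in> chart_image d"
      have "y \<in> ?O \<or> y \<in> ?N"
        unfolding overlap_eq[OF dA] using y K(2) by blast
      then show "\<exists>W. y \<in> W \<and> smooth_on W (section_comp A E d \<Psi> i ?s)"
        by (rule disjE) (rule exI, rule conjI, assumption, rule 1, rule exI, rule conjI, assumption, rule 2)
    qed
  qed
qed

text \<open>The constants are uniform in \<open>\<rho>\<close>, while \<open>\<phi>\<close> is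
  fixed. Fixing \<open>\<phi>\<close> keeps all the sections in one space of sections with support
  in a given compact set, where a seminorm of the (LF) topology is continuous for a Frechet
  topology.\<close>

definition jet_bounded :: "('a, 'm) chart \<Rightarrow> ('e \<Rightarrow> complex^'k) \<Rightarrow> 'k \<Rightarrow> (real^'m \<Rightarrow> complex)
    \<Rightarrow> (('a, 'm, 'e) dual_section \<Rightarrow> real) \<Rightarrow> bool" where
  "jet_bounded c \<Phi> j \<phi> p \<longleftrightarrow> (\<exists>K n. 0 \<le> K \<and> (\<forall>\<rho> M. smooth_on UNIV \<rho> \<longrightarrow> 0 \<le> M \<longrightarrow>
     (\<forall>x\<in>closure {y. \<phi> y \<noteq> 0}. jet_norm n \<rho> x \<le> M) \<longrightarrow> p (frame_section A E c \<Phi> j (\<lambda>y. \<phi> y * \<rho> y)) \<le> K * M))"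

lemma jet_bounded_sum:
  assumes "finite F" "\<And>p. p \<in> F \<Longrightarrow> jet_bounded c \<Phi> j \<phi> p"
  shows "jet_bounded c \<Phi> j \<phi> (\<lambda>s. \<Sum>p\<in>F. p s)"
  using assms
proof (induction F)
  case empty
  show ?case unfolding jet_bounded_def by (intro exI[of _ 0]) simp
next
  case (insert q F)
  let ?S = "closure {y. \<phi> y \<noteq> 0}" and ?s = "\<lambda>\<rho>. frame_section A E c \<Phi> j (\<lambda>y. \<phi> y * \<rho> y)"
  have "jet_bounded c \<Phi> j \<phi> q" using insert.prems by simp
  then obtain K n where 1: "0 \<le> K" "\<forall>\<rho> M. smooth_on UNIV \<rho> \<longrightarrow> 0 \<le> M \<longrightarrow> (\<forall>x\<in>?S. jet_norm n \<rho> x \<le> M) \<longrightarrow> q (?s \<rho>) \<le> K * M"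
    unfolding jet_bounded_def by (elim exE conjE)
  have "jet_bounded c \<Phi> j \<phi> (\<lambda>s. \<Sum>p\<in>F. p s)" using insert.prems by (intro insert.IH) simp
  then obtain K' n' where 2: "0 \<le> K'" "\<forall>\<rho> M. smooth_on UNIV \<rho> \<longrightarrow> 0 \<le> M \<longrightarrow> (\<forall>x\<in>?S. jet_norm n' \<rho> x \<le> M) \<longrightarrow> (\<Sum>p\<in>F. p (?s \<rho>)) \<le> K' * M"
    unfolding jet_bounded_def by (elim exE conjE)
  show ?case
    unfolding jet_bounded_def
  proof (intro exI[of _ "K + K'"] exI[of _ "max n n'"] conjI allI impI)
    show "0 \<le> K + K'" using 1(1) 2(1) by simp
    fix \<rho> :: "real^'m \<Rightarrow> complex" and M :: real
    assume \<rho>: "smooth_on UNIV \<rho>" "0 \<le> M" "\<forall>x\<in>?S. jet_norm (max n n') \<rho> x \<le> M"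
    have l: "\<forall>x\<in>?S. jet_norm n \<rho> x \<le> M" "\<forall>x\<in>?S. jet_norm n' \<rho> x \<le> M"
      using \<rho>(3) jet_norm_mono[of n "max n n'" \<rho>] jet_norm_mono[of n' "max n n'" \<rho>]
      by (meson max.cobounded1 max.cobounded2 order_trans)+
    have "q (?s \<rho>) \<le> K * M" using 1(2) \<rho>(1,2) l(1) by (elim allE impE) auto
    moreover have "(\<Sum>p\<in>F. p (?s \<rho>)) \<le> K' * M" using 2(2) \<rho>(1,2) l(2) by (elim allE impE) auto
    ultimately show "(\<Sum>p\<in>insert q F. p (?s \<rho>)) \<le> (K + K') * M"
      using insert.hyps by (simp add: distrib_right)
  qed
qed

text \<open>The comparison is asked for on sections supported in one compact set only, which is all
  that an estimate from a Frechet space of supported sections provides.\<close>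

lemma jet_bounded_dominated:
  assumes t: "triv_chart A E c \<Phi>" and \<phi>: "\<phi> \<in> test_functions (chart_image c)"
    and q: "jet_bounded c \<Phi> j \<phi> q" and C: "0 \<le> C"
    and le: "\<And>s. s \<in> compact_sections A E \<Longrightarrow> section_support s \<subseteq> chart_inv c ` closure {y. \<phi> y \<noteq> 0} \<Longrightarrow> p s \<le> C * q s"
  shows "jet_bounded c \<Phi> j \<phi> p"
proof -
  let ?S = "closure {y. \<phi> y \<noteq> 0}" and ?s = "\<lambda>\<rho>. frame_section A E c \<Phi> j (\<lambda>y. \<phi> y * \<rho> y)"
  obtain K n where 1: "0 \<le> K" "\<forall>\<rho> M. smooth_on UNIV \<rho> \<longrightarrow> 0 \<le> M \<longrightarrow> (\<forall>x\<in>?S. jet_norm n \<rho> x \<le> M) \<longrightarrow> q (?s \<rho>) \<le> K * M"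
    using q unfolding jet_bounded_def by (elim exE conjE)
  show ?thesis
    unfolding jet_bounded_def
  proof (intro exI[of _ "C * K"] exI[of _ n] conjI allI impI)
    show "0 \<le> C * K" using 1(1) C by simp
    fix \<rho> :: "real^'m \<Rightarrow> complex" and M :: real
    assume \<rho>: "smooth_on UNIV \<rho>" "0 \<le> M" "\<forall>x\<in>?S. jet_norm n \<rho> x \<le> M"
    have f: "(\<lambda>y. \<phi> y * \<rho> y) \<in> test_functions (chart_image c)" by (rule test_functions_mult[OF \<phi> \<rho>(1)])
    have sub: "closure {y. \<phi> y * \<rho> y \<noteq> 0} \<subseteq> ?S" by (rule closure_mono) auto
    have "section_support (?s \<rho>) \<subseteq> chart_inv c ` ?S"
      using frame_section_compact(2)[OF t f, of j] image_mono[OF sub, of "chart_inv c"] by (rule order_trans)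
    then have "p (?s \<rho>) \<le> C * q (?s \<rho>)" by (rule le[OF frame_section_compact(1)[OF t f]])
    also have "\<dots> \<le> C * (K * M)"
      by (rule mult_left_mono[OF _ C]) (use 1(2) \<rho> in \<open>elim allE impE; auto\<close>)
    finally show "p (?s \<rho>) \<le> C * K * M" by simp
  qed
qed

text \<open>Over the compact support the component is a smooth factor times \<open>\<rho>\<close>
  composed with the change of charts, so the uniform bound for such products applies; the change of
  charts leads into the support of \<open>\<phi>\<close>, where the jets of \<open>\<rho>\<close>
  are controlled. At all other points the component vanishes on an open neighbourhood.\<close>

lemma jet_bounded_frechet:
  assumes t: "triv_chart A E c \<Phi>" and \<phi>: "\<phi> \<in> test_functions (chart_image c)"
    and t': "triv_chart A E d \<Psi>" and C: "compact C" "C \<noteq> {}" "C \<subseteq> fst d"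
  shows "jet_bounded c \<Phi> j \<phi> (\<lambda>s. SUP y\<in>snd d ` C. cmod (partial_derivs is (section_comp A E d \<Psi> i s) y))"
proof -
  note cA = triv_chartD(1)[OF t] and dA = triv_chartD(1)[OF t']
  let ?S = "closure {y. \<phi> y \<noteq> 0}" and ?s = "\<lambda>\<rho>. frame_section A E c \<Phi> j (\<lambda>y. \<phi> y * \<rho> y)"
  let ?K = "chart_inv c ` ?S" and ?T = "snd c \<circ> chart_inv d"
  note \<phi>D = test_functionsD[OF \<phi>]
  have K: "compact ?K" "?K \<subseteq> fst c" using compact_chart_inv[OF cA \<phi>D(2,3)] by blast+
  have cK: "closed ?K" by (rule compact_imp_closed[OF K(1)])
  have S: "\<phi> y * \<rho> y = 0" if "y \<notin> ?S" for y and \<rho> :: "real^'m \<Rightarrow> complex"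
    using that closure_subset[of "{y. \<phi> y \<noteq> 0}"] by auto
  let ?O = "snd d ` (fst d \<inter> fst c)" and ?N = "snd d ` (fst d \<inter> - ?K)" and ?C = "snd d ` (C \<inter> ?K)"
  have O: "open ?O" by (rule open_chart_image[OF manifold dA chart(1)[OF cA]])
  have N: "open ?N" by (rule open_chart_image[OF manifold dA open_Compl[OF cK]])
  have cC: "compact ?C" by (rule compact_chart_image[OF dA compact_Int_closed[OF C(1) cK]]) (use C(3) in blast)
  have CO: "?C \<subseteq> ?O" using C(3) K(2) by blast
  obtain b where b1: "smooth_on ?O b" and
    b2: "\<forall>\<phi>. \<forall>y\<in>?O. section_comp A E d \<Psi> i (frame_section A E c \<Phi> j \<phi>) y = \<phi> (?T y) * b y"
    using section_comp_frame_section[OF t t', of i j] by (elim exE conjE)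
  note b = b1 b2[rule_format]
  have a: "smooth_on ?O (\<lambda>y. \<phi> (?T y) * b y)"
    by (rule smooth_on_mult[OF O smooth_on_compose[OF O \<phi>D(1) transition[OF dA cA]] b(1)]) simp
  obtain B where B: "0 \<le> B" "\<forall>\<rho>. smooth_on UNIV \<rho> \<longrightarrow> (\<forall>y\<in>?C.
      cmod (partial_derivs is (\<lambda>y. (\<phi> (?T y) * b y) * \<rho> (?T y)) y) \<le> B * jet_norm (length is) \<rho> (?T y))"
    using partial_derivs_mult_compose_bound[OF O transition[OF dA cA] subset_UNIV cC CO a, of "is"] by (elim exE conjE)
  have TC: "?T y \<in> ?S" if "y \<in> ?C" for y
  proof -
    obtain p where p: "p \<in> C" "p \<in> ?K" "y = snd d p" using \<open>y \<in> ?C\<close> by blast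
    obtain x where x: "x \<in> ?S" "p = chart_inv c x" using p(2) by blast
    have "chart_inv d y = p" using p C(3) chart_simps(1)[OF dA] by blast
    then show ?thesis using x \<phi>D(3) chart_simps(3)[OF cA, of x] by auto
  qed
  show ?thesis
    unfolding jet_bounded_def
  proof (intro exI[of _ B] exI[of _ "length is"] conjI allI impI B(1))
    fix \<rho> :: "real^'m \<Rightarrow> complex" and M :: real
    assume \<rho>: "smooth_on UNIV \<rho>" "0 \<le> M" "\<forall>x\<in>?S. jet_norm (length is) \<rho> x \<le> M"
    show "(SUP y\<in>snd d ` C. cmod (partial_derivs is (section_comp A E d \<Psi> i (?s \<rho>)) y)) \<le> B * M"
    proof (rule cSUP_least)
      show "snd d ` C \<noteq> {}" using C(2) by simp
      fix y assume y: "y \<in> snd d ` C"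
      show "cmod (partial_derivs is (section_comp A E d \<Psi> i (?s \<rho>)) y) \<le> B * M"
      proof (cases "y \<in> ?N")
        case True
        have "partial_derivs is (section_comp A E d \<Psi> i (?s \<rho>)) y = partial_derivs is (\<lambda>_. 0) y"
          by (rule partial_derivs_cong[OF N section_comp_frame_section_zero[OF t' _ cA S] True])
        then show ?thesis using B(1) \<rho>(2) by simp
      next
        case False
        then have yC: "y \<in> ?C" using y C(3) by blast
        then have yO: "y \<in> ?O" using CO by blast
        have "partial_derivs is (section_comp A E d \<Psi> i (?s \<rho>)) y = partial_derivs is (\<lambda>y. (\<phi> (?T y) * b y) * \<rho> (?T y)) y"
          by (rule partial_derivs_cong[OF O _ yO]) (simp only: b(2) mult_ac)
        also have "cmod \<dots> \<le> B * jet_norm (length is) \<rho> (?T y)"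
          using B(2) \<rho>(1) yC by (elim allE impE) auto
        also have "\<dots> \<le> B * M" by (rule mult_left_mono[OF bspec[OF \<rho>(3) TC[OF yC]] B(1)])
        finally show ?thesis .
      qed
    qed
  qed
qed

text \<open>All sections \<open>\<phi> \<rho>\<close> are supported in the compact image of the
  support of \<open>\<phi>\<close>. On sections supported there \<open>p\<close> is dominated by
  finitely many Frechet seminorms, each of which is jet bounded.\<close>

lemma jet_bounded_LF:
  assumes t: "triv_chart A E c \<Phi>" and \<phi>: "\<phi> \<in> test_functions (chart_image c)"
    and p: "seminorm_on (compact_sections A E) p"
      "\<And>K. compact K \<Longrightarrow> continuous_map (frechet_topology A E K) euclideanreal p"
  shows "jet_bounded c \<Phi> j \<phi> p"
proof -
  let ?K = "chart_inv c ` closure {y. \<phi> y \<noteq> 0}"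
  have K: "compact ?K" using compact_chart_inv(1)[OF triv_chartD(1)[OF t] test_functionsD(2,3)[OF \<phi>]] .
  have cK: "closed ?K" by (rule compact_imp_closed[OF K])
  let ?P = "{\<lambda>s. (SUP y\<in>snd c ` C. cmod (partial_derivs is (section_comp A E c \<Phi> j s) y)) | c \<Phi> j is C.
          triv_chart A E c \<Phi> \<and> compact C \<and> C \<noteq> {} \<and> C \<subseteq> fst c}"
  have P: "seminorm_on {s \<in> compact_sections A E. section_support s \<subseteq> ?K} q" if q: "q \<in> ?P" for q
  proof -
    obtain d \<Psi> i "is" C where "q = (\<lambda>s. SUP y\<in>snd d ` C. cmod (partial_derivs is (section_comp A E d \<Psi> i s) y))"
      "triv_chart A E d \<Psi>" "compact C" "C \<noteq> {}" "C \<subseteq> fst d" using q by (elim CollectE exE conjE) (rule that)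
    then show ?thesis using seminorm_on_frechet[OF _ _ _ _ cK] by simp
  qed
  have p': "seminorm_on {s \<in> compact_sections A E. section_support s \<subseteq> ?K} p"
    by (rule seminorm_on_subset[OF p(1)]) blast
  have "\<exists>F C. finite F \<and> F \<subseteq> ?P \<and> 0 \<le> C \<and> (\<forall>s\<in>{s \<in> compact_sections A E. section_support s \<subseteq> ?K}. p s \<le> C * (\<Sum>q\<in>F. q s))"
  proof (rule continuous_seminorm_bound[OF csubspace_sections_supported[OF cK] P p' p(2)[OF K, unfolded frechet_topology_def]])
    fix F C assume "finite F" "F \<subseteq> ?P" "0 \<le> C"
      "\<And>s. s \<in> {s \<in> compact_sections A E. section_support s \<subseteq> ?K} \<Longrightarrow> p s \<le> C * (\<Sum>q\<in>F. q s)"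
    then show ?thesis by (intro exI conjI ballI)
  qed
  then obtain F C where F: "finite F" "F \<subseteq> ?P" "0 \<le> C"
    "\<forall>s\<in>{s \<in> compact_sections A E. section_support s \<subseteq> ?K}. p s \<le> C * (\<Sum>q\<in>F. q s)"
    by (elim exE conjE)
  have le: "p s \<le> C * (\<Sum>q\<in>F. q s)" if "s \<in> compact_sections A E" "section_support s \<subseteq> ?K" for s
    using bspec[OF F(4), of s] that by simp
  show ?thesis
  proof (rule jet_bounded_dominated[OF t \<phi> jet_bounded_sum[OF F(1)] F(3) le])
    fix q assume "q \<in> F"
    then have "q \<in> ?P" using F(2) by blast
    then obtain d \<Psi> i "is" C where "q = (\<lambda>s. SUP y\<in>snd d ` C. cmod (partial_derivs is (section_comp A E d \<Psi> i s) y))"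
      "triv_chart A E d \<Psi>" "compact C" "C \<noteq> {}" "C \<subseteq> fst d" by (elim CollectE exE conjE) (rule that)
    then show "jet_bounded c \<Phi> j \<phi> q" using jet_bounded_frechet[OF t \<phi>] by simp
  qed
qed

lemma topspace_LF: "topspace (LF_topology A E) = compact_sections A E"
  unfolding LF_topology_def by simp

text \<open>Two reductions are chained: continuity bounds \<open>\<bar>u\<bar>\<close> by finitely
  many defining seminorms of the (LF) topology, and each of these is jet bounded through its
  continuity on Frechet spaces.\<close>

lemma distribution_jet_bounded:
  assumes u: "u \<in> distributions A E" and t: "triv_chart A E c \<Phi>" and \<phi>: "\<phi> \<in> test_functions (chart_image c)"
  shows "jet_bounded c \<Phi> j \<phi> (\<lambda>s. cmod (u s))"
proof -
  have u': "linear_on (compact_sections A E) u" "continuous_map (LF_topology A E) euclidean u"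
    using u unfolding distributions_def continuous_dual_def topspace_LF by blast+
  let ?P = "{p. seminorm_on (compact_sections A E) p
        \<and> (\<forall>K. compact K \<longrightarrow> continuous_map (frechet_topology A E K) euclideanreal p)}"
  have q: "seminorm_on (compact_sections A E) (\<lambda>s. cmod (u s))"
    using u'(1) unfolding seminorm_on_def linear_on_def by (simp add: norm_triangle_ineq norm_mult scaleC_complex_def)
  have c: "continuous_map (LF_topology A E) euclideanreal (\<lambda>s. cmod (u s))"
    by (rule continuous_map_compose[OF u'(2), unfolded o_def]) (simp add: continuous_on_norm_id)
  obtain F C where F: "finite F" "F \<subseteq> ?P" "0 \<le> C"
    "\<And>s. s \<in> compact_sections A E \<Longrightarrow> cmod (u s) \<le> C * (\<Sum>q\<in>F. q s)"
    by (rule continuous_seminorm_bound[OF csubspace_compact_sections _ q c[unfolded LF_topology_def]]) blast+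
  show ?thesis
  proof (rule jet_bounded_dominated[OF t \<phi> jet_bounded_sum[OF F(1)] F(3) F(4)])
    fix q assume "q \<in> F"
    then have "q \<in> ?P" using F(2) by blast
    then show "jet_bounded c \<Phi> j \<phi> q" by (intro jet_bounded_LF[OF t \<phi>]) blast+
  qed
qed

lemma local_distribution_local_rep:
  assumes u: "u \<in> distributions A E" and t: "triv_chart A E c \<Phi>"
  shows "local_distribution (chart_image c) (local_rep A E c \<Phi> j u)"
proof -
  have l: "linear_on (compact_sections A E) u"
    using u unfolding distributions_def continuous_dual_def topspace_LF by blast
  show ?thesis
    unfolding local_distribution_def local_rep_frame_section
  proof (intro conjI ballI allI)
    fix \<phi> assume \<phi>: "\<phi> \<in> test_functions (chart_image c)"
    note 1 = frame_section_compact(1)[OF t \<phi>, of j]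
    show "u (frame_section A E c \<Phi> j (\<lambda>y. a * \<phi> y)) = a * u (frame_section A E c \<Phi> j \<phi>)" for a
      using l 1 unfolding frame_section_cmult linear_on_def scaleC_complex_def by blast
    show "u (frame_section A E c \<Phi> j (\<lambda>y. \<phi> y + \<psi> y)) = u (frame_section A E c \<Phi> j \<phi>) + u (frame_section A E c \<Phi> j \<psi>)"
      if \<psi>: "\<psi> \<in> test_functions (chart_image c)" for \<psi>
      using l 1 frame_section_compact(1)[OF t \<psi>, of j] unfolding frame_section_add linear_on_def by blast
    show "\<exists>K n. 0 \<le> K \<and> (\<forall>\<rho> M. smooth_on UNIV \<rho> \<longrightarrow> 0 \<le> M \<longrightarrow>
        (\<forall>x\<in>closure {y. \<phi> y \<noteq> 0}. jet_norm n \<rho> x \<le> M) \<longrightarrow> cmod (u (frame_section A E c \<Phi> j (\<lambda>y. \<phi> y * \<rho> y))) \<le> K * M)"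
      using distribution_jet_bounded[OF u t \<phi>, of j] unfolding jet_bounded_def .
  qed
qed

text \<open>The sections given by \<open>\<phi>\<close> times a wave with
  \<open>\<bar>\<xi>\<bar> \<le> R\<close> form a bounded set, as the jets of these waves are
  uniformly bounded and every defining (LF) seminorm is jet bounded. The supremum over this set is a
  continuous seminorm; here the topology of uniform convergence on bounded sets enters.\<close>

lemma fourier_cutoff_locally_bounded:
  assumes t: "triv_chart A E c \<Phi>" and \<phi>: "\<phi> \<in> test_functions (chart_image c)"
  shows "\<exists>w\<in>continuous_seminorms (distribution_topology A E). \<forall>u\<in>distributions A E. \<forall>\<xi>. norm \<xi> \<le> R \<longrightarrow>
    cmod (fourier_cutoff \<phi> (local_rep A E c \<Phi> j u) \<xi>) \<le> w u"
proof (cases "0 \<le> R")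
  case False
  then have neg: "\<not> norm \<xi> \<le> R" for \<xi> :: "real^'m" using norm_ge_zero[of \<xi>] by linarith
  \<comment> \<open>For negative \<open>R\<close> the estimate is vacuous and any continuous
    seminorm will do; a nonempty bounded set supplies one.\<close>
  have "bounded_subset (LF_topology A E) {0}"
    unfolding LF_topology_def
    by (rule bounded_subset_seminorm_topology[OF csubspace_compact_sections])
      (use csubspace_compact_sections in \<open>auto simp: csubspace_def\<close>)
  then have "(\<lambda>u. SUP x\<in>{0}. cmod (u x)) \<in> continuous_seminorms (distribution_topology A E)"
    unfolding distribution_topology_def
    by (rule strong_dual_seminorm_continuous) (simp_all add: topspace_LF csubspace_compact_sections)
  then show ?thesis using neg by blast
next
  case R: True
  let ?s = "\<lambda>\<xi>. frame_section A E c \<Phi> j (\<lambda>y. \<phi> y * wave \<xi> y)"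
  let ?B = "?s ` {\<xi>. norm \<xi> \<le> R}"
  let ?P = "{p. seminorm_on (compact_sections A E) p
        \<and> (\<forall>K. compact K \<longrightarrow> continuous_map (frechet_topology A E K) euclideanreal p)}"
  have f: "(\<lambda>y. \<phi> y * wave \<xi> y) \<in> test_functions (chart_image c)" for \<xi>
    by (rule test_functions_mult[OF \<phi> smooth_on_wave])
  have B: "bounded_subset (LF_topology A E) ?B"
    unfolding LF_topology_def
  proof (rule bounded_subset_seminorm_topology[OF csubspace_compact_sections])
    show "seminorm_on (compact_sections A E) p" if "p \<in> ?P" for p using that by blast
    show "?B \<subseteq> compact_sections A E" using frame_section_compact(1)[OF t f] by blast
    fix p assume "p \<in> ?P"
    then have "jet_bounded c \<Phi> j \<phi> p" by (intro jet_bounded_LF[OF t \<phi>]) blast+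
    then obtain K n where K: "0 \<le> K" "\<forall>\<rho> M. smooth_on UNIV \<rho> \<longrightarrow> 0 \<le> M \<longrightarrow> (\<forall>x\<in>closure {y. \<phi> y \<noteq> 0}. jet_norm n \<rho> x \<le> M) \<longrightarrow>
        p (frame_section A E c \<Phi> j (\<lambda>y. \<phi> y * \<rho> y)) \<le> K * M"
      unfolding jet_bounded_def by (elim exE conjE)
    let ?M = "real (card {is :: 'm list. length is \<le> n}) * (1 + R) ^ n"
    have M: "0 \<le> ?M" using R by simp
    show "bdd_above (p ` ?B)"
    proof (rule bdd_aboveI2[where M = "K * ?M"])
      fix s assume "s \<in> ?B"
      then obtain \<xi> where \<xi>: "norm \<xi> \<le> R" "s = ?s \<xi>" by blast
      have "bracket \<xi> \<le> 1 + R" using bracket_le[of \<xi>] \<xi>(1) by linarith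
      then have "bracket \<xi> ^ n \<le> (1 + R) ^ n" using bracket_ge_1[of \<xi>] by (intro power_mono) auto
      then have "jet_norm n (wave \<xi>) x \<le> ?M" for x
        using jet_norm_wave[of n \<xi> x] mult_left_mono[of "bracket \<xi> ^ n" "(1 + R) ^ n" "real (card {is :: 'm list. length is \<le> n})"] by simp
      then show "p s \<le> K * ?M" unfolding \<xi>(2) using K(2) M smooth_on_wave[of UNIV \<xi>] by (elim allE impE) auto
    qed
  qed
  have ne: "?B \<noteq> {}" using R by (auto intro!: exI[of _ 0])
  have w: "(\<lambda>u. SUP x\<in>?B. cmod (u x)) \<in> continuous_seminorms (distribution_topology A E)"
    unfolding distribution_topology_def
    by (rule strong_dual_seminorm_continuous[OF B ne]) (simp add: topspace_LF csubspace_compact_sections)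
  show ?thesis
  proof (rule bexI[OF _ w], intro ballI allI impI)
    fix u and \<xi> :: "real^'m" assume u: "u \<in> distributions A E" and \<xi>: "norm \<xi> \<le> R"
    have "bdd_above ((\<lambda>x. cmod (u x)) ` ?B)"
      by (rule continuous_dual_bounded[OF u[unfolded distributions_def] B]) (simp add: topspace_LF csubspace_compact_sections)
    then have "cmod (u (?s \<xi>)) \<le> (SUP x\<in>?B. cmod (u x))"
      by (intro cSUP_upper) (use \<xi> in blast)
    then show "cmod (fourier_cutoff \<phi> (local_rep A E c \<Phi> j u) \<xi>) \<le> (SUP x\<in>?B. cmod (u x))"
      by (simp only: fourier_cutoff_wave local_rep_frame_section)
  qed
qed

end

section \<open>Cutoffs on the manifold and in coordinates\<close>

definition pull_back :: "('a, 'm::finite) chart \<Rightarrow> (real^'m \<Rightarrow> complex) \<Rightarrow> 'a \<Rightarrow> complex" where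
  "pull_back c \<phi> = (\<lambda>p. if p \<in> fst c then \<phi> (snd c p) else 0)"

context vector_bundle_on_manifold
begin

lemma push_forward_test_function:
  assumes c: "c \<in> A" and \<phi>: "\<phi> \<in> manifold_test_functions A (fst c)"
  shows "push_forward c \<phi> \<in> test_functions (chart_image c)"
    "closure {y. push_forward c \<phi> y \<noteq> 0} \<subseteq> snd c ` closure {p. \<phi> p \<noteq> 0}"
proof -
  let ?K = "closure {p. \<phi> p \<noteq> 0}"
  have \<phi>D: "smooth_on (chart_image c) (\<phi> \<circ> chart_inv c)" "compact ?K" "?K \<subseteq> fst c"
    using \<phi> c unfolding manifold_test_functions_def by blast+
  have K: "compact (snd c ` ?K)" by (rule compact_chart_image[OF c \<phi>D(2,3)])
  have cK: "closed (snd c ` ?K)" by (rule compact_imp_closed[OF K])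
  have sub: "snd c ` ?K \<subseteq> chart_image c" using \<phi>D(3) by (auto simp: chart_image_def)
  have nz: "{y. push_forward c \<phi> y \<noteq> 0} \<subseteq> snd c ` ?K"
  proof
    fix y assume "y \<in> {y. push_forward c \<phi> y \<noteq> 0}"
    then have y: "y \<in> chart_image c" "\<phi> (chart_inv c y) \<noteq> 0" by (auto simp: push_forward_def split: if_splits)
    have "chart_inv c y \<in> ?K" using y(2) closure_subset[of "{p. \<phi> p \<noteq> 0}"] by blast
    then have "snd c (chart_inv c y) \<in> snd c ` ?K" by (rule imageI)
    then show "y \<in> snd c ` ?K" by (simp add: chart_simps(3)[OF c y(1)])
  qed
  then show cl: "closure {y. push_forward c \<phi> y \<noteq> 0} \<subseteq> snd c ` ?K" by (rule closure_minimal[OF _ cK])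
  have 1: "smooth_on (chart_image c) (push_forward c \<phi>)"
    by (subst smooth_on_cong[OF chart(2)[OF c] _, where g = "\<phi> \<circ> chart_inv c"]) (use \<phi>D(1) in \<open>simp_all add: push_forward_def\<close>)
  have 2: "smooth_on (- (snd c ` ?K)) (push_forward c \<phi>)"
    by (subst smooth_on_cong[OF open_Compl[OF cK], where g = "\<lambda>_. 0"]) (use nz smooth_on_const in auto)
  have "smooth_on UNIV (push_forward c \<phi>)"
  proof (rule smooth_on_local)
    fix y :: "real^'m"
    have "y \<in> chart_image c \<or> y \<in> - (snd c ` ?K)" using sub by blast
    then show "\<exists>W. y \<in> W \<and> smooth_on W (push_forward c \<phi>)"
      by (rule disjE) (rule exI, rule conjI, assumption, rule 1, rule exI, rule conjI, assumption, rule 2)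
  qed
  moreover have "compact (closure {y. push_forward c \<phi> y \<noteq> 0})"
    using compact_Int_closed[OF K closed_closure] cl by (metis Int_absorb1)
  ultimately show "push_forward c \<phi> \<in> test_functions (chart_image c)"
    using cl sub unfolding test_functions_def by blast
qed

text \<open>Cutoffs are constructed in coordinates, whereas admissible data carry functions on the
  manifold; pushing the pull-back forward returns the original function. Smoothness in a further
  chart holds on the overlap by composition and off the compact support because the function
  vanishes there.\<close>

lemma pull_back_test_function:
  assumes c: "c \<in> A" and \<phi>: "\<phi> \<in> test_functions (chart_image c)"
  shows "pull_back c \<phi> \<in> manifold_test_functions A (fst c)" "push_forward c (pull_back c \<phi>) = \<phi>"
    "closure {p. pull_back c \<phi> p \<noteq> 0} \<subseteq> chart_inv c ` closure {y. \<phi> y \<noteq> 0}"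
proof -
  let ?S = "closure {y. \<phi> y \<noteq> 0}"
  let ?K = "chart_inv c ` ?S"
  note \<phi>D = test_functionsD[OF \<phi>]
  have K: "compact ?K" "?K \<subseteq> fst c" using compact_chart_inv[OF c \<phi>D(2,3)] by blast+
  have cK: "closed ?K" by (rule compact_imp_closed[OF K(1)])
  have nz: "{p. pull_back c \<phi> p \<noteq> 0} \<subseteq> ?K"
  proof
    fix p assume "p \<in> {p. pull_back c \<phi> p \<noteq> 0}"
    then have p: "p \<in> fst c" "\<phi> (snd c p) \<noteq> 0" by (auto simp: pull_back_def split: if_splits)
    have "snd c p \<in> ?S" using p(2) closure_subset[of "{y. \<phi> y \<noteq> 0}"] by blast
    then have "chart_inv c (snd c p) \<in> ?K" by (rule imageI)
    then show "p \<in> ?K" by (simp add: chart_simps(1)[OF c p(1)])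
  qed
  then show cl: "closure {p. pull_back c \<phi> p \<noteq> 0} \<subseteq> ?K" by (rule closure_minimal[OF _ cK])
  have "compact (closure {p. pull_back c \<phi> p \<noteq> 0})"
    using compact_Int_closed[OF K(1) closed_closure] cl by (metis Int_absorb1)
  moreover have "smooth_on (chart_image d) (pull_back c \<phi> \<circ> chart_inv d)" if d: "d \<in> A" for d
  proof -
    let ?O = "snd d ` (fst d \<inter> fst c)" and ?N = "snd d ` (fst d \<inter> - ?K)"
    have O: "open ?O" by (rule open_chart_image[OF manifold d chart(1)[OF c]])
    have N: "open ?N" by (rule open_chart_image[OF manifold d open_Compl[OF cK]])
    have "smooth_on ?O (\<lambda>y. \<phi> ((snd c \<circ> chart_inv d) y))"
      by (rule smooth_on_compose[OF O \<phi>D(1) transition[OF d c]]) simp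
    then have 1: "smooth_on ?O (pull_back c \<phi> \<circ> chart_inv d)"
      by (subst smooth_on_cong[OF O, where g = "\<lambda>y. \<phi> ((snd c \<circ> chart_inv d) y)"])
        (simp_all add: pull_back_def overlap_eq[OF d])
    have 2: "smooth_on ?N (pull_back c \<phi> \<circ> chart_inv d)"
    proof (subst smooth_on_cong[OF N])
      show "(pull_back c \<phi> \<circ> chart_inv d) y = 0" if "y \<in> ?N" for y
        using that nz unfolding overlap_eq[OF d] by auto
    qed (rule smooth_on_const)
    show ?thesis
    proof (rule smooth_on_local)
      fix y assume "y \<in> chart_image d"
      then have "y \<in> ?O \<or> y \<in> ?N" unfolding overlap_eq[OF d] using K(2) by blast
      then show "\<exists>W. y \<in> W \<and> smooth_on W (pull_back c \<phi> \<circ> chart_inv d)"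
        by (rule disjE) (rule exI, rule conjI, assumption, rule 1, rule exI, rule conjI, assumption, rule 2)
    qed
  qed
  ultimately show "pull_back c \<phi> \<in> manifold_test_functions A (fst c)"
    unfolding manifold_test_functions_def using cl K(2) by blast
  show "push_forward c (pull_back c \<phi>) = \<phi>"
  proof
    fix y
    have "\<phi> y = 0" if "y \<notin> chart_image c" using that \<phi>D(3) closure_subset[of "{y. \<phi> y \<noteq> 0}"] by blast
    then show "push_forward c (pull_back c \<phi>) y = \<phi> y"
      using chart_simps(3,4)[OF c] by (simp add: push_forward_def pull_back_def)
  qed
qed

lemma coord_covector_in_cotangent_space:
  "coord_covector A c p \<xi> \<in> cotangent_space A p"
proof -
  have add: "(\<lambda>c. X c + Y c) \<in> tangent_space A p" and scale: "(\<lambda>c. a *\<^sub>R X c) \<in> tangent_space A p"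
    if X: "X \<in> tangent_space A p" and Y: "Y \<in> tangent_space A p" for X Y a
  proof -
    have X0: "\<not> (c \<in> A \<and> p \<in> fst c) \<Longrightarrow> X c = 0" and Y0: "\<not> (c \<in> A \<and> p \<in> fst c) \<Longrightarrow> Y c = 0" for c
      using X Y unfolding tangent_space_def by blast+
    have D: "X d = frechet_derivative (snd d \<circ> chart_inv c) (at (snd c p)) (X c)"
      "Y d = frechet_derivative (snd d \<circ> chart_inv c) (at (snd c p)) (Y c)"
      "linear (frechet_derivative (snd d \<circ> chart_inv c) (at (snd c p)))"
      if "c \<in> A" "d \<in> A" "p \<in> fst c \<and> p \<in> fst d" for c d
      using X Y that linear_frechet_derivative[OF transition_differentiable[OF manifold that(1,2)]]
      unfolding tangent_space_def by blast+
    show "(\<lambda>c. X c + Y c) \<in> tangent_space A p"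
      unfolding tangent_space_def
    proof (intro CollectI conjI allI impI ballI)
      fix c d assume a: "c \<in> A" "d \<in> A" "p \<in> fst c \<and> p \<in> fst d"
      show "X d + Y d = frechet_derivative (snd d \<circ> chart_inv c) (at (snd c p)) (X c + Y c)"
        unfolding linear_add[OF D(3)[OF a]] D(1,2)[OF a, symmetric] ..
    qed (use X0 Y0 in simp)
    show "(\<lambda>c. a *\<^sub>R X c) \<in> tangent_space A p"
      unfolding tangent_space_def
    proof (intro CollectI conjI allI impI ballI)
      fix c d assume a: "c \<in> A" "d \<in> A" "p \<in> fst c \<and> p \<in> fst d"
      show "a *\<^sub>R X d = frechet_derivative (snd d \<circ> chart_inv c) (at (snd c p)) (a *\<^sub>R X c)"
        unfolding linear_cmul[OF D(3)[OF a]] D(1)[OF a, symmetric] ..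
    qed (use X0 in simp)
  qed
  show ?thesis
    unfolding cotangent_space_def coord_covector_def
    by (simp add: add scale distrib_left sum.distrib sum_distrib_left mult.left_commute)
qed

lemma coord_covector_scale: "coord_covector A c p (t *\<^sub>R \<xi>) = (\<lambda>X. t * coord_covector A c p \<xi> X)"
  by (rule ext) (simp add: coord_covector_def sum_distrib_left mult.assoc)

lemma coord_covector_nonzero:
  assumes "c \<in> A" "p \<in> fst c" "\<xi> \<noteq> 0"
  shows "coord_covector A c p \<xi> \<noteq> (\<lambda>X. 0)"
proof
  assume z: "coord_covector A c p \<xi> = (\<lambda>X. 0)"
  have "\<xi> $ j = 0" for j
  proof -
    have "coord_vector A c p j c = axis j 1"
      using assms transition_self[OF manifold] by (simp add: coord_vector_def)
    then have "coord_covector A c p \<xi> (coord_vector A c p j) = (\<Sum>i\<in>UNIV. \<xi> $ i * axis j 1 $ i)"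
      using coord_vector_tangent[OF manifold assms(1,2)] by (simp add: coord_covector_def)
    also have "\<dots> = \<xi> $ j" by (simp add: axis_def if_distrib[of "\<lambda>a. _ * a"] cong: if_cong)
    finally show ?thesis using z by simp
  qed
  then show False using assms(3) by (simp add: vec_eq_iff)
qed

end

section \<open>Admissible data and the closed conic set\<close>

locale wave_front_constraint = vector_bundle_on_manifold A E
  for A :: "('a::{t2_space, second_countable_topology}, 'm::finite) chart set"
    and E :: "('a, 'e, 'k::finite) cvbundle" +
  fixes L :: "('a \<times> ('a, 'm) covector) set"
  assumes closed_conic: "closed_conic A L"
begin

text \<open>A nonempty closed cone contains \<open>0\<close>, so admissibility also concerns the
  zero covector; \<open>L\<close> avoids it as a subset of the bundle without its zero
  section.\<close>

lemma zero_covector_not_in: "(p, coord_covector A c p 0) \<notin> L"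
proof -
  have "L \<subseteq> cotangent_bundle_nonzero A"
    using closed_conic closedin_subset unfolding closed_conic_def by fastforce
  moreover have "coord_covector A c p 0 = (\<lambda>X. 0)" by (simp add: coord_covector_def fun_eq_iff)
  ultimately show ?thesis unfolding cotangent_bundle_nonzero_def by auto
qed

lemma scaled_covector_in:
  assumes "0 < t"
  shows "(p, coord_covector A c p (t *\<^sub>R \<xi>)) \<in> L \<longleftrightarrow> (p, coord_covector A c p \<xi>) \<in> L"
proof -
  have *: "(p, coord_covector A c p (s *\<^sub>R \<eta>)) \<in> L" if "(p, coord_covector A c p \<eta>) \<in> L" "0 < s" for s \<eta>
    using closed_conic that unfolding closed_conic_def conic_def coord_covector_scale by blast
  show ?thesis
  proof
    assume "(p, coord_covector A c p (t *\<^sub>R \<xi>)) \<in> L"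
    from *[OF this, of "1 / t"] show "(p, coord_covector A c p \<xi>) \<in> L" using assms by simp
  qed (use * assms in blast)
qed

text \<open>\<open>L\<close> is closed relative to the complement of the zero section, hence is cut
  out there by a closed set of the whole bundle. The condition \<open>\<xi> \<noteq> 0\<close>
  belongs to the set because the closure of \<open>L\<close> may meet the zero section.\<close>

lemma open_coordinates_avoiding:
  assumes c: "c \<in> A"
  shows "open {(y, \<xi>). y \<in> chart_image c \<and> \<xi> \<noteq> 0 \<and> (chart_inv c y, coord_covector A c (chart_inv c y) \<xi>) \<notin> L}"
proof -
  have o: "openin (cotangent_topology A) W \<longleftrightarrow> W \<subseteq> cotangent_bundle A \<and> (\<forall>c\<in>A.
     open {(y, \<xi>). y \<in> chart_image c \<and> (chart_inv c y, coord_covector A c (chart_inv c y) \<xi>) \<in> W})" for W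
    unfolding cotangent_topology_def topology_inverse'[OF istopology_cotangent] ..
  have cov: "(p, coord_covector A d p \<xi>) \<in> cotangent_bundle A" for d p \<xi>
    using coord_covector_in_cotangent_space by (simp add: cotangent_bundle_def)
  have "openin (cotangent_topology A) (cotangent_bundle A)"
    unfolding o
  proof (intro conjI ballI subset_refl)
    fix d assume "d \<in> A"
    have "{(y, \<xi>). y \<in> chart_image d \<and> (chart_inv d y, coord_covector A d (chart_inv d y) \<xi>) \<in> cotangent_bundle A} =
        chart_image d \<times> UNIV" using cov by auto
    then show "open {(y, \<xi>). y \<in> chart_image d \<and> (chart_inv d y, coord_covector A d (chart_inv d y) \<xi>) \<in> cotangent_bundle A}"
      using open_Times[OF chart(2)[OF \<open>d \<in> A\<close>] open_UNIV] by simp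
  qed
  then have top: "cotangent_bundle A \<subseteq> topspace (cotangent_topology A)" by (rule openin_subset)
  have "closedin (subtopology (cotangent_topology A) (cotangent_bundle_nonzero A)) L"
    using closed_conic unfolding closed_conic_def by blast
  then obtain T where T: "closedin (cotangent_topology A) T" "L = T \<inter> cotangent_bundle_nonzero A"
    unfolding closedin_subtopology by blast
  let ?W = "topspace (cotangent_topology A) - T"
  let ?O = "{(y, \<xi>). y \<in> chart_image c \<and> (chart_inv c y, coord_covector A c (chart_inv c y) \<xi>) \<in> ?W}"
  have "openin (cotangent_topology A) ?W" using T(1) by (simp add: closedin_def)
  then have "open ?O" using c unfolding o by blast
  then have "open (?O \<inter> (UNIV \<times> (- {0})))" by (intro open_Int open_Times) auto
  moreover have "?O \<inter> (UNIV \<times> (- {0})) =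
      {(y, \<xi>). y \<in> chart_image c \<and> \<xi> \<noteq> 0 \<and> (chart_inv c y, coord_covector A c (chart_inv c y) \<xi>) \<notin> L}"
  proof -
    have "(chart_inv c y, coord_covector A c (chart_inv c y) \<xi>) \<in> ?W \<longleftrightarrow> (chart_inv c y, coord_covector A c (chart_inv c y) \<xi>) \<notin> L"
      if "y \<in> chart_image c" "\<xi> \<noteq> 0" for y \<xi>
    proof -
      have "(chart_inv c y, coord_covector A c (chart_inv c y) \<xi>) \<in> cotangent_bundle_nonzero A"
        unfolding cotangent_bundle_nonzero_def
        using coord_covector_in_cotangent_space coord_covector_nonzero[OF c chart_simps(4)[OF c that(1)] that(2)] by simp
      then show ?thesis using T(2) top cov by blast
    qed
    then show ?thesis by auto
  qed
  ultimately show ?thesis by simp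
qed

lemma admissible_mono:
  assumes "admissible A E L c \<Phi> \<phi> V" "\<psi> \<in> manifold_test_functions A (fst c)"
    "closure {p. \<psi> p \<noteq> 0} \<subseteq> closure {p. \<phi> p \<noteq> 0}"
  shows "admissible A E L c \<Phi> \<psi> V"
  using assms unfolding admissible_def by blast

text \<open>The product of the support and the unit directions of \<open>V\<close> is compact inside
  an open set, so a uniform \<open>\<epsilon>\<close>-neighbourhood of it remains in that set. The
  conic neighbourhood of aperture \<open>\<epsilon>/2\<close> therefore still avoids
  \<open>L\<close>, and a bounded shift changes the direction of a long vector only a
  little.\<close>

lemma admissible_thickening:
  assumes ad: "admissible A E L c \<Phi> \<phi> V"
  shows "\<exists>V'. admissible A E L c \<Phi> \<phi> V' \<and>
    (\<forall>B. \<exists>R. \<forall>\<xi>\<in>V. \<forall>\<theta>. R \<le> norm \<xi> \<longrightarrow> norm \<theta> \<le> B \<longrightarrow> \<xi> + \<theta> \<in> V')"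
proof -
  let ?K = "closure {p. \<phi> p \<noteq> 0}"
  have t: "triv_chart A E c \<Phi>" and \<phi>: "\<phi> \<in> manifold_test_functions A (fst c)" and V: "closed V" "is_cone V"
    and av: "\<And>p \<xi>. p \<in> ?K \<Longrightarrow> \<xi> \<in> V \<Longrightarrow> (p, coord_covector A c p \<xi>) \<notin> L"
    using ad unfolding admissible_def by blast+
  note cA = triv_chartD(1)[OF t]
  have K: "compact ?K" "?K \<subseteq> fst c" using \<phi> unfolding manifold_test_functions_def by blast+
  let ?S = "V \<inter> sphere 0 1"
  have S: "compact ?S" by (rule closed_Int_compact[OF V(1) compact_sphere])
  let ?G = "{(y, \<xi>). y \<in> chart_image c \<and> \<xi> \<noteq> 0 \<and> (chart_inv c y, coord_covector A c (chart_inv c y) \<xi>) \<notin> L}"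
  have sub: "snd c ` ?K \<times> ?S \<subseteq> ?G"
  proof clarify
    fix p \<xi> assume p: "p \<in> ?K" and \<xi>: "\<xi> \<in> V" "\<xi> \<in> sphere 0 1"
    have "p \<in> fst c" using p K(2) by blast
    then show "snd c p \<in> chart_image c \<and> \<xi> \<noteq> 0 \<and> (chart_inv c (snd c p), coord_covector A c (chart_inv c (snd c p)) \<xi>) \<notin> L"
      using av[OF p \<xi>(1)] \<xi>(2) chart_simps(1,2)[OF cA] by auto
  qed
  obtain \<epsilon> where \<epsilon>: "0 < \<epsilon>" "(\<Union>x\<in>snd c ` ?K \<times> ?S. ball x \<epsilon>) \<subseteq> ?G"
    using compact_subset_open_imp_ball_epsilon_subset[OF compact_Times[OF compact_chart_image[OF cA K] S] open_coordinates_avoiding[OF cA] sub] .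
  let ?\<delta> = "\<epsilon> / 2"
  \<comment> \<open>Written as a projection along the compact set of unit directions, so that
    closedness of the cone follows from closedness of the relation.\<close>
  define V' where "V' = {\<xi>. \<exists>\<zeta>. \<zeta> \<in> ?S \<and> (\<zeta>, \<xi>) \<in> {z. norm (snd z - norm (snd z) *\<^sub>R fst z) \<le> ?\<delta> * norm (snd z)}}"
  have V': "\<xi> \<in> V' \<longleftrightarrow> (\<exists>\<zeta>\<in>?S. norm (\<xi> - norm \<xi> *\<^sub>R \<zeta>) \<le> ?\<delta> * norm \<xi>)" for \<xi>
    by (auto simp: V'_def)
  have "closed V'"
    unfolding V'_def by (intro closed_compact_projection[OF S] closed_Collect_le continuous_intros)
  moreover have "is_cone V'"
    unfolding is_cone_def
  proof (intro ballI allI impI)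
    fix \<xi> :: "real^'m" and t :: real assume \<xi>: "\<xi> \<in> V'" and t0: "0 < t"
    obtain \<zeta> where \<zeta>: "\<zeta> \<in> ?S" "norm (\<xi> - norm \<xi> *\<^sub>R \<zeta>) \<le> ?\<delta> * norm \<xi>" using \<xi> V' by blast
    have "t *\<^sub>R \<xi> - norm (t *\<^sub>R \<xi>) *\<^sub>R \<zeta> = t *\<^sub>R (\<xi> - norm \<xi> *\<^sub>R \<zeta>)" using t0 by (simp add: scaleR_diff_right)
    then have "norm (t *\<^sub>R \<xi> - norm (t *\<^sub>R \<xi>) *\<^sub>R \<zeta>) = t * norm (\<xi> - norm \<xi> *\<^sub>R \<zeta>)" using t0 by simp
    also have "\<dots> \<le> t * (?\<delta> * norm \<xi>)" by (rule mult_left_mono[OF \<zeta>(2)]) (use t0 in simp)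
    also have "\<dots> = ?\<delta> * norm (t *\<^sub>R \<xi>)" using t0 by simp
    finally show "t *\<^sub>R \<xi> \<in> V'" using \<zeta>(1) V' by blast
  qed
  moreover have "(p, coord_covector A c p \<xi>) \<notin> L" if p: "p \<in> ?K" and \<xi>: "\<xi> \<in> V'" for p \<xi>
  proof (cases "\<xi> = 0")
    case True
    then show ?thesis using zero_covector_not_in by simp
  next
    case False
    then have n: "0 < norm \<xi>" by simp
    have pc: "p \<in> fst c" using p K(2) by blast
    obtain \<zeta> where \<zeta>: "\<zeta> \<in> ?S" "norm (\<xi> - norm \<xi> *\<^sub>R \<zeta>) \<le> ?\<delta> * norm \<xi>" using \<xi> V' by blast
    let ?x = "(1 / norm \<xi>) *\<^sub>R \<xi>"
    have "?x - \<zeta> = (1 / norm \<xi>) *\<^sub>R (\<xi> - norm \<xi> *\<^sub>R \<zeta>)" unfolding scaleR_diff_right using n by simp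
    then have "norm (?x - \<zeta>) = (1 / norm \<xi>) * norm (\<xi> - norm \<xi> *\<^sub>R \<zeta>)" using n by simp
    also have "\<dots> \<le> (1 / norm \<xi>) * (?\<delta> * norm \<xi>)" by (rule mult_left_mono[OF \<zeta>(2)]) simp
    also have "\<dots> < \<epsilon>" using n \<epsilon>(1) by simp
    finally have "dist (snd c p, \<zeta>) (snd c p, ?x) < \<epsilon>" by (simp add: dist_Pair_Pair dist_norm norm_minus_commute)
    then have "(snd c p, ?x) \<in> ball (snd c p, \<zeta>) \<epsilon>" by simp
    then have "(snd c p, ?x) \<in> ?G" using \<epsilon>(2) p \<zeta>(1) by blast
    then have "(p, coord_covector A c p ?x) \<notin> L" using chart_simps(1)[OF cA pc] by simp
    then show ?thesis using scaled_covector_in[of "1 / norm \<xi>"] n by simp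
  qed
  ultimately have "admissible A E L c \<Phi> \<phi> V'" using t \<phi> unfolding admissible_def by blast
  moreover have "\<exists>R. \<forall>\<xi>\<in>V. \<forall>\<theta>. R \<le> norm \<xi> \<longrightarrow> norm \<theta> \<le> B \<longrightarrow> \<xi> + \<theta> \<in> V'" for B
  proof (intro exI ballI allI impI)
    fix \<xi> \<theta> :: "real^'m"
    \<comment> \<open>The shift contributes at most \<open>\<bar>B\<bar>\<close> to the vector and
      again to its norm. The threshold makes their total at most \<open>?\<delta>\<close> times the
      length of the shifted vector, and the summand \<open>1\<close> keeps \<open>\<xi>\<close>
      nonzero.\<close>
    assume \<xi>: "\<xi> \<in> V" and R: "2 * \<bar>B\<bar> / ?\<delta> + \<bar>B\<bar> + 1 \<le> norm \<xi>" and \<theta>: "norm \<theta> \<le> B"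
    have d: "0 \<le> 2 * \<bar>B\<bar> / ?\<delta>" using \<epsilon>(1) by simp
    have n: "0 < norm \<xi>" using R d by linarith
    let ?\<zeta> = "(1 / norm \<xi>) *\<^sub>R \<xi>"
    have \<zeta>: "?\<zeta> \<in> ?S" using V(2) \<xi> n unfolding is_cone_def by simp
    have "norm \<xi> - norm \<theta> \<le> norm (\<xi> + \<theta>)" using norm_triangle_ineq4[of "\<xi> + \<theta>" \<theta>] by simp
    then have "2 * \<bar>B\<bar> / ?\<delta> \<le> norm (\<xi> + \<theta>)" using R \<theta> by linarith
    then have big: "2 * \<bar>B\<bar> \<le> ?\<delta> * norm (\<xi> + \<theta>)" using \<epsilon>(1) by (simp add: field_simps)
    have *: "(\<xi> + \<theta>) - s *\<^sub>R z = \<theta> + (norm \<xi> - s) *\<^sub>R z" if "norm \<xi> *\<^sub>R z = \<xi>" for s z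
      using that by (simp add: scaleR_diff_left)
    have eq: "(\<xi> + \<theta>) - norm (\<xi> + \<theta>) *\<^sub>R ?\<zeta> = \<theta> + (norm \<xi> - norm (\<xi> + \<theta>)) *\<^sub>R ?\<zeta>"
      by (rule *) (use n in simp)
    have "norm ((\<xi> + \<theta>) - norm (\<xi> + \<theta>) *\<^sub>R ?\<zeta>) \<le> norm \<theta> + norm ((norm \<xi> - norm (\<xi> + \<theta>)) *\<^sub>R ?\<zeta>)"
      unfolding eq by (rule norm_triangle_ineq)
    also have "norm ((norm \<xi> - norm (\<xi> + \<theta>)) *\<^sub>R ?\<zeta>) = \<bar>norm \<xi> - norm (\<xi> + \<theta>)\<bar>" using n by simp
    also have "\<dots> \<le> norm \<theta>" using norm_triangle_ineq3[of \<xi> "\<xi> + \<theta>"] by simp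
    finally have "norm ((\<xi> + \<theta>) - norm (\<xi> + \<theta>) *\<^sub>R ?\<zeta>) \<le> ?\<delta> * norm (\<xi> + \<theta>)" using \<theta> big by linarith
    then show "\<xi> + \<theta> \<in> V'" using \<zeta> V' by blast
  qed
  ultimately show ?thesis by blast
qed

text \<open>Openness gives a product neighbourhood in coordinates, with a cutoff supported in its
  first factor. The cone consists of the vectors whose positive multiple of length
  \<open>norm \<eta>\<close> lies within \<open>e\<close> of \<open>\<eta>\<close>; the condition is
  multiplied out by the norm, so that it is closed and \<open>0\<close> satisfies it.
  \<open>W\<close> is the open version with strict inequality.\<close>

lemma admissible_neighbourhood:
  assumes t: "triv_chart A E c \<Phi>" and p: "p \<in> fst c" and \<eta>: "\<eta> \<noteq> 0" "(p, coord_covector A c p \<eta>) \<notin> L"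
  shows "\<exists>\<phi> V W. admissible A E L c \<Phi> \<phi> V \<and> push_forward c \<phi> (snd c p) \<noteq> 0 \<and> open W \<and> is_cone W \<and> \<eta> \<in> W \<and> W \<subseteq> V"
proof -
  note cA = triv_chartD(1)[OF t]
  let ?G = "{(y, \<xi>). y \<in> chart_image c \<and> \<xi> \<noteq> 0 \<and> (chart_inv c y, coord_covector A c (chart_inv c y) \<xi>) \<notin> L}"
  have "(snd c p, \<eta>) \<in> ?G" using \<eta> p chart_simps(1,2)[OF cA p] by simp
  then obtain X Y where "open X" "open Y" "(snd c p, \<eta>) \<in> X \<times> Y" "X \<times> Y \<subseteq> ?G"
    by (rule open_prod_elim[OF open_coordinates_avoiding[OF cA]])
  then have XY: "open X" "open Y" "snd c p \<in> X" "\<eta> \<in> Y" "X \<times> Y \<subseteq> ?G" by auto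
  obtain e where e: "0 < e" "cball \<eta> e \<subseteq> Y" using XY(2,4) open_contains_cball by blast
  obtain \<psi> where \<psi>: "\<psi> \<in> test_functions X" "\<psi> (snd c p) \<noteq> 0" using exists_test_function[OF XY(1,3)] by blast
  have "X \<subseteq> chart_image c" using XY(4,5) by blast
  then have \<psi>c: "\<psi> \<in> test_functions (chart_image c)" using test_functions_subset_domain[OF \<psi>(1)] by blast
  let ?\<phi> = "pull_back c \<psi>"
  note pb = pull_back_test_function[OF cA \<psi>c]
  let ?h = "\<lambda>\<xi>. norm (norm \<eta> *\<^sub>R \<xi> - norm \<xi> *\<^sub>R \<eta>)"
  let ?V = "{\<xi>. ?h \<xi> \<le> e * norm \<xi>}" and ?W = "{\<xi>. ?h \<xi> < e * norm \<xi>}"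
  have h: "?h (t *\<^sub>R \<xi>) = t * ?h \<xi>" if "0 < t" for t \<xi>
  proof -
    have "norm \<eta> *\<^sub>R (t *\<^sub>R \<xi>) - norm (t *\<^sub>R \<xi>) *\<^sub>R \<eta> = t *\<^sub>R (norm \<eta> *\<^sub>R \<xi> - norm \<xi> *\<^sub>R \<eta>)"
      using that by (simp add: scaleR_diff_right mult.commute)
    then show ?thesis using that by simp
  qed
  have "closed ?V" by (intro closed_Collect_le continuous_intros)
  moreover have "is_cone ?V" using h by (simp add: is_cone_def mult.left_commute)
  moreover have "(q, coord_covector A c q \<xi>) \<notin> L" if q: "q \<in> closure {p. ?\<phi> p \<noteq> 0}" and \<xi>: "\<xi> \<in> ?V" for q \<xi>
  proof (cases "\<xi> = 0")
    case True
    then show ?thesis using zero_covector_not_in by simp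
  next
    case False
    then have n: "0 < norm \<xi>" by simp
    obtain y where y: "y \<in> closure {y. \<psi> y \<noteq> 0}" "q = chart_inv c y" using q pb(3) by blast
    have yX: "y \<in> X" using y(1) test_functionsD(3)[OF \<psi>(1)] by blast
    let ?t = "norm \<eta> / norm \<xi>"
    have t: "0 < ?t" using n \<eta>(1) by simp
    have "\<eta> - ?t *\<^sub>R \<xi> = (- 1 / norm \<xi>) *\<^sub>R (norm \<eta> *\<^sub>R \<xi> - norm \<xi> *\<^sub>R \<eta>)"
      using n by (simp add: scaleR_diff_right)
    then have "norm (\<eta> - ?t *\<^sub>R \<xi>) = (1 / norm \<xi>) * ?h \<xi>" by simp
    also have "\<dots> \<le> (1 / norm \<xi>) * (e * norm \<xi>)" by (rule mult_left_mono) (use \<xi> in auto)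
    also have "\<dots> = e" using n by simp
    finally have "?t *\<^sub>R \<xi> \<in> cball \<eta> e" by (simp add: dist_norm)
    then have "(y, ?t *\<^sub>R \<xi>) \<in> ?G" using e(2) XY(5) yX by blast
    then show ?thesis using scaled_covector_in[OF t] y(2) by simp
  qed
  ultimately have "admissible A E L c \<Phi> ?\<phi> ?V" using t pb(1) unfolding admissible_def by blast
  moreover have "push_forward c ?\<phi> (snd c p) \<noteq> 0" using pb(2) \<psi>(2) by simp
  moreover have "open ?W" by (intro open_Collect_less continuous_intros)
  moreover have "is_cone ?W" using h by (simp add: is_cone_def mult.left_commute)
  moreover have "\<eta> \<in> ?W" using e(1) \<eta>(1) by simp
  moreover have "?W \<subseteq> ?V" by auto
  ultimately show ?thesis by blast
qed

end

section \<open>Comparison of the two families of seminorms\<close>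

text \<open>The right side exceeds the left side by \<open>(b x - a y)^2 / (a b)\<close>. With the
  norms of two functions as \<open>a\<close> and \<open>b\<close>, this pointwise estimate
  integrates to the triangle inequality in \<open>L2\<close>.\<close>

lemma square_add_le:
  fixes x y a b :: real
  assumes "0 < a" "0 < b"
  shows "(x + y)\<^sup>2 \<le> (a + b) / a * x\<^sup>2 + (a + b) / b * y\<^sup>2"
proof -
  have "0 \<le> (b * x - a * y)\<^sup>2" by simp
  then have "a * b * (x + y)\<^sup>2 \<le> (a + b) * b * x\<^sup>2 + (a + b) * a * y\<^sup>2"
    by (simp add: power2_eq_square algebra_simps)
  then have "(x + y)\<^sup>2 \<le> ((a + b) * b * x\<^sup>2 + (a + b) * a * y\<^sup>2) / (a * b)"
    using assms by (simp add: pos_le_divide_eq mult.commute)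
  also have "\<dots> = (a + b) / a * x\<^sup>2 + (a + b) / b * y\<^sup>2" using assms by (simp add: field_simps)
  finally show ?thesis .
qed

lemma weighted_L2_triangle:
  fixes f g :: "real^'m::finite \<Rightarrow> complex"
  assumes f: "set_integrable lborel V (\<lambda>\<xi>. (cmod (f \<xi>))\<^sup>2 * w \<xi>)"
    and g: "set_integrable lborel V (\<lambda>\<xi>. (cmod (g \<xi>))\<^sup>2 * w \<xi>)"
    and fg: "set_integrable lborel V (\<lambda>\<xi>. (cmod (f \<xi> + g \<xi>))\<^sup>2 * w \<xi>)" and w: "\<And>\<xi>. 0 \<le> w \<xi>"
  shows "sqrt (LINT \<xi>:V|lborel. (cmod (f \<xi> + g \<xi>))\<^sup>2 * w \<xi>) \<le>
    sqrt (LINT \<xi>:V|lborel. (cmod (f \<xi>))\<^sup>2 * w \<xi>) + sqrt (LINT \<xi>:V|lborel. (cmod (g \<xi>))\<^sup>2 * w \<xi>)"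
proof (rule field_le_epsilon)
  let ?I = "\<lambda>f. LINT \<xi>:V|lborel. (cmod (f \<xi>))\<^sup>2 * w \<xi>"
  fix e :: real assume e: "0 < e"
  have I0: "0 \<le> ?I h" for h :: "real^'m \<Rightarrow> complex"
    unfolding set_lebesgue_integral_def by (rule integral_nonneg_AE) (use w in simp)
  \<comment> \<open>The norms are enlarged by \<open>e/2\<close>, since the estimate divides by
    \<open>a\<close> and \<open>b\<close> and the norms may vanish.\<close>
  define a b where "a = sqrt (?I f) + e / 2" and "b = sqrt (?I g) + e / 2"
  have ab: "0 < a" "0 < b" using e I0[of f] I0[of g] by (simp_all add: a_def b_def add_nonneg_pos)
  have "z \<le> (sqrt z + e / 2)\<^sup>2" if "0 \<le> z" for z
    using power_mono[of "sqrt z" "sqrt z + e / 2" 2] that e by simp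
  then have le: "?I f \<le> a\<^sup>2" "?I g \<le> b\<^sup>2" using I0 unfolding a_def b_def by blast+
  have i: "set_integrable lborel V (\<lambda>\<xi>. (a + b) / a * ((cmod (f \<xi>))\<^sup>2 * w \<xi>))" "set_integrable lborel V (\<lambda>\<xi>. (a + b) / b * ((cmod (g \<xi>))\<^sup>2 * w \<xi>))"
    by (intro set_integrable_mult_right impI f g)+
  have "?I (\<lambda>\<xi>. f \<xi> + g \<xi>) \<le> (LINT \<xi>:V|lborel. (a + b) / a * ((cmod (f \<xi>))\<^sup>2 * w \<xi>) + (a + b) / b * ((cmod (g \<xi>))\<^sup>2 * w \<xi>))"
  proof (rule set_integral_mono[OF fg set_integral_add(1)[OF i]])
    fix \<xi> assume "\<xi> \<in> V"
    have "(cmod (f \<xi> + g \<xi>))\<^sup>2 \<le> (cmod (f \<xi>) + cmod (g \<xi>))\<^sup>2" by (intro power_mono norm_triangle_ineq) simp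
    also have "\<dots> \<le> (a + b) / a * (cmod (f \<xi>))\<^sup>2 + (a + b) / b * (cmod (g \<xi>))\<^sup>2" by (rule square_add_le[OF ab])
    finally have "(cmod (f \<xi> + g \<xi>))\<^sup>2 \<le> (a + b) / a * (cmod (f \<xi>))\<^sup>2 + (a + b) / b * (cmod (g \<xi>))\<^sup>2" .
    from mult_right_mono[OF this w[of \<xi>]]
    show "(cmod (f \<xi> + g \<xi>))\<^sup>2 * w \<xi> \<le> (a + b) / a * ((cmod (f \<xi>))\<^sup>2 * w \<xi>) + (a + b) / b * ((cmod (g \<xi>))\<^sup>2 * w \<xi>)"
      by (simp only: distrib_right mult.assoc)
  qed
  also have "\<dots> = (a + b) / a * ?I f + (a + b) / b * ?I g"
    by (simp only: set_integral_add(2)[OF i] set_integral_mult_right)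
  also have "\<dots> \<le> (a + b) / a * a\<^sup>2 + (a + b) / b * b\<^sup>2"
    using ab le by (intro add_mono mult_left_mono) auto
  also have "\<dots> = (a + b)\<^sup>2" using ab by (simp add: power2_eq_square field_simps)
  finally have "sqrt (?I (\<lambda>\<xi>. f \<xi> + g \<xi>)) \<le> a + b" using ab by (intro real_le_lsqrt) auto
  then show "sqrt (?I (\<lambda>\<xi>. f \<xi> + g \<xi>)) \<le> sqrt (?I f) + sqrt (?I g) + e" by (simp add: a_def b_def)
qed

lemma seminorm_on_Max:
  fixes p :: "'k::finite \<Rightarrow> 'v::complex_vect \<Rightarrow> real"
  assumes "csubspace S" "\<And>j. seminorm_on S (p j)"
  shows "seminorm_on S (\<lambda>x. Max (range (\<lambda>j. p j x)))"
proof -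
  have "Max (range (\<lambda>j. p j x)) = (SUP j. p j x)" for x by (rule cSup_eq_Max[symmetric]) auto
  then show ?thesis
    using seminorm_on_SUP[OF assms(1), of UNIV p] assms(2) by simp
qed

lemma continuous_map_seminorm_topology_inclusion:
  assumes S: "csubspace S" and P: "\<And>p. p \<in> P \<Longrightarrow> seminorm_on S p"
    and S': "csubspace S'" and P': "\<And>p. p \<in> P' \<Longrightarrow> seminorm_on S' p" and sub: "S \<subseteq> S'"
    and bound: "\<And>p. p \<in> P' \<Longrightarrow> \<exists>F C. finite F \<and> F \<subseteq> P \<and> 0 \<le> C \<and> (\<forall>x\<in>S. p x \<le> C * (\<Sum>q\<in>F. q x))"
  shows "continuous_map (seminorm_topology S P) (seminorm_topology S' P') (\<lambda>x. x)"
proof (rule continuous_map_into_seminorm_topology[OF S' P'])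
  show "(\<lambda>x. x) \<in> topspace (seminorm_topology S P) \<rightarrow> S'" using sub by auto
  fix p x and e :: real assume p: "p \<in> P'" and x: "x \<in> topspace (seminorm_topology S P)" and e: "0 < e"
  have x: "x \<in> S" using x by simp
  obtain F C where F: "finite F" "F \<subseteq> P" "0 \<le> C" "\<forall>x\<in>S. p x \<le> C * (\<Sum>q\<in>F. q x)"
    using bound[OF p] by (elim exE conjE)
  have PF: "seminorm_on S q" if "q \<in> F" for q using P F(2) that by blast
  have "\<exists>\<delta>>0. \<forall>x\<in>S. (\<forall>q\<in>F. q x < \<delta>) \<longrightarrow> p x < e"
  proof (rule seminorm_bound_ball[OF S PF F(1,3) bspec[OF F(4)] e])
    fix \<delta> assume "0 < \<delta>" "\<And>x. x \<in> S \<Longrightarrow> (\<And>q. q \<in> F \<Longrightarrow> q x < \<delta>) \<Longrightarrow> p x < e"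
    then show ?thesis by (intro exI conjI ballI impI) auto
  qed
  then obtain \<delta> where \<delta>: "0 < \<delta>" "\<forall>x\<in>S. (\<forall>q\<in>F. q x < \<delta>) \<longrightarrow> p x < e" by (elim exE conjE)
  let ?W = "{y \<in> S. \<forall>q\<in>F. q (y - x) < \<delta>}"
  show "\<exists>W. openin (seminorm_topology S P) W \<and> x \<in> W \<and> (\<forall>y\<in>W. p (y - x) < e)"
  proof (intro exI[of _ ?W] conjI ballI)
    show "openin (seminorm_topology S P) ?W" by (rule openin_seminorm_ball[OF F(1,2) x \<delta>(1)])
    have "q (x - x) < \<delta>" if "q \<in> F" for q using seminorm_on_zero[OF S PF[OF that]] \<delta>(1) by simp
    then show "x \<in> ?W" using x by (intro CollectI conjI ballI)
    fix y assume "y \<in> ?W"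
    then show "p (y - x) < e" using bspec[OF \<delta>(2), of "y - x"] csubspace_diff[OF S _ x] by simp
  qed
qed

lemma local_rep_add: "local_rep A E c \<Phi> j (u + v) = (\<lambda>\<phi>. local_rep A E c \<Phi> j u \<phi> + local_rep A E c \<Phi> j v \<phi>)"
  by (simp add: local_rep_def fun_eq_iff)

lemma local_rep_scaleC: "local_rep A E c \<Phi> j (a *\<^sub>C u) = (\<lambda>\<phi>. a * local_rep A E c \<Phi> j u \<phi>)"
  by (simp add: local_rep_def scaleC_fun_def scaleC_complex_def fun_eq_iff)

section \<open>The spaces of finite Sobolev order\<close>

context wave_front_constraint
begin

abbreviation transform where
  "transform c \<Phi> \<phi> j u \<equiv> fourier_cutoff (push_forward c \<phi>) (local_rep A E c \<Phi> j u)"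

lemma transform_add: "transform c \<Phi> \<phi> j (u + v) = (\<lambda>\<xi>. transform c \<Phi> \<phi> j u \<xi> + transform c \<Phi> \<phi> j v \<xi>)"
  by (simp add: local_rep_add fourier_cutoff_def fun_eq_iff)

lemma transform_scaleC: "transform c \<Phi> \<phi> j (a *\<^sub>C u) = (\<lambda>\<xi>. a * transform c \<Phi> \<phi> j u \<xi>)"
  by (simp add: local_rep_scaleC fourier_cutoff_def fun_eq_iff)

lemma csubspace_distributions: "csubspace (distributions A E)"
  unfolding distributions_def by (rule csubspace_continuous_dual)

lemma topspace_distribution_topology: "topspace (distribution_topology A E) = distributions A E"
  unfolding distribution_topology_def strong_dual_def distributions_def by simp

lemma admissibleD:
  assumes "admissible A E L c \<Phi> \<phi> V"
  shows "triv_chart A E c \<Phi>" "c \<in> A" "push_forward c \<phi> \<in> test_functions (chart_image c)"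
    "closed V" "is_cone V" "V \<in> sets borel"
proof -
  show t: "triv_chart A E c \<Phi>" and V: "closed V" "is_cone V"
    using assms unfolding admissible_def by blast+
  show c: "c \<in> A" by (rule triv_chartD(1)[OF t])
  show "push_forward c \<phi> \<in> test_functions (chart_image c)"
    by (rule push_forward_test_function(1)[OF c]) (use assms in \<open>simp add: admissible_def\<close>)
  show "V \<in> sets borel" using V(1) by simp
qed

lemma transform_continuous:
  assumes "admissible A E L c \<Phi> \<phi> V" "u \<in> distributions A E"
  shows "continuous_on UNIV (transform c \<Phi> \<phi> j u)"
  by (rule continuous_fourier_cutoff[OF local_distribution_local_rep[OF assms(2) admissibleD(1)[OF assms(1)]] admissibleD(3)[OF assms(1)]])

lemma transform_measurable:
  assumes "admissible A E L c \<Phi> \<phi> V" "u \<in> distributions A E"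
  shows "transform c \<Phi> \<phi> j u \<in> borel_measurable borel"
  by (rule borel_measurable_continuous_onI[OF transform_continuous[OF assms]])

text \<open>Admissible data avoid \<open>L\<close>, hence the wave front set, so the patching over
  the compact support applies to them. Conversely, a covector outside \<open>L\<close> has
  admissible data around it, and their finite mass makes its direction regular. The Sobolev
  integrals thus have their proper meaning on the whole space, which linearity and the triangle
  inequality rely on.\<close>

lemma sobolev_WF_space_iff:
  "u \<in> sobolev_WF_space A E L r \<longleftrightarrow> u \<in> distributions A E \<and>
    (\<forall>c \<Phi> \<phi> V j. admissible A E L c \<Phi> \<phi> V \<longrightarrow> sobolev_mass V r (transform c \<Phi> \<phi> j u) < \<infinity>)"
proof (intro iffI conjI allI impI)
  assume u: "u \<in> sobolev_WF_space A E L r"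
  then show ud: "u \<in> distributions A E" unfolding sobolev_WF_space_def by simp
  fix c \<Phi> \<phi> V j assume ad: "admissible A E L c \<Phi> \<phi> V"
  note D = admissibleD[OF ad]
  have \<phi>: "\<phi> \<in> manifold_test_functions A (fst c)" and
    av: "\<And>p \<xi>. p \<in> closure {p. \<phi> p \<noteq> 0} \<Longrightarrow> \<xi> \<in> V \<Longrightarrow> (p, coord_covector A c p \<xi>) \<notin> L"
    using ad unfolding admissible_def by blast+
  have sub: "closure {p. \<phi> p \<noteq> 0} \<subseteq> fst c" using \<phi> unfolding manifold_test_functions_def by blast
  show "sobolev_mass V r (transform c \<Phi> \<phi> j u) < \<infinity>"
  proof (rule sobolev_mass_regular[OF local_distribution_local_rep[OF ud D(1)] D(3-5)])
    fix y \<eta> assume y: "y \<in> closure {y. push_forward c \<phi> y \<noteq> 0}" and \<eta>: "\<eta> \<in> V"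
    obtain p where p: "p \<in> closure {p. \<phi> p \<noteq> 0}" "y = snd c p"
      using y push_forward_test_function(2)[OF D(2) \<phi>] by blast
    show "(y, \<eta>) \<notin> WF_sobolev_local (chart_image c) r (local_rep A E c \<Phi> j u)"
    proof
      assume "(y, \<eta>) \<in> WF_sobolev_local (chart_image c) r (local_rep A E c \<Phi> j u)"
      then have "(p, coord_covector A c p \<eta>) \<in> WF_sobolev A E r u"
        unfolding WF_sobolev_def p(2) using D(1) p(1) sub by blast
      then show False using u av[OF p(1) \<eta>] unfolding sobolev_WF_space_def by blast
    qed
  qed
next
  assume u: "u \<in> distributions A E \<and>
    (\<forall>c \<Phi> \<phi> V j. admissible A E L c \<Phi> \<phi> V \<longrightarrow> sobolev_mass V r (transform c \<Phi> \<phi> j u) < \<infinity>)"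
  then have ud: "u \<in> distributions A E" and fin: "\<And>c \<Phi> \<phi> V j. admissible A E L c \<Phi> \<phi> V \<Longrightarrow> sobolev_mass V r (transform c \<Phi> \<phi> j u) < \<infinity>"
    by blast+
  have "WF_sobolev A E r u \<subseteq> L"
  proof
    fix z assume "z \<in> WF_sobolev A E r u"
    then obtain p c \<Phi> \<xi> j where z: "z = (p, coord_covector A c p \<xi>)" and t: "triv_chart A E c \<Phi>" and p: "p \<in> fst c"
      and wf: "(snd c p, \<xi>) \<in> WF_sobolev_local (chart_image c) r (local_rep A E c \<Phi> j u)"
      unfolding WF_sobolev_def by blast
    have \<xi>: "\<xi> \<noteq> 0" using wf unfolding WF_sobolev_local_def by blast
    show "z \<in> L"
    proof (rule ccontr)
      assume "z \<notin> L"
      then have "(p, coord_covector A c p \<xi>) \<notin> L" using z by simp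
      from admissible_neighbourhood[OF t p \<xi> this]
      obtain \<phi> V W where ad: "admissible A E L c \<Phi> \<phi> V" and nz: "push_forward c \<phi> (snd c p) \<noteq> 0"
        and W: "open W" "is_cone W" "\<xi> \<in> W" "W \<subseteq> V" by (elim exE conjE)
      have Wb: "W \<in> sets borel" using W(1) by simp
      have "sobolev_mass W r (transform c \<Phi> \<phi> j u) < \<infinity>"
        using sobolev_mass_subset[OF W(4)] fin[OF ad] by (rule le_less_trans)
      then have "set_integrable lborel W (\<lambda>\<xi>. (cmod (transform c \<Phi> \<phi> j u \<xi>))\<^sup>2 * bracket \<xi> powr (2 * r))"
        using sobolev_mass_integrable[OF transform_measurable[OF ad ud] Wb] by simp
      then show False
        using wf W(1-3) nz admissibleD(3)[OF ad] unfolding WF_sobolev_local_def by blast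
    qed
  qed
  then show "u \<in> sobolev_WF_space A E L r" using ud unfolding sobolev_WF_space_def by simp
qed

lemma sobolev_integrable:
  assumes "u \<in> sobolev_WF_space A E L r" "admissible A E L c \<Phi> \<phi> V"
  shows "set_integrable lborel V (\<lambda>\<xi>. (cmod (transform c \<Phi> \<phi> j u \<xi>))\<^sup>2 * bracket \<xi> powr (2 * r))"
proof -
  have u: "u \<in> distributions A E" "sobolev_mass V r (transform c \<Phi> \<phi> j u) < \<infinity>"
    using assms unfolding sobolev_WF_space_iff by blast+
  show ?thesis using sobolev_mass_integrable[OF transform_measurable[OF assms(2) u(1)] admissibleD(6)[OF assms(2)]] u(2) by simp
qed

lemma csubspace_sobolev_WF_space: "csubspace (sobolev_WF_space A E L r)"
  unfolding csubspace_def
proof (intro conjI ballI allI)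
  note d = csubspace_distributions[unfolded csubspace_def]
  \<comment> \<open>The alternative \<open>a = 0\<close> allows the same argument to show that the
    zero distribution belongs to the space.\<close>
  have s: "a *\<^sub>C u \<in> sobolev_WF_space A E L r" if u: "u \<in> distributions A E"
    "a = 0 \<or> u \<in> sobolev_WF_space A E L r" for a u
    unfolding sobolev_WF_space_iff
  proof (intro conjI allI impI)
    show au: "a *\<^sub>C u \<in> distributions A E" using d u(1) by simp
    fix c \<Phi> \<phi> V j assume ad: "admissible A E L c \<Phi> \<phi> V"
    have "set_integrable lborel V (\<lambda>\<xi>. (cmod (transform c \<Phi> \<phi> j (a *\<^sub>C u) \<xi>))\<^sup>2 * bracket \<xi> powr (2 * r))"
    proof (cases "a = 0")
      case True
      then show ?thesis unfolding transform_scaleC by (simp add: set_integrable_def)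
    next
      case False
      then have "set_integrable lborel V (\<lambda>\<xi>. (cmod a)\<^sup>2 * ((cmod (transform c \<Phi> \<phi> j u \<xi>))\<^sup>2 * bracket \<xi> powr (2 * r)))"
        using sobolev_integrable[OF _ ad] u(2) by (intro set_integrable_mult_right impI) blast
      then show ?thesis unfolding transform_scaleC by (simp add: norm_mult power_mult_distrib mult.assoc)
    qed
    then show "sobolev_mass V r (transform c \<Phi> \<phi> j (a *\<^sub>C u)) < \<infinity>"
      using sobolev_mass_integrable[OF transform_measurable[OF ad au] admissibleD(6)[OF ad]] by simp
  qed
  show "0 \<in> sobolev_WF_space A E L r" using s[of 0 0] d by simp
  fix u assume u: "u \<in> sobolev_WF_space A E L r"
  then have ud: "u \<in> distributions A E" unfolding sobolev_WF_space_iff by blast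
  show "a *\<^sub>C u \<in> sobolev_WF_space A E L r" for a using s[OF ud] u by blast
  fix v assume v: "v \<in> sobolev_WF_space A E L r"
  then have vd: "v \<in> distributions A E" unfolding sobolev_WF_space_iff by blast
  show "u + v \<in> sobolev_WF_space A E L r"
    unfolding sobolev_WF_space_iff
  proof (intro conjI allI impI)
    show "u + v \<in> distributions A E" using d ud vd by blast
    fix c \<Phi> \<phi> V j assume ad: "admissible A E L c \<Phi> \<phi> V"
    show "sobolev_mass V r (transform c \<Phi> \<phi> j (u + v)) < \<infinity>"
      unfolding transform_add
      by (rule sobolev_mass_add[OF transform_measurable[OF ad ud] transform_measurable[OF ad vd] admissibleD(6)[OF ad]])
        (use u v ad in \<open>unfold sobolev_WF_space_iff, blast+\<close>)
  qed
qed

definition sobolev_part where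
  "sobolev_part r c \<Phi> \<phi> V j u = sqrt (LINT \<xi>:V|lborel. (cmod (transform c \<Phi> \<phi> j u \<xi>))\<^sup>2 * bracket \<xi> powr (2 * r))"

definition decay_part where
  "decay_part \<nu> c \<Phi> \<phi> V j u = (SUP \<xi>\<in>V. bracket \<xi> powr \<nu> * cmod (transform c \<Phi> \<phi> j u \<xi>))"

lemma sobolev_seminorm_eq: "sobolev_seminorm A E r c \<Phi> \<phi> V = (\<lambda>u. Max (range (\<lambda>j. sobolev_part r c \<Phi> \<phi> V j u)))"
  by (simp add: sobolev_seminorm_def sobolev_part_def fun_eq_iff)

lemma decay_seminorm_eq: "decay_seminorm A E \<nu> c \<Phi> \<phi> V = (\<lambda>u. Max (range (\<lambda>j. decay_part \<nu> c \<Phi> \<phi> V j u)))"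
  by (simp add: decay_seminorm_def decay_part_def fun_eq_iff)

lemma sobolev_part_le: "sobolev_part r c \<Phi> \<phi> V j u \<le> sobolev_seminorm A E r c \<Phi> \<phi> V u"
  unfolding sobolev_seminorm_eq by (rule Max_ge) auto

lemma decay_part_le: "decay_part \<nu> c \<Phi> \<phi> V j u \<le> decay_seminorm A E \<nu> c \<Phi> \<phi> V u"
  unfolding decay_seminorm_eq by (rule Max_ge) auto

lemma seminorm_on_sobolev:
  assumes ad: "admissible A E L c \<Phi> \<phi> V"
  shows "seminorm_on (sobolev_WF_space A E L r) (sobolev_seminorm A E r c \<Phi> \<phi> V)"
  unfolding sobolev_seminorm_eq
proof (rule seminorm_on_Max[OF csubspace_sobolev_WF_space])
  fix j
  show "seminorm_on (sobolev_WF_space A E L r) (sobolev_part r c \<Phi> \<phi> V j)"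
  proof (rule seminorm_onI[OF csubspace_sobolev_WF_space])
    fix u v assume u: "u \<in> sobolev_WF_space A E L r" and v: "v \<in> sobolev_WF_space A E L r"
    have uv: "u + v \<in> sobolev_WF_space A E L r"
      using csubspace_sobolev_WF_space u v unfolding csubspace_def by blast
    show "sobolev_part r c \<Phi> \<phi> V j (u + v) \<le> sobolev_part r c \<Phi> \<phi> V j u + sobolev_part r c \<Phi> \<phi> V j v"
      unfolding sobolev_part_def transform_add
      by (rule weighted_L2_triangle[OF sobolev_integrable[OF u ad] sobolev_integrable[OF v ad]
          sobolev_integrable[OF uv ad, unfolded transform_add]]) simp
  next
    fix a u assume u: "u \<in> sobolev_WF_space A E L r"
    have "(LINT \<xi>:V|lborel. (cmod (transform c \<Phi> \<phi> j (a *\<^sub>C u) \<xi>))\<^sup>2 * bracket \<xi> powr (2 * r)) =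
        (LINT \<xi>:V|lborel. (cmod a)\<^sup>2 * ((cmod (transform c \<Phi> \<phi> j u \<xi>))\<^sup>2 * bracket \<xi> powr (2 * r)))"
      unfolding transform_scaleC by (simp only: norm_mult power_mult_distrib mult.assoc)
    then show "sobolev_part r c \<Phi> \<phi> V j (a *\<^sub>C u) \<le> cmod a * sobolev_part r c \<Phi> \<phi> V j u"
      unfolding sobolev_part_def by (simp add: real_sqrt_mult)
  qed
qed

text \<open>On the space the mass is finite, so it coincides with the Bochner integral. Seminorms
  can then be compared through the extended nonnegative integrals.\<close>

lemma sobolev_part_eq:
  assumes "u \<in> sobolev_WF_space A E L r" "admissible A E L c \<Phi> \<phi> V"
  shows "sobolev_part r c \<Phi> \<phi> V j u = sqrt (enn2real (sobolev_mass V r (transform c \<Phi> \<phi> j u)))"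
proof -
  have u: "u \<in> distributions A E" "sobolev_mass V r (transform c \<Phi> \<phi> j u) < \<infinity>"
    using assms unfolding sobolev_WF_space_iff by blast+
  let ?I = "LINT \<xi>:V|lborel. (cmod (transform c \<Phi> \<phi> j u \<xi>))\<^sup>2 * bracket \<xi> powr (2 * r)"
  have "0 \<le> ?I" unfolding set_lebesgue_integral_def by (rule integral_nonneg_AE) simp
  then have "?I = enn2real (ennreal ?I)" by (rule enn2real_ennreal[symmetric])
  also have "ennreal ?I = sobolev_mass V r (transform c \<Phi> \<phi> j u)"
    by (rule sobolev_mass_integral[OF transform_measurable[OF assms(2) u(1)] admissibleD(6)[OF assms(2)] u(2)])
  finally show ?thesis by (simp only: sobolev_part_def)
qed

lemma sobolev_WF_space_antimono:
  assumes "r \<le> s" shows "sobolev_WF_space A E L s \<subseteq> sobolev_WF_space A E L r"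
proof
  fix u assume u: "u \<in> sobolev_WF_space A E L s"
  show "u \<in> sobolev_WF_space A E L r"
    unfolding sobolev_WF_space_iff
  proof (intro conjI allI impI)
    show "u \<in> distributions A E" using u unfolding sobolev_WF_space_iff by blast
    fix c \<Phi> \<phi> V j assume ad: "admissible A E L c \<Phi> \<phi> V"
    then have "sobolev_mass V s (transform c \<Phi> \<phi> j u) < \<infinity>" using u unfolding sobolev_WF_space_iff by blast
    then show "sobolev_mass V r (transform c \<Phi> \<phi> j u) < \<infinity>"
      by (rule le_less_trans[OF sobolev_mass_mono[OF assms]])
  qed
qed

lemma sobolev_seminorm_mono:
  assumes "r \<le> s" "u \<in> sobolev_WF_space A E L s" "admissible A E L c \<Phi> \<phi> V"
  shows "sobolev_seminorm A E r c \<Phi> \<phi> V u \<le> sobolev_seminorm A E s c \<Phi> \<phi> V u"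
proof -
  have u: "u \<in> sobolev_WF_space A E L r" using sobolev_WF_space_antimono[OF assms(1)] assms(2) by blast
  have "sobolev_part r c \<Phi> \<phi> V j u \<le> sobolev_part s c \<Phi> \<phi> V j u" for j
  proof -
    have "sobolev_mass V s (transform c \<Phi> \<phi> j u) < \<infinity>" using assms(2,3) unfolding sobolev_WF_space_iff by blast
    then show ?thesis
      unfolding sobolev_part_eq[OF u assms(3)] sobolev_part_eq[OF assms(2,3)]
      by (intro real_sqrt_le_mono enn2real_mono sobolev_mass_mono[OF assms(1)]) simp
  qed
  then have "sobolev_part r c \<Phi> \<phi> V j u \<le> sobolev_seminorm A E s c \<Phi> \<phi> V u" for j
    using sobolev_part_le order_trans by blast
  then show ?thesis unfolding sobolev_seminorm_eq[of r] by (intro Max.boundedI) auto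
qed

end

section \<open>Decay estimates from Sobolev seminorms\<close>

context wave_front_constraint
begin

text \<open>From a radius \<open>R\<close> on, the whole translated cube lies in the thickened cone
  \<open>V'\<close>, so the averaging formula and the bound for averages apply. For the remaining
  \<open>\<xi>\<close> the bracket is bounded and the seminorm \<open>w\<close> controls the
  transform. The data \<open>\<phi>'\<close>, \<open>V'\<close>, \<open>w\<close> and
  \<open>C\<close> are independent of \<open>u\<close> and \<open>\<xi>\<close>, which makes this an
  estimate between seminorms.\<close>

lemma decay_bound:
  assumes ad: "admissible A E L c \<Phi> \<phi> V" and \<nu>: "0 \<le> \<nu>"
  shows "\<exists>\<phi>' V' w C. admissible A E L c \<Phi> \<phi>' V' \<and> w \<in> continuous_seminorms (distribution_topology A E) \<and> 0 \<le> C \<and>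
    (\<forall>u\<in>sobolev_WF_space A E L \<nu>. \<forall>\<xi>\<in>V.
      bracket \<xi> powr \<nu> * cmod (transform c \<Phi> \<phi> j u \<xi>) \<le> C * (sobolev_part \<nu> c \<Phi> \<phi>' V' j u + w u))"
proof -
  note D = admissibleD[OF ad]
  have \<phi>: "\<phi> \<in> manifold_test_functions A (fst c)" using ad unfolding admissible_def by blast
  from fourier_cutoff_average[OF D(3)] obtain b \<psi> where \<psi>: "\<psi> \<in> test_functions (chart_image c)"
    "{y. \<psi> y \<noteq> 0} \<subseteq> {y. push_forward c \<phi> y \<noteq> 0}"
    and avg: "\<forall>v \<xi>. local_distribution (chart_image c) v \<longrightarrow>
      fourier_cutoff (push_forward c \<phi>) v \<xi> = integral (cbox 0 b) (\<lambda>\<theta>. fourier_cutoff \<psi> v (\<xi> + \<theta>))"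
    by (elim exE conjE)
  let ?\<phi> = "pull_back c \<psi>"
  note pb = pull_back_test_function[OF D(2) \<psi>(1)]
  have "{p. ?\<phi> p \<noteq> 0} \<subseteq> {p. \<phi> p \<noteq> 0}"
  proof
    fix p assume "p \<in> {p. ?\<phi> p \<noteq> 0}"
    then have p: "p \<in> fst c" "\<psi> (snd c p) \<noteq> 0" by (auto simp: pull_back_def split: if_splits)
    then have "push_forward c \<phi> (snd c p) \<noteq> 0" using \<psi>(2) by blast
    then show "p \<in> {p. \<phi> p \<noteq> 0}" using chart_simps(1,2)[OF D(2) p(1)] by (simp add: push_forward_def)
  qed
  \<comment> \<open>The modified cutoff has no larger support, so it is admissible with the original
    cone; the thickening is carried out for it afterwards.\<close>
  then have ad1: "admissible A E L c \<Phi> ?\<phi> V" by (intro admissible_mono[OF ad pb(1)] closure_mono)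
  obtain V' where ad2: "admissible A E L c \<Phi> ?\<phi> V'"
    and thick: "\<forall>B. \<exists>R. \<forall>\<xi>\<in>V. \<forall>\<theta>. R \<le> norm \<xi> \<longrightarrow> norm \<theta> \<le> B \<longrightarrow> \<xi> + \<theta> \<in> V'"
    using admissible_thickening[OF ad1] by (elim exE conjE)
  have "bounded (cbox 0 b)" by (rule bounded_cbox)
  then obtain B where B: "\<forall>\<theta>\<in>cbox 0 b. norm \<theta> \<le> B" unfolding bounded_iff by (elim exE)
  obtain R where R: "\<forall>\<xi>\<in>V. \<forall>\<theta>. R \<le> norm \<xi> \<longrightarrow> norm \<theta> \<le> B \<longrightarrow> \<xi> + \<theta> \<in> V'"
    using spec[OF thick, of B] by (elim exE)
  obtain w where w: "w \<in> continuous_seminorms (distribution_topology A E)"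
    "\<forall>u\<in>distributions A E. \<forall>\<xi>. norm \<xi> \<le> R \<longrightarrow> cmod (transform c \<Phi> \<phi> j u \<xi>) \<le> w u"
    using fourier_cutoff_locally_bounded[OF D(1,3), of R j] by (elim bexE)
  obtain C where C: "0 \<le> C" "\<forall>f V \<xi>. continuous_on UNIV f \<longrightarrow> V \<in> sets borel \<longrightarrow> sobolev_mass V \<nu> f < \<infinity> \<longrightarrow>
    (\<forall>\<theta>\<in>cbox 0 b. \<xi> + \<theta> \<in> V) \<longrightarrow>
    bracket \<xi> powr \<nu> * cmod (integral (cbox 0 b) (\<lambda>\<theta>. f (\<xi> + \<theta>))) \<le> C * sqrt (enn2real (sobolev_mass V \<nu> f))"
    using average_sup_bound[where b = b and \<nu> = \<nu>] by (elim exE conjE)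
  let ?M = "(1 + \<bar>R\<bar>) powr \<nu>"
  show ?thesis
  proof (intro exI conjI ballI)
    show "admissible A E L c \<Phi> ?\<phi> V'" by (rule ad2)
    show "w \<in> continuous_seminorms (distribution_topology A E)" by (rule w(1))
    show "0 \<le> C + ?M" using C(1) by simp
    fix u \<xi> assume u: "u \<in> sobolev_WF_space A E L \<nu>" and \<xi>: "\<xi> \<in> V"
    have ud: "u \<in> distributions A E" using u unfolding sobolev_WF_space_iff by blast
    have w0: "0 \<le> w u"
      using w(1) ud seminorm_on_nonneg[OF csubspace_distributions, of w u]
      unfolding continuous_seminorms_def topspace_distribution_topology by blast
    have s0: "0 \<le> sobolev_part \<nu> c \<Phi> ?\<phi> V' j u"
      unfolding sobolev_part_eq[OF u ad2] by simp
    show "bracket \<xi> powr \<nu> * cmod (transform c \<Phi> \<phi> j u \<xi>) \<le> (C + ?M) * (sobolev_part \<nu> c \<Phi> ?\<phi> V' j u + w u)"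
    proof (cases "R \<le> norm \<xi>")
      case True
      have cont: "continuous_on UNIV (transform c \<Phi> ?\<phi> j u)" by (rule transform_continuous[OF ad2 ud])
      have fin: "sobolev_mass V' \<nu> (transform c \<Phi> ?\<phi> j u) < \<infinity>" using u ad2 unfolding sobolev_WF_space_iff by blast
      have "\<forall>\<theta>\<in>cbox 0 b. \<xi> + \<theta> \<in> V'" using R \<xi> True B by blast
      then have "bracket \<xi> powr \<nu> * cmod (integral (cbox 0 b) (\<lambda>\<theta>. transform c \<Phi> ?\<phi> j u (\<xi> + \<theta>))) \<le> C * sobolev_part \<nu> c \<Phi> ?\<phi> V' j u"
        unfolding sobolev_part_eq[OF u ad2] using C(2)[rule_format, OF cont admissibleD(6)[OF ad2] fin] by blast
      moreover have "transform c \<Phi> \<phi> j u \<xi> = integral (cbox 0 b) (\<lambda>\<theta>. transform c \<Phi> ?\<phi> j u (\<xi> + \<theta>))"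
        unfolding pb(2) using avg[rule_format, OF local_distribution_local_rep[OF ud D(1)]] .
      ultimately have "bracket \<xi> powr \<nu> * cmod (transform c \<Phi> \<phi> j u \<xi>) \<le> C * sobolev_part \<nu> c \<Phi> ?\<phi> V' j u" by simp
      also have "\<dots> \<le> (C + ?M) * (sobolev_part \<nu> c \<Phi> ?\<phi> V' j u + w u)"
        using C(1) s0 w0 by (intro mult_mono) auto
      finally show ?thesis .
    next
      case False
      have "bracket \<xi> \<le> 1 + \<bar>R\<bar>" using bracket_le[of \<xi>] False by linarith
      then have "bracket \<xi> powr \<nu> \<le> ?M" using bracket_ge_1[of \<xi>] \<nu> by (intro powr_mono2) auto
      moreover have "cmod (transform c \<Phi> \<phi> j u \<xi>) \<le> w u" using w(2) ud False by simp
      ultimately have "bracket \<xi> powr \<nu> * cmod (transform c \<Phi> \<phi> j u \<xi>) \<le> ?M * w u" by (intro mult_mono) auto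
      also have "\<dots> \<le> (C + ?M) * (sobolev_part \<nu> c \<Phi> ?\<phi> V' j u + w u)"
        using C(1) s0 w0 by (intro mult_mono) auto
      finally show ?thesis .
    qed
  qed
qed

text \<open>The inclusion is local and needs one cutoff and one cone at a time: rapid decay in an
  open cone makes every weighted square integral over it finite.\<close>

lemma WF_sobolev_subset_WF:
  assumes u: "u \<in> distributions A E"
  shows "WF_sobolev A E r u \<subseteq> WF A E u"
proof -
  have "WF_sobolev_local (chart_image c) r (local_rep A E c \<Phi> j u) \<subseteq> WF_local (chart_image c) (local_rep A E c \<Phi> j u)"
    if t: "triv_chart A E c \<Phi>" for c \<Phi> j
  proof
    let ?v = "local_rep A E c \<Phi> j u" and ?U = "chart_image c"
    fix z assume "z \<in> WF_sobolev_local ?U r ?v"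
    then obtain y \<eta> where z: "z = (y, \<eta>)" "y \<in> ?U" "\<eta> \<noteq> 0" and
      nex: "\<not> (\<exists>V \<phi>. open V \<and> is_cone V \<and> \<eta> \<in> V \<and> \<phi> \<in> test_functions ?U \<and> \<phi> y \<noteq> 0
          \<and> set_integrable lborel V (\<lambda>\<xi>. (cmod (fourier_cutoff \<phi> ?v \<xi>))\<^sup>2 * bracket \<xi> powr (2 * r)))"
      unfolding WF_sobolev_local_def by blast
    have "\<not> (\<exists>V \<phi>. open V \<and> is_cone V \<and> \<eta> \<in> V \<and> \<phi> \<in> test_functions ?U \<and> \<phi> y \<noteq> 0
          \<and> (\<forall>\<nu>>0. bdd_above ((\<lambda>\<xi>. bracket \<xi> powr \<nu> * cmod (fourier_cutoff \<phi> ?v \<xi>)) ` V)))"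
    proof (rule notI, elim exE conjE)
      fix V \<phi> assume V: "open V" "is_cone V" "\<eta> \<in> V" and \<phi>: "\<phi> \<in> test_functions ?U" "\<phi> y \<noteq> 0"
        and bd: "\<forall>\<nu>>0. bdd_above ((\<lambda>\<xi>. bracket \<xi> powr \<nu> * cmod (fourier_cutoff \<phi> ?v \<xi>)) ` V)"
      \<comment> \<open>Decay is known for positive orders only, hence the maximum with
        \<open>1\<close>.\<close>
      let ?\<nu> = "max 1 (r + real CARD('m))"
      have m: "fourier_cutoff \<phi> ?v \<in> borel_measurable borel"
        by (rule fourier_cutoff_measurable[OF local_distribution_local_rep[OF u t] \<phi>(1)])
      have Vb: "V \<in> sets borel" using V(1) by simp
      have "bdd_above ((\<lambda>\<xi>. bracket \<xi> powr ?\<nu> * cmod (fourier_cutoff \<phi> ?v \<xi>)) ` V)" using bd by simp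
      then obtain q where q: "\<forall>\<xi>\<in>V. bracket \<xi> powr ?\<nu> * cmod (fourier_cutoff \<phi> ?v \<xi>) \<le> q"
        unfolding bdd_above_def by blast
      have "sobolev_mass V r (fourier_cutoff \<phi> ?v) \<le> ennreal (q\<^sup>2) * (\<integral>\<^sup>+\<xi>. ennreal (1 / bracket (\<xi> :: real^'m) ^ (2 * CARD('m))) \<partial>lborel)"
        by (rule sobolev_mass_decay[OF m Vb, of ?\<nu>]) (use q in auto)
      also have "\<dots> < \<infinity>" using bracket_weight_finite[where 'm = 'm] by (simp add: ennreal_mult_less_top)
      finally have "set_integrable lborel V (\<lambda>\<xi>. (cmod (fourier_cutoff \<phi> ?v \<xi>))\<^sup>2 * bracket \<xi> powr (2 * r))"
        using sobolev_mass_integrable[OF m Vb] by simp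
      then show False using nex V \<phi> by blast
    qed
    then show "z \<in> WF_local ?U ?v" unfolding z(1) WF_local_def using z(2,3) by simp
  qed
  then show ?thesis unfolding WF_sobolev_def WF_def by blast
qed

text \<open>For the inclusion from the intersection, a covector outside \<open>L\<close> has
  admissible data around it; the decay estimate of every order applies to the same cutoff and cone
  because \<open>u\<close> lies in the Sobolev spaces of all orders.\<close>

lemma WF_space_eq: "WF_space A E L = (\<Inter>r. sobolev_WF_space A E L r)"
proof (intro equalityI subsetI)
  fix u assume u: "u \<in> WF_space A E L"
  then show "u \<in> (\<Inter>r. sobolev_WF_space A E L r)"
    using WF_sobolev_subset_WF unfolding WF_space_def sobolev_WF_space_def by blast
next
  fix u assume u: "u \<in> (\<Inter>r. sobolev_WF_space A E L r)"
  then have ud: "u \<in> distributions A E" unfolding sobolev_WF_space_def by blast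
  have "WF A E u \<subseteq> L"
  proof
    fix z assume "z \<in> WF A E u"
    then obtain p c \<Phi> \<xi> j where z: "z = (p, coord_covector A c p \<xi>)" and t: "triv_chart A E c \<Phi>" and p: "p \<in> fst c"
      and wf: "(snd c p, \<xi>) \<in> WF_local (chart_image c) (local_rep A E c \<Phi> j u)"
      unfolding WF_def by blast
    have \<xi>: "\<xi> \<noteq> 0" using wf unfolding WF_local_def by blast
    show "z \<in> L"
    proof (rule ccontr)
      assume "z \<notin> L"
      then have "(p, coord_covector A c p \<xi>) \<notin> L" using z by simp
      from admissible_neighbourhood[OF t p \<xi> this]
      obtain \<phi> V W where ad: "admissible A E L c \<Phi> \<phi> V" and nz: "push_forward c \<phi> (snd c p) \<noteq> 0"
        and W: "open W" "is_cone W" "\<xi> \<in> W" "W \<subseteq> V" by (elim exE conjE)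
      have "bdd_above ((\<lambda>\<xi>. bracket \<xi> powr \<nu> * cmod (transform c \<Phi> \<phi> j u \<xi>)) ` W)" if pos: "0 < \<nu>" for \<nu>
      proof -
        obtain \<phi>' V' w C where
          *: "\<forall>u\<in>sobolev_WF_space A E L \<nu>. \<forall>\<xi>\<in>V. bracket \<xi> powr \<nu> * cmod (transform c \<Phi> \<phi> j u \<xi>) \<le> C * (sobolev_part \<nu> c \<Phi> \<phi>' V' j u + w u)"
          using decay_bound[OF ad less_imp_le[OF pos], of j] by (elim exE conjE)
        have "u \<in> sobolev_WF_space A E L \<nu>" using u by blast
        from bspec[OF * this] show ?thesis
          by (intro bdd_aboveI2[where M = "C * (sobolev_part \<nu> c \<Phi> \<phi>' V' j u + w u)"]) (use W(4) in blast)
      qed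
      then show False
        using wf W(1-3) nz admissibleD(3)[OF ad] unfolding WF_local_def by blast
    qed
  qed
  then show "u \<in> WF_space A E L" using ud unfolding WF_space_def by simp
qed

lemma WF_spaceD: "u \<in> WF_space A E L \<Longrightarrow> u \<in> sobolev_WF_space A E L r"
  unfolding WF_space_eq by blast

lemma csubspace_WF_space: "csubspace (WF_space A E L)"
  unfolding WF_space_eq csubspace_def
  by (intro conjI ballI allI INT_I) (simp_all add: csubspace_sobolev_WF_space[unfolded csubspace_def])

lemma decay_bdd_above:
  assumes "admissible A E L c \<Phi> \<phi> V" "0 \<le> \<nu>" "u \<in> sobolev_WF_space A E L \<nu>"
  shows "bdd_above ((\<lambda>\<xi>. bracket \<xi> powr \<nu> * cmod (transform c \<Phi> \<phi> j u \<xi>)) ` V)"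
proof -
  obtain \<phi>' V' w C where
    *: "\<forall>u\<in>sobolev_WF_space A E L \<nu>. \<forall>\<xi>\<in>V. bracket \<xi> powr \<nu> * cmod (transform c \<Phi> \<phi> j u \<xi>) \<le> C * (sobolev_part \<nu> c \<Phi> \<phi>' V' j u + w u)"
    using decay_bound[OF assms(1,2), of j] by (elim exE conjE)
  from bspec[OF * assms(3)] show ?thesis
    by (intro bdd_aboveI2[where M = "C * (sobolev_part \<nu> c \<Phi> \<phi>' V' j u + w u)"]) blast
qed

lemma seminorm_on_decay:
  assumes ad: "admissible A E L c \<Phi> \<phi> V" and V: "V \<noteq> {}" and \<nu>: "0 < \<nu>"
  shows "seminorm_on (WF_space A E L) (decay_seminorm A E \<nu> c \<Phi> \<phi> V)"
  unfolding decay_seminorm_eq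
proof (rule seminorm_on_Max[OF csubspace_WF_space])
  fix j
  show "seminorm_on (WF_space A E L) (decay_part \<nu> c \<Phi> \<phi> V j)"
    unfolding decay_part_def
  proof (rule seminorm_on_SUP[OF csubspace_WF_space V])
    show "bdd_above ((\<lambda>\<xi>. bracket \<xi> powr \<nu> * cmod (transform c \<Phi> \<phi> j u \<xi>)) ` V)" if "u \<in> WF_space A E L" for u
      using ad \<nu> WF_spaceD[OF that] by (intro decay_bdd_above) auto
    fix \<xi>
    show "seminorm_on (WF_space A E L) (\<lambda>u. bracket \<xi> powr \<nu> * cmod (transform c \<Phi> \<phi> j u \<xi>))"
      unfolding seminorm_on_def transform_add transform_scaleC
      by (simp add: norm_mult mult_left_mono norm_triangle_ineq flip: distrib_left)
  qed
qed

text \<open>The constant is the square root of the integral of \<open>bracket ^ (-2m)\<close>, with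
  \<open>m\<close> the dimension. It depends on neither \<open>u\<close> nor
  \<open>j\<close>.\<close>

lemma sobolev_part_le_decay:
  assumes ad: "admissible A E L c \<Phi> \<phi> V" and V: "V \<noteq> {}" and \<nu>: "0 < \<nu>" "r + real CARD('m) \<le> \<nu>"
  shows "\<exists>C\<ge>0. \<forall>u\<in>WF_space A E L. \<forall>j. sobolev_part r c \<Phi> \<phi> V j u \<le> C * decay_part \<nu> c \<Phi> \<phi> V j u"
proof -
  let ?w = "\<integral>\<^sup>+\<xi>. ennreal (1 / bracket (\<xi> :: real^'m) ^ (2 * CARD('m))) \<partial>lborel"
  show ?thesis
  proof (intro exI[of _ "sqrt (enn2real ?w)"] conjI ballI allI)
    fix u j assume u: "u \<in> WF_space A E L"
    have ud: "u \<in> distributions A E" using u unfolding WF_space_def by simp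
    let ?q = "decay_part \<nu> c \<Phi> \<phi> V j u"
    have le: "bracket \<xi> powr \<nu> * cmod (transform c \<Phi> \<phi> j u \<xi>) \<le> ?q" if "\<xi> \<in> V" for \<xi>
      unfolding decay_part_def
      by (rule cSUP_upper[OF that decay_bdd_above[OF ad _ WF_spaceD[OF u]]]) (use \<nu> in simp)
    \<comment> \<open>A point of \<open>V\<close> is needed to fix the sign of the supremum.\<close>
    have q0: "0 \<le> ?q"
    proof -
      obtain \<xi> where "\<xi> \<in> V" using V by blast
      from le[OF this] show ?thesis by (rule order_trans[rotated]) simp
    qed
    have "sobolev_mass V r (transform c \<Phi> \<phi> j u) \<le> ennreal (?q\<^sup>2) * ?w"
      by (rule sobolev_mass_decay[OF transform_measurable[OF ad ud] admissibleD(6)[OF ad] le \<nu>(2)])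
    then have "enn2real (sobolev_mass V r (transform c \<Phi> \<phi> j u)) \<le> enn2real (ennreal (?q\<^sup>2) * ?w)"
      by (rule enn2real_mono) (use bracket_weight_finite[where 'm = 'm] in \<open>simp add: ennreal_mult_less_top\<close>)
    then have "sobolev_part r c \<Phi> \<phi> V j u \<le> sqrt (?q\<^sup>2 * enn2real ?w)"
      unfolding sobolev_part_eq[OF WF_spaceD[OF u] ad] by (simp add: enn2real_mult)
    then show "sobolev_part r c \<Phi> \<phi> V j u \<le> sqrt (enn2real ?w) * ?q"
      using q0 by (simp add: real_sqrt_mult mult.commute)
  qed simp
qed

section \<open>The two topologies and the projective limit\<close>

abbreviation sobolev_family where
  "sobolev_family r \<equiv> continuous_seminorms (distribution_topology A E)
      \<union> {sobolev_seminorm A E r c \<Phi> \<phi> V | c \<Phi> \<phi> V. admissible A E L c \<Phi> \<phi> V}"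

abbreviation decay_family where
  "decay_family \<equiv> continuous_seminorms (distribution_topology A E)
      \<union> {decay_seminorm A E \<nu> c \<Phi> \<phi> V | \<nu> c \<Phi> \<phi> V. 0 < \<nu> \<and> admissible A E L c \<Phi> \<phi> V \<and> V \<noteq> {}}"

lemma sobolev_family_cases:
  assumes "p \<in> sobolev_family r"
  obtains "p \<in> continuous_seminorms (distribution_topology A E)"
  | c \<Phi> \<phi> V where "p = sobolev_seminorm A E r c \<Phi> \<phi> V" "admissible A E L c \<Phi> \<phi> V"
  using assms by (elim UnE CollectE exE conjE)

lemma decay_family_cases:
  assumes "p \<in> decay_family"
  obtains "p \<in> continuous_seminorms (distribution_topology A E)"
  | \<nu> c \<Phi> \<phi> V where "p = decay_seminorm A E \<nu> c \<Phi> \<phi> V" "0 < \<nu>" "admissible A E L c \<Phi> \<phi> V" "V \<noteq> {}"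
  using assms by (elim UnE CollectE exE conjE)

lemma seminorm_on_continuous_seminorms:
  "p \<in> continuous_seminorms (distribution_topology A E) \<Longrightarrow> seminorm_on (distributions A E) p"
  unfolding continuous_seminorms_def topspace_distribution_topology by blast

lemma seminorm_on_sobolev_family:
  assumes "p \<in> sobolev_family r" shows "seminorm_on (sobolev_WF_space A E L r) p"
  using assms
proof (cases rule: sobolev_family_cases)
  case 1
  show ?thesis
    by (rule seminorm_on_subset[OF seminorm_on_continuous_seminorms[OF 1]]) (simp add: sobolev_WF_space_def)
next
  case 2
  then show ?thesis by (simp only: seminorm_on_sobolev)
qed

lemma seminorm_on_decay_family:
  assumes "p \<in> decay_family" shows "seminorm_on (WF_space A E L) p"
  using assms
proof (cases rule: decay_family_cases)
  case 1
  show ?thesis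
    by (rule seminorm_on_subset[OF seminorm_on_continuous_seminorms[OF 1]]) (simp add: WF_space_def)
next
  case 2
  show ?thesis unfolding 2(1) by (rule seminorm_on_decay[OF 2(3,4,2)])
qed

lemma sobolev_inclusion_continuous:
  assumes "r \<le> s"
  shows "continuous_map (sobolev_WF_topology A E L s) (sobolev_WF_topology A E L r) (\<lambda>u. u)"
  unfolding sobolev_WF_topology_def
proof (rule continuous_map_seminorm_topology_inclusion[OF csubspace_sobolev_WF_space seminorm_on_sobolev_family
      csubspace_sobolev_WF_space seminorm_on_sobolev_family sobolev_WF_space_antimono[OF assms]])
  fix p assume "p \<in> sobolev_family r"
  then show "\<exists>F C. finite F \<and> F \<subseteq> sobolev_family s \<and> 0 \<le> C \<and> (\<forall>u\<in>sobolev_WF_space A E L s. p u \<le> C * (\<Sum>q\<in>F. q u))"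
  proof (cases rule: sobolev_family_cases)
    case 1
    then show ?thesis by (intro exI[of _ "{p}"] exI[of _ 1]) simp
  next
    case (2 c \<Phi> \<phi> V)
    show ?thesis
    proof (intro exI[of _ "{sobolev_seminorm A E s c \<Phi> \<phi> V}"] exI[of _ 1] conjI ballI)
      show "{sobolev_seminorm A E s c \<Phi> \<phi> V} \<subseteq> sobolev_family s" using 2(2) by blast
      show "p u \<le> 1 * (\<Sum>q\<in>{sobolev_seminorm A E s c \<Phi> \<phi> V}. q u)" if "u \<in> sobolev_WF_space A E L s" for u
        using sobolev_seminorm_mono[OF assms that 2(2)] 2(1) by simp
    qed simp_all
  qed
qed

text \<open>Each Sobolev seminorm is dominated by a single decay seminorm with the same cutoff and
  cone, as soon as the order of decay is positive and at least \<open>r\<close> plus the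
  dimension.\<close>

lemma WF_inclusion_continuous:
  "continuous_map (WF_topology A E L) (sobolev_WF_topology A E L r) (\<lambda>u. u)"
  unfolding sobolev_WF_topology_def WF_topology_def
proof (rule continuous_map_seminorm_topology_inclusion[OF csubspace_WF_space seminorm_on_decay_family
      csubspace_sobolev_WF_space seminorm_on_sobolev_family])
  show "WF_space A E L \<subseteq> sobolev_WF_space A E L r" using WF_spaceD by blast
  fix p assume "p \<in> sobolev_family r"
  then show "\<exists>F C. finite F \<and> F \<subseteq> decay_family \<and> 0 \<le> C \<and> (\<forall>u\<in>WF_space A E L. p u \<le> C * (\<Sum>q\<in>F. q u))"
  proof (cases rule: sobolev_family_cases)
    case 1
    then show ?thesis by (intro exI[of _ "{p}"] exI[of _ 1]) simp
  next
    case (2 c \<Phi> \<phi> V)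
    show ?thesis
    proof (cases "V = {}")
      \<comment> \<open>Decay seminorms are indexed by nonempty cones. For the empty cone the
        Sobolev seminorm is \<open>0\<close>, which the empty sum dominates.\<close>
      case True
      then show ?thesis
        by (intro exI[of _ "{}"] exI[of _ 0]) (simp add: 2(1) sobolev_seminorm_def set_lebesgue_integral_def)
    next
      case False
      let ?\<nu> = "max 1 (r + real CARD('m))"
      let ?q = "decay_seminorm A E ?\<nu> c \<Phi> \<phi> V"
      have "0 < ?\<nu>" "r + real CARD('m) \<le> ?\<nu>" by auto
      from sobolev_part_le_decay[OF 2(2) False this]
      obtain C where C: "0 \<le> C" "\<forall>u\<in>WF_space A E L. \<forall>j. sobolev_part r c \<Phi> \<phi> V j u \<le> C * decay_part ?\<nu> c \<Phi> \<phi> V j u"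
        by (elim exE conjE)
      show ?thesis
      proof (intro exI[of _ "{?q}"] exI[of _ C] conjI ballI)
        show "{?q} \<subseteq> decay_family" using 2(2) False \<open>0 < ?\<nu>\<close> by blast
        fix u assume u: "u \<in> WF_space A E L"
        have "sobolev_part r c \<Phi> \<phi> V j u \<le> C * decay_part ?\<nu> c \<Phi> \<phi> V j u" for j
          using bspec[OF C(2) u] by blast
        then have "sobolev_part r c \<Phi> \<phi> V j u \<le> C * ?q u" for j
          using mult_left_mono[OF decay_part_le C(1)] by (rule order_trans)
        then have "p u \<le> C * ?q u" unfolding 2(1) sobolev_seminorm_eq by (intro Max.boundedI) auto
        then show "p u \<le> C * (\<Sum>q\<in>{?q}. q u)" by simp
      qed (simp_all add: C(1))
    qed
  qed
qed

text \<open>Seminorms of a single order dominate each member of the family, so continuity of the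
  inverse map can be tested in one factor of the product. The cutoff and cone from
  \<open>decay_bound\<close> may vary with the component \<open>j\<close>, hence the choice of data
  for each \<open>j\<close> and the sum over all of them.\<close>

lemma decay_family_bound:
  assumes "p \<in> decay_family"
  shows "\<exists>\<nu> F C. finite F \<and> F \<subseteq> sobolev_family \<nu> \<and> 0 \<le> C \<and> (\<forall>u\<in>WF_space A E L. p u \<le> C * (\<Sum>q\<in>F. q u))"
  using assms
proof (cases rule: decay_family_cases)
  case 1
  then show ?thesis by (intro exI[of _ "{p}"] exI[of _ 1]) simp
next
  case (2 \<nu> c \<Phi> \<phi> V)
  have "\<forall>j. \<exists>\<phi>' V' w C. admissible A E L c \<Phi> \<phi>' V' \<and> w \<in> continuous_seminorms (distribution_topology A E) \<and> 0 \<le> C \<and>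
    (\<forall>u\<in>sobolev_WF_space A E L \<nu>. \<forall>\<xi>\<in>V.
      bracket \<xi> powr \<nu> * cmod (transform c \<Phi> \<phi> j u \<xi>) \<le> C * (sobolev_part \<nu> c \<Phi> \<phi>' V' j u + w u))"
    by (intro allI decay_bound 2(3) less_imp_le 2(2))
  from choice[OF this] obtain \<phi>' where "\<forall>j. \<exists>V' w C. admissible A E L c \<Phi> (\<phi>' j) V' \<and> w \<in> continuous_seminorms (distribution_topology A E) \<and> 0 \<le> C \<and>
    (\<forall>u\<in>sobolev_WF_space A E L \<nu>. \<forall>\<xi>\<in>V.
      bracket \<xi> powr \<nu> * cmod (transform c \<Phi> \<phi> j u \<xi>) \<le> C * (sobolev_part \<nu> c \<Phi> (\<phi>' j) V' j u + w u))" ..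
  from choice[OF this] obtain V' where "\<forall>j. \<exists>w C. admissible A E L c \<Phi> (\<phi>' j) (V' j) \<and> w \<in> continuous_seminorms (distribution_topology A E) \<and> 0 \<le> C \<and>
    (\<forall>u\<in>sobolev_WF_space A E L \<nu>. \<forall>\<xi>\<in>V.
      bracket \<xi> powr \<nu> * cmod (transform c \<Phi> \<phi> j u \<xi>) \<le> C * (sobolev_part \<nu> c \<Phi> (\<phi>' j) (V' j) j u + w u))" ..
  from choice[OF this] obtain w where "\<forall>j. \<exists>C. admissible A E L c \<Phi> (\<phi>' j) (V' j) \<and> w j \<in> continuous_seminorms (distribution_topology A E) \<and> 0 \<le> C \<and>
    (\<forall>u\<in>sobolev_WF_space A E L \<nu>. \<forall>\<xi>\<in>V.
      bracket \<xi> powr \<nu> * cmod (transform c \<Phi> \<phi> j u \<xi>) \<le> C * (sobolev_part \<nu> c \<Phi> (\<phi>' j) (V' j) j u + w j u))" ..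
  from choice[OF this] obtain C where *: "\<forall>j. admissible A E L c \<Phi> (\<phi>' j) (V' j) \<and> w j \<in> continuous_seminorms (distribution_topology A E) \<and> 0 \<le> C j \<and>
    (\<forall>u\<in>sobolev_WF_space A E L \<nu>. \<forall>\<xi>\<in>V.
      bracket \<xi> powr \<nu> * cmod (transform c \<Phi> \<phi> j u \<xi>) \<le> C j * (sobolev_part \<nu> c \<Phi> (\<phi>' j) (V' j) j u + w j u))" ..
  let ?s = "\<lambda>j. sobolev_seminorm A E \<nu> c \<Phi> (\<phi>' j) (V' j)"
  let ?F = "range ?s \<union> range w"
  have F: "finite ?F" "?F \<subseteq> sobolev_family \<nu>" using * by (simp, blast)
  show ?thesis
  proof (rule exI[of _ \<nu>], rule exI[of _ ?F], rule exI[of _ "2 * (\<Sum>j\<in>UNIV. C j)"], intro conjI ballI F)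
    show "0 \<le> 2 * (\<Sum>j\<in>UNIV. C j)" using * by (simp add: sum_nonneg)
    fix u assume u: "u \<in> WF_space A E L"
    let ?S = "\<Sum>q\<in>?F. q u"
    have q0: "0 \<le> q u" if "q \<in> ?F" for q
      by (rule seminorm_on_nonneg[OF csubspace_sobolev_WF_space seminorm_on_sobolev_family WF_spaceD[OF u]])
        (use F(2) that in blast)
    have qS: "q u \<le> ?S" if "q \<in> ?F" for q
      by (rule member_le_sum[OF that]) (use q0 F(1) in auto)
    have S0: "0 \<le> ?S" by (rule sum_nonneg) (rule q0)
    have "decay_part \<nu> c \<Phi> \<phi> V j u \<le> 2 * (\<Sum>j\<in>UNIV. C j) * ?S" for j
      unfolding decay_part_def
    proof (rule cSUP_least[OF 2(4)])
      fix \<xi> assume \<xi>: "\<xi> \<in> V"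
      have "bracket \<xi> powr \<nu> * cmod (transform c \<Phi> \<phi> j u \<xi>) \<le> C j * (sobolev_part \<nu> c \<Phi> (\<phi>' j) (V' j) j u + w j u)"
        using * WF_spaceD[OF u] \<xi> by blast
      \<comment> \<open>The set \<open>?F\<close> counts coinciding seminorms only once, so the two
        summands are bounded by the full sum separately; this is the origin of the factor
        \<open>2\<close>.\<close>
      also have "\<dots> \<le> C j * (?S + ?S)"
      proof (rule mult_left_mono)
        show "sobolev_part \<nu> c \<Phi> (\<phi>' j) (V' j) j u + w j u \<le> ?S + ?S"
          using sobolev_part_le[of \<nu> c \<Phi> "\<phi>' j" "V' j" j u] qS[of "?s j"] qS[of "w j"] by simp
        show "0 \<le> C j" using * by blast
      qed
      also have "\<dots> = 2 * C j * ?S" by simp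
      also have "\<dots> \<le> 2 * (\<Sum>j\<in>UNIV. C j) * ?S"
        using S0 member_le_sum[of j UNIV C] * by (intro mult_right_mono) auto
      finally show "bracket \<xi> powr \<nu> * cmod (transform c \<Phi> \<phi> j u \<xi>) \<le> 2 * (\<Sum>j\<in>UNIV. C j) * ?S" .
    qed
    then show "p u \<le> 2 * (\<Sum>j\<in>UNIV. C j) * ?S" unfolding 2(1) decay_seminorm_eq by (intro Max.boundedI) auto
  qed
qed

text \<open>With inclusions as linking maps a thread is constant, because any two real indices are
  comparable. Its value lies in the spaces of all orders.\<close>

lemma topspace_projective_limit:
  "topspace (projective_limit (sobolev_WF_topology A E L) (\<lambda>r s u. u)) = (\<lambda>u r. u) ` WF_space A E L"
proof -
  have "topspace (projective_limit (sobolev_WF_topology A E L) (\<lambda>r s u. u)) =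
      {t. (\<forall>r. t r \<in> sobolev_WF_space A E L r) \<and> (\<forall>r s. r \<le> s \<longrightarrow> t s = t r)}"
    by (auto simp: projective_limit_def sobolev_WF_topology_def PiE_UNIV_domain)
  also have "\<dots> = (\<lambda>u r. u) ` WF_space A E L"
  proof (intro equalityI subsetI)
    fix t assume t: "t \<in> {t. (\<forall>r. t r \<in> sobolev_WF_space A E L r) \<and> (\<forall>r s. r \<le> s \<longrightarrow> t s = t r)}"
    have t0: "t = (\<lambda>r. t 0)"
    proof
      fix r :: real show "t r = t 0" using t linear[of 0 r] by auto
    qed
    have "t 0 \<in> WF_space A E L" unfolding WF_space_eq
    proof
      fix r
      have "t r \<in> sobolev_WF_space A E L r" using t by blast
      moreover have "t r = t 0" by (rule fun_cong[OF t0])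
      ultimately show "t 0 \<in> sobolev_WF_space A E L r" by simp
    qed
    with t0 show "t \<in> (\<lambda>u r. u) ` WF_space A E L" by (rule image_eqI)
  next
    fix t assume "t \<in> (\<lambda>u (r :: real). u) ` WF_space A E L"
    then show "t \<in> {t. (\<forall>r. t r \<in> sobolev_WF_space A E L r) \<and> (\<forall>r s. r \<le> s \<longrightarrow> t s = t r)}"
      using WF_spaceD by auto
  qed
  finally show ?thesis .
qed

text \<open>Continuity into the limit is continuity into each factor. The inverse reads off one
  component of a constant thread, here the one of index \<open>0\<close>; its continuity with
  respect to a decay seminorm is tested in the factor whose Sobolev seminorms dominate that
  seminorm.\<close>

lemma homeomorphic_projective_limit:
  "homeomorphic_map (WF_topology A E L) (projective_limit (sobolev_WF_topology A E L) (\<lambda>r s u. u)) (\<lambda>u r. u)"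
proof -
  let ?X = "WF_topology A E L" and ?Y = "projective_limit (sobolev_WF_topology A E L) (\<lambda>r s u. u)"
  have X: "topspace ?X = WF_space A E L" by (simp add: WF_topology_def)
  have Y: "topspace ?Y = (\<lambda>u r. u) ` WF_space A E L" by (rule topspace_projective_limit)
  have f: "continuous_map ?X ?Y (\<lambda>u r. u)"
    unfolding projective_limit_def
    by (simp add: continuous_map_in_subtopology continuous_map_componentwise_UNIV WF_inclusion_continuous image_subset_iff)
  have proj: "continuous_map ?Y (sobolev_WF_topology A E L \<nu>) (\<lambda>t. t \<nu>)" for \<nu>
    unfolding projective_limit_def by (intro continuous_map_from_subtopology continuous_map_product_projection) simp
  have g: "continuous_map ?Y ?X (\<lambda>t. t 0)"
    unfolding WF_topology_def
  proof (rule continuous_map_into_seminorm_topology[OF csubspace_WF_space seminorm_on_decay_family])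
    show "(\<lambda>t. t 0) \<in> topspace ?Y \<rightarrow> WF_space A E L" unfolding Y by auto
    fix p x and e :: real assume p: "p \<in> decay_family" and x: "x \<in> topspace ?Y" and e: "0 < e"
    obtain u where u: "u \<in> WF_space A E L" "x = (\<lambda>r. u)" using x unfolding Y by blast
    obtain \<nu> F C where F: "finite F" "F \<subseteq> sobolev_family \<nu>" "0 \<le> C" "\<forall>u\<in>WF_space A E L. p u \<le> C * (\<Sum>q\<in>F. q u)"
      using decay_family_bound[OF p] by (elim exE conjE)
    have PF: "seminorm_on (WF_space A E L) q" if "q \<in> F" for q
      by (rule seminorm_on_subset[OF seminorm_on_sobolev_family[of q \<nu>]]) (use F(2) that WF_spaceD in blast)+
    have "\<exists>\<delta>>0. \<forall>x\<in>WF_space A E L. (\<forall>q\<in>F. q x < \<delta>) \<longrightarrow> p x < e"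
    proof (rule seminorm_bound_ball[OF csubspace_WF_space PF F(1,3) bspec[OF F(4)] e])
      fix \<delta> assume "0 < \<delta>" "\<And>x. x \<in> WF_space A E L \<Longrightarrow> (\<And>q. q \<in> F \<Longrightarrow> q x < \<delta>) \<Longrightarrow> p x < e"
      then show ?thesis by (intro exI conjI ballI impI) auto
    qed
    then obtain \<delta> where \<delta>: "0 < \<delta>" "\<forall>x\<in>WF_space A E L. (\<forall>q\<in>F. q x < \<delta>) \<longrightarrow> p x < e" by (elim exE conjE)
    let ?B = "{y \<in> sobolev_WF_space A E L \<nu>. \<forall>q\<in>F. q (y - u) < \<delta>}"
    have B: "openin (sobolev_WF_topology A E L \<nu>) ?B"
      unfolding sobolev_WF_topology_def by (rule openin_seminorm_ball[OF F(1,2) WF_spaceD[OF u(1)] \<delta>(1)])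
    show "\<exists>W. openin ?Y W \<and> x \<in> W \<and> (\<forall>y\<in>W. p (y 0 - x 0) < e)"
    proof (intro exI[of _ "{t \<in> topspace ?Y. t \<nu> \<in> ?B}"] conjI ballI)
      show "openin ?Y {t \<in> topspace ?Y. t \<nu> \<in> ?B}" by (rule openin_continuous_map_preimage[OF proj B])
      have "q (x \<nu> - u) < \<delta>" if "q \<in> F" for q
        using seminorm_on_zero[OF csubspace_WF_space PF[OF that]] \<delta>(1) u(2) by simp
      moreover have "x \<nu> \<in> sobolev_WF_space A E L \<nu>" using u(2) WF_spaceD[OF u(1)] by simp
      ultimately show "x \<in> {t \<in> topspace ?Y. t \<nu> \<in> ?B}" using x by (intro CollectI conjI ballI)
      fix t assume t: "t \<in> {t \<in> topspace ?Y. t \<nu> \<in> ?B}"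
      obtain v where v: "v \<in> WF_space A E L" "t = (\<lambda>r. v)" using t unfolding Y by blast
      have "\<forall>q\<in>F. q (v - u) < \<delta>" using t v(2) by simp
      then have "p (v - u) < e" using bspec[OF \<delta>(2) csubspace_diff[OF csubspace_WF_space v(1) u(1)]] by blast
      then show "p (t 0 - x 0) < e" using v(2) u(2) by simp
    qed
  qed
  have "homeomorphic_maps ?X ?Y (\<lambda>u r. u) (\<lambda>t. t 0)"
    unfolding homeomorphic_maps_def using f g by (auto simp: Y)
  then show ?thesis unfolding homeomorphic_map_maps by blast
qed

end

theorem proposition4p21:
  fixes A :: "('a::{t2_space, second_countable_topology}, 'm::finite) chart set"
    and E :: "('a, 'e, 'k::finite) cvbundle"
    and L :: "('a \<times> ('a, 'm) covector) set"
  assumes "smooth_manifold A" and "vector_bundle A E" and "closed_conic A L"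
  shows "WF_space A E L = (\<Inter>r. sobolev_WF_space A E L r)
    \<and> (\<forall>r\<^sub>1 r\<^sub>2. r\<^sub>1 \<le> r\<^sub>2 \<longrightarrow>
         sobolev_WF_space A E L r\<^sub>2 \<subseteq> sobolev_WF_space A E L r\<^sub>1
         \<and> continuous_map (sobolev_WF_topology A E L r\<^sub>2) (sobolev_WF_topology A E L r\<^sub>1) (\<lambda>u. u))
    \<and> homeomorphic_map (WF_topology A E L)
        (projective_limit (sobolev_WF_topology A E L) (\<lambda>r\<^sub>1 r\<^sub>2 u. u)) (\<lambda>u r. u)"
proof -
  interpret wave_front_constraint A E L by unfold_locales (fact assms)+
  show ?thesis
    by (intro conjI allI impI WF_space_eq sobolev_WF_space_antimono sobolev_inclusion_continuous
        homeomorphic_projective_limit)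
qed

end
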